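(* Let $\omega\Subset\Omega$ be a domain. Then the principal eigenvalue $\lambda_1(Q;\omega)$ of $Q'$ in $\omega$ is isolated, i.e. there exists $\delta>0$ such that $Q'$ has no eigenvalue $\lambda$ in $\omega$ with $0<|\lambda-\lambda_1(Q;\omega)|<\delta$.
   Context: Fix $n\ge2$, $1<p<\infty$, a domain $\Omega\subseteq\mathbb{R}^n$. $H:\Omega\times\mathbb{R}^n\to[0,\infty)$: for a.e. $x$, $H(x,\cdot)$ is a norm; $x\mapsto H(x,\xi)$ measurable; for each domain $\omega\Subset\Omega$ there are $0<\kappa_\omega\le\nu_\omega$ with $\kappa_\omega|\xi|\le H(x,\xi)\le\nu_\omega|\xi|$ for a.e. $x\in\omega$; for a.e. $x$, $(\mathbb{R}^n,H(x,\cdot))$ is uniformly convex and $H(x,\cdot)$ is differentiable on $\mathbb{R}^n\setminus\{0\}$. $\mathcal{A}(x,\xi)=\nabla_\xi(H(x,\xi)^p/p)$. $V\in M^q_{loc}(p;\Omega)=\bigcap_{\omega\Subset\Omega}M^q(p;\omega)$ (over subdomains), where $f\in M^q(p;\omega)$ iff $\sup_{y\in\omega,0<r<\mathrm{diam}\,\omega}r^{-n/q'}\int_{\omega\cap B_r(y)}|f|<\infty$ if $p<n$, $q>n/p$; the same with $(\log(\mathrm{diam}\,\omega/r))^{q/n'}$ replacing $r^{-n/q'}$ if $p=n$, $q>n$; $f\in L^1(\omega)$ if $p>n$. $Q[\phi;\omega]=\int_\omega(H(x,\nabla\phi)^p+V|\phi|^p)dx$, $Q'[u]=-\mathrm{div}\,\mathcal{A}(x,\nabla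 u)+V|u|^{p-2}u$. Generalized principal eigenvalue: $\lambda_1(Q;\omega)=\inf_{\phi\in C_c^\infty(\omega)\setminus\{0\}}Q[\phi;\omega]/\|\phi\|^p_{L^p(\omega)}$. A real $\lambda$ is an eigenvalue of $Q'$ in $\omega$ with eigenfunction $v$ if $v\in W^{1,p}_0(\omega)\setminus\{0\}$ and $\int_\omega\mathcal{A}(x,\nabla v)\cdot\nabla\varphi+\int_\omega(V-\lambda)|v|^{p-2}v\varphi=0$ for all $\varphi\in C_c^\infty(\omega)$. A principal eigenvalue is an eigenvalue with a nonnegative eigenfunction; it is known that for a domain $\omega\Subset\Omega$, $\lambda_1(Q;\omega)$ is the unique principal eigenvalue of $Q'$ in $\omega$. *)

theory Defs
  imports "HOL-Analysis.Analysis"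
begin

coinductive smooth_fun :: "('a::euclidean_space \<Rightarrow> real) \<Rightarrow> bool" where
  "(\<forall>x. f differentiable (at x)) \<Longrightarrow>
   (\<forall>b\<in>Basis. smooth_fun (\<lambda>x. frechet_derivative f (at x) b)) \<Longrightarrow> smooth_fun f"

definition test_fun :: "'a::euclidean_space set \<Rightarrow> ('a \<Rightarrow> real) \<Rightarrow> bool" where
  "test_fun w \<phi> \<longleftrightarrow> smooth_fun \<phi> \<and> compact (closure {x. \<phi> x \<noteq> 0})
      \<and> closure {x. \<phi> x \<noteq> 0} \<subseteq> w"

definition grad :: "('a::euclidean_space \<Rightarrow> real) \<Rightarrow> 'a \<Rightarrow> 'a" where
  "grad f x = (SOME g. (f has_derivative (\<lambda>h. g \<bullet> h)) (at x))"

definition domain :: "'a::euclidean_space set \<Rightarrow> bool" where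
  "domain U \<longleftrightarrow> open U \<and> connected U \<and> U \<noteq> {}"

definition cc_subdomain :: "'a::euclidean_space set \<Rightarrow> 'a set \<Rightarrow> bool" where
  "cc_subdomain w U \<longleftrightarrow> domain w \<and> compact (closure w) \<and> closure w \<subseteq> U"

definition Lp_on :: "real \<Rightarrow> 'a::euclidean_space set \<Rightarrow> ('a \<Rightarrow> real) \<Rightarrow> bool" where
  "Lp_on p w v \<longleftrightarrow> v \<in> borel_measurable (lebesgue_on w)
      \<and> integrable (lebesgue_on w) (\<lambda>x. \<bar>v x\<bar> powr p)"

definition weak_grad :: "'a::euclidean_space set \<Rightarrow> ('a \<Rightarrow> real) \<Rightarrow> ('a \<Rightarrow> 'a) \<Rightarrow> bool" where
  "weak_grad w v g \<longleftrightarrow>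
     (\<forall>\<phi>. test_fun w \<phi> \<longrightarrow>
        (\<forall>b\<in>Basis. integrable (lebesgue_on w) (\<lambda>x. v x * (grad \<phi> x \<bullet> b))
          \<and> integrable (lebesgue_on w) (\<lambda>x. (g x \<bullet> b) * \<phi> x)
          \<and> (\<integral>x. v x * (grad \<phi> x \<bullet> b) \<partial>lebesgue_on w)
             = - (\<integral>x. (g x \<bullet> b) * \<phi> x \<partial>lebesgue_on w)))"

definition W1p :: "real \<Rightarrow> 'a::euclidean_space set \<Rightarrow> ('a \<Rightarrow> real) \<Rightarrow> ('a \<Rightarrow> 'a) \<Rightarrow> bool" where
  "W1p p w v g \<longleftrightarrow> Lp_on p w v \<and> (\<forall>b\<in>Basis. Lp_on p w (\<lambda>x. g x \<bullet> b)) \<and> weak_grad w v g"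

definition W01p :: "real \<Rightarrow> 'a::euclidean_space set \<Rightarrow> ('a \<Rightarrow> real) \<Rightarrow> ('a \<Rightarrow> 'a) \<Rightarrow> bool" where
  "W01p p w v g \<longleftrightarrow> W1p p w v g \<and>
     (\<exists>\<phi>::nat \<Rightarrow> 'a \<Rightarrow> real. (\<forall>k. test_fun w (\<phi> k)) \<and>
        (\<lambda>k. \<integral>x. \<bar>\<phi> k x - v x\<bar> powr p \<partial>lebesgue_on w) \<longlonglongrightarrow> 0 \<and>
        (\<lambda>k. \<integral>x. norm (grad (\<phi> k) x - g x) powr p \<partial>lebesgue_on w) \<longlonglongrightarrow> 0)"

definition morrey :: "real \<Rightarrow> real \<Rightarrow> 'a::euclidean_space set \<Rightarrow> ('a \<Rightarrow> real) \<Rightarrow> bool" where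
  "morrey q p w f \<longleftrightarrow>
     (let n = real DIM('a) in
      if p < n then q > n / p \<and>
         (\<forall>y\<in>w. \<forall>r. 0 < r \<longrightarrow> integrable (lebesgue_on (w \<inter> ball y r)) f) \<and>
         bdd_above {r powr (- n / (q / (q - 1))) * (\<integral>x. \<bar>f x\<bar> \<partial>lebesgue_on (w \<inter> ball y r))
                    | y r. y \<in> w \<and> 0 < r \<and> r < diameter w}
      else if p = n then q > n \<and>
         (\<forall>y\<in>w. \<forall>r. 0 < r \<longrightarrow> integrable (lebesgue_on (w \<inter> ball y r)) f) \<and>
         bdd_above {(ln (diameter w / r)) powr (q / (n / (n - 1))) *
                      (\<integral>x. \<bar>f x\<bar> \<partial>lebesgue_on (w \<inter> ball y r))
                    | y r. y \<in> w \<and> 0 < r \<and> r < diameter w}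
      else integrable (lebesgue_on w) f)"

definition morrey_loc :: "real \<Rightarrow> real \<Rightarrow> 'a::euclidean_space set \<Rightarrow> ('a \<Rightarrow> real) \<Rightarrow> bool" where
  "morrey_loc q p U f \<longleftrightarrow> (\<forall>w. cc_subdomain w U \<longrightarrow> morrey q p w f)"

definition is_norm_fun :: "('a::euclidean_space \<Rightarrow> real) \<Rightarrow> bool" where
  "is_norm_fun N \<longleftrightarrow> (\<forall>\<xi>. N \<xi> \<ge> 0) \<and> (\<forall>\<xi>. N \<xi> = 0 \<longleftrightarrow> \<xi> = 0)
     \<and> (\<forall>c \<xi>. N (c *\<^sub>R \<xi>) = \<bar>c\<bar> * N \<xi>) \<and> (\<forall>\<xi> \<eta>. N (\<xi> + \<eta>) \<le> N \<xi> + N \<eta>)"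

definition unif_convex_norm :: "('a::euclidean_space \<Rightarrow> real) \<Rightarrow> bool" where
  "unif_convex_norm N \<longleftrightarrow> (\<forall>\<epsilon>>0. \<exists>\<delta>>0. \<forall>\<xi> \<eta>. N \<xi> \<le> 1 \<longrightarrow> N \<eta> \<le> 1 \<longrightarrow> N (\<xi> - \<eta>) \<ge> \<epsilon>
        \<longrightarrow> N ((1/2) *\<^sub>R (\<xi> + \<eta>)) \<le> 1 - \<delta>)"

definition admissible_H :: "'a::euclidean_space set \<Rightarrow> ('a \<Rightarrow> 'a \<Rightarrow> real) \<Rightarrow> bool" where
  "admissible_H U H \<longleftrightarrow>
     (\<forall>x \<xi>. H x \<xi> \<ge> 0) \<and>
     (AE x in lebesgue_on U. is_norm_fun (H x)) \<and>
     (\<forall>\<xi>. (\<lambda>x. H x \<xi>) \<in> borel_measurable (lebesgue_on U)) \<and>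
     (\<forall>w. cc_subdomain w U \<longrightarrow> (\<exists>\<kappa> \<nu>. 0 < \<kappa> \<and> \<kappa> \<le> \<nu> \<and>
          (AE x in lebesgue_on w. \<forall>\<xi>. \<kappa> * norm \<xi> \<le> H x \<xi> \<and> H x \<xi> \<le> \<nu> * norm \<xi>))) \<and>
     (AE x in lebesgue_on U. unif_convex_norm (H x)) \<and>
     (AE x in lebesgue_on U. \<forall>\<xi>. \<xi> \<noteq> 0 \<longrightarrow> H x differentiable (at \<xi>))"

definition Aop :: "real \<Rightarrow> ('a::euclidean_space \<Rightarrow> 'a \<Rightarrow> real) \<Rightarrow> 'a \<Rightarrow> 'a \<Rightarrow> 'a" where
  "Aop p H x \<xi> = grad (\<lambda>\<eta>. H x \<eta> powr p / p) \<xi>"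

definition Qfun :: "real \<Rightarrow> ('a::euclidean_space \<Rightarrow> 'a \<Rightarrow> real) \<Rightarrow> ('a \<Rightarrow> real) \<Rightarrow> 'a set \<Rightarrow> ('a \<Rightarrow> real) \<Rightarrow> real" where
  "Qfun p H V w \<phi> = (\<integral>x. H x (grad \<phi> x) powr p + V x * \<bar>\<phi> x\<bar> powr p \<partial>lebesgue_on w)"

definition lambda1 :: "real \<Rightarrow> ('a::euclidean_space \<Rightarrow> 'a \<Rightarrow> real) \<Rightarrow> ('a \<Rightarrow> real) \<Rightarrow> 'a set \<Rightarrow> real" where
  "lambda1 p H V w = Inf {Qfun p H V w \<phi> / (\<integral>x. \<bar>\<phi> x\<bar> powr p \<partial>lebesgue_on w) | \<phi>.
                          test_fun w \<phi> \<and> (\<exists>x. \<phi> x \<noteq> 0)}"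

definition is_eigenvalue :: "real \<Rightarrow> ('a::euclidean_space \<Rightarrow> 'a \<Rightarrow> real) \<Rightarrow> ('a \<Rightarrow> real) \<Rightarrow> 'a set \<Rightarrow> real \<Rightarrow> bool" where
  "is_eigenvalue p H V w lam \<longleftrightarrow>
     (\<exists>v g. W01p p w v g \<and> \<not> (AE x in lebesgue_on w. v x = 0) \<and>
        (\<forall>\<phi>. test_fun w \<phi> \<longrightarrow>
           (\<integral>x. Aop p H x (g x) \<bullet> grad \<phi> x \<partial>lebesgue_on w)
           + (\<integral>x. (V x - lam) * (\<bar>v x\<bar> powr (p - 2) * v x) * \<phi> x \<partial>lebesgue_on w) = 0))"

end

theory Submission
  imports Defs "HOL-Complex_Analysis.Great_Picard"
begin

text \<open>An eigenvalue differing from \<open>lam1\<close> is larger than \<open>lam1\<close>, and by Picone's inequality its eigenfunctions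
  change sign. If such eigenvalues accumulated at \<open>lam1\<close>, the normalized positive and negative parts of
  their eigenfunctions would both be minimizing sequences of the Rayleigh quotient: testing the equation
  with the positive part shows that its quotient is the eigenvalue. By compactness the two sequences converge in
  $L^p$, along a subsequence, to nonnegative eigenfunctions for \<open>lam1\<close> with disjoint supports, and the strong
  maximum principle makes both of them positive almost everywhere, a contradiction.

  The potential is controlled by an Adams-type inequality: the $V$-weighted $L^p$ norm of a test function is at most
  $\delta$ times the norm of its gradient plus $C_\delta$ times its norm. It is obtained by telescoping dyadic averages and
  a discrete Wolff inequality. Compactness replaces weak convergence by midpoint combinations and uniform convexity.\<close>

text \<open>No regularity of an eigenfunction beyond membership in the Sobolev closure enters.
  Positivity comes from the logarithm: testing with a cut-off times \<open>v powr (1 - p)\<close>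
  bounds the gradient of \<open>ln v\<close> on balls, whereas a non-null zero set next to a
  non-null set of positivity would make the oscillation of \<open>ln v\<close> infinite;
  connectedness turns this local alternative into a global one.

  The free parameter \<delta> of the weighted inequality is used twice: it absorbs the potential
  into the energy, which bounds the Rayleigh quotient from below, and it makes the potential term
  continuous along sequences converging in L^p whose gradients are merely bounded.

  The averages of V over dyadic cubes decay geometrically unless p = n, where only a power of the
  generation is gained. This endpoint alone forces the Wolff-type duality argument; elsewhere a
  weighted Hoelder inequality is enough.

  Since test functions are smooth in a coinductive sense, each nonlinear expression in a solution
  (positive part, negative power, logarithm) enters through a smooth regularization vanishing where
  it must, followed by a limit in L^p.\<close>

abbreviation (input) LIMSEQ_ascii (infix "---->" 60) where "X ----> L == X \<longlonglongrightarrow> L"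

section \<open>Smooth functions and test functions\<close>

text \<open>The index \<open>k\<close> is there because differentiating
  \<open>exp (- inverse t)\<close> produces powers of \<open>inverse t\<close>; the whole family,
  unlike its member \<open>k = 0\<close>, is closed under differentiation up to linear
  combinations.\<close>

definition flat_exp :: "nat => real => real" where
  "flat_exp k t = (if t > 0 then inverse t ^ k * exp (- inverse t) else 0)"

lemma flat_exp_tendsto_0: "(flat_exp k \<longlongrightarrow> 0) (at 0)"
proof -
  have lim: "((%t. inverse t ^ k * exp (- inverse t)) \<longlongrightarrow> 0) (at_right (0::real))"
  proof -
    have "((%x. x ^ k / exp x) \<longlongrightarrow> (0::real)) at_top"
      by (rule tendsto_power_div_exp_0)
    then have "((%x. inverse x ^ k / exp (inverse x)) \<longlongrightarrow> (0::real)) (at_right 0)"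
      by (rule filterlim_compose) (rule filterlim_inverse_at_top_right)
    then show ?thesis
      by (simp add: exp_minus divide_inverse)
  qed
  have r: "(flat_exp k \<longlongrightarrow> 0) (at_right 0)"
  proof (rule Lim_transform_eventually[OF lim])
    show "\<forall>\<^sub>F t in at_right 0. inverse t ^ k * exp (- inverse t) = flat_exp k t"
      using eventually_at_right_less[of "0::real"] by eventually_elim (simp add: flat_exp_def)
  qed
  have l: "(flat_exp k \<longlongrightarrow> 0) (at_left 0)"
  proof (rule Lim_transform_eventually[OF tendsto_const])
    show "\<forall>\<^sub>F t in at_left 0. 0 = flat_exp k t"
      unfolding eventually_at_left_field by (intro exI[of _ "-1"]) (auto simp: flat_exp_def)
  qed
  show ?thesis
    using r l by (simp add: filterlim_split_at)
qed

lemma flat_exp_Suc: "flat_exp k t / t = flat_exp (Suc k) t"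
  by (auto simp: flat_exp_def field_simps)

text \<open>At \<open>0\<close> the difference quotient of \<open>flat_exp k\<close> is
  \<open>flat_exp (Suc k)\<close>, which tends to zero. Away from \<open>0\<close> the formula is
  the product rule or the derivative of a locally zero function.\<close>

lemma DERIV_flat_exp:
  "(flat_exp k has_real_derivative (flat_exp (k + 2) t - real k * flat_exp (Suc k) t)) (at t)"
proof (cases "t = 0")
  case True
  have "((%h. (flat_exp k (0 + h) - flat_exp k 0) / h) \<longlongrightarrow> 0) (at 0)"
    using flat_exp_tendsto_0[of "Suc k"] by (simp add: flat_exp_Suc flat_exp_def[of k 0])
  then show ?thesis
    using True by (simp add: DERIV_def flat_exp_def)
next
  case False
  show ?thesis
  proof (cases "t > 0")
    case True
    have "((%t. inverse t ^ k * exp (- inverse t)) has_real_derivative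
        (flat_exp (k + 2) t - real k * flat_exp (Suc k) t)) (at t)"
    proof (cases k)
      case 0
      then show ?thesis using True
        by (auto intro!: derivative_eq_intros simp: flat_exp_def power2_eq_square)
    next
      case (Suc m)
      show ?thesis using True unfolding Suc
        by (auto intro!: derivative_eq_intros simp: flat_exp_def power2_eq_square algebra_simps)
          (cases m; simp)
    qed
    then show ?thesis
    proof (rule has_field_derivative_transform_within_open[where S = "{0<..}"])
    qed (use True in \<open>auto simp: flat_exp_def\<close>)
  next
    case neg: False
    have "((%t. 0) has_real_derivative (flat_exp (k + 2) t - real k * flat_exp (Suc k) t)) (at t)"
      using neg by (simp add: flat_exp_def)
    then show ?thesis
    proof (rule has_field_derivative_transform_within_open[where S = "{..<0}"])
    qed (use False neg in \<open>auto simp: flat_exp_def\<close>)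
  qed
qed

text \<open>A class of functions closed under differentiation; its members are smooth by coinduction.\<close>

inductive smooth_gen :: "('a::euclidean_space => real) => bool" where
  base: "smooth_fun f ==> smooth_gen f"
| const: "smooth_gen (%x. c)"
| inner: "smooth_gen (%x. x \<bullet> c)"
| square: "smooth_gen (%x. x \<bullet> x)"
| add: "smooth_gen f ==> smooth_gen g ==> smooth_gen (%x. f x + g x)"
| mult: "smooth_gen f ==> smooth_gen g ==> smooth_gen (%x. f x * g x)"
| powr: "smooth_gen f ==> (!!x. f x > 0) ==> smooth_gen (%x. f x powr a)"
| ln: "smooth_gen f ==> (!!x. f x > 0) ==> smooth_gen (%x. ln (f x))"
| flat: "smooth_gen f ==> smooth_gen (%x. flat_exp k (f x))"

lemma smooth_gen_deriv:
  "smooth_gen f ==> \<exists>f'. (\<forall>x. (f has_derivative f' x) (at x)) \<and> (\<forall>b\<in>Basis. smooth_gen (%x. f' x b))"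
proof (induction rule: smooth_gen.induct)
  case (base f)
  then have "\<forall>x. f differentiable (at x)" "\<forall>b\<in>Basis. smooth_fun (%x. frechet_derivative f (at x) b)"
    by (auto elim: smooth_fun.cases)
  then show ?case
    by (intro exI[of _ "%x. frechet_derivative f (at x)"])
      (auto intro: smooth_gen.base simp: frechet_derivative_works[symmetric])
next
  case (const c)
  show ?case by (intro exI[of _ "%x h. 0"]) (auto intro: smooth_gen.const)
next
  case (inner c)
  show ?case by (intro exI[of _ "%x h. h \<bullet> c"])
      (auto intro!: smooth_gen.const derivative_eq_intros)
next
  case square
  show ?case
  proof (intro exI[of _ "%x h. 2 * (x \<bullet> h)"] conjI allI ballI)
    fix x :: 'a
    show "((%x. x \<bullet> x) has_derivative (%h. 2 * (x \<bullet> h))) (at x)"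
      by (auto intro!: derivative_eq_intros simp: inner_commute)
    show "smooth_gen (%x::'a. 2 * (x \<bullet> b))" for b
      by (intro smooth_gen.mult smooth_gen.const smooth_gen.inner)
  qed
next
  case (add f g)
  then obtain f' g' where "!!x. (f has_derivative f' x) (at x)" "!!b. b \<in> Basis ==> smooth_gen (%x. f' x b)"
    "!!x. (g has_derivative g' x) (at x)" "!!b. b \<in> Basis ==> smooth_gen (%x. g' x b)" by blast
  then show ?case
    by (intro exI[of _ "%x h. f' x h + g' x h"]) (auto intro!: smooth_gen.add has_derivative_add)
next
  case (mult f g)
  then obtain f' g' where "!!x. (f has_derivative f' x) (at x)" "!!b. b \<in> Basis ==> smooth_gen (%x. f' x b)"
    "!!x. (g has_derivative g' x) (at x)" "!!b. b \<in> Basis ==> smooth_gen (%x. g' x b)" by blast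
  then show ?case
    by (intro exI[of _ "%x h. f x * g' x h + f' x h * g x"])
      (auto intro!: smooth_gen.add smooth_gen.mult mult.hyps has_derivative_mult)
next
  case (powr f a)
  then obtain f' where f': "!!x. (f has_derivative f' x) (at x)" "!!b. b \<in> Basis ==> smooth_gen (%x. f' x b)"
    by blast
  show ?case
  proof (intro exI[of _ "%x h. a * f x powr (a - 1) * f' x h"] conjI allI ballI)
    fix x
    have "((%t. t powr a) has_real_derivative a * f x powr (a - 1)) (at (f x))"
      using powr.hyps(2)[of x] by (rule has_real_derivative_powr)
    from has_derivative_compose[OF f'(1)[of x] this[unfolded has_field_derivative_def]]
    show "((%x. f x powr a) has_derivative (%h. a * f x powr (a - 1) * f' x h)) (at x)" .
    show "smooth_gen (%x. a * f x powr (a - 1) * f' x b)" if "b \<in> Basis" for b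
      using that by (intro smooth_gen.mult smooth_gen.const smooth_gen.powr powr.hyps f')
  qed
next
  case (ln f)
  then obtain f' where f': "!!x. (f has_derivative f' x) (at x)" "!!b. b \<in> Basis ==> smooth_gen (%x. f' x b)"
    by blast
  show ?case
  proof (intro exI[of _ "%x h. f x powr (-1) * f' x h"] conjI allI ballI)
    fix x
    have "(ln has_real_derivative f x powr (-1)) (at (f x))"
      using DERIV_ln[OF ln.hyps(2)[of x]] ln.hyps(2)[of x] by (simp add: powr_minus)
    from has_derivative_compose[OF f'(1)[of x] this[unfolded has_field_derivative_def]]
    show "((%x. ln (f x)) has_derivative (%h. f x powr (-1) * f' x h)) (at x)" .
    show "smooth_gen (%x. f x powr (-1) * f' x b)" if "b \<in> Basis" for b
      using that by (intro smooth_gen.mult smooth_gen.powr ln.hyps f')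
  qed
next
  case (flat f k)
  then obtain f' where f': "!!x. (f has_derivative f' x) (at x)" "!!b. b \<in> Basis ==> smooth_gen (%x. f' x b)"
    by blast
  show ?case
  proof (intro exI[of _ "%x h. (flat_exp (k + 2) (f x) + (- real k) * flat_exp (Suc k) (f x)) * f' x h"] conjI allI ballI)
    fix x
    from has_derivative_compose[OF f'(1)[of x] DERIV_flat_exp[unfolded has_field_derivative_def]]
    show "((%x. flat_exp k (f x)) has_derivative (%h. (flat_exp (k + 2) (f x) + (- real k) * flat_exp (Suc k) (f x)) * f' x h)) (at x)"
      by simp
    show "smooth_gen (%x. (flat_exp (k + 2) (f x) + (- real k) * flat_exp (Suc k) (f x)) * f' x b)" if "b \<in> Basis" for b
      using that by (intro smooth_gen.mult smooth_gen.add smooth_gen.const smooth_gen.flat flat.hyps f')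
  qed
qed

text \<open>The class is its own coinductive invariant. Because every smooth function is a
  generator, this transfers all closure rules of the class to \<open>smooth_fun\<close>.\<close>

lemma smooth_gen_imp_smooth_fun: "smooth_gen f ==> smooth_fun f"
proof (coinduction arbitrary: f rule: smooth_fun.coinduct)
  case (smooth_fun f)
  from smooth_gen_deriv[OF this] obtain f' where f': "!!x. (f has_derivative f' x) (at x)"
    "!!b. b \<in> Basis ==> smooth_gen (%x. f' x b)" by blast
  have "frechet_derivative f (at x) = f' x" for x
    using frechet_derivative_at[OF f'(1)] by simp
  then have "\<forall>b\<in>Basis. smooth_gen (%x. frechet_derivative f (at x) b)" using f'(2) by simp
  moreover have "\<forall>x. f differentiable (at x)" using f'(1) by (meson differentiableI)
  ultimately show ?case by blast
qed

lemma smooth_intros: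
  shows smooth_const: "smooth_fun (%x. c)"
    and smooth_inner: "smooth_fun (%x. x \<bullet> d)"
    and smooth_square: "smooth_fun (%x. x \<bullet> x)"
    and smooth_add: "smooth_fun f ==> smooth_fun g ==> smooth_fun (%x. f x + g x)"
    and smooth_mult: "smooth_fun f ==> smooth_fun g ==> smooth_fun (%x. f x * g x)"
    and smooth_powr: "smooth_fun f ==> (!!x. f x > 0) ==> smooth_fun (%x. f x powr a)"
    and smooth_ln: "smooth_fun f ==> (!!x. f x > 0) ==> smooth_fun (%x. ln (f x))"
    and smooth_flat_exp: "smooth_fun f ==> smooth_fun (%x. flat_exp k (f x))"
proof -
  note S = smooth_gen_imp_smooth_fun and b = smooth_gen.base
  show "smooth_fun (%x. c)" by (rule S[OF smooth_gen.const])
  show "smooth_fun (%x. x \<bullet> d)" by (rule S[OF smooth_gen.inner])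
  show "smooth_fun (%x. x \<bullet> x)" by (rule S[OF smooth_gen.square])
  show "smooth_fun (%x. f x + g x)" if "smooth_fun f" "smooth_fun g"
    by (rule S[OF smooth_gen.add[OF b b]]) (fact that)+
  show "smooth_fun (%x. f x * g x)" if "smooth_fun f" "smooth_fun g"
    by (rule S[OF smooth_gen.mult[OF b b]]) (fact that)+
  show "smooth_fun (%x. f x powr a)" if "smooth_fun f" "!!x. f x > 0"
    by (rule S[OF smooth_gen.powr[OF b]]) (fact that)+
  show "smooth_fun (%x. ln (f x))" if "smooth_fun f" "!!x. f x > 0"
    by (rule S[OF smooth_gen.ln[OF b]]) (fact that)+
  show "smooth_fun (%x. flat_exp k (f x))" if "smooth_fun f"
    by (rule S[OF smooth_gen.flat[OF b]]) (fact that)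
qed

lemma smooth_diff: "smooth_fun f ==> smooth_fun g ==> smooth_fun (%x. f x - g x)"
  using smooth_add[OF _ smooth_mult[OF smooth_const[of "-1"]], of f g] by simp

lemma smooth_power: "smooth_fun f ==> smooth_fun (%x. f x ^ m)"
  by (induction m) (auto intro: smooth_const smooth_mult)

text \<open>\<open>grad\<close> is a choice among representing vectors; uniqueness of the derivative
  makes the choice irrelevant.\<close>

lemma grad_eqI:
  assumes "(f has_derivative (%h. g \<bullet> h)) (at x)"
  shows "grad f x = g"
proof -
  have "(f has_derivative (%h. grad f x \<bullet> h)) (at x)"
    unfolding grad_def using assms by (rule someI)
  from has_derivative_unique[OF this assms]
  have "grad f x \<bullet> h = g \<bullet> h" for h by metis
  then show ?thesis by (metis vector_eq_rdot)
qed

text \<open>Riesz representation in coordinates: the representing vector has the values of the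
  derivative on the basis as its components.\<close>

lemma grad_works:
  assumes "f differentiable (at x)"
  shows "(f has_derivative (%h. grad f x \<bullet> h)) (at x)"
proof -
  from assms obtain f' where f': "(f has_derivative f') (at x)" by (auto simp: differentiable_def)
  interpret f': bounded_linear f' using f' by (rule has_derivative_bounded_linear)
  have "f' h = (\<Sum>b\<in>Basis. f' b *\<^sub>R b) \<bullet> h" for h
  proof -
    have "f' h = f' (\<Sum>b\<in>Basis. (h \<bullet> b) *\<^sub>R b)" by (simp add: euclidean_representation)
    also have "... = (\<Sum>b\<in>Basis. (h \<bullet> b) * f' b)" by (simp add: f'.sum f'.scaleR)
    also have "... = (\<Sum>b\<in>Basis. f' b *\<^sub>R b) \<bullet> h"
      by (simp add: inner_sum_left) (simp add: inner_commute mult.commute)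
    finally show ?thesis .
  qed
  then have "f' = (%h. (\<Sum>b\<in>Basis. f' b *\<^sub>R b) \<bullet> h)" by (rule ext)
  with f' have "(f has_derivative (%h. (\<Sum>b\<in>Basis. f' b *\<^sub>R b) \<bullet> h)) (at x)" by (rule subst[rotated])
  then show ?thesis unfolding grad_def by (rule someI)
qed

lemma smooth_differentiable: "smooth_fun f ==> f differentiable (at x)"
  by (auto elim: smooth_fun.cases)

lemma smooth_grad: "smooth_fun f ==> (f has_derivative (%h. grad f x \<bullet> h)) (at x)"
  by (intro grad_works smooth_differentiable)

lemma smooth_continuous: "smooth_fun f ==> continuous_on S f"
  by (meson continuous_at_imp_continuous_on differentiable_imp_continuous_within smooth_differentiable)

lemma smooth_grad_inner:
  assumes "smooth_fun f" "b \<in> Basis"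
  shows "smooth_fun (%x. grad f x \<bullet> b)"
proof -
  have "frechet_derivative f (at x) b = grad f x \<bullet> b" for x
    using frechet_derivative_at[OF smooth_grad[OF assms(1)]] by metis
  moreover have "smooth_fun (%x. frechet_derivative f (at x) b)"
    using assms by (auto elim!: smooth_fun.cases)
  ultimately show ?thesis by simp
qed

lemma smooth_grad_continuous:
  assumes "smooth_fun f" shows "continuous_on S (grad f)"
proof -
  have "continuous_on S (%x. \<Sum>b\<in>Basis. (grad f x \<bullet> b) *\<^sub>R b)"
    by (intro continuous_intros smooth_continuous smooth_grad_inner assms)
  then show ?thesis by (simp add: euclidean_representation)
qed

text \<open>The complement of the closed support is a neighbourhood of \<open>x\<close> on which the
  function vanishes identically.\<close>

lemma grad_outside:
  assumes "x \<notin> closure {x. f x ~= 0}"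
  shows "grad f x = 0"
proof (rule grad_eqI)
  have "((%x. 0) has_derivative (%h. (0::'a) \<bullet> h)) (at x)" by simp
  then show "(f has_derivative (%h. (0::'a) \<bullet> h)) (at x)"
  proof (rule has_derivative_transform_within_open)
    show "open (- closure {x. f x ~= 0})" by auto
    show "x \<in> - closure {x. f x ~= 0}" using assms by simp
    show "0 = f y" if "y \<in> - closure {x. f x ~= 0}" for y
    proof (rule ccontr)
      assume "0 ~= f y"
      then have "y \<in> closure {x. f x ~= 0}" using closure_subset by fastforce
      then show False using that by simp
    qed
  qed
qed

section \<open>Algebra of test functions and their gradients\<close>

lemma test_fun_smooth: "test_fun w phi ==> smooth_fun phi"
  by (simp add: test_fun_def)

lemma test_fun_outside:
  assumes "test_fun w phi" "x \<notin> w"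
  shows "phi x = 0" "grad phi x = 0"
proof -
  have x: "x \<notin> closure {x. phi x ~= 0}" using assms by (auto simp: test_fun_def)
  then show "phi x = 0" using closure_subset[of "{x. phi x ~= 0}"] by auto
  from x show "grad phi x = 0" by (rule grad_outside)
qed

lemma test_funI:
  assumes "test_fun w phi" "smooth_fun psi" "!!x. phi x = 0 ==> psi x = 0"
  shows "test_fun w psi"
proof -
  have sub: "closure {x. psi x ~= 0} \<subseteq> closure {x. phi x ~= 0}"
    by (rule closure_mono) (use assms(3) in auto)
  have "compact (closure {x. psi x ~= 0})"
    using compact_Int_closed[of "closure {x. phi x ~= 0}" "closure {x. psi x ~= 0}"] assms(1) sub
    by (simp add: test_fun_def Int_absorb1)
  then show ?thesis using assms sub by (auto simp: test_fun_def)
qed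

lemma test_fun_add:
  assumes "test_fun w phi" "test_fun w psi"
  shows "test_fun w (%x. phi x + psi x)"
proof -
  have sub: "closure {x. phi x + psi x ~= 0} \<subseteq> closure {x. phi x ~= 0} \<union> closure {x. psi x ~= 0}"
    unfolding closure_Un[symmetric] by (rule closure_mono) auto
  have "compact (closure {x. phi x ~= 0} \<union> closure {x. psi x ~= 0})"
    using assms by (auto simp: test_fun_def)
  then have "compact (closure {x. phi x + psi x ~= 0})"
    using compact_Int_closed[OF _ closed_closure, of _ "{x. phi x + psi x ~= 0}"] sub
    by (metis Int_absorb1)
  then show ?thesis using assms sub by (auto simp: test_fun_def intro: smooth_add)
qed

lemma test_fun_scale: "test_fun w phi ==> test_fun w (%x. c * phi x)"
  by (rule test_funI[of w phi]) (simp_all add: smooth_mult[OF smooth_const test_fun_smooth])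

lemma grad_add:
  "smooth_fun f ==> smooth_fun g ==> grad (%x. f x + g x) x = grad f x + grad g x"
  by (rule grad_eqI) (simp add: inner_add_left has_derivative_add smooth_grad)

lemma grad_scale: "smooth_fun f ==> grad (%x. c * f x) x = c *\<^sub>R grad f x"
  by (rule grad_eqI) (simp add: has_derivative_mult_right smooth_grad)

lemma grad_mult:
  "smooth_fun f ==> smooth_fun g ==> grad (%x. f x * g x) x = f x *\<^sub>R grad g x + g x *\<^sub>R grad f x"
  by (rule grad_eqI, rule has_derivative_eq_rhs, rule has_derivative_mult[OF smooth_grad smooth_grad])
    (auto simp: inner_add_left mult.commute)

lemma grad_compose:
  assumes "smooth_fun f" "(F has_real_derivative F') (at (f x))"
  shows "grad (%x. F (f x)) x = F' *\<^sub>R grad f x"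
  by (rule grad_eqI)
    (use has_derivative_compose[OF smooth_grad[OF assms(1)] assms(2)[unfolded has_field_derivative_def]] in simp)

lemma test_fun_bounded:
  assumes "test_fun w phi"
  obtains K where "K > 0" "!!x. \<bar>phi x\<bar> <= K" "!!x. norm (grad phi x) <= K"
proof -
  let ?C = "closure {x. phi x ~= 0}"
  have C: "compact ?C" and s: "smooth_fun phi" using assms by (auto simp: test_fun_def)
  have "bounded (phi ` ?C)"
    by (intro compact_imp_bounded compact_continuous_image C smooth_continuous s)
  then obtain a where "a > 0" and a: "!!x. x \<in> ?C ==> \<bar>phi x\<bar> <= a"
    unfolding bounded_pos real_norm_def by blast
  have "bounded (grad phi ` ?C)"
    by (intro compact_imp_bounded compact_continuous_image C smooth_grad_continuous s)
  then obtain b where "b > 0" and b: "!!x. x \<in> ?C ==> norm (grad phi x) <= b"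
    unfolding bounded_pos by blast
  have "\<bar>phi x\<bar> <= a + b \<and> norm (grad phi x) <= a + b" for x
  proof (cases "x \<in> ?C")
    case True
    show ?thesis using a[OF True] b[OF True] \<open>a > 0\<close> \<open>b > 0\<close> by linarith
  next
    case False
    then have "phi x = 0" using closure_subset[of "{x. phi x ~= 0}"] by auto
    then show ?thesis using grad_outside[OF False] \<open>a > 0\<close> \<open>b > 0\<close> by simp
  qed
  then show ?thesis using that[of "a + b"] \<open>a > 0\<close> \<open>b > 0\<close> by simp
qed

lemma ex_bump:
  fixes a :: "'a::euclidean_space"
  assumes "r > 0" "cball a r \<subseteq> w"
  obtains eta where "test_fun w eta" "!!x. eta x >= 0" "!!x. x \<in> ball a r \<longleftrightarrow> eta x > 0"
proof -
  \<comment> \<open>The argument is \<open>r^2 - |x - a|^2\<close>, expanded into inner products so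
    that the closure rules of smooth functions apply; it is positive exactly on the open
    ball.\<close>
  define eta where "eta = (%x. flat_exp 0 (r\<^sup>2 - (x \<bullet> x - 2 * (x \<bullet> a) + a \<bullet> a)))"
  have eq: "x \<bullet> x - 2 * (x \<bullet> a) + a \<bullet> a = (dist a x)\<^sup>2" for x
    by (simp add: dist_norm power2_norm_eq_inner inner_diff_left inner_diff_right inner_commute)
  have sm: "smooth_fun eta"
    unfolding eta_def
    by (intro smooth_flat_exp smooth_diff smooth_add smooth_const smooth_mult smooth_inner smooth_square)
  have pos: "x \<in> ball a r \<longleftrightarrow> eta x > 0" for x
  proof -
    have "dist a x < r \<longleftrightarrow> (dist a x)\<^sup>2 < r\<^sup>2"
      using \<open>r > 0\<close> by (metis less_eq_real_def power2_less_imp_less power_strict_mono zero_le_dist zero_less_numeral)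
    then show ?thesis unfolding eta_def eq flat_exp_def by simp
  qed
  have nn: "eta x >= 0" for x unfolding eta_def flat_exp_def by auto
  have "{x. eta x ~= 0} = ball a r" 
  proof (rule set_eqI)
    fix x show "x \<in> {x. eta x ~= 0} \<longleftrightarrow> x \<in> ball a r"
      using pos[of x] nn[of x] by (auto simp: less_le)
  qed
  then have "closure {x. eta x ~= 0} = cball a r" using \<open>r > 0\<close> by simp
  then have "test_fun w eta" using assms sm by (simp add: test_fun_def)
  then show ?thesis by (rule that) (rule nn, rule pos)
qed

section \<open>The Poincare inequality on convex sets\<close>

text \<open>A convex function lies above its tangents. Integrated with \<open>a\<close> a mean
  value, this is Jensen's inequality, and most convexity arguments below are reduced to it. The
  boundary values are treated apart because convexity is applied on the open half-line.\<close>

lemma powr_above_tangent: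
  fixes a s p :: real
  assumes "p >= 1" "a >= 0" "s >= 0"
  shows "a powr p + p * a powr (p - 1) * (s - a) <= s powr p"
proof (cases "a = 0")
  case True then show ?thesis by simp
next
  case False
  then have "a > 0" using assms by simp
  show ?thesis
  proof (cases "s = 0")
    case True
    have "a powr (p - 1) * a = a powr p" using powr_add[of a "p - 1" 1] \<open>a > 0\<close> by simp
    moreover have "1 * a powr p <= p * a powr p" using assms by (intro mult_right_mono) auto
    ultimately show ?thesis using True by (simp add: mult.assoc)
  next
    case False
    then have "s > 0" using assms by simp
    have "s powr p - a powr p >= (p * a powr (p - 1)) * (s - a)"
    proof (rule convex_on_imp_above_tangent[where A = "{0<..}"])
      show "a \<in> interior {0<..}" using \<open>a > 0\<close> by (simp add: interior_open)
      show "((%x. x powr p) has_real_derivative p * a powr (p - 1)) (at a within {0<..})"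
        using has_real_derivative_powr[OF \<open>a > 0\<close>] by (rule has_field_derivative_at_within)
    qed (use assms \<open>s > 0\<close> powr_convex in auto)
    then show ?thesis by linarith
  qed
qed

lemma nn_integral_lborel_affine:
  fixes F :: "'a::euclidean_space => ennreal"
  assumes [measurable]: "F \<in> borel_measurable borel" and "c > 0"
  shows "(\<integral>\<^sup>+x. F (t + c *\<^sub>R x) \<partial>lborel) = ennreal (inverse c ^ DIM('a)) * (\<integral>\<^sup>+x. F x \<partial>lborel)"
proof -
  have "(\<integral>\<^sup>+x. F x \<partial>lborel) = (\<integral>\<^sup>+x. F x \<partial>density (distr lborel borel (%x. t + c *\<^sub>R x)) (%_. \<bar>c\<bar>^DIM('a)))"
    using lborel_affine[of c t] \<open>c > 0\<close> by simp
  also have "... = ennreal (c ^ DIM('a)) * (\<integral>\<^sup>+x. F (t + c *\<^sub>R x) \<partial>lborel)"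
    using \<open>c > 0\<close> by (simp add: nn_integral_density nn_integral_distr nn_integral_cmult)
  finally have "ennreal (inverse c ^ DIM('a)) * (\<integral>\<^sup>+x. F x \<partial>lborel)
      = ennreal (inverse c ^ DIM('a) * c ^ DIM('a)) * (\<integral>\<^sup>+x. F (t + c *\<^sub>R x) \<partial>lborel)"
    using \<open>c > 0\<close> by (simp add: ennreal_mult mult.assoc)
  also have "inverse c ^ DIM('a) * c ^ DIM('a) = 1"
    using \<open>c > 0\<close> by (simp add: power_mult_distrib[symmetric])
  finally show ?thesis by simp
qed

text \<open>The tangent inequality at the mean value of \<open>u\<close>, integrated: the linear
  term has integral zero.\<close>

lemma jensen_unit_interval:
  fixes u :: "real => real"
  assumes "p >= 1" and cont: "continuous_on {0..1} u" and nn: "!!t. 0 <= u t"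
  shows "integral {0..1} u powr p <= integral {0..1} (%t. u t powr p)"
proof -
  define a where "a = integral {0..1} u"
  have i1: "u integrable_on {0..1}" using cont by (rule integrable_continuous_real)
  have a: "a >= 0" unfolding a_def by (rule integral_nonneg[OF i1]) (use nn in auto)
  have "continuous_on {0..1} (%t. u t powr p)"
    using cont nn \<open>p >= 1\<close> by (intro continuous_on_powr' continuous_on_const) auto
  then have i2: "(%t. u t powr p) integrable_on {0..1}" by (rule integrable_continuous_real)
  have ha: "(u has_integral a) {0..1}" unfolding a_def by (rule integrable_integral[OF i1])
  have hc: "((%t::real. c) has_integral c) {0..1}" for c :: real
    using has_integral_const_real[of c 0 1] by simp
  have h: "((%t. a powr p + p * a powr (p - 1) * (u t - a)) has_integral
      (a powr p + p * a powr (p - 1) * (a - a))) {0..1}"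
    by (intro has_integral_add has_integral_mult_right has_integral_diff ha hc)
  have "a powr p = integral {0..1} (%t. a powr p + p * a powr (p - 1) * (u t - a))"
    using h by (simp add: integral_unique)
  also have "... <= integral {0..1} (%t. u t powr p)"
  proof (rule integral_le)
    show "(%t. a powr p + p * a powr (p - 1) * (u t - a)) integrable_on {0..1}"
      using h by (auto simp: integrable_on_def)
  qed (use i2 powr_above_tangent[OF \<open>p >= 1\<close> a nn] in auto)
  finally show ?thesis by (simp add: a_def)
qed

text \<open>Fundamental theorem of calculus along the segment from \<open>y\<close> to
  \<open>x\<close>, then Jensen in the parameter. The bound is a nonnegative extended integral so
  that Tonelli's theorem can exchange it with integrals over \<open>x\<close> and
  \<open>y\<close>.\<close>

lemma powr_diff_le_segment:
  fixes phi :: "'a::euclidean_space => real"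
  assumes phi: "smooth_fun phi" and "p >= 1" and d: "norm (x - y) <= d"
  shows "ennreal (\<bar>phi x - phi y\<bar> powr p)
    <= (\<integral>\<^sup>+t. ennreal (d powr p * norm (grad phi (y + t *\<^sub>R (x - y))) powr p) * indicator {0..1} t \<partial>lborel)"
proof -
  define \<gamma> where "\<gamma> t = y + t *\<^sub>R (x - y)" for t
  have d0: "d >= 0" using d norm_ge_zero order_trans by blast
  have c\<gamma>: "continuous_on S \<gamma>" for S unfolding \<gamma>_def by (intro continuous_intros)
  define u where "u t = norm (grad phi (\<gamma> t))" for t
  have cu: "continuous_on S u" for S
    unfolding u_def by (intro continuous_on_norm continuous_on_compose2[OF smooth_grad_continuous[OF phi, of UNIV] c\<gamma>]) auto
  have der: "((%t. phi (\<gamma> t)) has_vector_derivative (grad phi (\<gamma> t) \<bullet> (x - y))) (at t within S)" for t S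
  proof -
    have "(\<gamma> has_derivative (%h. h *\<^sub>R (x - y))) (at t within S)"
      unfolding \<gamma>_def by (auto intro!: derivative_eq_intros)
    from has_derivative_compose[OF this smooth_grad[OF phi]]
    show ?thesis by (simp add: has_vector_derivative_def)
  qed
  have "((%t. grad phi (\<gamma> t) \<bullet> (x - y)) has_integral (phi (\<gamma> 1) - phi (\<gamma> 0))) {0..1}"
    by (rule fundamental_theorem_of_calculus) (auto intro: der)
  then have hi: "((%t. grad phi (\<gamma> t) \<bullet> (x - y)) has_integral (phi x - phi y)) {0..1}"
    by (simp add: \<gamma>_def)
  have iu: "(%t. d * u t) integrable_on {0..1}"
    by (intro integrable_continuous_real continuous_intros cu)
  have "norm (phi x - phi y) <= integral {0..1} (%t. d * u t)"
    unfolding integral_unique[OF hi, symmetric]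
  proof (rule integral_norm_bound_integral)
    fix t :: real
    have "\<bar>grad phi (\<gamma> t) \<bullet> (x - y)\<bar> <= norm (grad phi (\<gamma> t)) * norm (x - y)" by (rule Cauchy_Schwarz_ineq2)
    also have "... <= u t * d" unfolding u_def by (rule mult_left_mono[OF d]) simp
    finally show "norm (grad phi (\<gamma> t) \<bullet> (x - y)) <= d * u t" by (simp add: mult.commute)
  qed (use hi iu in auto)
  then have "\<bar>phi x - phi y\<bar> <= d * integral {0..1} u" by simp
  then have "\<bar>phi x - phi y\<bar> powr p <= (d * integral {0..1} u) powr p"
    using \<open>p >= 1\<close> by (intro powr_mono2) auto
  also have "... = d powr p * integral {0..1} u powr p"
    by (rule powr_mult) 
  also have "... <= d powr p * integral {0..1} (%t. u t powr p)"
    by (intro mult_left_mono jensen_unit_interval \<open>p >= 1\<close> cu) (auto simp: u_def)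
  also have "... = integral {0..1} (%t. d powr p * u t powr p)" by simp
  finally have le: "\<bar>phi x - phi y\<bar> powr p <= integral {0..1} (%t. d powr p * u t powr p)" .
  have cp: "continuous_on {0..1} (%t. d powr p * u t powr p)"
    using \<open>p >= 1\<close> by (intro continuous_on_mult continuous_on_const continuous_on_powr' cu) (auto simp: u_def)
  have si: "set_integrable lborel {0..1} (%t. d powr p * u t powr p)"
    unfolding set_integrable_def by (rule borel_integrable_compact[OF _ cp]) simp
  have "ennreal (integral {0..1} (%t. d powr p * u t powr p)) = ennreal (LINT t:{0..1}|lborel. d powr p * u t powr p)"
    by (simp only: set_borel_integral_eq_integral(2)[OF si])
  also have "... = (\<integral>\<^sup>+t. ennreal (indicator {0..1} t *\<^sub>R (d powr p * u t powr p)) \<partial>lborel)"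
    unfolding set_lebesgue_integral_def
    by (rule nn_integral_eq_integral[symmetric]) (use si in \<open>auto simp: set_integrable_def\<close>)
  also have "... = (\<integral>\<^sup>+t. ennreal (d powr p * u t powr p) * indicator {0..1} t \<partial>lborel)"
    by (intro nn_integral_cong) (auto split: split_indicator)
  finally show ?thesis using ennreal_leI[OF le] by (simp add: u_def \<gamma>_def)
qed

text \<open>The point $(1-t)y+tx$ is at least half as far from one of $x$, $y$ as they are from each other,
  so integrating in that variable costs a Jacobian of at most $2^n$.\<close>

lemma poincare_kernel:
  fixes phi :: "'a::euclidean_space => real" and R :: "'a => 'a => bool"
  assumes phi: "smooth_fun phi" and p: "p >= 1"
    and meas: "{z. R (fst z) (snd z)} \<in> sets (borel \<Otimes>\<^sub>M borel)"
    and sym: "!!x y. R x y ==> R y x"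
    and seg: "!!x y t. R x y ==> 0 <= t ==> t <= 1 ==> R (y + t *\<^sub>R (x - y)) y"
    and d: "!!x y. R x y ==> norm (x - y) <= d"
  shows "(\<integral>\<^sup>+x. \<integral>\<^sup>+y. indicator {z. R (fst z) (snd z)} (x, y) * ennreal (\<bar>phi x - phi y\<bar> powr p) \<partial>lborel \<partial>lborel)
    <= ennreal (2 ^ DIM('a) * d powr p) *
       (\<integral>\<^sup>+x. \<integral>\<^sup>+y. indicator {z. R (fst z) (snd z)} (x, y) * ennreal (norm (grad phi x) powr p) \<partial>lborel \<partial>lborel)"
proof -
  define S where "S = {z. R (fst z) (snd z)}"
  define k :: "'a => 'a => ennreal" where "k x y = indicator S (x, y)" for x y
  have k_def': "k x y = (if R x y then 1 else 0)" for x y by (simp add: k_def S_def)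
  have Sm [measurable]: "S \<in> sets (borel \<Otimes>\<^sub>M borel)" unfolding S_def by (rule meas)
  define g where "g z = ennreal (norm (grad phi z) powr p)" for z
  have [measurable]: "grad phi \<in> borel_measurable borel"
    using borel_measurable_continuous_onI[OF smooth_grad_continuous[OF phi]] .
  have [measurable]: "g \<in> borel_measurable borel" unfolding g_def by measurable
  have [measurable]: "phi \<in> borel_measurable borel"
    using borel_measurable_continuous_onI[OF smooth_continuous[OF phi]] .
  define J where "J = (\<integral>\<^sup>+x. \<integral>\<^sup>+y. k x y * g x \<partial>lborel \<partial>lborel)"
  have ksym: "k x y = k y x" for x y using sym by (auto simp: k_def')
  have J2: "(\<integral>\<^sup>+y. \<integral>\<^sup>+z. k z y * g z \<partial>lborel \<partial>lborel) = J"
    unfolding J_def k_def by (rule lborel_pair.Fubini') measurable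
  have inner: "(\<integral>\<^sup>+x. k x y * g (y + t *\<^sub>R (x - y)) \<partial>lborel) <= ennreal (2 ^ DIM('a)) * (\<integral>\<^sup>+z. k z y * g z \<partial>lborel)"
    if "t >= 1/2" "t <= 1" for t y
  proof -
    have "(\<integral>\<^sup>+x. k x y * g (y + t *\<^sub>R (x - y)) \<partial>lborel)
        <= (\<integral>\<^sup>+x. k (y + t *\<^sub>R (x - y)) y * g (y + t *\<^sub>R (x - y)) \<partial>lborel)"
      by (intro nn_integral_mono mult_right_mono) (use that seg in \<open>auto simp: k_def'\<close>)
    also have "... = (\<integral>\<^sup>+x. (%z. k z y * g z) ((y - t *\<^sub>R y) + t *\<^sub>R x) \<partial>lborel)"
      by (intro nn_integral_cong) (simp add: algebra_simps)
    also have "... = ennreal (inverse t ^ DIM('a)) * (\<integral>\<^sup>+z. k z y * g z \<partial>lborel)"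
      by (rule nn_integral_lborel_affine) (use that in \<open>auto simp: k_def\<close>)
    also have "... <= ennreal (2 ^ DIM('a)) * (\<integral>\<^sup>+z. k z y * g z \<partial>lborel)"
    proof -
      have "inverse t <= inverse (1/2)" by (rule le_imp_inverse_le) (use that in auto)
      then show ?thesis using that by (intro mult_right_mono ennreal_leI power_mono) auto
    qed
    finally show ?thesis .
  qed
  have T: "(\<integral>\<^sup>+x. \<integral>\<^sup>+y. k x y * g (y + t *\<^sub>R (x - y)) \<partial>lborel \<partial>lborel) <= ennreal (2 ^ DIM('a)) * J"
    if t: "0 <= t" "t <= 1" for t
  proof (cases "t >= 1/2")
    case True
    have "(\<integral>\<^sup>+x. \<integral>\<^sup>+y. k x y * g (y + t *\<^sub>R (x - y)) \<partial>lborel \<partial>lborel)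
      = (\<integral>\<^sup>+y. \<integral>\<^sup>+x. k x y * g (y + t *\<^sub>R (x - y)) \<partial>lborel \<partial>lborel)"
      unfolding k_def by (rule lborel_pair.Fubini'[symmetric]) measurable
    also have "... <= (\<integral>\<^sup>+y. ennreal (2 ^ DIM('a)) * (\<integral>\<^sup>+z. k z y * g z \<partial>lborel) \<partial>lborel)"
      by (intro nn_integral_mono inner) (use True t in auto)
    also have "... = ennreal (2 ^ DIM('a)) * J"
      unfolding J2[symmetric] k_def by (rule nn_integral_cmult) measurable
    finally show ?thesis .
  next
    \<comment> \<open>For a parameter below one half the roles of \<open>x\<close> and
      \<open>y\<close> are exchanged: symmetry of \<open>R\<close> turns \<open>t\<close> into
      \<open>1 - t\<close>, and \<open>inner\<close> applies.\<close>
    case False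
    have "(\<integral>\<^sup>+x. \<integral>\<^sup>+y. k x y * g (y + t *\<^sub>R (x - y)) \<partial>lborel \<partial>lborel)
      = (\<integral>\<^sup>+x. \<integral>\<^sup>+y. k y x * g (x + (1 - t) *\<^sub>R (y - x)) \<partial>lborel \<partial>lborel)"
    proof (intro nn_integral_cong)
      fix x y :: 'a
      have "y + t *\<^sub>R (x - y) = x + (1 - t) *\<^sub>R (y - x)" by (simp add: algebra_simps)
      then show "k x y * g (y + t *\<^sub>R (x - y)) = k y x * g (x + (1 - t) *\<^sub>R (y - x))"
        using ksym[of x y] by simp
    qed
    also have "... <= (\<integral>\<^sup>+y. ennreal (2 ^ DIM('a)) * (\<integral>\<^sup>+z. k z y * g z \<partial>lborel) \<partial>lborel)"
      by (intro nn_integral_mono inner) (use False t in auto)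
    also have "... = ennreal (2 ^ DIM('a)) * J"
      unfolding J2[symmetric] k_def by (rule nn_integral_cmult) measurable
    finally show ?thesis .
  qed
  have "(\<integral>\<^sup>+x. \<integral>\<^sup>+y. k x y * ennreal (\<bar>phi x - phi y\<bar> powr p) \<partial>lborel \<partial>lborel)
    <= (\<integral>\<^sup>+x. \<integral>\<^sup>+y. (\<integral>\<^sup>+t. k x y * (ennreal (d powr p) * g (y + t *\<^sub>R (x - y)) * indicator {0..1} t) \<partial>lborel) \<partial>lborel \<partial>lborel)"
  proof (intro nn_integral_mono)
    fix x y :: 'a
    show "k x y * ennreal (\<bar>phi x - phi y\<bar> powr p)
      <= (\<integral>\<^sup>+t. k x y * (ennreal (d powr p) * g (y + t *\<^sub>R (x - y)) * indicator {0..1} t) \<partial>lborel)"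
      using powr_diff_le_segment[OF phi p d, of x y]
      by (auto simp: k_def' g_def ennreal_mult)
  qed
  also have "... = (\<integral>\<^sup>+x. \<integral>\<^sup>+t. (\<integral>\<^sup>+y. k x y * (ennreal (d powr p) * g (y + t *\<^sub>R (x - y)) * indicator {0..1} t) \<partial>lborel) \<partial>lborel \<partial>lborel)"
    unfolding k_def by (intro nn_integral_cong lborel_pair.Fubini'[symmetric]) measurable
  also have "... = (\<integral>\<^sup>+t. \<integral>\<^sup>+x. (\<integral>\<^sup>+y. k x y * (ennreal (d powr p) * g (y + t *\<^sub>R (x - y)) * indicator {0..1} t) \<partial>lborel) \<partial>lborel \<partial>lborel)"
    unfolding k_def by (rule lborel_pair.Fubini'[symmetric]) measurable
  also have "... = (\<integral>\<^sup>+t. ennreal (d powr p) * indicator {0..1} t * (\<integral>\<^sup>+x. \<integral>\<^sup>+y. k x y * g (y + t *\<^sub>R (x - y)) \<partial>lborel \<partial>lborel) \<partial>lborel)"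
    unfolding k_def by (intro nn_integral_cong) (simp add: nn_integral_cmult[symmetric] mult_ac)
  also have "... <= (\<integral>\<^sup>+t. ennreal (d powr p) * (ennreal (2 ^ DIM('a)) * J) * indicator {0..1::real} t \<partial>lborel)"
  proof (intro nn_integral_mono)
    fix t :: real
    show "ennreal (d powr p) * indicator {0..1} t * (\<integral>\<^sup>+x. \<integral>\<^sup>+y. k x y * g (y + t *\<^sub>R (x - y)) \<partial>lborel \<partial>lborel)
      <= ennreal (d powr p) * (ennreal (2 ^ DIM('a)) * J) * indicator {0..1::real} t"
      using T[of t] by (cases "t \<in> {0..1}") (auto intro: mult_left_mono)
  qed
  also have "... = ennreal (2 ^ DIM('a) * d powr p) * J"
    by (subst nn_integral_cmult_indicator) (auto simp: ennreal_mult mult_ac)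
  finally show ?thesis unfolding J_def k_def g_def S_def .
qed

text \<open>The kernel inequality for the relation of lying in \<open>B\<close> together;
  integrating out the idle variable yields the factor \<open>emeasure lborel B\<close>.\<close>

lemma poincare_convex:
  fixes phi :: "'a::euclidean_space => real"
  assumes phi: "smooth_fun phi" and p: "p >= 1" and B: "convex B" "B \<in> sets borel"
    and d: "!!x y. x \<in> B ==> y \<in> B ==> norm (x - y) <= d"
  shows "(\<integral>\<^sup>+x. \<integral>\<^sup>+y. indicator B x * indicator B y * ennreal (\<bar>phi x - phi y\<bar> powr p) \<partial>lborel \<partial>lborel)
    <= ennreal (2 ^ DIM('a) * d powr p) * emeasure lborel B *
       (\<integral>\<^sup>+x. indicator B x * ennreal (norm (grad phi x) powr p) \<partial>lborel)"
proof -
  have [measurable]: "B \<in> sets borel" by fact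
  have [measurable]: "grad phi \<in> borel_measurable borel"
    using borel_measurable_continuous_onI[OF smooth_grad_continuous[OF phi]] .
  let ?R = "%x y. x \<in> B \<and> y \<in> B"
  have ind: "indicator {z. ?R (fst z) (snd z)} (x, y) = (indicator B x * indicator B y :: ennreal)" for x y :: 'a
    by (auto split: split_indicator)
  have "{z. ?R (fst z) (snd z)} = B \<times> B" by auto
  then have m: "{z. ?R (fst z) (snd z)} \<in> sets (borel \<Otimes>\<^sub>M borel)" by simp
  have "(\<integral>\<^sup>+x. \<integral>\<^sup>+y. indicator B x * indicator B y * ennreal (\<bar>phi x - phi y\<bar> powr p) \<partial>lborel \<partial>lborel)
    <= ennreal (2 ^ DIM('a) * d powr p) *
       (\<integral>\<^sup>+x. \<integral>\<^sup>+y. indicator B x * indicator B y * ennreal (norm (grad phi x) powr p) \<partial>lborel \<partial>lborel)"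
    unfolding ind[symmetric]
  proof (rule poincare_kernel[OF phi p m])
    fix x y :: 'a and t :: real assume "?R x y" "0 <= t" "t <= 1"
    moreover have "y + t *\<^sub>R (x - y) = (1 - t) *\<^sub>R y + t *\<^sub>R x" by (simp add: algebra_simps)
    ultimately show "?R (y + t *\<^sub>R (x - y)) y" using B(1) by (auto simp: convex_alt)
  qed (use d in auto)
  also have "(\<integral>\<^sup>+x. \<integral>\<^sup>+y. indicator B x * indicator B y * ennreal (norm (grad phi x) powr p) \<partial>lborel \<partial>lborel)
    = (\<integral>\<^sup>+x. (indicator B x * ennreal (norm (grad phi x) powr p)) * emeasure lborel B \<partial>lborel)"
  proof (intro nn_integral_cong)
    fix x :: 'a
    have "(\<integral>\<^sup>+y. indicator B x * indicator B y * ennreal (norm (grad phi x) powr p) \<partial>lborel)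
        = (\<integral>\<^sup>+y. (indicator B x * ennreal (norm (grad phi x) powr p)) * indicator B y \<partial>lborel)"
      by (intro nn_integral_cong) (simp add: mult_ac)
    also have "... = (indicator B x * ennreal (norm (grad phi x) powr p)) * emeasure lborel B"
      by (subst nn_integral_cmult_indicator) auto
    finally show "(\<integral>\<^sup>+y. indicator B x * indicator B y * ennreal (norm (grad phi x) powr p) \<partial>lborel)
      = (indicator B x * ennreal (norm (grad phi x) powr p)) * emeasure lborel B" .
  qed
  also have "... = emeasure lborel B * (\<integral>\<^sup>+x. indicator B x * ennreal (norm (grad phi x) powr p) \<partial>lborel)"
    by (subst nn_integral_multc) (auto simp: mult_ac)
  finally show ?thesis by (simp add: mult.assoc)
qed

section \<open>Dyadic averages\<close>

text \<open>The half-open dyadic cube of side \<open>1 / 2^j\<close> that contains \<open>x\<close>.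
  Equality of integer parts makes membership an equivalence relation, so no enumeration of cubes is
  ever required.\<close>

definition cell :: "nat => 'a::euclidean_space => 'a set" where
  "cell j x = {y. \<forall>b\<in>Basis. \<lfloor>2^j * (y \<bullet> b)\<rfloor> = \<lfloor>2^j * (x \<bullet> b)\<rfloor>}"

lemma cell_refl [simp]: "x \<in> cell j x"
  by (simp add: cell_def)

lemma cell_sym: "y \<in> cell j x \<longleftrightarrow> x \<in> cell j y"
  by (auto simp: cell_def)

lemma cell_eq: "y \<in> cell j x ==> cell j y = cell j x"
  by (auto simp: cell_def)

text \<open>Nesting of dyadic cubes: the integer part of a coordinate at the coarser scale is the
  integer quotient of the finer one by a power of two.\<close>

lemma cell_antimono:
  assumes "i <= j" shows "cell j x \<subseteq> cell i x"
proof -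
  have "\<lfloor>2^i * t\<rfloor> = \<lfloor>2^j * t\<rfloor> div 2^(j-i)" for t :: real
  proof -
    have "(2::real)^j = 2^i * 2^(j-i)" using assms by (simp add: power_add[symmetric])
    then have "2^i * t = (2^j * t) / real_of_int (2^(j-i))" by simp
    then show ?thesis by (simp only: floor_divide_real_eq_div zero_le_power zero_le_numeral)
  qed
  then show ?thesis by (auto simp: cell_def)
qed

text \<open>With the relation of sharing a cell jointly measurable, the kernel inequality treats all
  cells of a generation at once, without summing over cubes.\<close>

lemma cell_kernel_measurable: "{z. fst z \<in> cell j (snd z)} \<in> sets (borel \<Otimes>\<^sub>M (borel :: 'a::euclidean_space measure))"
proof -
  have "Measurable.pred (borel \<Otimes>\<^sub>M borel) (%z::'a \<times> 'a. \<forall>b\<in>Basis. \<lfloor>2^j * (fst z \<bullet> b)\<rfloor> = \<lfloor>2^j * (snd z \<bullet> b)\<rfloor>)"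
    by measurable
  then show ?thesis by (simp add: cell_def pred_def space_pair_measure)
qed

lemma cell_measurable [measurable]: "cell j x \<in> sets borel"
proof -
  have "Measurable.pred borel (%y::'a. \<forall>b\<in>Basis. \<lfloor>2^j * (y \<bullet> b)\<rfloor> = \<lfloor>2^j * (x \<bullet> b)\<rfloor>)"
    by measurable
  then show ?thesis by (simp add: cell_def pred_def)
qed

lemma mem_cell_iff:
  "y \<in> cell j x \<longleftrightarrow> (\<forall>b\<in>Basis. real_of_int \<lfloor>2^j * (x \<bullet> b)\<rfloor> / 2^j <= y \<bullet> b \<and> y \<bullet> b < real_of_int \<lfloor>2^j * (x \<bullet> b)\<rfloor> / 2^j + 1 / 2^j)"
  by (auto simp: cell_def floor_eq_iff field_simps)

lemma convex_cell: "convex (cell j x)"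
proof -
  have "cell j x = (\<Inter>b\<in>Basis. {y. real_of_int \<lfloor>2^j * (x \<bullet> b)\<rfloor> / 2^j <= b \<bullet> y} \<inter> {y. b \<bullet> y < real_of_int \<lfloor>2^j * (x \<bullet> b)\<rfloor> / 2^j + 1 / 2^j})"
    by (auto simp: mem_cell_iff inner_commute)
  then show ?thesis
    by (auto intro!: convex_INT convex_Int convex_halfspace_lt convex_halfspace_ge)
qed

lemma cell_norm_diff:
  fixes x :: "'a::euclidean_space"
  assumes "y \<in> cell j x" shows "norm (y - x) <= real DIM('a) / 2^j"
proof -
  have "norm (y - x) <= (\<Sum>b\<in>Basis. \<bar>(y - x) \<bullet> b\<bar>)" by (rule norm_le_l1)
  also have "... <= (\<Sum>b\<in>(Basis::'a set). 1 / 2^j)"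
  proof (rule sum_mono)
    fix b :: 'a assume "b \<in> Basis"
    then have "real_of_int \<lfloor>2^j * (x \<bullet> b)\<rfloor> / 2^j <= y \<bullet> b" "y \<bullet> b < real_of_int \<lfloor>2^j * (x \<bullet> b)\<rfloor> / 2^j + 1 / 2^j"
      "real_of_int \<lfloor>2^j * (x \<bullet> b)\<rfloor> / 2^j <= x \<bullet> b" "x \<bullet> b < real_of_int \<lfloor>2^j * (x \<bullet> b)\<rfloor> / 2^j + 1 / 2^j"
      using assms cell_refl[of x j] unfolding mem_cell_iff by auto
    then show "\<bar>(y - x) \<bullet> b\<bar> <= 1 / 2^j" by (simp add: inner_diff_left)
  qed
  finally show ?thesis by simp
qed

text \<open>The half-open cube lies between an open and a closed box of the same volume.\<close>

lemma emeasure_cell: "emeasure lborel (cell j (x::'a::euclidean_space)) = ennreal ((1 / 2^j)^DIM('a))"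
proof -
  define a where "a = (\<Sum>b\<in>Basis. (real_of_int \<lfloor>2^j * (x \<bullet> b)\<rfloor> / 2^j) *\<^sub>R b)"
  define c where "c = a + (\<Sum>b\<in>Basis. (1 / 2^j) *\<^sub>R b)"
  have ab: "a \<bullet> b = real_of_int \<lfloor>2^j * (x \<bullet> b)\<rfloor> / 2^j" "c \<bullet> b = a \<bullet> b + 1 / 2^j" if "b \<in> Basis" for b
    using that by (simp_all add: a_def c_def inner_add_left)
  have "box a c \<subseteq> cell j x" "cell j x \<subseteq> cbox a c"
    by (auto simp: mem_cell_iff mem_box ab less_imp_le)
  then have "emeasure lborel (box a c) <= emeasure lborel (cell j x)" "emeasure lborel (cell j x) <= emeasure lborel (cbox a c)"
    by (auto intro!: emeasure_mono)
  moreover have "emeasure lborel (box a c) = ennreal ((1 / 2^j)^DIM('a))" "emeasure lborel (cbox a c) = ennreal ((1 / 2^j)^DIM('a))"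
    by (simp_all add: emeasure_lborel_box_eq emeasure_lborel_cbox_eq ab inner_diff_left)
  ultimately show ?thesis by simp
qed

text \<open>This class and its subclass of boundedly supported functions are stable under every
  operation applied to averages below, and the subclass consists of integrable functions;
  integrability conditions thus reduce to closure rules.\<close>

definition bdd_borel :: "('a::euclidean_space => real) => bool" where
  "bdd_borel f \<longleftrightarrow> f \<in> borel_measurable borel \<and> (\<exists>K. \<forall>x. \<bar>f x\<bar> <= K)"

definition bdd_supp :: "('a::euclidean_space => real) => bool" where
  "bdd_supp f \<longleftrightarrow> bdd_borel f \<and> (\<exists>R. \<forall>x. f x ~= 0 --> norm x <= R)"

lemma bdd_borel_measurable [measurable_dest]: "bdd_borel f ==> f \<in> borel_measurable borel"
  by (simp add: bdd_borel_def)

lemma bdd_supp_bdd_borel: "bdd_supp f ==> bdd_borel f"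
  by (simp add: bdd_supp_def)

lemma bdd_supp_measurable [measurable_dest]: "bdd_supp f ==> f \<in> borel_measurable borel"
  by (simp add: bdd_supp_def bdd_borel_def)

lemma bdd_borel_const: "bdd_borel (%x. c)"
  by (auto simp: bdd_borel_def)

lemma bdd_borel_indicator: "A \<in> sets borel ==> bdd_borel (indicator A)"
  by (auto simp: bdd_borel_def intro!: exI[of _ 1] split: split_indicator)

lemma bdd_borel_add:
  assumes "bdd_borel f" "bdd_borel g" shows "bdd_borel (%x. f x + g x)"
proof -
  obtain K L where "!!x. \<bar>f x\<bar> <= K" "!!x. \<bar>g x\<bar> <= L"
    using assms by (auto simp: bdd_borel_def)
  then have "\<forall>x. \<bar>f x + g x\<bar> <= K + L" by (meson abs_triangle_ineq add_mono order_trans)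
  then show ?thesis using assms by (auto simp: bdd_borel_def)
qed

lemma bdd_borel_mult:
  assumes "bdd_borel f" "bdd_borel g" shows "bdd_borel (%x. f x * g x)"
proof -
  obtain K L where K: "!!x. \<bar>f x\<bar> <= K" and L: "!!x. \<bar>g x\<bar> <= L"
    using assms by (auto simp: bdd_borel_def)
  have "\<bar>f x * g x\<bar> <= K * L" for x
    unfolding abs_mult by (rule mult_mono[OF K L]) (use K[of x] in auto)
  then show ?thesis using assms by (auto simp: bdd_borel_def)
qed

lemma bdd_borel_diff: "bdd_borel f ==> bdd_borel g ==> bdd_borel (%x. f x - g x)"
  using bdd_borel_add[of f "%x. (-1) * g x"] bdd_borel_mult[OF bdd_borel_const[of "-1"], of g] by simp

lemma bdd_borel_abs: "bdd_borel f ==> bdd_borel (%x. \<bar>f x\<bar>)"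
  unfolding bdd_borel_def by auto

lemma bdd_borel_powr: "bdd_borel f ==> p >= 0 ==> bdd_borel (%x. \<bar>f x\<bar> powr p)"
  unfolding bdd_borel_def
  by (clarsimp, rule exI, rule allI, rule powr_mono2) auto

lemma bdd_borel_sum: "(!!i. i \<in> I ==> bdd_borel (f i)) ==> bdd_borel (%x. \<Sum>i\<in>I. f i x)"
  by (induction I rule: infinite_finite_induct) (simp_all add: bdd_borel_const bdd_borel_add)

lemma bdd_supp_mult: "bdd_supp f ==> bdd_borel g ==> bdd_supp (%x. f x * g x)"
  using bdd_borel_mult[of f g] unfolding bdd_supp_def by auto

lemma bdd_supp_mult2: "bdd_borel f ==> bdd_supp g ==> bdd_supp (%x. f x * g x)"
  using bdd_supp_mult[of g f] by (simp add: mult.commute)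

lemma bdd_supp_zero: "bdd_supp (%x. 0)"
  by (simp add: bdd_supp_def bdd_borel_const)

lemma bdd_supp_add:
  assumes "bdd_supp f" "bdd_supp g" shows "bdd_supp (%x. f x + g x)"
proof -
  obtain R S where "!!x. f x ~= 0 ==> norm x <= R" "!!x. g x ~= 0 ==> norm x <= S"
    using assms by (auto simp: bdd_supp_def)
  then have "\<forall>x. f x + g x ~= 0 --> norm x <= max R S"
    by (metis add.right_neutral max.coboundedI1 max.coboundedI2)
  then show ?thesis using assms bdd_borel_add[of f g] by (auto simp: bdd_supp_def)
qed

lemma bdd_supp_sum: "(!!i. i \<in> I ==> bdd_supp (f i)) ==> bdd_supp (%x. \<Sum>i\<in>I. f i x)"
  by (induction I rule: infinite_finite_induct) (simp_all add: bdd_supp_zero bdd_supp_add)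

lemma bdd_supp_powr: "bdd_supp f ==> p >= 0 ==> bdd_supp (%x. \<bar>f x\<bar> powr p)"
  using bdd_borel_powr[of f p] unfolding bdd_supp_def by auto

lemma bdd_supp_diff: "bdd_supp f ==> bdd_supp g ==> bdd_supp (%x. f x - g x)"
  using bdd_supp_add[of f "%x. (-1) * g x"] bdd_supp_mult2[OF bdd_borel_const[of "-1"], of g] by simp

lemma bdd_supp_integrable:
  assumes "bdd_supp f" shows "integrable lborel f"
proof -
  obtain K R where K: "!!x. \<bar>f x\<bar> <= K" and R: "!!x. f x ~= 0 ==> norm x <= R"
    and [measurable]: "f \<in> borel_measurable borel"
    using assms by (auto simp: bdd_supp_def bdd_borel_def)
  show ?thesis
  proof (rule integrableI_bounded_set[where A = "cball 0 R" and B = K])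
    show "emeasure lborel (cball (0::'a) R) < \<infinity>"
      using emeasure_bounded_finite[of "cball 0 R"] by simp
  qed (use K R in force)+
qed

lemma cell_integrable:
  assumes "bdd_borel f" shows "integrable lborel (%y. indicator (cell j x) y * f y)"
proof (rule bdd_supp_integrable)
  have "norm y <= norm x + real DIM('a) / 2^j" if "y \<in> cell j x" for y
    using cell_norm_diff[OF that] norm_triangle_sub[of y x] by linarith
  then have "bdd_supp (indicator (cell j x))"
    by (auto simp: bdd_supp_def bdd_borel_indicator indicator_def intro!: exI[of _ "norm x + real DIM('a) / 2^j"])
  then show "bdd_supp (%y. indicator (cell j x) y * f y)" using assms by (rule bdd_supp_mult)
qed

text \<open>The conditional expectation with respect to the dyadic cubes of generation
  \<open>j\<close>; the prefactor is the inverse of their volume.\<close>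

definition cell_avg :: "nat => ('a::euclidean_space => real) => 'a => real" where
  "cell_avg j f x = (2^j)^DIM('a) * (LINT y|lborel. indicator (cell j x) y * f y)"

lemma cell_avg_cell: "y \<in> cell j x ==> cell_avg j f y = cell_avg j f x"
  by (simp add: cell_avg_def cell_eq)

lemma cell_avg_mono:
  assumes "bdd_borel f" "bdd_borel g" "!!y. y \<in> cell j x ==> f y <= g y"
  shows "cell_avg j f x <= cell_avg j g x"
  unfolding cell_avg_def
  by (rule mult_left_mono, rule integral_mono[OF cell_integrable[OF assms(1)] cell_integrable[OF assms(2)]])
    (use assms(3) in \<open>auto split: split_indicator\<close>)

lemma cell_avg_add:
  assumes "bdd_borel f" "bdd_borel g"
  shows "cell_avg j (%y. f y + g y) x = cell_avg j f x + cell_avg j g x"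
  unfolding cell_avg_def using cell_integrable[OF assms(1)] cell_integrable[OF assms(2)]
  by (simp add: distrib_left)

lemma cell_avg_diff:
  assumes "bdd_borel f" "bdd_borel g"
  shows "cell_avg j (%y. f y - g y) x = cell_avg j f x - cell_avg j g x"
  unfolding cell_avg_def using cell_integrable[OF assms(1)] cell_integrable[OF assms(2)]
  by (simp add: right_diff_distrib)

lemma cell_avg_cmult: "cell_avg j (%y. c * f y) x = c * cell_avg j f x"
  unfolding cell_avg_def by (simp add: mult.left_commute)

lemma cell_avg_const: "cell_avg j (%y. c) x = c"
proof -
  have "(LINT y|lborel. indicator (cell j x) y * c) = measure lborel (cell j x) * c" by simp
  also have "measure lborel (cell j x) = (1/2^j)^DIM('a)"
    by (simp add: measure_def emeasure_cell)
  finally show ?thesis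
    by (simp add: cell_avg_def power_one_over)
qed

lemma cell_avg_cong: "(!!y. y \<in> cell j x ==> f y = g y) ==> cell_avg j f x = cell_avg j g x"
  unfolding cell_avg_def by (auto intro!: Bochner_Integration.integral_cong split: split_indicator)

lemma cell_avg_nonneg: "(!!y. y \<in> cell j x ==> f y >= 0) ==> cell_avg j f x >= 0"
  unfolding cell_avg_def by (auto intro!: mult_nonneg_nonneg integral_nonneg_AE split: split_indicator)

lemma cell_avg_abs_le:
  assumes "bdd_borel f" shows "\<bar>cell_avg j f x\<bar> <= cell_avg j (%y. \<bar>f y\<bar>) x"
proof -
  have "cell_avg j f x <= cell_avg j (%y. \<bar>f y\<bar>) x"
    by (intro cell_avg_mono bdd_borel_abs assms) auto
  moreover have "cell_avg j (%y. (-1) * f y) x <= cell_avg j (%y. \<bar>f y\<bar>) x"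
    by (intro cell_avg_mono bdd_borel_abs bdd_borel_mult bdd_borel_const assms) auto
  ultimately show ?thesis unfolding cell_avg_cmult by linarith
qed

lemma cell_kernel_section_measurable [measurable]:
  "(%z::'a::euclidean_space \<times> 'a. indicator (cell j (fst z)) (snd z) :: real) \<in> borel_measurable (borel \<Otimes>\<^sub>M borel)"
  "(%z::'a::euclidean_space \<times> 'a. indicator (cell j (fst z)) (snd z) :: ennreal) \<in> borel_measurable (borel \<Otimes>\<^sub>M borel)"
proof -
  have eq: "indicator (cell j (fst z)) (snd z) = (indicator {z. fst z \<in> cell j (snd z)} z :: 'b::zero_neq_one)" for z :: "'a \<times> 'a"
    using cell_sym by (auto split: split_indicator)
  show "(%z::'a::euclidean_space \<times> 'a. indicator (cell j (fst z)) (snd z) :: real) \<in> borel_measurable (borel \<Otimes>\<^sub>M borel)"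
    "(%z::'a::euclidean_space \<times> 'a. indicator (cell j (fst z)) (snd z) :: ennreal) \<in> borel_measurable (borel \<Otimes>\<^sub>M borel)"
    unfolding eq using cell_kernel_measurable by measurable
qed

lemma bdd_borel_cell_avg:
  assumes "bdd_borel f" shows "bdd_borel (cell_avg j f)"
proof -
  obtain K where K: "!!x. \<bar>f x\<bar> <= K" using assms by (auto simp: bdd_borel_def)
  have [measurable]: "f \<in> borel_measurable borel" using assms by simp
  have "(%x. \<integral>y. indicator (cell j x) y * f y \<partial>lborel) \<in> borel_measurable borel"
    by (rule lborel.borel_measurable_lebesgue_integral)
      (use cell_kernel_section_measurable(1)[of j] in \<open>simp add: split_beta'\<close>)
  then have "cell_avg j f \<in> borel_measurable borel" unfolding cell_avg_def[abs_def] by measurable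
  moreover have "\<bar>cell_avg j f x\<bar> <= K" for x
  proof -
    have "\<bar>cell_avg j f x\<bar> <= cell_avg j (%y. \<bar>f y\<bar>) x" by (rule cell_avg_abs_le[OF assms])
    also have "... <= cell_avg j (%y. K) x"
      by (intro cell_avg_mono bdd_borel_abs bdd_borel_const assms K)
    finally show ?thesis by (simp add: cell_avg_const)
  qed
  ultimately show ?thesis by (auto simp: bdd_borel_def)
qed

lemma bdd_supp_cell_avg:
  assumes "bdd_supp f" shows "bdd_supp (cell_avg j f)"
proof -
  obtain R where R: "!!x. f x ~= 0 ==> norm x <= R" using assms by (auto simp: bdd_supp_def)
  have "norm x <= R + real DIM('a) / 2^j" if "cell_avg j f x ~= 0" for x
  proof (rule ccontr)
    assume *: "\<not> ?thesis"
    have "f y = 0" if "y \<in> cell j x" for y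
    proof (rule ccontr)
      assume "f y ~= 0"
      then show False using R[of y] cell_norm_diff[OF that] norm_triangle_sub[of x y] * 
        by (simp add: norm_minus_commute)
    qed
    then have "cell_avg j f x = cell_avg j (%y. 0) x" by (intro cell_avg_cong) auto
    then show False using that by (simp add: cell_avg_const)
  qed
  then show ?thesis using bdd_borel_cell_avg[of f j] assms by (auto simp: bdd_supp_def)
qed

text \<open>The averaging kernel is symmetric because \<open>cell\<close> is, so Fubini's theorem
  moves the average from one factor to the other.\<close>

lemma cell_avg_self_adjoint:
  assumes f: "bdd_supp f" and g: "bdd_supp g"
  shows "(LINT x|lborel. cell_avg j f x * g x) = (LINT x|lborel. f x * cell_avg j g x)"
proof -
  have [measurable]: "f \<in> borel_measurable borel" "g \<in> borel_measurable borel" using f g by simp_all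
  define F where "F x y = indicator (cell j x) y * f y * g x" for x y
  have Fm: "(%z. F (fst z) (snd z)) \<in> borel_measurable (borel \<Otimes>\<^sub>M borel)"
    unfolding F_def by measurable
  have "integrable lborel (%z. F (fst z) (snd z))"
  proof (rule bdd_supp_integrable)
    obtain K R where K: "!!x. \<bar>f x\<bar> <= K" and R: "!!x. f x ~= 0 ==> norm x <= R"
      using f by (auto simp: bdd_supp_def bdd_borel_def)
    obtain L S where L: "!!x. \<bar>g x\<bar> <= L" and S: "!!x. g x ~= 0 ==> norm x <= S"
      using g by (auto simp: bdd_supp_def bdd_borel_def)
    have "\<bar>F x y\<bar> <= K * L" for x y
    proof -
      have "\<bar>f y\<bar> * \<bar>g x\<bar> <= K * L" by (intro mult_mono K L) (use K[of y] in auto)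
      moreover have "0 <= K * L" using K[of y] L[of x] by (intro mult_nonneg_nonneg) auto
      ultimately show ?thesis unfolding F_def by (auto split: split_indicator simp: abs_mult)
    qed
    moreover have "norm z <= S + R" if "F (fst z) (snd z) ~= 0" for z :: "'a \<times> 'a"
      using R[of "snd z"] S[of "fst z"] that norm_Pair_le[of "fst z" "snd z"] by (auto simp: F_def)
    ultimately show "bdd_supp (%z. F (fst z) (snd z))"
      using Fm unfolding bdd_supp_def bdd_borel_def borel_prod by blast
  qed
  then have int: "integrable (lborel \<Otimes>\<^sub>M lborel) (case_prod F)"
    by (simp add: lborel_prod split_beta')
  have "(LINT x|lborel. cell_avg j f x * g x) = (2^j)^DIM('a) * (LINT x|lborel. \<integral>y. F x y \<partial>lborel)"
    unfolding cell_avg_def F_def integral_mult_left_zero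
    by (subst integral_mult_right_zero[symmetric]) (simp only: mult.assoc)
  also have "(LINT x|lborel. \<integral>y. F x y \<partial>lborel) = (LINT y|lborel. \<integral>x. F x y \<partial>lborel)"
    by (rule lborel_pair.Fubini_integral[symmetric, OF int])
  also have "... = (LINT y|lborel. f y * (LINT x|lborel. indicator (cell j y) x * g x))"
  proof (intro Bochner_Integration.integral_cong refl)
    fix y :: 'a
    have "F x y = f y * (indicator (cell j y) x * g x)" for x
      using cell_sym[of y j x] by (auto simp: F_def split: split_indicator)
    then show "(LINT x|lborel. F x y) = f y * (LINT x|lborel. indicator (cell j y) x * g x)" by simp
  qed
  also have "(2^j)^DIM('a) * ... = (LINT x|lborel. f x * cell_avg j g x)"
    unfolding cell_avg_def integral_mult_right_zero[symmetric] by (intro Bochner_Integration.integral_cong) auto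
  finally show ?thesis .
qed

lemma cell_avg_jensen:
  assumes "bdd_borel f" "p >= 1"
  shows "\<bar>cell_avg j f x\<bar> powr p <= cell_avg j (%y. \<bar>f y\<bar> powr p) x"
proof -
  define a where "a = cell_avg j (%y. \<bar>f y\<bar>) x"
  have a: "a >= 0" unfolding a_def by (intro cell_avg_nonneg) auto
  \<comment> \<open>The tangent is taken at \<open>a\<close>, the average of the absolute value of
    \<open>f\<close>, so that averaging kills the linear term.\<close>
  have "cell_avg j (%y. a powr p + p * a powr (p - 1) * (\<bar>f y\<bar> - a)) x
     = a powr p + p * a powr (p - 1) * (a - a)"
    using assms
    by (simp add: cell_avg_add cell_avg_cmult cell_avg_const cell_avg_diff a_def[symmetric]
        bdd_borel_abs bdd_borel_mult bdd_borel_const bdd_borel_diff)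
  then have "a powr p = cell_avg j (%y. a powr p + p * a powr (p - 1) * (\<bar>f y\<bar> - a)) x" by simp
  also have "... <= cell_avg j (%y. \<bar>f y\<bar> powr p) x"
    using assms powr_above_tangent[OF \<open>p >= 1\<close> a]
    by (intro cell_avg_mono bdd_borel_add bdd_borel_const bdd_borel_mult bdd_borel_abs bdd_borel_diff bdd_borel_powr) auto
  finally show ?thesis
    using cell_avg_abs_le[OF assms(1), of j x] powr_mono2[of p "\<bar>cell_avg j f x\<bar>" a] assms(2)
    by (auto simp: a_def)
qed

lemma ennreal_cell_avg:
  fixes x :: "'a::euclidean_space"
  assumes "bdd_borel f" "!!y. f y >= 0"
  shows "ennreal (cell_avg j f x) = ennreal ((2^j)^DIM('a)) * (\<integral>\<^sup>+y. indicator (cell j x) y * ennreal (f y) \<partial>lborel)"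
proof -
  have "(\<integral>\<^sup>+y. indicator (cell j x) y * ennreal (f y) \<partial>lborel) = (\<integral>\<^sup>+y. ennreal (indicator (cell j x) y * f y) \<partial>lborel)"
    by (intro nn_integral_cong) (auto split: split_indicator)
  also have "... = ennreal (LINT y|lborel. indicator (cell j x) y * f y)"
    by (intro nn_integral_eq_integral cell_integrable assms) (use assms in auto)
  finally show ?thesis
    unfolding cell_avg_def by (simp add: ennreal_mult')
qed

lemma test_fun_bdd_supp:
  fixes w :: "'a::euclidean_space set"
  assumes "test_fun w phi" shows "bdd_supp phi" "bdd_supp (%x. norm (grad phi x))"
proof -
  obtain K where K: "!!x. \<bar>phi x\<bar> <= K" "!!x. norm (grad phi x) <= K" using test_fun_bounded[OF assms] by blast
  have s: "smooth_fun phi" using assms by (rule test_fun_smooth)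
  let ?C = "closure {x. phi x ~= 0}"
  have "bounded ?C" using assms by (auto simp: test_fun_def compact_imp_bounded)
  then obtain R where R: "!!x. x \<in> ?C ==> norm x <= R" by (auto simp: bounded_iff)
  have [measurable]: "phi \<in> borel_measurable borel" "grad phi \<in> borel_measurable borel"
    using borel_measurable_continuous_onI[OF smooth_continuous[OF s]]
      borel_measurable_continuous_onI[OF smooth_grad_continuous[OF s]] by auto
  have "x \<in> ?C" if "phi x ~= 0" for x using that closure_subset[of "{x. phi x ~= 0}"] by auto
  moreover have "x \<in> ?C" if "norm (grad phi x) ~= 0" for x using that grad_outside[of x phi] by auto
  ultimately have "\<forall>x. phi x ~= 0 --> norm x <= R" "\<forall>x. norm (grad phi x) ~= 0 --> norm x <= R"
    using R by blast+
  moreover have "\<forall>x. \<bar>phi x\<bar> <= K" "\<forall>x. \<bar>norm (grad phi x)\<bar> <= K" using K by auto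
  ultimately show "bdd_supp phi" "bdd_supp (%x. norm (grad phi x))"
    unfolding bdd_supp_def bdd_borel_def
    using measurable_compose[OF \<open>grad phi \<in> borel_measurable borel\<close> borel_measurable_norm] \<open>phi \<in> borel_measurable borel\<close> by blast+
qed

text \<open>Poincare's inequality with exponent 1 on one cell. The constant collects
  \<open>2^n\<close> for passing to a child cell, \<open>2^n\<close> from the Jacobian in the
  Poincare inequality and \<open>n\<close> from the diameter bound, with n the dimension.\<close>

lemma cell_avg_telescope:
  fixes w :: "'a::euclidean_space set"
  assumes phi: "test_fun w phi"
  shows "\<bar>cell_avg (Suc j) phi x - cell_avg j phi x\<bar>
    <= (4^DIM('a) * DIM('a)) * (cell_avg j (%y. norm (grad phi y)) x / 2^j)"
proof -
  let ?n = "DIM('a)" and ?f = "%y. norm (grad phi y)"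
  have b: "bdd_borel phi" "bdd_borel ?f" using test_fun_bdd_supp[OF phi] by (auto intro: bdd_supp_bdd_borel)
  define h where "h y = cell_avg j (%z. \<bar>phi y - phi z\<bar>) x" for y
  have bz: "bdd_borel (%z. \<bar>phi y - phi z\<bar>)" for y by (intro bdd_borel_abs bdd_borel_diff bdd_borel_const b)
  have h0: "h y >= 0" for y unfolding h_def by (intro cell_avg_nonneg) auto
  have hb: "bdd_borel h"
  proof -
    have [measurable]: "phi \<in> borel_measurable borel" using b by simp
    have "(%y. \<integral>z. indicator (cell j x) z * \<bar>phi y - phi z\<bar> \<partial>lborel) \<in> borel_measurable borel"
      by (rule lborel.borel_measurable_lebesgue_integral) measurable
    then have m: "h \<in> borel_measurable borel" unfolding h_def cell_avg_def by measurable
    obtain K where K: "!!x. \<bar>phi x\<bar> <= K" using b by (auto simp: bdd_borel_def)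
    have "h y <= cell_avg j (%z. K + K) x" for y
      unfolding h_def
    proof (intro cell_avg_mono bz bdd_borel_const)
      fix z show "\<bar>phi y - phi z\<bar> <= K + K" using K[of y] K[of z] by linarith
    qed
    then have "\<bar>h y\<bar> <= K + K" for y using h0[of y] by (simp add: cell_avg_const)
    then show ?thesis using m by (auto simp: bdd_borel_def)
  qed
  have "cell_avg (Suc j) phi x - cell_avg j phi x = cell_avg (Suc j) (%y. phi y - cell_avg j phi x) x"
    by (simp add: cell_avg_diff b bdd_borel_const cell_avg_const)
  also have "\<bar>...\<bar> <= cell_avg (Suc j) (%y. \<bar>phi y - cell_avg j phi x\<bar>) x"
    by (intro cell_avg_abs_le bdd_borel_diff b bdd_borel_const)
  also have "... <= cell_avg (Suc j) h x"
  proof (intro cell_avg_mono hb bdd_borel_abs bdd_borel_diff b bdd_borel_const)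
    fix y
    have "phi y - cell_avg j phi x = cell_avg j (%z. phi y - phi z) x"
      by (simp add: cell_avg_diff b bdd_borel_const cell_avg_const)
    then show "\<bar>phi y - cell_avg j phi x\<bar> <= h y"
      unfolding h_def by (simp add: cell_avg_abs_le bdd_borel_diff bdd_borel_const b)
  qed
  \<comment> \<open>The child cell has \<open>2^n\<close> times smaller volume, and \<open>h\<close>
    is nonnegative on the parent.\<close>
  also have "... <= 2^?n * cell_avg j h x"
  proof -
    have "(LINT y|lborel. indicator (cell (Suc j) x) y * h y) <= (LINT y|lborel. indicator (cell j x) y * h y)"
      using cell_antimono[of j "Suc j" x] h0
      by (intro integral_mono cell_integrable hb mult_right_mono) (auto split: split_indicator)
    then show ?thesis
      unfolding cell_avg_def by (simp add: power_mult_distrib mult.assoc)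
  qed
  also have "cell_avg j h x <= 2^?n * (?n / 2^j) * cell_avg j ?f x"
  proof -
    let ?Q = "cell j x"
    have "ennreal (cell_avg j h x) = ennreal ((2^j)^?n) * (\<integral>\<^sup>+y. indicator ?Q y * (ennreal ((2^j)^?n) * (\<integral>\<^sup>+z. indicator ?Q z * ennreal \<bar>phi y - phi z\<bar> \<partial>lborel)) \<partial>lborel)"
      unfolding ennreal_cell_avg[OF hb h0] unfolding h_def by (subst ennreal_cell_avg[OF bz]) auto
    also have "... = ennreal ((2^j)^?n) * ennreal ((2^j)^?n) * (\<integral>\<^sup>+y. \<integral>\<^sup>+z. indicator ?Q y * indicator ?Q z * ennreal (\<bar>phi y - phi z\<bar> powr 1) \<partial>lborel \<partial>lborel)"
    proof -
      have [measurable]: "phi \<in> borel_measurable borel" using b by simp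
      have "(\<integral>\<^sup>+y. indicator ?Q y * (ennreal ((2^j)^?n) * (\<integral>\<^sup>+z. indicator ?Q z * ennreal \<bar>phi y - phi z\<bar> \<partial>lborel)) \<partial>lborel)
        = (\<integral>\<^sup>+y. ennreal ((2^j)^?n) * (\<integral>\<^sup>+z. indicator ?Q y * indicator ?Q z * ennreal (\<bar>phi y - phi z\<bar> powr 1) \<partial>lborel) \<partial>lborel)"
        by (intro nn_integral_cong) (auto split: split_indicator)
      also have "... = ennreal ((2^j)^?n) * (\<integral>\<^sup>+y. \<integral>\<^sup>+z. indicator ?Q y * indicator ?Q z * ennreal (\<bar>phi y - phi z\<bar> powr 1) \<partial>lborel \<partial>lborel)"
        by (rule nn_integral_cmult) measurable
      finally show ?thesis by (simp add: mult.assoc)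
    qed
    also have "... <= ennreal ((2^j)^?n) * ennreal ((2^j)^?n) * (ennreal (2 ^ ?n * (?n / 2^j) powr 1) * emeasure lborel ?Q *
       (\<integral>\<^sup>+x. indicator ?Q x * ennreal (norm (grad phi x) powr 1) \<partial>lborel))"
    proof (intro mult_left_mono poincare_convex test_fun_smooth[OF phi] convex_cell)
      fix y z assume "y \<in> cell j x" "z \<in> cell j x"
      then show "norm (y - z) <= ?n / 2^j" using cell_norm_diff[of y j z] cell_eq[of z j x] by simp
    qed auto
    also have "... = ennreal ((2^j)^?n) * emeasure lborel ?Q * ennreal (2 ^ ?n * (?n / 2^j)) * (ennreal ((2^j)^?n) *
       (\<integral>\<^sup>+x. indicator ?Q x * ennreal (norm (grad phi x)) \<partial>lborel))"
      by (simp add: mult_ac)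
    also have "ennreal ((2^j)^?n) * emeasure lborel ?Q = 1"
      by (simp add: emeasure_cell ennreal_mult[symmetric] power_mult_distrib[symmetric])
    also have "ennreal ((2^j)^?n) * (\<integral>\<^sup>+x. indicator ?Q x * ennreal (norm (grad phi x)) \<partial>lborel) = ennreal (cell_avg j ?f x)"
      by (rule ennreal_cell_avg[symmetric]) (use b in auto)
    also have "1 * ennreal (2 ^ ?n * (?n / 2^j)) * ennreal (cell_avg j ?f x) = ennreal (2 ^ ?n * (?n / 2^j) * cell_avg j ?f x)"
      by (subst ennreal_mult) (auto simp: cell_avg_nonneg)
    finally show ?thesis
      by (subst (asm) ennreal_le_iff) (auto intro!: mult_nonneg_nonneg divide_nonneg_nonneg cell_avg_nonneg)
  qed
  finally show ?thesis
    using power_mult_distrib[of "2::real" 2 ?n] by (simp add: mult_ac)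
qed

text \<open>Jensen turns the deviation from the average into an average of differences; the kernel
  inequality for the relation of sharing a cell then bounds its integral over the whole
  space.\<close>

lemma cell_avg_approx:
  fixes w :: "'a::euclidean_space set"
  assumes phi: "test_fun w phi" and p: "p >= 1"
  shows "(LINT x|lborel. \<bar>phi x - cell_avg j phi x\<bar> powr p)
    <= 2^DIM('a) * (DIM('a) / 2^j) powr p * (LINT x|lborel. norm (grad phi x) powr p)"
proof -
  let ?n = "DIM('a)" and ?f = "%y. norm (grad phi y)"
  have s: "bdd_supp phi" "bdd_supp ?f" using test_fun_bdd_supp[OF phi] by auto
  then have b: "bdd_borel phi" "bdd_borel ?f" by (auto intro: bdd_supp_bdd_borel)
  have [measurable]: "phi \<in> borel_measurable borel" "?f \<in> borel_measurable borel" using b by simp_all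
  have fp: "integrable lborel (%x. ?f x powr p)"
    using bdd_supp_integrable[OF bdd_supp_powr[OF s(2), of p]] p by simp
  have int: "integrable lborel (%x. \<bar>phi x - cell_avg j phi x\<bar> powr p)"
    by (intro bdd_supp_integrable bdd_supp_powr bdd_supp_diff s bdd_supp_cell_avg) (use p in auto)
  define S where "S = {z. fst z \<in> cell j (snd z :: 'a)}"
  have Sm [measurable]: "S \<in> sets (borel \<Otimes>\<^sub>M borel)" unfolding S_def by (rule cell_kernel_measurable)
  have ind: "indicator (cell j x) y = (indicator S (x, y) :: ennreal)" for x y
    using cell_sym[of x j y] by (auto simp: S_def split: split_indicator)
  have "ennreal (LINT x|lborel. \<bar>phi x - cell_avg j phi x\<bar> powr p) = (\<integral>\<^sup>+x. ennreal (\<bar>phi x - cell_avg j phi x\<bar> powr p) \<partial>lborel)"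
    by (rule nn_integral_eq_integral[symmetric, OF int]) auto
  also have "... <= (\<integral>\<^sup>+x. ennreal ((2^j)^?n) * (\<integral>\<^sup>+y. indicator S (x, y) * ennreal (\<bar>phi x - phi y\<bar> powr p) \<partial>lborel) \<partial>lborel)"
  proof (rule nn_integral_mono)
    fix x
    have bx: "bdd_borel (%y. phi x - phi y)" by (intro bdd_borel_diff bdd_borel_const b)
    have "phi x - cell_avg j phi x = cell_avg j (%y. phi x - phi y) x"
      by (simp add: cell_avg_diff b bdd_borel_const cell_avg_const)
    then have "\<bar>phi x - cell_avg j phi x\<bar> powr p <= cell_avg j (%y. \<bar>phi x - phi y\<bar> powr p) x"
      using cell_avg_jensen[OF bx p] by simp
    then have "ennreal (\<bar>phi x - cell_avg j phi x\<bar> powr p) <= ennreal (cell_avg j (%y. \<bar>phi x - phi y\<bar> powr p) x)"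
      by (rule ennreal_leI)
    also have "... = ennreal ((2^j)^?n) * (\<integral>\<^sup>+y. indicator S (x, y) * ennreal (\<bar>phi x - phi y\<bar> powr p) \<partial>lborel)"
      unfolding ind[symmetric] by (rule ennreal_cell_avg) (use bdd_borel_powr[OF bx] p in auto)
    finally show "ennreal (\<bar>phi x - cell_avg j phi x\<bar> powr p) <= ..." .
  qed
  also have "... = ennreal ((2^j)^?n) * (\<integral>\<^sup>+x. \<integral>\<^sup>+y. indicator S (x, y) * ennreal (\<bar>phi x - phi y\<bar> powr p) \<partial>lborel \<partial>lborel)"
    by (rule nn_integral_cmult) measurable
  also have "... <= ennreal ((2^j)^?n) * (ennreal (2 ^ ?n * (?n / 2^j) powr p) *
      (\<integral>\<^sup>+x. \<integral>\<^sup>+y. indicator S (x, y) * ennreal (norm (grad phi x) powr p) \<partial>lborel \<partial>lborel))"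
    unfolding S_def
  proof (intro mult_left_mono poincare_kernel test_fun_smooth[OF phi] p cell_kernel_measurable)
    fix x y :: 'a and t :: real
    assume "x \<in> cell j y" "0 <= t" "t <= 1"
    moreover have "y + t *\<^sub>R (x - y) = (1 - t) *\<^sub>R y + t *\<^sub>R x" by (simp add: algebra_simps)
    ultimately show "y + t *\<^sub>R (x - y) \<in> cell j y" using convex_cell[of j y] by (auto simp: convex_alt)
  qed (use cell_sym cell_norm_diff in auto)
  also have "(\<integral>\<^sup>+x. \<integral>\<^sup>+y. indicator S (x, y) * ennreal (norm (grad phi x) powr p) \<partial>lborel \<partial>lborel)
      = (\<integral>\<^sup>+x. ennreal ((1/2^j)^?n) * ennreal (norm (grad phi x) powr p) \<partial>lborel)"
    unfolding ind[symmetric] by (intro nn_integral_cong) (simp add: nn_integral_multc emeasure_cell)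
  also have "... = ennreal ((1/2^j)^?n) * ennreal (LINT x|lborel. ?f x powr p)"
    by (simp add: nn_integral_cmult nn_integral_eq_integral[OF fp])
  also have "ennreal ((2^j)^?n) * (ennreal (2 ^ ?n * (?n / 2^j) powr p) * (ennreal ((1/2^j)^?n) * ennreal (LINT x|lborel. ?f x powr p)))
    = ennreal ((2^j)^?n * (1/2^j)^?n * (2 ^ ?n * (?n / 2^j) powr p * (LINT x|lborel. ?f x powr p)))"
    by (simp add: ennreal_mult mult_ac)
  also have "(2^j)^?n * (1/2^j)^?n = (1::real)" by (simp add: power_mult_distrib[symmetric])
  finally show ?thesis by (subst (asm) ennreal_le_iff) auto
qed

section \<open>The dyadic trace inequality\<close>

text \<open>Young's inequality for the two functions divided by their norms; if one norm is zero,
  the product vanishes almost everywhere.\<close>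

lemma holder_integral:
  fixes f g :: "'b => real"
  assumes p: "p > 1" "s > 1" "1/p + 1/s = 1"
    and [measurable]: "f \<in> borel_measurable M" "g \<in> borel_measurable M"
    and nn: "!!x. f x >= 0" "!!x. g x >= 0"
    and fi: "integrable M (%x. f x powr p)" and gi: "integrable M (%x. g x powr s)"
  shows "integrable M (%x. f x * g x)"
    and "(LINT x|M. f x * g x) <= (LINT x|M. f x powr p) powr (1/p) * (LINT x|M. g x powr s) powr (1/s)"
proof -
  show int: "integrable M (%x. f x * g x)"
  proof (rule Bochner_Integration.integrable_bound)
    show "integrable M (%x. f x powr p / p + g x powr s / s)" using fi gi by auto
    show "AE x in M. norm (f x * g x) <= norm (f x powr p / p + g x powr s / s)"
      using Youngs_inequality[OF p nn] nn p by (intro AE_I2) (simp add: abs_of_nonneg)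
  qed measurable
  define A where "A = (LINT x|M. f x powr p)"
  define B where "B = (LINT x|M. g x powr s)"
  have "A >= 0" "B >= 0" unfolding A_def B_def by (auto intro: integral_nonneg_AE)
  show "(LINT x|M. f x * g x) <= (LINT x|M. f x powr p) powr (1/p) * (LINT x|M. g x powr s) powr (1/s)"
  proof (cases "A = 0 \<or> B = 0")
    case True
    have "AE x in M. f x * g x = 0"
    proof (cases "A = 0")
      case True
      then have "AE x in M. f x powr p = 0"
        unfolding A_def using integral_nonneg_eq_0_iff_AE[OF fi] by simp
      then show ?thesis by eventually_elim simp
    next
      case False
      then have "B = 0" using \<open>A = 0 \<or> B = 0\<close> by simp
      then have "AE x in M. g x powr s = 0"
        unfolding B_def using integral_nonneg_eq_0_iff_AE[OF gi] by simp
      then show ?thesis by eventually_elim simp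
    qed
    then have "(LINT x|M. f x * g x) = (LINT x|M. 0)" by (intro integral_cong_AE) auto
    then show ?thesis by simp
  next
    case False
    then have "A > 0" "B > 0" using \<open>A >= 0\<close> \<open>B >= 0\<close> by auto
    define a where "a = A powr (1/p)"
    define b where "b = B powr (1/s)"
    have ab: "a > 0" "b > 0" "a powr p = A" "b powr s = B"
      unfolding a_def b_def using \<open>A > 0\<close> \<open>B > 0\<close> p by (auto simp: powr_powr)
    have "(LINT x|M. f x * g x) / (a * b) = (LINT x|M. (f x / a) * (g x / b))" by simp
    also have "... <= (LINT x|M. f x powr p / A / p + g x powr s / B / s)"
    proof (rule integral_mono)
      show "integrable M (%x. f x / a * (g x / b))" using int by (simp add: field_simps)
      show "integrable M (%x. f x powr p / A / p + g x powr s / B / s)" using fi gi by auto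
      fix x
      have "f x / a * (g x / b) <= (f x / a) powr p / p + (g x / b) powr s / s"
        by (rule Youngs_inequality[OF p]) (use nn ab in auto)
      then show "f x / a * (g x / b) <= f x powr p / A / p + g x powr s / B / s"
        using nn ab by (simp add: powr_divide)
    qed
    also have "... = A / A / p + B / B / s"
      unfolding A_def B_def using fi gi by simp
    also have "... = 1" using \<open>A > 0\<close> \<open>B > 0\<close> p by simp
    finally have "(LINT x|M. f x * g x) <= a * b" using ab by (simp add: field_simps)
    then show ?thesis unfolding a_def b_def A_def B_def .
  qed
qed

text \<open>Jensen for the weights \<open>w\<close> applied to the quotients
  \<open>a j / w j\<close>, with the tangent taken at the full sum. The freedom to choose
  \<open>w\<close> is what exploits geometric decay later.\<close>

lemma powr_sum_le_weighted:
  fixes a w :: "nat => real"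
  assumes p: "p >= 1" and I: "finite I" and a: "!!j. j \<in> I ==> a j >= 0"
    and w: "!!j. j \<in> I ==> w j > 0" "sum w I <= 1"
  shows "(\<Sum>j\<in>I. a j) powr p <= (\<Sum>j\<in>I. w j powr (1 - p) * a j powr p)"
proof -
  define S where "S = (\<Sum>j\<in>I. a j)"
  have S: "S >= 0" unfolding S_def by (rule sum_nonneg) (use a in auto)
  \<comment> \<open>The missing mass \<open>1 - sum w I\<close> is nonnegative and counted with
    factor \<open>p >= 1\<close>, so weights of total mass below one are admissible.\<close>
  have "S powr p <= sum w I * S powr p + p * (1 - sum w I) * S powr p"
  proof -
    have "1 * (1 - sum w I) <= p * (1 - sum w I)" using p w by (intro mult_right_mono) auto
    then have "1 * S powr p <= (sum w I + p * (1 - sum w I)) * S powr p" by (intro mult_right_mono) auto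
    then show ?thesis by (simp add: algebra_simps)
  qed
  also have "... = (\<Sum>j\<in>I. w j * (S powr p + p * S powr (p - 1) * (a j / w j - S)))"
  proof -
    have "S powr (p - 1) * S = S powr p"
      using S powr_add[of S "p - 1" 1] by (cases "S = 0") auto
    moreover have "(\<Sum>j\<in>I. w j * (S powr p + p * S powr (p - 1) * (a j / w j - S)))
        = (\<Sum>j\<in>I. w j * S powr p + p * S powr (p - 1) * a j - w j * (p * S powr (p - 1) * S))"
      by (intro sum.cong refl) (use w in \<open>force simp: field_simps\<close>)
    moreover have "... = sum w I * S powr p + p * (S powr (p - 1) * S) - sum w I * (p * (S powr (p - 1) * S))"
      by (simp add: sum.distrib sum_subtractf sum_distrib_left[symmetric] sum_distrib_right[symmetric] S_def mult.assoc)
    ultimately show ?thesis by (simp add: algebra_simps)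
  qed
  also have "... <= (\<Sum>j\<in>I. w j * (a j / w j) powr p)"
  proof (intro sum_mono mult_left_mono)
    fix j assume j: "j \<in> I"
    show "S powr p + p * S powr (p - 1) * (a j / w j - S) <= (a j / w j) powr p"
      by (rule powr_above_tangent[OF p S]) (use a[OF j] w(1)[OF j] in auto)
    show "0 <= w j" using w(1)[OF j] by simp
  qed
  also have "... = (\<Sum>j\<in>I. w j powr (1 - p) * a j powr p)"
  proof (intro sum.cong refl)
    fix j assume j: "j \<in> I"
    show "w j * (a j / w j) powr p = w j powr (1 - p) * a j powr p"
      using a[OF j] w(1)[OF j] by (simp add: powr_divide powr_diff)
  qed
  finally show ?thesis unfolding S_def .
qed

text \<open>Self-adjointness against the indicator of a large ball, whose average is 1 at every
  point where \<open>f\<close> is nonzero.\<close>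

lemma integral_cell_avg:
  assumes f: "bdd_supp f" shows "(LINT x|lborel. cell_avg j f x) = (LINT x|lborel. f x)"
proof -
  obtain R where R: "!!x. f x ~= 0 ==> norm x <= R" using f by (auto simp: bdd_supp_def)
  obtain R' where R': "!!x. cell_avg j f x ~= 0 ==> norm x <= R'"
    using bdd_supp_cell_avg[OF f, of j] by (auto simp: bdd_supp_def)
  \<comment> \<open>The radius covers the support of the average as well as every cell that meets
    the support of \<open>f\<close>, cells having diameter at most the dimension.\<close>
  define T where "T = max R' (R + DIM('a))"
  define g :: "'a => real" where "g = indicator (cball 0 T)"
  have g: "bdd_supp g"
    by (auto simp: bdd_supp_def g_def bdd_borel_indicator indicator_def intro!: exI[of _ T])
  have "(LINT x|lborel. cell_avg j f x) = (LINT x|lborel. cell_avg j f x * g x)"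
    by (intro Bochner_Integration.integral_cong) (use R' in \<open>force simp: g_def T_def split: split_indicator\<close>)+
  also have "... = (LINT x|lborel. f x * cell_avg j g x)" by (rule cell_avg_self_adjoint[OF f g])
  also have "... = (LINT x|lborel. f x)"
  proof (intro Bochner_Integration.integral_cong refl)
    fix x
    show "f x * cell_avg j g x = f x"
    proof (cases "f x = 0")
      case False
      have "g y = 1" if "y \<in> cell j x" for y
      proof -
        have "real DIM('a) / 2^j <= real DIM('a)" by (simp add: field_simps)
        then have "norm y <= R + DIM('a)"
          using cell_norm_diff[OF that] R[OF False] norm_triangle_sub[of y x] by linarith
        then show ?thesis by (simp add: g_def T_def)
      qed
      then have "cell_avg j g x = cell_avg j (%_. 1) x" by (intro cell_avg_cong) auto
      then show ?thesis by (simp add: cell_avg_const)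
    qed simp
  qed
  finally show ?thesis .
qed

text \<open>Jensen moves the power inside the average, and self-adjointness moves the average onto
  the weight, where it is bounded by \<open>c\<close>.\<close>

lemma integral_powr_cell_avg_le:
  assumes f: "bdd_supp f" and U: "bdd_supp U" "!!x. U x >= 0" and p: "p >= 1"
    and c: "!!x. cell_avg j U x <= c"
  shows "(LINT x|lborel. U x * \<bar>cell_avg j f x\<bar> powr p) <= c * (LINT x|lborel. \<bar>f x\<bar> powr p)"
proof -
  have fp: "bdd_supp (%x. \<bar>f x\<bar> powr p)" by (rule bdd_supp_powr[OF f]) (use p in auto)
  have "(LINT x|lborel. U x * \<bar>cell_avg j f x\<bar> powr p) <= (LINT x|lborel. cell_avg j (%y. \<bar>f y\<bar> powr p) x * U x)"
  proof (intro integral_mono bdd_supp_integrable)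
    show "bdd_supp (%x. U x * \<bar>cell_avg j f x\<bar> powr p)"
      by (intro bdd_supp_mult U bdd_borel_powr bdd_borel_cell_avg bdd_supp_bdd_borel f) (use p in auto)
    show "bdd_supp (%x. cell_avg j (%y. \<bar>f y\<bar> powr p) x * U x)"
      by (intro bdd_supp_mult bdd_supp_cell_avg fp bdd_supp_bdd_borel U)
    fix x show "U x * \<bar>cell_avg j f x\<bar> powr p <= cell_avg j (%y. \<bar>f y\<bar> powr p) x * U x"
      using mult_left_mono[OF cell_avg_jensen[OF bdd_supp_bdd_borel[OF f] p, of j x] U(2)[of x]]
      by (simp add: mult.commute)
  qed
  also have "... = (LINT x|lborel. \<bar>f x\<bar> powr p * cell_avg j U x)"
    by (rule cell_avg_self_adjoint[OF fp U(1)])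
  also have "... <= (LINT x|lborel. \<bar>f x\<bar> powr p * c)"
    by (intro integral_mono mult_left_mono c bdd_supp_integrable bdd_supp_mult fp bdd_borel_cell_avg bdd_supp_bdd_borel U bdd_borel_const) auto
  also have "... = c * (LINT x|lborel. \<bar>f x\<bar> powr p)" by simp
  finally show ?thesis .
qed

text \<open>The non-endpoint estimate: each generation is bounded separately and the generations are
  recombined with weights. It loses nothing essential when \<open>d\<close> decays
  geometrically.\<close>

lemma potential_sum_weighted:
  assumes f: "bdd_supp f" "!!x. f x >= 0" and U: "bdd_supp U" "!!x. U x >= 0" and p: "p >= 1"
    and I: "finite I" and w: "!!j. j \<in> I ==> w j > 0" "sum w I <= 1"
    and d: "!!j x. j \<in> I ==> cell_avg j U x <= (2^j) powr p * d j"
  shows "(LINT x|lborel. U x * (\<Sum>j\<in>I. cell_avg j f x / 2^j) powr p)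
    <= (\<Sum>j\<in>I. w j powr (1 - p) * d j) * (LINT x|lborel. f x powr p)"
proof -
  have E0: "cell_avg j f x >= 0" for j x by (rule cell_avg_nonneg) (use f in auto)
  have sE: "bdd_supp (%x. U x * \<bar>cell_avg j f x\<bar> powr p)" for j
    by (intro bdd_supp_mult U bdd_borel_powr bdd_borel_cell_avg bdd_supp_bdd_borel f) (use p in auto)
  have sS: "bdd_supp (%x. U x * \<bar>\<Sum>j\<in>I. cell_avg j f x * (1 / 2^j)\<bar> powr p)"
    by (intro bdd_supp_mult U bdd_borel_powr bdd_borel_sum bdd_borel_mult bdd_borel_const bdd_borel_cell_avg bdd_supp_bdd_borel f) (use p in auto)
  have "(LINT x|lborel. U x * (\<Sum>j\<in>I. cell_avg j f x / 2^j) powr p)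
    <= (LINT x|lborel. (\<Sum>j\<in>I. w j powr (1 - p) / (2^j) powr p * (U x * \<bar>cell_avg j f x\<bar> powr p)))"
  proof (intro integral_mono)
    have "(\<Sum>j\<in>I. cell_avg j f x / 2^j) = \<bar>\<Sum>j\<in>I. cell_avg j f x * (1 / 2^j)\<bar>" for x
      using E0 by (simp add: sum_nonneg)
    then show "integrable lborel (%x. U x * (\<Sum>j\<in>I. cell_avg j f x / 2^j) powr p)"
      using bdd_supp_integrable[OF sS] by simp
    show "integrable lborel (%x. \<Sum>j\<in>I. w j powr (1 - p) / (2^j) powr p * (U x * \<bar>cell_avg j f x\<bar> powr p))"
      by (intro Bochner_Integration.integrable_sum integrable_mult_right bdd_supp_integrable[OF sE])
    fix x
    have "(\<Sum>j\<in>I. cell_avg j f x / 2^j) powr p <= (\<Sum>j\<in>I. w j powr (1 - p) * (cell_avg j f x / 2^j) powr p)"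
      by (rule powr_sum_le_weighted[OF p I]) (use E0 w in auto)
    also have "... = (\<Sum>j\<in>I. w j powr (1 - p) / (2^j) powr p * \<bar>cell_avg j f x\<bar> powr p)"
      by (intro sum.cong refl) (use E0 in \<open>simp add: powr_divide\<close>)
    finally have "U x * (\<Sum>j\<in>I. cell_avg j f x / 2^j) powr p
        <= U x * (\<Sum>j\<in>I. w j powr (1 - p) / (2^j) powr p * \<bar>cell_avg j f x\<bar> powr p)"
      using U(2) by (rule mult_left_mono)
    then show "U x * (\<Sum>j\<in>I. cell_avg j f x / 2^j) powr p
       <= (\<Sum>j\<in>I. w j powr (1 - p) / (2^j) powr p * (U x * \<bar>cell_avg j f x\<bar> powr p))"
      by (simp add: sum_distrib_left mult_ac)
  qed
  also have "... = (\<Sum>j\<in>I. w j powr (1 - p) / (2^j) powr p * (LINT x|lborel. U x * \<bar>cell_avg j f x\<bar> powr p))"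
    by (subst Bochner_Integration.integral_sum)
       (auto intro!: integrable_mult_right bdd_supp_integrable[OF sE])
  also have "... <= (\<Sum>j\<in>I. w j powr (1 - p) / (2^j) powr p * (((2^j) powr p * d j) * (LINT x|lborel. \<bar>f x\<bar> powr p)))"
    by (intro sum_mono mult_left_mono integral_powr_cell_avg_le f U p d) auto
  also have "... = (\<Sum>j\<in>I. w j powr (1 - p) * d j) * (LINT x|lborel. f x powr p)"
    using f(2) by (simp add: sum_distrib_left mult_ac)
  finally show ?thesis .
qed

text \<open>After division by \<open>x + y\<close> both numbers lie in the unit interval, where
  \<open>u <= u powr t\<close>.\<close>

lemma powr_add_le_add_powr:
  fixes x y t :: real
  assumes "x >= 0" "y >= 0" "0 < t" "t <= 1"
  shows "(x + y) powr t <= x powr t + y powr t"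
proof (cases "x = 0 \<or> y = 0")
  case False
  then have pos: "x > 0" "y > 0" "x + y > 0" using assms by auto
  have le: "u <= u powr t" if "0 < u" "u <= 1" for u :: real
    using powr_mono'[of t 1 u] that assms by simp
  have "1 = x / (x + y) + y / (x + y)" using pos by (simp add: add_divide_distrib[symmetric])
  also have "... <= (x / (x + y)) powr t + (y / (x + y)) powr t"
    by (intro add_mono le) (use pos in auto)
  also have "... = (x powr t + y powr t) / (x + y) powr t"
    using pos by (simp add: powr_divide add_divide_distrib)
  finally show ?thesis using pos by (simp add: field_simps)
qed auto

lemma powr_sum_le_sum_powr:
  fixes b :: "nat => real"
  assumes "!!i. b i >= 0" "0 < t" "t <= 1"
  shows "(\<Sum>i\<in>I. b i) powr t <= (\<Sum>i\<in>I. b i powr t)"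
proof (induction I rule: infinite_finite_induct)
  case (insert i I)
  have "(b i + (\<Sum>i\<in>I. b i)) powr t <= b i powr t + (\<Sum>i\<in>I. b i) powr t"
    by (rule powr_add_le_add_powr) (use assms in \<open>auto intro: sum_nonneg\<close>)
  then show ?case using insert by simp
qed auto

text \<open>A discrete chain rule: the increment of the s-th power of the partial sums is at most
  \<open>s\<close> times the new term times the (s-1)-st power of the new partial sum. Since
  \<open>s - 1 <= 1\<close>, that power is subadditive and splits over the terms.\<close>

lemma powr_partial_sums_le:
  fixes b :: "nat => real"
  assumes b: "!!i. b i >= 0" and s: "1 < s" "s <= 2"
  shows "(\<Sum>j\<in>{a..<m}. b j) powr s <= s * (\<Sum>j\<in>{a..<m}. \<Sum>i\<in>{a..j}. b j * b i powr (s - 1))"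
proof (induction m)
  case (Suc m)
  show ?case
  proof (cases "a <= m")
    case True
    define S where "S = (\<Sum>j\<in>{a..<m}. b j)"
    define T where "T = (\<Sum>i\<in>{a..m}. b i)"
    have T: "T = S + b m" unfolding S_def T_def using True
      by (metis atLeastLessThanSuc_atLeastAtMost sum.atLeastLessThan_Suc)
    have S0: "S >= 0" unfolding S_def by (rule sum_nonneg) (use b in auto)
    have T0: "T >= 0" unfolding T using S0 b[of m] by simp
    have "T powr s + s * T powr (s - 1) * (S - T) <= S powr s"
      by (rule powr_above_tangent) (use s S0 T0 in auto)
    then have "T powr s <= S powr s + s * (b m * T powr (s - 1))"
      unfolding T by (simp add: algebra_simps)
    also have "T powr (s - 1) <= (\<Sum>i\<in>{a..m}. b i powr (s - 1))"
      unfolding T_def by (rule powr_sum_le_sum_powr) (use b s in auto)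
    then have "S powr s + s * (b m * T powr (s - 1)) <= S powr s + s * (b m * (\<Sum>i\<in>{a..m}. b i powr (s - 1)))"
      using b s by (intro add_left_mono mult_left_mono) auto
    also have "... <= s * (\<Sum>j\<in>{a..<m}. \<Sum>i\<in>{a..j}. b j * b i powr (s - 1)) + s * (b m * (\<Sum>i\<in>{a..m}. b i powr (s - 1)))"
      using Suc.IH unfolding S_def by simp
    also have "... = s * (\<Sum>j\<in>{a..<Suc m}. \<Sum>i\<in>{a..j}. b j * b i powr (s - 1))"
      using True by (simp add: sum_distrib_left distrib_left)
    finally show ?thesis using True unfolding T_def by (simp add: atLeastLessThanSuc_atLeastAtMost)
  qed simp
qed simp

text \<open>Hoelder for the splitting of \<open>F powr (p - 1) * U\<close> into
  \<open>F powr (p - 1) * U powr (1/s)\<close> and \<open>U powr (1/p)\<close>; the identity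
  \<open>(p - 1) * s = p\<close> restores the power \<open>p\<close> of \<open>F\<close>.\<close>

lemma cell_avg_holder:
  assumes F: "bdd_borel F" "!!x. F x >= 0" and U: "bdd_borel U" "!!x. U x >= 0"
    and p: "p > 1" "s > 1" "1/p + 1/s = 1"
  shows "cell_avg j (%y. F y powr (p - 1) * U y) x powr s
    <= cell_avg j (%y. F y powr p * U y) x * cell_avg j U x powr (s / p)"
proof -
  let ?n = "(2^j)^DIM('a) :: real" and ?Q = "cell j x"
  have [measurable]: "F \<in> borel_measurable borel" "U \<in> borel_measurable borel" using F U by simp_all
  have ps: "(p - 1) * s = p" using p by (simp add: field_simps)
  have Fb: "bdd_borel (%y. F y powr r)" if "r >= 0" for r
    using bdd_borel_powr[OF F(1) that] F(2) by simp
  have i1: "integrable lborel (%y. indicator ?Q y * (F y powr p * U y))"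
    using p by (intro cell_integrable bdd_borel_mult Fb U) auto
  have i2: "integrable lborel (%y. indicator ?Q y * U y)" by (intro cell_integrable U)
  define a where "a y = indicator ?Q y * (F y powr (p - 1) * U y powr (1/s))" for y
  define b where "b y = indicator ?Q y * U y powr (1/p)" for y
  have as: "a y powr s = indicator ?Q y * (F y powr p * U y)" for y
    using p U(2)[of y] ps F(2)[of y] by (auto simp: a_def powr_mult powr_powr split: split_indicator)
  have bp: "b y powr p = indicator ?Q y * U y" for y
    using p U(2)[of y] by (auto simp: b_def powr_powr split: split_indicator)
  have ab: "a y * b y = indicator ?Q y * (F y powr (p - 1) * U y)" for y
  proof -
    have "U y powr (1/s) * U y powr (1/p) = U y"
      using p(3) U(2)[of y] by (simp add: powr_add[symmetric] add.commute)
    then show ?thesis by (auto simp: a_def b_def split: split_indicator)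
  qed
  have s1: "1/s + 1/p = 1" using p(3) by simp
  have hold: "(LINT y|lborel. a y * b y) <= (LINT y|lborel. a y powr s) powr (1/s) * (LINT y|lborel. b y powr p) powr (1/p)"
  proof (rule holder_integral(2)[OF p(2,1) s1])
    show "a y >= 0" "b y >= 0" for y using U(2)[of y] by (auto simp: a_def b_def)
    show "integrable lborel (%y. a y powr s)" "integrable lborel (%y. b y powr p)" using i1 i2 by (simp_all add: as bp)
  qed (auto simp: a_def b_def)
  define A where "A = (LINT y|lborel. indicator ?Q y * (F y powr p * U y))"
  define B where "B = (LINT y|lborel. indicator ?Q y * U y)"
  define C where "C = (LINT y|lborel. indicator ?Q y * (F y powr (p - 1) * U y))"
  have nn: "A >= 0" "B >= 0" "C >= 0" unfolding A_def B_def C_def using U F by (auto intro!: integral_nonneg_AE)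
  have le: "C <= A powr (1/s) * B powr (1/p)" using hold unfolding as bp ab A_def B_def C_def .
  have "(?n * C) powr s <= (?n * (A powr (1/s) * B powr (1/p))) powr s"
    using nn le p by (intro powr_mono2 mult_left_mono mult_nonneg_nonneg) auto
  also have "... = ?n powr s * (A * B powr (s/p))"
    using nn p by (simp add: powr_mult powr_powr)
  also have "... = (?n * A) * (?n * B) powr (s/p)"
  proof -
    have "1 + s/p = s" using p by (simp add: field_simps)
    then have "?n powr s = ?n * ?n powr (s/p)" using powr_add[of ?n 1 "s/p"] by simp
    then show ?thesis using nn by (simp add: powr_mult)
  qed
  finally show ?thesis unfolding cell_avg_def A_def B_def C_def .
qed

text \<open>The endpoint case: $\int UF^p=\int f\,B$ with $B=\sum_j 2^{-j}E_j(F^{p-1}U)$, and a dyadic form of Wolff's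
  inequality bounds the conjugate norm of $B$ by $\int UF^p$ itself.\<close>

lemma potential_sum_dual:
  fixes f U :: "'a::euclidean_space => real"
  assumes f: "bdd_supp f" "!!x. f x >= 0" and U: "bdd_supp U" "!!x. U x >= 0" and p: "p >= 2"
    and d: "!!j x. a <= j ==> cell_avg j U x <= (2^j) powr p * d j"
    and d0: "!!j. d j >= 0"
  shows "(LINT x|lborel. U x * (\<Sum>j\<in>{a..<m}. cell_avg j f x / 2^j) powr p)
    <= (2 * (p / (p - 1)) * (\<Sum>j\<in>{a..<m}. d j powr (1 / (p - 1)))) powr (p - 1) * (LINT x|lborel. f x powr p)"
proof -
  \<comment> \<open>The conjugate exponent. The assumption \<open>p >= 2\<close> gives
    \<open>s <= 2\<close>, the range in which partial sums can be expanded into a double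
    sum.\<close>
  define s where "s = p / (p - 1)"
  have s: "1 < s" "s <= 2" "1/p + 1/s = 1" "p > 1" using p by (auto simp: s_def field_simps)
  have sp: "s / p = 1 / (p - 1)" "(p - 1) * (s - 1) = 1" "p / s = p - 1" using p by (auto simp: s_def field_simps)
  define F where "F x = (\<Sum>j\<in>{a..<m}. cell_avg j f x / 2^j)" for x
  have E0: "cell_avg j f x >= 0" for j x by (rule cell_avg_nonneg) (use f in auto)
  have F0: "F x >= 0" for x unfolding F_def by (rule sum_nonneg) (use E0 in auto)
  have Fs: "bdd_supp F"
    unfolding F_def divide_inverse
    by (intro bdd_supp_sum bdd_supp_mult bdd_supp_cell_avg f bdd_borel_const)
  have Fr: "bdd_borel (%x. F x powr r)" if "r >= 0" for r
    using bdd_borel_powr[OF bdd_supp_bdd_borel[OF Fs] that] F0 by simp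
  define h where "h x = F x powr (p - 1) * U x" for x
  have h0: "h x >= 0" for x unfolding h_def using U by simp
  have hs: "bdd_supp h" unfolding h_def by (intro bdd_supp_mult2 Fr U) (use p in auto)
  define b where "b j x = cell_avg j h x / 2^j" for j x
  have b0: "b j x >= 0" for j x unfolding b_def by (auto intro!: divide_nonneg_nonneg cell_avg_nonneg h0)
  have bs: "bdd_supp (b j)" for j
    unfolding b_def divide_inverse by (intro bdd_supp_mult bdd_supp_cell_avg hs bdd_borel_const)
  have bsr: "bdd_supp (%x. b j x powr r)" if "r >= 0" for j r
    using bdd_supp_powr[OF bs that] b0 by simp
  define A where "A = (LINT x|lborel. F x powr p * U x)"
  have As: "bdd_supp (%x. F x powr p * U x)" by (intro bdd_supp_mult2 Fr U) (use p in auto)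
  have A0: "A >= 0" unfolding A_def using U by (auto intro!: integral_nonneg_AE)
  define B where "B x = (\<Sum>j\<in>{a..<m}. b j x)" for x
  have B0: "B x >= 0" for x unfolding B_def by (rule sum_nonneg) (use b0 in auto)
  have Bs: "bdd_supp B" unfolding B_def by (intro bdd_supp_sum bs)
  have Bsr: "bdd_supp (%x. B x powr r)" if "r >= 0" for r
    using bdd_supp_powr[OF Bs that] B0 by simp
  have fs: "bdd_supp (%x. f x powr p)" using bdd_supp_powr[OF f(1), of p] f(2) p by simp
  have "A = (LINT x|lborel. h x * F x)"
    unfolding A_def h_def
  proof (intro Bochner_Integration.integral_cong refl)
    fix x
    have "F x powr p = F x powr (p - 1) * F x" using powr_add[of "F x" "p - 1" 1] F0[of x] by simp
    then show "F x powr p * U x = F x powr (p - 1) * U x * F x" by simp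
  qed
  also have "... = (LINT x|lborel. (\<Sum>j\<in>{a..<m}. h x * cell_avg j f x * inverse (2^j)))"
    unfolding F_def by (simp add: sum_distrib_left divide_inverse mult.assoc)
  also have "... = (\<Sum>j\<in>{a..<m}. (LINT x|lborel. h x * cell_avg j f x) * inverse (2^j))"
    by (subst Bochner_Integration.integral_sum)
      (auto intro!: integrable_mult_left bdd_supp_integrable bdd_supp_mult hs bdd_supp_cell_avg bdd_supp_bdd_borel f)
  also have "... = (\<Sum>j\<in>{a..<m}. (LINT x|lborel. cell_avg j h x * f x) * inverse (2^j))"
    by (simp add: cell_avg_self_adjoint[OF hs f(1)])
  also have "... = (LINT x|lborel. (\<Sum>j\<in>{a..<m}. cell_avg j h x * f x * inverse (2^j)))"
    by (subst Bochner_Integration.integral_sum)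
      (auto intro!: integrable_mult_left bdd_supp_integrable bdd_supp_mult hs bdd_supp_cell_avg bdd_supp_bdd_borel f)
  also have "... = (LINT x|lborel. f x * B x)"
    unfolding B_def b_def by (simp add: sum_distrib_left divide_inverse mult_ac)
  also have "... <= (LINT x|lborel. f x powr p) powr (1/p) * (LINT x|lborel. B x powr s) powr (1/s)"
    by (rule holder_integral(2)[OF s(4) s(1) s(3)])
      (use f B0 Bs bdd_supp_integrable[OF fs] bdd_supp_integrable[OF Bsr] s in auto)
  finally have A1: "A <= (LINT x|lborel. f x powr p) powr (1/p) * (LINT x|lborel. B x powr s) powr (1/s)" .

  \<comment> \<open>A power of \<open>b i\<close> is constant on cells of every generation
    \<open>k >= i\<close>, so averaging leaves it fixed. Both integrals are therefore the same
    integral of \<open>h * b i powr (s - 1)\<close>, divided by \<open>2^j\<close> and by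
    \<open>2^i\<close> respectively.\<close>
  have cross: "(LINT x|lborel. b j x * b i x powr (s - 1)) = (2^i / 2^j) * (LINT x|lborel. b i x powr s)" if "i <= j" for i j
  proof -
    have g: "bdd_supp (%x. b i x powr (s - 1))" by (rule bsr) (use s in auto)
    have avg: "cell_avg k (%x. b i x powr (s - 1)) x = b i x powr (s - 1)" if "i <= k" for k x
    proof -
      have "cell_avg k (%x. b i x powr (s - 1)) x = cell_avg k (%_. b i x powr (s - 1)) x"
      proof (rule cell_avg_cong)
        fix y assume "y \<in> cell k x"
        then have "y \<in> cell i x" using cell_antimono[OF that] by blast
        then show "b i y powr (s - 1) = b i x powr (s - 1)" unfolding b_def by (simp add: cell_avg_cell)
      qed
      then show ?thesis by (simp add: cell_avg_const)
    qed
    have eq: "(LINT x|lborel. b k x * b i x powr (s - 1)) = (LINT x|lborel. h x * b i x powr (s - 1)) / 2^k" if "i <= k" for k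
    proof -
      have "(LINT x|lborel. b k x * b i x powr (s - 1)) = (LINT x|lborel. cell_avg k h x * b i x powr (s - 1)) / 2^k"
        unfolding b_def[of k] by simp
      also have "... = (LINT x|lborel. h x * b i x powr (s - 1)) / 2^k"
        unfolding cell_avg_self_adjoint[OF hs g] avg[OF that] ..
      finally show ?thesis .
    qed
    have "b i x * b i x powr (s - 1) = b i x powr s" for x
      using powr_add[of "b i x" 1 "s - 1"] b0[of i x] by simp
    then have "(LINT x|lborel. b i x powr s) = (LINT x|lborel. h x * b i x powr (s - 1)) / 2^i"
      using eq[of i] by simp
    then show ?thesis using eq[OF that] by simp
  qed
  \<comment> \<open>Hoelder on each cell: the average of \<open>U\<close> contributes the decay
    \<open>d i\<close>, and the powers of \<open>2^i\<close> cancel because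
    \<open>p * (s / p) = s\<close>.\<close>
  have single: "(LINT x|lborel. b i x powr s) <= d i powr (1 / (p - 1)) * A" if "a <= i" for i
  proof -
    have "(LINT x|lborel. b i x powr s) <= (LINT x|lborel. d i powr (1 / (p - 1)) * cell_avg i (%y. F y powr p * U y) x)"
    proof (rule integral_mono[OF bdd_supp_integrable[OF bsr] bdd_supp_integrable[OF bdd_supp_mult2[OF bdd_borel_const bdd_supp_cell_avg[OF As]]]])
      show "0 <= s" using s by simp
      fix x
      have "(((2::real)^i) powr p) powr (s/p) = (2^i) powr (p * (s/p))" by (rule powr_powr)
      then have ns: "(((2::real)^i) powr p) powr (s/p) = (2^i) powr s" using s(4) by simp
      have "cell_avg i h x powr s <= cell_avg i (%y. F y powr p * U y) x * cell_avg i U x powr (s / p)"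
        unfolding h_def using F0 U bdd_supp_bdd_borel[OF Fs] bdd_supp_bdd_borel[OF U(1)] s by (intro cell_avg_holder) auto
      also have "... <= cell_avg i (%y. F y powr p * U y) x * ((2^i) powr p * d i) powr (s / p)"
        using U s p by (intro mult_left_mono powr_mono2 d that cell_avg_nonneg) auto
      also have "... = cell_avg i (%y. F y powr p * U y) x * ((2^i) powr s * d i powr (1 / (p - 1)))"
        unfolding powr_mult sp(1) ns[unfolded sp(1)] ..
      finally have "cell_avg i h x powr s / (2^i) powr s <= d i powr (1 / (p - 1)) * cell_avg i (%y. F y powr p * U y) x"
        by (simp add: field_simps)
      then show "b i x powr s <= d i powr (1 / (p - 1)) * cell_avg i (%y. F y powr p * U y) x"
        unfolding b_def using h0 by (simp add: powr_divide cell_avg_nonneg)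
    qed
    also have "... = d i powr (1 / (p - 1)) * A"
      using integral_cell_avg[OF As] by (simp add: A_def)
    finally show ?thesis .
  qed
  have geo: "(\<Sum>j\<in>{i..<m}. (2^i / 2^j :: real)) <= 2" for i
  proof -
    have "(\<Sum>j\<in>{i..<m}. (2^i / 2^j :: real)) <= 2 - 2 * 2^i / 2^m" if "i <= m" for m
      using that
    proof (induction m rule: dec_induct)
      case (step k)
      define q :: real where "q = 2^i / 2^k"
      have "2 * 2^i / 2^k = 2 * q" "2 * 2^i / 2^Suc k = q" by (auto simp: q_def)
      then show ?case using step by (simp add: q_def[symmetric])
    qed simp
    moreover have "2 - 2 * 2^i / 2^m <= (2::real)" by simp
    ultimately have "(\<Sum>j\<in>{i..<m}. (2^i / 2^j :: real)) <= 2" if "i <= m"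
      using that order_trans by blast
    then show ?thesis by (cases "i <= m") auto
  qed
  define D where "D = (\<Sum>i\<in>{a..<m}. d i powr (1 / (p - 1)))"
  have D0: "D >= 0" unfolding D_def by (rule sum_nonneg) auto
  have "(LINT x|lborel. B x powr s) <= (LINT x|lborel. s * (\<Sum>j\<in>{a..<m}. \<Sum>i\<in>{a..j}. b j x * b i x powr (s - 1)))"
    unfolding B_def
  proof (rule integral_mono)
    show "integrable lborel (%x. (\<Sum>j\<in>{a..<m}. b j x) powr s)"
      using bdd_supp_integrable[OF Bsr, of s] s unfolding B_def by simp
    show "integrable lborel (%x. s * (\<Sum>j\<in>{a..<m}. \<Sum>i\<in>{a..j}. b j x * b i x powr (s - 1)))"
      by (intro integrable_mult_right Bochner_Integration.integrable_sum bdd_supp_integrable bdd_supp_mult bs bdd_supp_bdd_borel bsr)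
        (use s in auto)
    show "(\<Sum>j\<in>{a..<m}. b j x) powr s <= s * (\<Sum>j\<in>{a..<m}. \<Sum>i\<in>{a..j}. b j x * b i x powr (s - 1))" for x
      by (rule powr_partial_sums_le) (use b0 s in auto)
  qed
  also have "... = s * (\<Sum>j\<in>{a..<m}. \<Sum>i\<in>{a..j}. (LINT x|lborel. b j x * b i x powr (s - 1)))"
  proof -
    have "integrable lborel (%x. b j x * b i x powr (s - 1))" for i j
      by (intro bdd_supp_integrable bdd_supp_mult bs bdd_supp_bdd_borel bsr) (use s in auto)
    then show ?thesis by (simp add: Bochner_Integration.integral_sum Bochner_Integration.integrable_sum)
  qed
  also have "... = s * (\<Sum>j\<in>{a..<m}. \<Sum>i\<in>{a..j}. (2^i / 2^j) * (LINT x|lborel. b i x powr s))"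
    by (simp add: cross)
  also have "... = s * (\<Sum>i\<in>{a..<m}. \<Sum>j\<in>{i..<m}. (2^i / 2^j) * (LINT x|lborel. b i x powr s))"
  proof -
    have "(\<Sum>j\<in>{a..<m}. \<Sum>i\<in>{a..j}. g i j) = (\<Sum>i\<in>{a..<m}. \<Sum>j\<in>{i..<m}. g i j)" for g :: "nat => nat => real"
      unfolding sum.Sigma[OF finite_atLeastLessThan ballI[OF finite_atLeastAtMost]]
        sum.Sigma[OF finite_atLeastLessThan ballI[OF finite_atLeastLessThan]]
      by (rule sum.reindex_bij_witness[where i = prod.swap and j = prod.swap]) auto
    then show ?thesis by simp
  qed
  also have "... = s * (\<Sum>i\<in>{a..<m}. (\<Sum>j\<in>{i..<m}. (2^i / 2^j)) * (LINT x|lborel. b i x powr s))"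
    by (simp add: sum_distrib_right)
  also have "... <= s * (\<Sum>i\<in>{a..<m}. 2 * (d i powr (1 / (p - 1)) * A))"
    using s by (intro mult_left_mono sum_mono mult_mono geo single) (auto intro!: integral_nonneg_AE)
  also have "... = (2 * s * D) * A"
    unfolding D_def by (simp add: sum_distrib_left sum_distrib_right mult_ac)
  finally have B1: "(LINT x|lborel. B x powr s) <= (2 * s * D) * A" .
  define N where "N = (LINT x|lborel. f x powr p)"
  have N0: "N >= 0" unfolding N_def by (auto intro: integral_nonneg_AE)
  \<comment> \<open>The quantity \<open>A\<close> occurs on both sides, to the power
    \<open>1/s\<close> on the right. It is a finite integral, so it can be divided out.\<close>
  have "A <= (2 * s * D) powr (p - 1) * N"
  proof (cases "A = 0")
    case False
    then have "A > 0" using A0 by simp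
    have "A <= N powr (1/p) * (2 * s * D * A) powr (1/s)"
      using A1 unfolding N_def[symmetric]
      by (rule order_trans) (use B1 s in \<open>auto intro!: mult_left_mono powr_mono2 integral_nonneg_AE\<close>)
    also have "... = (N powr (1/p) * (2 * s * D) powr (1/s)) * A powr (1/s)"
      using D0 A0 s by (simp add: powr_mult)
    finally have "A / A powr (1/s) <= N powr (1/p) * (2 * s * D) powr (1/s)"
      using \<open>A > 0\<close> by (simp add: field_simps)
    moreover have "A / A powr (1/s) = A powr (1/p)"
    proof -
      have "1/p = 1 - 1/s" using s(3) by simp
      then show ?thesis using \<open>A > 0\<close> by (simp add: powr_diff)
    qed
    ultimately have "(A powr (1/p)) powr p <= (N powr (1/p) * (2 * s * D) powr (1/s)) powr p"
      using p by (intro powr_mono2) auto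
    also have "... = N * (2 * s * D) powr (p - 1)"
      using N0 p sp by (simp add: powr_mult powr_powr)
    finally show ?thesis using \<open>A > 0\<close> p by (simp add: powr_powr mult.commute)
  qed (use N0 in auto)
  then show ?thesis unfolding A_def N_def D_def s_def F_def by (simp add: mult.commute)
qed

lemma powr_add3_le:
  fixes x y z p :: real
  assumes "x >= 0" "y >= 0" "z >= 0" "p >= 0"
  shows "(x + y + z) powr p <= 3 powr p * (x powr p + y powr p + z powr p)"
proof -
  define m where "m = max x (max y z)"
  have "(x + y + z) powr p <= (3 * m) powr p" using assms by (intro powr_mono2) (auto simp: m_def)
  also have "... = 3 powr p * m powr p" by (rule powr_mult) 
  also have "... <= 3 powr p * (x powr p + y powr p + z powr p)"
    by (intro mult_left_mono) (auto simp: m_def max_def)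
  finally show ?thesis .
qed

text \<open>The function is split into its deviation from the average of generation
  \<open>m\<close>, the telescoped averages from \<open>a\<close> to \<open>m\<close>, and the
  coarse average of generation \<open>a\<close>. Only the last part costs the norm of
  \<open>phi\<close> itself.\<close>

lemma trace_inequality:
  fixes w :: "'a::euclidean_space set"
  assumes phi: "test_fun w phi" and U: "bdd_supp U" "!!x. U x >= 0" and p: "p >= 1"
    and c: "!!x. cell_avg a U x <= c"
    and \<tau>: "!!m. (LINT x|lborel. U x * (\<Sum>j\<in>{a..<m}. cell_avg j (%y. norm (grad phi y)) x / 2^j) powr p)
        <= \<tau> * (LINT x|lborel. norm (grad phi x) powr p)"
  shows "(LINT x|lborel. U x * \<bar>phi x\<bar> powr p) <= 3 powr p * (c * (LINT x|lborel. \<bar>phi x\<bar> powr p)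
     + (4^DIM('a) * DIM('a)) powr p * \<tau> * (LINT x|lborel. norm (grad phi x) powr p))"
proof -
  let ?f = "%y. norm (grad phi y)" and ?C = "4^DIM('a) * DIM('a) :: real"
  have sp: "bdd_supp phi" "bdd_supp ?f" using test_fun_bdd_supp[OF phi] by auto
  have b: "bdd_borel phi" "bdd_borel ?f" using sp by (auto intro: bdd_supp_bdd_borel)
  obtain K where K: "!!x. U x <= K" "K >= 0"
  proof -
    obtain K where "!!x. \<bar>U x\<bar> <= K" using U(1) by (auto simp: bdd_supp_def bdd_borel_def)
    then show ?thesis using that[of "\<bar>K\<bar>"] by (meson abs_ge_self abs_ge_zero order_trans)
  qed
  define S where "S m x = (\<Sum>j\<in>{a..<m}. cell_avg j ?f x / 2^j)" for m x
  have S0: "S m x >= 0" for m x unfolding S_def by (auto intro!: sum_nonneg divide_nonneg_nonneg cell_avg_nonneg)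
  have Sb: "bdd_borel (S m)" for m
    unfolding S_def divide_inverse by (intro bdd_borel_sum bdd_borel_mult bdd_borel_cell_avg b bdd_borel_const)
  have tele: "\<bar>cell_avg m phi x - cell_avg a phi x\<bar> <= ?C * S m x" if "a <= m" for m x
    using that
  proof (induction m rule: dec_induct)
    case (step m)
    have "\<bar>cell_avg (Suc m) phi x - cell_avg a phi x\<bar> <= ?C * (cell_avg m ?f x / 2^m) + ?C * S m x"
      using step.IH cell_avg_telescope[OF phi, of m x] by linarith
    then show ?case using step.hyps unfolding S_def by (simp add: distrib_left)
  qed (simp add: S_def)
  define N where "N = (LINT x|lborel. ?f x powr p)"
  define P where "P = (LINT x|lborel. \<bar>phi x\<bar> powr p)"
  have iphi: "integrable lborel (%x. U x * \<bar>phi x\<bar> powr p)"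
    by (intro bdd_supp_integrable bdd_supp_mult U bdd_borel_powr b) (use p in auto)
  have main: "(LINT x|lborel. U x * \<bar>phi x\<bar> powr p)
     <= 3 powr p * (K * (2^DIM('a) * (DIM('a) / 2^m) powr p * N) + c * P + ?C powr p * (\<tau> * N))" if m: "a <= m" for m
  proof -
    have i1: "integrable lborel (%x. \<bar>phi x - cell_avg m phi x\<bar> powr p)"
      by (intro bdd_supp_integrable bdd_supp_powr bdd_supp_diff sp bdd_supp_cell_avg) (use p in auto)
    have i2: "integrable lborel (%x. U x * \<bar>cell_avg a phi x\<bar> powr p)"
      by (intro bdd_supp_integrable bdd_supp_mult U bdd_borel_powr bdd_borel_cell_avg b) (use p in auto)
    have i3: "integrable lborel (%x. U x * S m x powr p)"
      using bdd_supp_integrable[OF bdd_supp_mult[OF U(1) bdd_borel_powr[OF Sb]], of p m] p S0 by simp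
    have "(LINT x|lborel. U x * \<bar>phi x\<bar> powr p) <= (LINT x|lborel. 3 powr p * (K * \<bar>phi x - cell_avg m phi x\<bar> powr p
        + U x * \<bar>cell_avg a phi x\<bar> powr p + ?C powr p * (U x * S m x powr p)))"
    proof (rule integral_mono[OF iphi])
      show "integrable lborel (%x. 3 powr p * (K * \<bar>phi x - cell_avg m phi x\<bar> powr p
        + U x * \<bar>cell_avg a phi x\<bar> powr p + ?C powr p * (U x * S m x powr p)))"
        using i1 i2 i3 by (intro integrable_mult_right Bochner_Integration.integrable_add)
      fix x
      have "\<bar>phi x\<bar> <= \<bar>phi x - cell_avg m phi x\<bar> + \<bar>cell_avg a phi x\<bar> + ?C * S m x"
        using tele[OF m, of x] by linarith
      then have "\<bar>phi x\<bar> powr p <= (\<bar>phi x - cell_avg m phi x\<bar> + \<bar>cell_avg a phi x\<bar> + ?C * S m x) powr p"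
        using p by (intro powr_mono2) auto
      also have "... <= 3 powr p * (\<bar>phi x - cell_avg m phi x\<bar> powr p + \<bar>cell_avg a phi x\<bar> powr p + (?C * S m x) powr p)"
        by (rule powr_add3_le) (use p S0 in auto)
      finally have "U x * \<bar>phi x\<bar> powr p <= U x * (3 powr p * (\<bar>phi x - cell_avg m phi x\<bar> powr p + \<bar>cell_avg a phi x\<bar> powr p + ?C powr p * S m x powr p))"
        using U(2)[of x] S0 by (simp add: powr_mult mult_left_mono)
      also have "... = 3 powr p * (U x * \<bar>phi x - cell_avg m phi x\<bar> powr p + U x * \<bar>cell_avg a phi x\<bar> powr p + ?C powr p * (U x * S m x powr p))"
        by (simp add: algebra_simps)
      also have "... <= 3 powr p * (K * \<bar>phi x - cell_avg m phi x\<bar> powr p + U x * \<bar>cell_avg a phi x\<bar> powr p + ?C powr p * (U x * S m x powr p))"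
        by (intro mult_left_mono add_right_mono mult_right_mono K) auto
      finally show "U x * \<bar>phi x\<bar> powr p <= ..." .
    qed
    also have "... = 3 powr p * (K * (LINT x|lborel. \<bar>phi x - cell_avg m phi x\<bar> powr p) + (LINT x|lborel. U x * \<bar>cell_avg a phi x\<bar> powr p)
        + ?C powr p * (LINT x|lborel. U x * S m x powr p))"
      using i1 i2 i3 by (simp only: integral_mult_right_zero Bochner_Integration.integral_add integrable_mult_right Bochner_Integration.integrable_add)
    also have "... <= 3 powr p * (K * (2^DIM('a) * (DIM('a) / 2^m) powr p * N) + c * P + ?C powr p * (\<tau> * N))"
      unfolding N_def P_def S_def
      by (intro mult_left_mono add_mono cell_avg_approx[OF phi p] integral_powr_cell_avg_le sp U p c \<tau> K) auto
    finally show ?thesis .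
  qed
  \<comment> \<open>The bound \<open>K\<close> of the weight multiplies only the deviation term, so
    it disappears as \<open>m\<close> grows; the final constants depend on \<open>U\<close> through
    \<open>c\<close> and \<tau> alone.\<close>
  have "(%m. (DIM('a) / 2^m) powr p) ----> 0"
  proof -
    have "(%m. real DIM('a) / 2^m) ----> 0"
      using LIMSEQ_divide_realpow_zero[of 2 "real DIM('a)"] by simp
    then have "(%m. (real DIM('a) / 2^m) powr p) ----> 0 powr p"
      using p by (intro tendsto_powr2 tendsto_const) auto
    then show ?thesis by simp
  qed
  then have "(%m. 3 powr p * (K * (2^DIM('a) * (DIM('a) / 2^m) powr p * N) + c * P + ?C powr p * (\<tau> * N)))
     ----> 3 powr p * (K * (2^DIM('a) * 0 * N) + c * P + ?C powr p * (\<tau> * N))"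
    by (intro tendsto_intros)
  then have "(LINT x|lborel. U x * \<bar>phi x\<bar> powr p) <= 3 powr p * (K * (2^DIM('a) * 0 * N) + c * P + ?C powr p * (\<tau> * N))"
    by (rule LIMSEQ_le_const) (use main in blast)
  then show ?thesis unfolding N_def P_def by (simp add: mult.assoc)
qed

section \<open>Morrey potentials\<close>

text \<open>Fatou's lemma in real-valued form, giving integrability of the limit together with the
  bound. It lifts the weighted inequality from bounded weights to the potential and from test
  functions to their closure.\<close>

lemma fatou_integrable:
  fixes f :: "nat => 'b => real"
  assumes int: "!!k. integrable M (f k)" and nn: "!!k x. f k x >= 0"
    and lim: "AE x in M. (%k. f k x) ----> g x" and g: "g \<in> borel_measurable M"
    and le: "!!k. (LINT x|M. f k x) <= B"
  shows "integrable M g" "(LINT x|M. g x) <= B"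
proof -
  have g0: "AE x in M. g x >= 0"
    using lim by eventually_elim (rule LIMSEQ_le_const, use nn in auto)
  have B: "B >= 0" by (rule order_trans[OF integral_nonneg_AE le[of 0]]) (use nn in auto)
  have "(\<integral>\<^sup>+x. ennreal (g x) \<partial>M) = (\<integral>\<^sup>+x. liminf (%k. ennreal (f k x)) \<partial>M)"
  proof (rule nn_integral_cong_AE)
    show "AE x in M. ennreal (g x) = liminf (%k. ennreal (f k x))"
      using lim
    proof eventually_elim
      case (elim x)
      then have "(%k. ennreal (f k x)) ----> ennreal (g x)" by (rule tendsto_ennrealI)
      then show ?case by (simp add: lim_imp_Liminf)
    qed
  qed
  also have "... <= liminf (%k. \<integral>\<^sup>+x. ennreal (f k x) \<partial>M)"
    by (rule nn_integral_liminf) (use int in auto)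
  also have "... = liminf (%k. ennreal (LINT x|M. f k x))"
    by (simp add: nn_integral_eq_integral[OF int] nn)
  also have "... <= liminf (%k::nat. ennreal B)"
    by (intro Liminf_mono always_eventually allI ennreal_leI le)
  also have "... = ennreal B" by (simp add: Liminf_const)
  finally have *: "(\<integral>\<^sup>+x. ennreal (g x) \<partial>M) <= ennreal B" .
  show "integrable M g"
    by (rule integrableI_nonneg[OF g g0]) (use * in \<open>simp add: le_less_trans\<close>)
  then show "(LINT x|M. g x) <= B"
    using * B g0 by (subst (asm) nn_integral_eq_integral) auto
qed

text \<open>Dyadic averages live on the whole space with Borel measure, the problem on
  \<open>w\<close> with Lebesgue measure; functions vanishing outside \<open>w\<close> do not see
  the difference.\<close>

lemma lebesgue_on_lborel:
  fixes g :: "'a::euclidean_space => real"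
  assumes w: "open w" and g: "g \<in> borel_measurable borel" "!!x. x \<notin> w ==> g x = 0"
  shows "integrable (lebesgue_on w) g \<longleftrightarrow> integrable lborel g"
    and "(LINT x|(lebesgue_on w). g x) = (LINT x|lborel. g x)"
proof -
  have ws: "w \<in> sets lebesgue" using w by auto
  have eq: "(%x. indicator w x * g x) = g" using g(2) by (auto split: split_indicator)
  show "integrable (lebesgue_on w) g \<longleftrightarrow> integrable lborel g"
    using integrable_restrict_space[of w lebesgue g] ws g(1) integrable_completion[of g lborel] by (simp add: eq)
  show "(LINT x|(lebesgue_on w). g x) = (LINT x|lborel. g x)"
    using integral_restrict_space[of w lebesgue g] ws g(1) integral_completion[of g lborel] by (simp add: eq)
qed

lemma geometric_tail_le:
  fixes r :: real
  assumes "0 < r" "r < 1"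
  shows "(\<Sum>j\<in>{a..<m}. r^(j - a)) <= 1 / (1 - r)"
proof -
  have "(\<Sum>j\<in>{a..<m}. r^(j - a)) = (\<Sum>k<m - a. r^k)"
    by (rule sum.reindex_bij_witness[where i = "%k. k + a" and j = "%j. j - a"]) auto
  also have "... = (1 - r^(m - a)) / (1 - r)" using assms by (simp add: sum_gp_strict)
  also have "... <= 1 / (1 - r)" using assms by (intro divide_right_mono) auto
  finally show ?thesis .
qed

text \<open>The two regimes of the potential: geometric decay, handled by weights, and summability
  of a root of \<open>d\<close>, handled by duality. The geometric rate is written as a square
  because one factor \<open>rho\<close> pays for the weights and the other keeps the sum
  convergent.\<close>

definition admissible_decay :: "real => nat => (nat => real) => bool" where
  "admissible_decay p j1 d \<longleftrightarrow> (\<forall>j. d j >= 0) \<and>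
    ((\<exists>M rho. 0 < rho \<and> rho < 1 \<and> (\<forall>j\<ge>j1. d j <= M * (rho^2)^j)) \<or>
     (p >= 2 \<and> summable (%j. d j powr (1 / (p - 1)))))"

lemma admissible_decay_geometricI:
  assumes "!!j. d j >= 0" "0 < rho" "rho < 1" "!!j. j >= j1 ==> d j <= M * (rho^2)^j"
  shows "admissible_decay p j1 d"
  unfolding admissible_decay_def using assms by blast

text \<open>Starting the sum at a late generation makes its constant small. The starting index is
  chosen before \<open>f\<close>, \<open>U\<close> and \<open>m\<close>, hence is uniform over all
  truncations of the potential.\<close>

lemma potential_small:
  assumes p: "p > 1" and dec: "admissible_decay p j1 d" and "\<epsilon> > 0"
  obtains a where "a >= j1" and "!!f U m. bdd_supp f ==> (!!x::'a::euclidean_space. f x >= 0) ==> bdd_supp U ==> (!!x. U x >= 0) ==>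
      (!!j x. j >= j1 ==> cell_avg j U x <= (2^j) powr p * d j) ==>
     (LINT x|lborel. U x * (\<Sum>j\<in>{a..<m}. cell_avg j f x / 2^j) powr p) <= \<epsilon> * (LINT x|lborel. f x powr p)"
proof -
  have d0: "d j >= 0" for j using dec by (simp add: admissible_decay_def)
  consider (geo) M rho where "0 < rho" "rho < 1" "!!j. j >= j1 ==> d j <= M * (rho^2)^j"
    | (smb) "p >= 2" "summable (%j. d j powr (1 / (p - 1)))"
  proof (cases "p >= 2 \<and> summable (%j. d j powr (1 / (p - 1)))")
    case True then show ?thesis using smb by simp
  next
    case False
    then obtain M rho where "0 < rho" "rho < 1" "\<forall>j\<ge>j1. d j <= M * (rho^2)^j"
      using dec[unfolded admissible_decay_def, THEN conjunct2] by (elim disjE exE conjE) simp_all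
    then show ?thesis using geo[of rho M] by simp
  qed
  then show ?thesis
  proof cases
    case geo
    \<comment> \<open>Chosen so that \<open>r powr (1 - p) = 1 / rho\<close>: the loss from
      geometric weights of ratio \<open>r\<close> is exactly one of the two factors
      \<open>rho\<close>.\<close>
    define r where "r = rho powr (1 / (p - 1))"
    have "rho powr (1 / (p - 1)) < 1 powr (1 / (p - 1))"
      by (rule powr_less_mono2) (use geo p in auto)
    then have r: "0 < r" "r < 1" unfolding r_def using geo by auto
    have rp: "r powr (1 - p) = 1 / rho"
    proof -
      have "1 / (p - 1) * (1 - p) = -1" using p by (simp add: field_simps)
      then show ?thesis unfolding r_def powr_powr using geo by (simp add: powr_minus divide_inverse)
    qed
    define K where "K = (1 - r) powr (1 - p) * \<bar>M\<bar> / (1 - rho)"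
    have K0: "K >= 0" unfolding K_def using geo by auto
    have "(%a. K * (rho^2)^a) ----> K * 0"
      using geo by (intro tendsto_intros LIMSEQ_power_zero) (auto simp: power_less_one_iff abs_square_less_1)
    then have "\<forall>\<^sub>F a in sequentially. K * (rho^2)^a < \<epsilon>"
      using \<open>\<epsilon> > 0\<close> by (intro order_tendstoD) auto
    then obtain a where a: "a >= j1" "K * (rho^2)^a < \<epsilon>"
      unfolding eventually_sequentially by (meson max.cobounded1 max.cobounded2)
    show ?thesis
    proof (rule that[OF a(1)])
      fix f U :: "'a => real" and m
      assume f: "bdd_supp f" "!!x. f x >= 0" and U: "bdd_supp U" "!!x. U x >= 0"
        and UE: "!!j x. j >= j1 ==> cell_avg j U x <= (2^j) powr p * d j"
      \<comment> \<open>Normalized geometric weights, of total mass at most one.\<close>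
      define w where "w j = (1 - r) * r^(j - a)" for j
      have w: "w j > 0" for j unfolding w_def using r by simp
      have "sum w {a..<m} = (1 - r) * (\<Sum>j\<in>{a..<m}. r^(j - a))" unfolding w_def by (simp add: sum_distrib_left)
      also have "... <= (1 - r) * (1 / (1 - r))" using r by (intro mult_left_mono geometric_tail_le) auto
      finally have w1: "sum w {a..<m} <= 1" using r by simp
      have "(LINT x|lborel. U x * (\<Sum>j\<in>{a..<m}. cell_avg j f x / 2^j) powr p)
        <= (\<Sum>j\<in>{a..<m}. w j powr (1 - p) * d j) * (LINT x|lborel. f x powr p)"
        by (rule potential_sum_weighted[OF f U _ _ w w1 UE]) (use p a in auto)
      also have "... <= \<epsilon> * (LINT x|lborel. f x powr p)"
      proof (rule mult_right_mono)
        have "(\<Sum>j\<in>{a..<m}. w j powr (1 - p) * d j) <= (\<Sum>j\<in>{a..<m}. (1 - r) powr (1 - p) * \<bar>M\<bar> * (rho^2)^a * rho^(j - a))"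
        proof (rule sum_mono)
          fix j assume j: "j \<in> {a..<m}"
          have wj: "w j powr (1 - p) = (1 - r) powr (1 - p) * (1 / rho)^(j - a)"
          proof -
            have "(r^(j - a)) powr (1 - p) = (r powr (1 - p))^(j - a)"
              using r by (simp add: powr_realpow[symmetric] powr_powr mult.commute)
            then show ?thesis unfolding w_def using r by (simp add: powr_mult rp)
          qed
          have "d j <= M * (rho^2)^j" by (rule geo(3)) (use j a in auto)
          also have "... <= \<bar>M\<bar> * (rho^2)^j" by (intro mult_right_mono) auto
          finally have "d j <= \<bar>M\<bar> * (rho^2)^j" .
          then have "w j powr (1 - p) * d j <= ((1 - r) powr (1 - p) * (1 / rho)^(j - a)) * (\<bar>M\<bar> * (rho^2)^j)"
            unfolding wj using geo by (intro mult_left_mono) auto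
          also have "... = (1 - r) powr (1 - p) * \<bar>M\<bar> * ((1 / rho)^(j - a) * (rho^2)^j)" by simp
          also have "(1 / rho)^(j - a) * (rho^2)^j = (rho^2)^a * rho^(j - a)"
          proof -
            have "j = a + (j - a)" using j by simp
            then have "(rho^2)^j = (rho^2)^a * (rho^2)^(j - a)" by (metis power_add)
            moreover have "(1 / rho)^(j - a) * (rho^2)^(j - a) = rho^(j - a)"
              using geo(1) by (simp add: power_mult_distrib[symmetric] power2_eq_square)
            ultimately show ?thesis by (simp add: mult.left_commute)
          qed
          finally show "w j powr (1 - p) * d j <= (1 - r) powr (1 - p) * \<bar>M\<bar> * (rho^2)^a * rho^(j - a)" by (simp add: mult_ac)
        qed
        also have "... = (1 - r) powr (1 - p) * \<bar>M\<bar> * (rho^2)^a * (\<Sum>j\<in>{a..<m}. rho^(j - a))" by (simp add: sum_distrib_left)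
        also have "... <= (1 - r) powr (1 - p) * \<bar>M\<bar> * (rho^2)^a * (1 / (1 - rho))"
          using geo by (intro mult_left_mono geometric_tail_le) auto
        also have "... = K * (rho^2)^a" by (simp add: K_def)
        finally show "(\<Sum>j\<in>{a..<m}. w j powr (1 - p) * d j) <= \<epsilon>" using a by simp
      qed (auto intro: integral_nonneg_AE)
      finally show "(LINT x|lborel. U x * (\<Sum>j\<in>{a..<m}. cell_avg j f x / 2^j) powr p) <= \<epsilon> * (LINT x|lborel. f x powr p)" .
    qed
  next
    case smb
    \<comment> \<open>The tail for which the constant of the dual estimate equals
      \<epsilon>.\<close>
    define \<epsilon>' where "\<epsilon>' = \<epsilon> powr (1 / (p - 1)) / (2 * (p / (p - 1)))"
    have \<epsilon>': "\<epsilon>' > 0" unfolding \<epsilon>'_def using p \<open>\<epsilon> > 0\<close> by auto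
    obtain N where N: "!!a m. a >= N ==> norm (\<Sum>j\<in>{a..<m}. d j powr (1 / (p - 1))) < \<epsilon>'"
      using smb(2) \<epsilon>' unfolding summable_Cauchy by meson
    define a where "a = max j1 N"
    show ?thesis
    proof (rule that)
      show "a >= j1" by (simp add: a_def)
      fix f U :: "'a => real" and m
      assume f: "bdd_supp f" "!!x. f x >= 0" and U: "bdd_supp U" "!!x. U x >= 0"
        and UE: "!!j x. j >= j1 ==> cell_avg j U x <= (2^j) powr p * d j"
      let ?D = "\<Sum>j\<in>{a..<m}. d j powr (1 / (p - 1))"
      have D: "0 <= ?D" "?D <= \<epsilon>'" using N[of a m] by (auto simp: a_def sum_nonneg)
      have "(LINT x|lborel. U x * (\<Sum>j\<in>{a..<m}. cell_avg j f x / 2^j) powr p)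
        <= (2 * (p / (p - 1)) * ?D) powr (p - 1) * (LINT x|lborel. f x powr p)"
        by (rule potential_sum_dual[OF f U smb(1) UE d0]) (auto simp: a_def)
      also have "... <= \<epsilon> * (LINT x|lborel. f x powr p)"
      proof (rule mult_right_mono)
        have "2 * (p / (p - 1)) * ?D <= 2 * (p / (p - 1)) * \<epsilon>'" using p D by (intro mult_left_mono) auto
        also have "... = \<epsilon> powr (1 / (p - 1))" unfolding \<epsilon>'_def using p by simp
        finally have "(2 * (p / (p - 1)) * ?D) powr (p - 1) <= (\<epsilon> powr (1 / (p - 1))) powr (p - 1)"
          using p D by (intro powr_mono2) auto
        also have "... = \<epsilon>" using p \<open>\<epsilon> > 0\<close> by (simp add: powr_powr)
        finally show "(2 * (p / (p - 1)) * ?D) powr (p - 1) <= \<epsilon>" .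
      qed (auto intro: integral_nonneg_AE)
      finally show "(LINT x|lborel. U x * (\<Sum>j\<in>{a..<m}. cell_avg j f x / 2^j) powr p) <= \<epsilon> * (LINT x|lborel. f x powr p)" .
    qed
  qed
qed

text \<open>The tail from generation \<open>a\<close> on pays with \<delta>, and the coarse average
  at generation \<open>a\<close> with \<open>C\<close>. Neither constant depends on the bound or the
  support of the weight.\<close>

lemma bounded_weight_inequality:
  assumes p: "p > 1" and dec: "admissible_decay p j1 d" and "\<delta> > 0"
  obtains C where "C >= 0" and "!!U phi. bdd_supp U ==> (!!x::'a::euclidean_space. U x >= 0) ==>
      (!!j x. j >= j1 ==> cell_avg j U x <= (2^j) powr p * d j) ==> test_fun w phi ==>
     (LINT x|lborel. U x * \<bar>phi x\<bar> powr p) <= \<delta> * (LINT x|lborel. norm (grad phi x) powr p) + C * (LINT x|lborel. \<bar>phi x\<bar> powr p)"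
proof -
  define C0 where "C0 = (4^DIM('a) * DIM('a) :: real) powr p"
  have C0: "C0 > 0" unfolding C0_def by simp
  define \<epsilon> where "\<epsilon> = \<delta> / (3 powr p * C0)"
  have \<epsilon>: "\<epsilon> > 0" unfolding \<epsilon>_def using C0 \<open>\<delta> > 0\<close> by simp
  obtain a where a: "a >= j1" and pot: "!!f U m. bdd_supp f ==> (!!x::'a. f x >= 0) ==> bdd_supp U ==> (!!x. U x >= 0) ==>
      (!!j x. j >= j1 ==> cell_avg j U x <= (2^j) powr p * d j) ==>
     (LINT x|lborel. U x * (\<Sum>j\<in>{a..<m}. cell_avg j f x / 2^j) powr p) <= \<epsilon> * (LINT x|lborel. f x powr p)"
    using potential_small[where 'a='a, OF p dec \<epsilon>] by blast
  have d0: "d j >= 0" for j using dec by (simp add: admissible_decay_def)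
  show ?thesis
  proof (rule that)
    show "3 powr p * ((2^a) powr p * d a) >= 0" using d0 by simp
    fix U phi :: "'a => real"
    assume U: "bdd_supp U" "!!x. U x >= 0" and UE: "!!j x. j >= j1 ==> cell_avg j U x <= (2^j) powr p * d j"
      and phi: "test_fun w phi"
    have "(LINT x|lborel. U x * \<bar>phi x\<bar> powr p) <= 3 powr p * (((2^a) powr p * d a) * (LINT x|lborel. \<bar>phi x\<bar> powr p)
      + C0 * \<epsilon> * (LINT x|lborel. norm (grad phi x) powr p))"
      unfolding C0_def
      by (rule trace_inequality[OF phi U _ UE[OF a] pot[OF test_fun_bdd_supp(2)[OF phi] _ U UE]]) (use p in auto)
    also have "... = (3 powr p * C0 * \<epsilon>) * (LINT x|lborel. norm (grad phi x) powr p) + 3 powr p * ((2^a) powr p * d a) * (LINT x|lborel. \<bar>phi x\<bar> powr p)"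
      by (simp add: algebra_simps)
    also have "3 powr p * C0 * \<epsilon> = \<delta>" unfolding \<epsilon>_def using C0 by simp
    finally show "(LINT x|lborel. U x * \<bar>phi x\<bar> powr p) <= \<delta> * (LINT x|lborel. norm (grad phi x) powr p)
      + 3 powr p * ((2^a) powr p * d a) * (LINT x|lborel. \<bar>phi x\<bar> powr p)" .
  qed
qed

text \<open>A bounded set is contained in a single ball about one of its points, so local
  integrability on such balls is integrability on \<open>w\<close>.\<close>

lemma morrey_integrable:
  fixes w :: "'a::euclidean_space set"
  assumes "morrey q p w V" "bounded w" "w ~= {}"
  shows "integrable (lebesgue_on w) V"
proof -
  obtain y where y: "y \<in> w" using assms by auto
  obtain R where R: "R > 0" "w \<subseteq> ball y R" using bounded_subset_ballD[OF assms(2), of y] by auto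
  then have eq: "w \<inter> ball y R = w" by auto
  have "integrable (lebesgue_on (w \<inter> ball y R)) V \<or> integrable (lebesgue_on w) V"
    using assms(1) y R(1) unfolding morrey_def Let_def by (simp split: if_splits)
  then show ?thesis by (simp add: eq)
qed

lemma morrey_ball_bound:
  fixes w :: "'a::euclidean_space set"
  assumes "morrey q p w V" "p < DIM('a) \<or> p = DIM('a)"
  obtains M where "M >= 0"
    "!!y r. y \<in> w ==> 0 < r ==> r < diameter w ==> (if p < DIM('a) then r powr (- real DIM('a) / (q / (q - 1))) else ln (diameter w / r) powr (q / (real DIM('a) / (real DIM('a) - 1)))) * (LINT x|(lebesgue_on (w \<inter> ball y r)). \<bar>V x\<bar>) <= M"
proof -
  define h where "h r = (if p < DIM('a) then r powr (- real DIM('a) / (q / (q - 1))) else ln (diameter w / r) powr (q / (real DIM('a) / (real DIM('a) - 1))))" for r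
  have "bdd_above {h r * (LINT x|(lebesgue_on (w \<inter> ball y r)). \<bar>V x\<bar>) | y r. y \<in> w \<and> 0 < r \<and> r < diameter w}"
    using assms unfolding morrey_def Let_def h_def by (auto split: if_splits)
  then obtain M where M: "!!z. z \<in> {h r * (LINT x|(lebesgue_on (w \<inter> ball y r)). \<bar>V x\<bar>) | y r. y \<in> w \<and> 0 < r \<and> r < diameter w} ==> z <= M"
    unfolding bdd_above_def by blast
  show ?thesis
  proof (rule that[of "\<bar>M\<bar>"])
    fix y r assume "y \<in> w" "0 < r" "r < diameter w"
    then have "h r * (LINT x|(lebesgue_on (w \<inter> ball y r)). \<bar>V x\<bar>) <= M" by (intro M) blast
    then show "(if p < DIM('a) then r powr (- real DIM('a) / (q / (q - 1))) else ln (diameter w / r) powr (q / (real DIM('a) / (real DIM('a) - 1)))) * (LINT x|(lebesgue_on (w \<inter> ball y r)). \<bar>V x\<bar>) <= \<bar>M\<bar>"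
      unfolding h_def by linarith
  qed simp
qed

text \<open>A small cell meeting \<open>w\<close> lies in a ball centred in \<open>w\<close>, where
  the Morrey condition applies. The factor \<open>(2^j) powr (p - n)\<close> is the natural scaling,
  so \<open>d\<close> measures the gain: a positive power of the scale for p < n, the plain total
  mass for p > n, a power of \<open>j\<close> for p = n.\<close>

lemma morrey_cell_bound:
  fixes w :: "'a::euclidean_space set"
  assumes n: "DIM('a) >= 2" and p: "1 < p" and V: "morrey q p w V" and w: "open w" "bounded w" "w ~= {}"
  obtains j1 d where "admissible_decay p j1 d"
    "!!j x. j >= j1 ==> (LINT y|(lebesgue_on w). indicator (cell j x) y * \<bar>V y\<bar>) <= (2^j) powr (p - DIM('a)) * d j"
proof -
  let ?n = "real DIM('a)"
  have Vi: "integrable (lebesgue_on w) (%y. \<bar>V y\<bar>)" using morrey_integrable[OF V w(2,3)] by auto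
  have ws: "w \<in> sets lebesgue" using w by auto
  define D where "D = diameter w"
  have D: "D > 0"
  proof -
    obtain y e where "e > 0" "ball y e \<subseteq> w" using w by (meson ex_in_conv open_contains_ball)
    then have "diameter (ball y e) <= D" unfolding D_def using w by (intro diameter_subset) auto
    then show ?thesis using \<open>e > 0\<close> by (simp add: diameter_ball)
  qed
  \<comment> \<open>Twice the diameter bound of a cell, so that a cell fits into an open ball around
    any of its points.\<close>
  define R where "R j = 2 * ?n / 2^j" for j
  have R0: "R j > 0" for j unfolding R_def using n by simp
  have "R ----> 0" unfolding R_def using LIMSEQ_divide_realpow_zero[of 2 "2 * ?n"] by simp
  have cellint: "integrable (lebesgue_on w) (%y. indicator A y * \<bar>V y\<bar>)" if "A \<in> sets borel" for A
  proof (rule Bochner_Integration.integrable_bound[OF Vi])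
    have "A \<inter> w \<in> sets (lebesgue_on w)" using that ws by (auto simp: sets_restrict_space)
    then have "indicator (A \<inter> w) \<in> borel_measurable (lebesgue_on w)" by (rule borel_measurable_indicator)
    then have "(indicator A :: 'a => real) \<in> borel_measurable (lebesgue_on w)"
      by (rule measurable_cong[THEN iffD1, rotated]) (auto split: split_indicator simp: space_restrict_space)
    then show "(%y. indicator A y * \<bar>V y\<bar>) \<in> borel_measurable (lebesgue_on w)" using Vi by measurable
  qed (auto split: split_indicator)
  have ball: "(LINT y|(lebesgue_on w). indicator (cell j x) y * \<bar>V y\<bar>) <= B"
    if "!!y. y \<in> w ==> (LINT x|(lebesgue_on (w \<inter> ball y (R j))). \<bar>V x\<bar>) <= B" "B >= 0" for j x B
  proof (cases "w \<inter> cell j x = {}")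
    case True
    then have "(LINT y|(lebesgue_on w). indicator (cell j x) y * \<bar>V y\<bar>) = (LINT y|(lebesgue_on w). 0)"
      by (intro Bochner_Integration.integral_cong) (auto split: split_indicator simp: space_restrict_space)
    then show ?thesis using that by simp
  next
    case False
    then obtain y where y: "y \<in> w" "y \<in> cell j x" by auto
    have sub: "cell j x \<subseteq> ball y (R j)"
    proof
      fix z assume "z \<in> cell j x"
      then have "norm (z - y) <= ?n / 2^j" using cell_norm_diff[of z j y] cell_eq[OF y(2)] by simp
      also have "... < R j" unfolding R_def using n by (simp add: divide_strict_right_mono)
      finally show "z \<in> ball y (R j)" by (simp add: dist_norm norm_minus_commute)
    qed
    have "(LINT y|(lebesgue_on w). indicator (cell j x) y * \<bar>V y\<bar>) <= (LINT z|(lebesgue_on w). indicator (ball y (R j)) z * \<bar>V z\<bar>)"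
      by (intro integral_mono cellint mult_right_mono) (use sub in \<open>auto split: split_indicator\<close>)
    also have "... = (LINT x|(lebesgue_on (w \<inter> ball y (R j))). \<bar>V x\<bar>)"
    proof -
      have b: "w \<inter> ball y (R j) \<in> sets lebesgue" using w by auto
      show ?thesis using integral_restrict_space[of w lebesgue "%z. indicator (ball y (R j)) z * \<bar>V z\<bar>"] ws b
         integral_restrict_space[of "w \<inter> ball y (R j)" lebesgue "%z. \<bar>V z\<bar>"]
        by (simp add: indicator_inter_arith mult.assoc)
    qed
    also have "... <= B" by (rule that(1)[OF y(1)])
    finally show ?thesis .
  qed
  have two: "(2^j) powr a = (2 powr a)^j" for a :: real and j :: nat
    by (simp add: powr_realpow[symmetric] powr_powr mult.commute)
  consider (lt) "p < ?n" | (eq) "p = ?n" | (gt) "p > ?n" by linarith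
  then show ?thesis
  proof cases
    case lt
    then have q: "q > ?n / p" using V unfolding morrey_def Let_def by (simp split: if_splits)
    have "?n / p > 1" using lt p by simp
    then have q1: "q > 1" using q by linarith
    define s where "s = ?n / (q / (q - 1))"
    have s: "s = ?n - ?n / q" unfolding s_def using q1 by (simp add: field_simps)
    have "?n / q < p" using q q1 p by (simp add: field_simps)
    \<comment> \<open>Equal to \<open>p - n / q\<close>, with n the dimension; its positivity is
      exactly the condition \<open>q > n / p\<close>.\<close>
    define \<gamma> where "\<gamma> = s + p - ?n"
    have \<gamma>: "\<gamma> > 0" unfolding \<gamma>_def s using \<open>?n / q < p\<close> by simp
    obtain M where M: "M >= 0" "!!y r. y \<in> w ==> 0 < r ==> r < D ==> r powr (- s) * (LINT x|(lebesgue_on (w \<inter> ball y r)). \<bar>V x\<bar>) <= M"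
      by (rule morrey_ball_bound[OF V disjI1[OF lt]]) (use lt in \<open>simp add: D_def s_def\<close>)
    have "\<forall>\<^sub>F j in sequentially. R j < D" using order_tendstoD(2)[OF \<open>R ----> 0\<close> D] .
    then obtain j1 where j1: "!!j. j >= j1 ==> R j < D" by (auto simp: eventually_sequentially)
    define rho where "rho = 2 powr (- \<gamma> / 2)"
    have rho: "0 < rho" "rho < 1" unfolding rho_def using \<gamma> powr_less_mono[of "- \<gamma> / 2" 0 2] by auto
    have rho2: "rho^2 = 2 powr (- \<gamma>)" unfolding rho_def by (simp add: power2_eq_square powr_add[symmetric])
    define d where "d j = M * (2 * ?n) powr s * (rho^2)^j" for j
    show ?thesis
    proof (rule that[of j1 d])
      show "admissible_decay p j1 d"
        by (rule admissible_decay_geometricI[OF _ rho, of _ _ "M * (2 * ?n) powr s"]) (use M(1) in \<open>auto simp: d_def\<close>)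
      fix j x assume j: "j >= j1"
      show "(LINT y|(lebesgue_on w). indicator (cell j x) y * \<bar>V y\<bar>) <= (2^j) powr (p - ?n) * d j"
      proof (rule ball)
        fix y assume y: "y \<in> w"
        have "R j powr (- s) * (LINT x|(lebesgue_on (w \<inter> ball y (R j))). \<bar>V x\<bar>) <= M" by (rule M(2)[OF y R0 j1[OF j]])
        then have "(LINT x|(lebesgue_on (w \<inter> ball y (R j))). \<bar>V x\<bar>) <= M * R j powr s"
          using R0[of j] by (simp add: powr_minus field_simps)
        also have "R j powr s = (2 * ?n) powr s / (2^j) powr s"
          unfolding R_def by (simp add: powr_divide)
        also have "... = (2 * ?n) powr s * (2 powr (- s))^j"
          unfolding two by (simp add: powr_minus power_inverse divide_inverse)
        also have "2 powr (- s) = 2 powr (p - ?n) * rho^2" unfolding rho2 \<gamma>_def by (simp add: powr_add[symmetric])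
        finally show "(LINT x|(lebesgue_on (w \<inter> ball y (R j))). \<bar>V x\<bar>) <= (2^j) powr (p - ?n) * d j"
          unfolding d_def two by (simp add: power_mult_distrib mult_ac)
      qed (use M(1) in \<open>auto simp: d_def\<close>)
    qed
  next
    case gt
    define rho where "rho = 2 powr (- (p - ?n) / 2)"
    have rho: "0 < rho" "rho < 1" unfolding rho_def using gt powr_less_mono[of "- (p - ?n) / 2" 0 2] by auto
    have "- t / 2 + - t / 2 = - t" for t :: real by simp
    from this[of "p - ?n"] have rho2: "rho^2 = 2 powr (- (p - ?n))" unfolding rho_def power2_eq_square powr_add[symmetric] by (rule arg_cong)
    define M where "M = (LINT y|(lebesgue_on w). \<bar>V y\<bar>)"
    have M: "M >= 0" unfolding M_def by (auto intro: integral_nonneg_AE)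
    show ?thesis
    proof (rule that[of 0 "%j. M * (rho^2)^j"])
      show "admissible_decay p 0 (%j. M * (rho^2)^j)"
        by (rule admissible_decay_geometricI[OF _ rho, of _ _ M]) (use M in auto)
      fix j x
      have "(LINT y|(lebesgue_on w). indicator (cell j x) y * \<bar>V y\<bar>) <= M"
        unfolding M_def by (intro integral_mono cellint Vi) (auto split: split_indicator)
      also have "M = (2^j) powr (p - ?n) * (M * (rho^2)^j)"
        unfolding two rho2 by (simp add: power_mult_distrib[symmetric] powr_add[symmetric])
      finally show "(LINT y|(lebesgue_on w). indicator (cell j x) y * \<bar>V y\<bar>) <= (2^j) powr (p - ?n) * (M * (rho^2)^j)" .
    qed
  next
    case eq
    then have q: "q > ?n" using V unfolding morrey_def Let_def by (simp split: if_splits)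
    \<comment> \<open>The exponent of the logarithm. The root of \<open>d j\<close> behaves like
      \<open>j powr (- q / n)\<close>, which is summable exactly because
      \<open>q > n\<close>.\<close>
    define \<beta> where "\<beta> = q / (?n / (?n - 1))"
    have \<beta>: "\<beta> / (p - 1) = q / ?n" "\<beta> > 0" unfolding \<beta>_def eq using n q by (auto simp: field_simps)
    obtain M where M: "M >= 0" "!!y r. y \<in> w ==> 0 < r ==> r < D ==> ln (D / r) powr \<beta> * (LINT x|(lebesgue_on (w \<inter> ball y r)). \<bar>V x\<bar>) <= M"
      by (rule morrey_ball_bound[OF V disjI2[OF eq]]) (use eq in \<open>simp add: D_def \<beta>_def\<close>)
    \<comment> \<open>The logarithm of \<open>D / R j\<close> grows with slope \<open>ln 2\<close>;
      half of this slope absorbs the additive constant once \<open>j\<close> is large.\<close>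
    define e where "e = ln 2 / (2::real)"
    have e: "e > 0" unfolding e_def by simp
    have ev: "\<forall>\<^sub>F j in sequentially. R j < D \<and> real j >= 1 \<and> ln (D / R j) >= e * real j"
    proof -
      have "\<forall>\<^sub>F j in sequentially. real j >= max 1 (- ln (D / (2 * ?n)) / e)"
        using filterlim_real_sequentially unfolding filterlim_at_top by blast
      moreover have "\<forall>\<^sub>F j in sequentially. R j < D" using order_tendstoD(2)[OF \<open>R ----> 0\<close> D] .
      ultimately show ?thesis
      proof eventually_elim
        case (elim j)
        have "D / R j = D / (2 * ?n) * 2^j" unfolding R_def by simp
        then have "ln (D / R j) = ln (D / (2 * ?n) * 2^j)" by simp
        also have "... = ln (D / (2 * ?n)) + ln (2^j)" by (rule ln_mult_pos) (use D n in auto)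
        finally have "ln (D / R j) = ln (D / (2 * ?n)) + real j * ln 2" by (simp add: ln_realpow)
        moreover have "- ln (D / (2 * ?n)) <= e * real j" using elim e by (simp add: field_simps)
        moreover have "real j * ln 2 = e * real j + e * real j" unfolding e_def by (simp add: field_simps)
        ultimately have "ln (D / R j) >= e * real j" by linarith
        then show ?case using elim by simp
      qed
    qed
    then obtain j1 where j1: "!!j. j >= j1 ==> R j < D \<and> real j >= 1 \<and> ln (D / R j) >= e * real j"
      by (auto simp: eventually_sequentially)
    define d where "d j = M * (e * real j) powr (- \<beta>)" for j
    show ?thesis
    proof (rule that[of j1 d])
      have "d j powr (1 / (p - 1)) = (M powr (1 / (p - 1)) * e powr (- (q / ?n))) * real j powr (- (q / ?n))" for j
      proof -
        have "- \<beta> * (1 / (p - 1)) = - (q / ?n)" using \<beta>(1) by simp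
        then show ?thesis unfolding d_def using M(1) e by (simp add: powr_mult powr_powr)
      qed
      moreover have "summable (%j. real j powr (- (q / ?n)))"
        using q n by (simp add: summable_real_powr_iff)
      ultimately have "summable (%j. d j powr (1 / (p - 1)))" by (simp add: summable_mult)
      then show "admissible_decay p j1 d"
        unfolding admissible_decay_def using M(1) eq n by (auto simp: d_def)
      fix j x assume j: "j >= j1"
      note jj = j1[OF j]
      show "(LINT y|(lebesgue_on w). indicator (cell j x) y * \<bar>V y\<bar>) <= (2^j) powr (p - ?n) * d j"
      proof (rule ball)
        fix y assume y: "y \<in> w"
        have ej: "e * real j > 0" using e jj by simp
        have "(e * real j) powr \<beta> * (LINT x|(lebesgue_on (w \<inter> ball y (R j))). \<bar>V x\<bar>)
           <= ln (D / R j) powr \<beta> * (LINT x|(lebesgue_on (w \<inter> ball y (R j))). \<bar>V x\<bar>)"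
          using ej jj \<beta> by (intro mult_right_mono powr_mono2 integral_nonneg_AE) auto
        also have "... <= M" by (rule M(2)[OF y R0]) (use jj in auto)
        finally have "(LINT x|(lebesgue_on (w \<inter> ball y (R j))). \<bar>V x\<bar>) <= d j"
        proof -
          assume le: "(e * real j) powr \<beta> * (LINT x|(lebesgue_on (w \<inter> ball y (R j))). \<bar>V x\<bar>) <= M"
          have "(e * real j) powr \<beta> > 0" using ej less_irrefl powr_gt_zero by metis
          then show ?thesis
            using le unfolding d_def powr_minus divide_inverse[symmetric] by (simp only: pos_le_divide_eq mult.commute)
        qed
        then show "(LINT x|(lebesgue_on (w \<inter> ball y (R j))). \<bar>V x\<bar>) <= (2^j) powr (p - ?n) * d j" by (simp add: eq)
      qed (use M(1) in \<open>auto simp: d_def\<close>)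
    qed
  qed
qed

text \<open>Bounded truncations of the potential satisfy the weighted inequality with common
  constants, and Fatou's lemma removes the truncation.\<close>

lemma morrey_adams:
  fixes w :: "'a::euclidean_space set"
  assumes n: "DIM('a) >= 2" and p: "1 < p" and V: "morrey q p w V" and w: "open w" "bounded w" "w ~= {}"
    and "\<delta> > 0"
  obtains C where "C >= 0" and "!!phi. test_fun w phi ==> integrable (lebesgue_on w) (%x. \<bar>V x\<bar> * \<bar>phi x\<bar> powr p)"
    and "!!phi. test_fun w phi ==> (LINT x|(lebesgue_on w). \<bar>V x\<bar> * \<bar>phi x\<bar> powr p)
      <= \<delta> * (LINT x|(lebesgue_on w). norm (grad phi x) powr p) + C * (LINT x|(lebesgue_on w). \<bar>phi x\<bar> powr p)"
proof -
  let ?n = "real DIM('a)"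
  have ws: "w \<in> sets lebesgue" using w by auto
  have Vi: "integrable (lebesgue_on w) (%y. \<bar>V y\<bar>)" using morrey_integrable[OF V w(2,3)] by auto
  obtain j1 d where dec: "admissible_decay p j1 d"
    and cb: "!!j x. j >= j1 ==> (LINT y|(lebesgue_on w). indicator (cell j x) y * \<bar>V y\<bar>) <= (2^j) powr (p - ?n) * d j"
    by (rule morrey_cell_bound[OF n p V w]) blast
  obtain C where C: "C >= 0" and est: "!!U phi. bdd_supp U ==> (!!x. U x >= 0) ==>
      (!!j x. j >= j1 ==> cell_avg j U x <= (2^j) powr p * d j) ==> test_fun w phi ==>
     (LINT x|lborel. U x * \<bar>phi x\<bar> powr p) <= \<delta> * (LINT x|lborel. norm (grad phi x) powr p) + C * (LINT x|lborel. \<bar>phi x\<bar> powr p)"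
    by (rule bounded_weight_inequality[OF p dec \<open>\<delta> > 0\<close>, of w]) blast
  have Wi: "integrable lebesgue (%x. indicator w x * \<bar>V x\<bar>)"
    using integrable_restrict_space[of w lebesgue "%x. \<bar>V x\<bar>"] ws Vi by simp
  then have "(%x. indicator w x * \<bar>V x\<bar>) \<in> borel_measurable lebesgue" by (rule borel_measurable_integrable)
  \<comment> \<open>The potential is only Lebesgue measurable, while averages are taken of Borel
    functions; hence a Borel representative, made nonnegative and cut off outside \<open>w\<close>
    below.\<close>
  then obtain W' where W': "W' \<in> borel_measurable lborel" "AE x in lborel. indicator w x * \<bar>V x\<bar> = W' x"
    by (rule bexE[OF completion_ex_borel_measurable_real])
  have [measurable]: "W' \<in> borel_measurable borel" using W'(1) by simp
  have [measurable]: "w \<in> sets borel" using w by auto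
  define W where "W x = indicator w x * max 0 (W' x)" for x
  have Wm [measurable]: "W \<in> borel_measurable borel" unfolding W_def by measurable
  have W0: "W x >= 0" for x by (auto simp: W_def)
  have Wae: "AE x in lborel. indicator w x * \<bar>V x\<bar> = W x"
    using W'(2) by eventually_elim (auto simp: W_def max_def split: split_indicator_asm split_indicator)
  then have Wae': "AE x in lebesgue. indicator w x * \<bar>V x\<bar> = W x" by (rule AE_completion)
  have Wint: "integrable lborel W"
  proof -
    have "W \<in> borel_measurable lebesgue" by (rule measurable_completion) simp
    then have "integrable lebesgue W" by (rule integrable_cong_AE_imp[OF Wi _ Wae'])
    then show ?thesis using integrable_completion[of W lborel] by simp
  qed
  have Wcell: "(LINT y|lborel. indicator (cell j x) y * W y) <= (2^j) powr (p - ?n) * d j" if "j >= j1" for j x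
  proof -
    have "(LINT y|lborel. indicator (cell j x) y * W y) = (LINT y|lebesgue. indicator (cell j x) y * W y)"
      by (rule integral_completion[symmetric]) measurable
    also have "... = (LINT y|lebesgue. indicator w y * (indicator (cell j x) y * \<bar>V y\<bar>))"
    proof (rule integral_cong_AE)
      have c: "indicator (cell j x) \<in> borel_measurable lebesgue"
        by (rule measurable_completion) measurable
      show "(%y. indicator (cell j x) y * W y) \<in> borel_measurable lebesgue"
        by (rule measurable_completion) measurable
      have "(%y. indicator (cell j x) y * (indicator w y * \<bar>V y\<bar>)) \<in> borel_measurable lebesgue"
        using c borel_measurable_integrable[OF Wi] by (rule borel_measurable_times)
      then show "(%y. indicator w y * (indicator (cell j x) y * \<bar>V y\<bar>)) \<in> borel_measurable lebesgue"
        by (simp add: mult.left_commute)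
      show "AE y in lebesgue. indicator (cell j x) y * W y = indicator w y * (indicator (cell j x) y * \<bar>V y\<bar>)"
        using Wae' by eventually_elim (simp add: mult.left_commute)
    qed
    also have "... = (LINT y|(lebesgue_on w). indicator (cell j x) y * \<bar>V y\<bar>)"
      using integral_restrict_space[of w lebesgue "%y. indicator (cell j x) y * \<bar>V y\<bar>"] ws by simp
    finally show ?thesis using cb[OF that] by simp
  qed
  \<comment> \<open>Truncation makes the weight bounded and keeps the cell bounds, since
    \<open>U m <= W\<close>.\<close>
  define U where "U m x = min (W x) (real m)" for m :: nat and x
  have Us: "bdd_supp (U m)" for m
  proof -
    obtain R where R: "!!x. x \<in> w ==> norm x <= R" using w(2) by (auto simp: bounded_iff)
    have "U m x ~= 0 --> norm x <= R" for x using R[of x] by (auto simp: U_def W_def split: split_indicator)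
    moreover have "\<bar>U m x\<bar> <= real m" for x using W0[of x] by (auto simp: U_def)
    moreover have "U m \<in> borel_measurable borel" unfolding U_def by measurable
    ultimately show ?thesis unfolding bdd_supp_def bdd_borel_def by blast
  qed
  have U0: "U m x >= 0" for m x using W0[of x] by (auto simp: U_def)
  have UE: "cell_avg j (U m) x <= (2^j) powr p * d j" if "j >= j1" for j m x
  proof -
    have "(LINT y|lborel. indicator (cell j x) y * U m y) <= (LINT y|lborel. indicator (cell j x) y * W y)"
    proof (rule integral_mono)
      show "integrable lborel (%y. indicator (cell j x) y * U m y)" by (rule cell_integrable[OF bdd_supp_bdd_borel[OF Us]])
      show "integrable lborel (%y. indicator (cell j x) y * W y)"
        by (rule Bochner_Integration.integrable_bound[OF Wint]) (auto split: split_indicator)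
      show "indicator (cell j x) y * U m y <= indicator (cell j x) y * W y" for y
        by (rule mult_left_mono) (auto simp: U_def)
    qed
    then have "cell_avg j (U m) x <= (2^j)^DIM('a) * ((2^j) powr (p - ?n) * d j)"
      unfolding cell_avg_def using Wcell[OF that, of x] by (intro mult_left_mono) auto
    also have "(2^j)^DIM('a) = (2^j::real) powr ?n" by (rule powr_realpow[symmetric]) simp
    also have "(2^j) powr ?n * ((2^j) powr (p - ?n) * d j) = (2^j) powr p * d j"
      by (simp add: mult.assoc[symmetric] powr_add[symmetric])
    finally show ?thesis .
  qed
  have main: "integrable (lebesgue_on w) (%x. \<bar>V x\<bar> * \<bar>phi x\<bar> powr p) \<and>
      (LINT x|(lebesgue_on w). \<bar>V x\<bar> * \<bar>phi x\<bar> powr p)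
      <= \<delta> * (LINT x|(lebesgue_on w). norm (grad phi x) powr p) + C * (LINT x|(lebesgue_on w). \<bar>phi x\<bar> powr p)"
    if phi: "test_fun w phi" for phi
  proof -
    have sp: "bdd_supp phi" "bdd_supp (%x. norm (grad phi x))" using test_fun_bdd_supp[OF phi] by auto
    have [measurable]: "phi \<in> borel_measurable borel" "(%x. norm (grad phi x)) \<in> borel_measurable borel" using sp by (simp_all add: bdd_supp_measurable)
    define B where "B = \<delta> * (LINT x|lborel. norm (grad phi x) powr p) + C * (LINT x|lborel. \<bar>phi x\<bar> powr p)"
    have lim: "(%m. U m x * \<bar>phi x\<bar> powr p) ----> W x * \<bar>phi x\<bar> powr p" for x
    proof -
      obtain N :: nat where N: "W x <= real N" using real_arch_simple by blast
      have "\<forall>\<^sub>F m in sequentially. W x * \<bar>phi x\<bar> powr p = U m x * \<bar>phi x\<bar> powr p"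
        using eventually_ge_at_top[of N] by eventually_elim (use N in \<open>auto simp: U_def\<close>)
      then show ?thesis by (rule Lim_transform_eventually[OF tendsto_const])
    qed
    have Ui: "integrable lborel (%x. U m x * \<bar>phi x\<bar> powr p)" for m
      by (intro bdd_supp_integrable bdd_supp_mult Us bdd_borel_powr bdd_supp_bdd_borel sp) (use p in auto)
    have fi: "integrable lborel (%x. W x * \<bar>phi x\<bar> powr p)" "(LINT x|lborel. W x * \<bar>phi x\<bar> powr p) <= B"
    proof -
      have nn: "U m x * \<bar>phi x\<bar> powr p >= 0" for m x using U0[of m x] by simp
      have l: "AE x in lborel. (%m. U m x * \<bar>phi x\<bar> powr p) ----> W x * \<bar>phi x\<bar> powr p" using lim by (intro AE_I2)
      have mW: "(%x. W x * \<bar>phi x\<bar> powr p) \<in> borel_measurable lborel" by measurable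
      have leB: "(LINT x|lborel. U m x * \<bar>phi x\<bar> powr p) <= B" for m unfolding B_def by (rule est[OF Us U0 UE phi])
      show "integrable lborel (%x. W x * \<bar>phi x\<bar> powr p)" by (rule fatou_integrable(1)[OF Ui nn l mW leB])
      show "(LINT x|lborel. W x * \<bar>phi x\<bar> powr p) <= B" by (rule fatou_integrable(2)[OF Ui nn l mW leB])
    qed
    have ae: "AE x in lebesgue_on w. W x * \<bar>phi x\<bar> powr p = \<bar>V x\<bar> * \<bar>phi x\<bar> powr p"
    proof -
      have "w \<inter> space lebesgue \<in> sets lebesgue" using ws by simp
      from AE_restrict_space_iff[OF this] show ?thesis
        using Wae' by (simp only:, elim eventually_mono) auto
    qed
    have wz: "W x * \<bar>phi x\<bar> powr p = 0" if "x \<notin> w" for x using that by (simp add: W_def)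
    have gz: "norm (grad phi x) powr p = 0" "\<bar>phi x\<bar> powr p = 0" if "x \<notin> w" for x
      using test_fun_outside[OF phi that] by auto
    have i1: "integrable (lebesgue_on w) (%x. W x * \<bar>phi x\<bar> powr p)"
      using lebesgue_on_lborel(1)[OF w(1) _ wz] fi(1) by simp
    have Vm: "(%x. \<bar>V x\<bar> * \<bar>phi x\<bar> powr p) \<in> borel_measurable (lebesgue_on w)"
    proof -
      have "(%x. \<bar>phi x\<bar> powr p) \<in> borel_measurable (lebesgue_on w)"
        by (intro measurable_restrict_space1 measurable_completion) measurable
      then show ?thesis using Vi by measurable
    qed
    have "integrable (lebesgue_on w) (%x. \<bar>V x\<bar> * \<bar>phi x\<bar> powr p)"
      by (rule integrable_cong_AE_imp[OF i1 Vm ae])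
    moreover have "(LINT x|(lebesgue_on w). \<bar>V x\<bar> * \<bar>phi x\<bar> powr p) = (LINT x|(lebesgue_on w). W x * \<bar>phi x\<bar> powr p)"
      by (rule integral_cong_AE) (use ae Vm i1 in auto)
    ultimately show ?thesis
      using fi(2) lebesgue_on_lborel(2)[OF w(1) _ wz] lebesgue_on_lborel(2)[OF w(1) _ gz(1)] lebesgue_on_lborel(2)[OF w(1) _ gz(2)]
      by (simp add: B_def)
  qed
  show ?thesis by (rule that[OF C]) (use main in blast)+
qed

section \<open>Elementary inequalities for powers and convergence of p-th power integrals\<close>

lemma powr_add_le:
  fixes x y p :: real
  assumes "x >= 0" "y >= 0" "p >= 0"
  shows "(x + y) powr p <= 2 powr p * (x powr p + y powr p)"
proof -
  have "(x + y) powr p <= (2 * max x y) powr p" using assms by (intro powr_mono2) auto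
  also have "... = 2 powr p * max x y powr p" by (rule powr_mult)
  also have "... <= 2 powr p * (x powr p + y powr p)" by (intro mult_left_mono) (auto simp: max_def)
  finally show ?thesis .
qed

text \<open>A mean value estimate obtained from the tangent inequality in both directions.\<close>

lemma powr_diff_abs_le:
  fixes a b p :: real
  assumes "a >= 0" "b >= 0" "p >= 1"
  shows "\<bar>a powr p - b powr p\<bar> <= p * (a + b) powr (p - 1) * \<bar>a - b\<bar>"
proof -
  have *: "x powr p - y powr p <= p * (x + y) powr (p - 1) * \<bar>x - y\<bar>" if "x >= 0" "y >= 0" for x y
  proof -
    have "x powr p - y powr p <= p * x powr (p - 1) * (x - y)"
      using powr_above_tangent[of p x y] assms that by (simp add: algebra_simps)
    also have "... <= p * x powr (p - 1) * \<bar>x - y\<bar>" using assms by (intro mult_left_mono) auto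
    also have "... <= p * (x + y) powr (p - 1) * \<bar>x - y\<bar>"
      using assms that by (intro mult_right_mono mult_left_mono powr_mono2) auto
    finally show ?thesis .
  qed
  show ?thesis using *[OF assms(1,2)] *[OF assms(2,1)] by (simp add: abs_le_iff add.commute abs_minus_commute)
qed

lemma conj_exponent:
  fixes p :: real assumes "p > 1" shows "p / (p - 1) > 1" "1 / p + 1 / (p / (p - 1)) = 1" "(p - 1) * (p / (p - 1)) = p"
  using assms by (auto simp: field_simps)

lemma holder_tendsto_0:
  fixes f :: "nat => 'b => real"
  assumes p: "p > 1" and f: "!!k. f k \<in> borel_measurable M" "!!k x. f k x >= 0" "!!k. integrable M (%x. f k x powr p)"
    and lim: "(%k. \<integral>x. f k x powr p \<partial>M) ----> 0"
    and g: "!!k. g k \<in> borel_measurable M" "!!k x. g k x >= 0" "!!k. integrable M (%x. g k x powr (p / (p - 1)))"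
      "!!k. (LINT x|M. g k x powr (p / (p - 1))) <= B"
  shows "!!k. integrable M (%x. f k x * g k x)" "(%k. \<integral>x. f k x * g k x \<partial>M) ----> 0"
proof -
  note h = holder_integral[OF p conj_exponent(1,2)[OF p] f(1) g(1) f(2) g(2) f(3) g(3)]
  show "integrable M (%x. f k x * g k x)" for k by (rule h(1))
  let ?s = "1 / (p / (p - 1))"
  have s: "?s >= 0" using p by simp
  have "(%k. (LINT x|M. f k x powr p) powr (1/p) * B powr ?s) ----> 0 powr (1/p) * B powr ?s"
    using p by (intro tendsto_mult tendsto_const tendsto_powr2 lim) (auto intro!: always_eventually integral_nonneg_AE)
  then have up: "(%k. (LINT x|M. f k x powr p) powr (1/p) * B powr ?s) ----> 0" by simp
  show "(%k. \<integral>x. f k x * g k x \<partial>M) ----> 0"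
  proof (rule tendsto_sandwich[OF _ _ tendsto_const up])
    show "\<forall>\<^sub>F k in sequentially. 0 <= (LINT x|M. f k x * g k x)"
      using f(2) g(2) by (intro always_eventually allI integral_nonneg_AE AE_I2 mult_nonneg_nonneg) auto
    show "\<forall>\<^sub>F k in sequentially. (LINT x|M. f k x * g k x) <= (LINT x|M. f k x powr p) powr (1/p) * B powr ?s"
    proof (intro always_eventually allI)
      fix k
      have "(LINT x|M. g k x powr (p / (p - 1))) powr ?s <= B powr ?s"
        using s g(4)[of k] by (intro powr_mono2 integral_nonneg_AE) auto
      then show "(LINT x|M. f k x * g k x) <= (LINT x|M. f k x powr p) powr (1/p) * B powr ?s"
        using h(2)[of k] by (meson mult_left_mono order_trans powr_ge_zero)
    qed
  qed
qed

text \<open>The majorant \<open>d\<close> of the difference is a separate argument so that the same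
  lemma serves for norms, for \<open>H x\<close> evaluated along a sequence of gradients, and for
  functions weighted by a root of the potential. Hoelder bounds the difference of the powers by
  \<open>d\<close> times a bounded factor.\<close>

lemma Lp_tendsto_integral_powr:
  fixes a :: "nat => 'b => real"
  assumes p: "p > 1" and m: "!!k. a k \<in> borel_measurable M" "b \<in> borel_measurable M" "!!k. d k \<in> borel_measurable M"
    and nn: "!!k x. a k x >= 0" "!!x. b x >= 0" "!!k x. d k x >= 0"
    and le: "!!k. AE x in M. \<bar>a k x - b x\<bar> <= d k x"
    and bi: "integrable M (%x. b x powr p)" and di: "!!k. integrable M (%x. d k x powr p)"
    and lim: "(%k. \<integral>x. d k x powr p \<partial>M) ----> 0"
  shows "!!k. integrable M (%x. a k x powr p)" "(%k. \<integral>x. a k x powr p \<partial>M) ----> (LINT x|M. b x powr p)"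
proof -
  note [measurable] = m
  have ale: "AE x in M. a k x powr p <= 2 powr p * (b x powr p + d k x powr p)" for k
    using le[of k]
  proof eventually_elim
    case (elim x)
    then have "a k x powr p <= (b x + d k x) powr p" using nn p by (intro powr_mono2) auto
    also have "... <= 2 powr p * (b x powr p + d k x powr p)" by (rule powr_add_le) (use nn p in auto)
    finally show ?case .
  qed
  show ai: "integrable M (%x. a k x powr p)" for k
  proof (rule Bochner_Integration.integrable_bound)
    show "integrable M (%x. 2 powr p * (b x powr p + d k x powr p))" using bi di by auto
    show "AE x in M. norm (a k x powr p) <= norm (2 powr p * (b x powr p + d k x powr p))"
      using ale[of k] by eventually_elim auto
  qed measurable
  obtain D where D: "!!k. (LINT x|M. d k x powr p) <= D"
    using convergent_imp_Bseq[OF convergentI[OF lim]] unfolding Bseq_def by fastforce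
  define g where "g k x = (a k x + b x) powr (p - 1)" for k x
  have gs: "g k x powr (p / (p - 1)) = (a k x + b x) powr p" for k x
    unfolding g_def powr_powr conj_exponent(3)[OF p] ..
  have abi: "integrable M (%x. (a k x + b x) powr p)" for k
  proof (rule Bochner_Integration.integrable_bound)
    show "integrable M (%x. 2 powr p * (a k x powr p + b x powr p))" using ai bi by auto
    show "AE x in M. norm ((a k x + b x) powr p) <= norm (2 powr p * (a k x powr p + b x powr p))"
      using powr_add_le[OF nn(1) nn(2)] p by (intro AE_I2) (auto simp: abs_of_nonneg)
  qed measurable
  have "(%k. \<integral>x. d k x * g k x \<partial>M) ----> 0"
  proof (rule holder_tendsto_0(2)[OF p m(3) nn(3) di lim])
    show "g k \<in> borel_measurable M" for k unfolding g_def by measurable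
    show "g k x >= 0" for k x by (simp add: g_def)
    show "integrable M (%x. g k x powr (p / (p - 1)))" for k unfolding gs by (rule abi)
    fix k
    have "(LINT x|M. (a k x + b x) powr p) <= (LINT x|M. 2 powr p * (2 powr p * (b x powr p + d k x powr p) + b x powr p))"
    proof (rule integral_mono_AE[OF abi])
      show "integrable M (%x. 2 powr p * (2 powr p * (b x powr p + d k x powr p) + b x powr p))" using bi di by auto
      show "AE x in M. (a k x + b x) powr p <= 2 powr p * (2 powr p * (b x powr p + d k x powr p) + b x powr p)"
        using ale[of k]
      proof eventually_elim
        case (elim x)
        have "(a k x + b x) powr p <= 2 powr p * (a k x powr p + b x powr p)" by (rule powr_add_le) (use nn p in auto)
        also have "... <= 2 powr p * (2 powr p * (b x powr p + d k x powr p) + b x powr p)"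
          using elim by (intro mult_left_mono add_right_mono) auto
        finally show ?case .
      qed
    qed
    also have "... = 2 powr p * (2 powr p * ((LINT x|M. b x powr p) + (LINT x|M. d k x powr p)) + (LINT x|M. b x powr p))"
      using bi di by simp
    also have "... <= 2 powr p * (2 powr p * ((LINT x|M. b x powr p) + D) + (LINT x|M. b x powr p))"
      using D[of k] by (intro mult_left_mono add_right_mono add_left_mono) auto
    finally show "(LINT x|M. g k x powr (p / (p - 1))) <= 2 powr p * (2 powr p * ((LINT x|M. b x powr p) + D) + (LINT x|M. b x powr p))"
      unfolding gs .
  qed
  then have up: "(%k. p * (LINT x|M. d k x * g k x)) ----> 0" by (rule tendsto_mult_right_zero)
  have [measurable]: "g k \<in> borel_measurable M" for k unfolding g_def by measurable
  have dgi: "integrable M (%x. d k x * g k x)" for k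
    using holder_integral(1)[OF p conj_exponent(1,2)[OF p] m(3) _ nn(3) _ di, of "g k" k] abi[of k] gs[of k] by (simp add: g_def[of k] del: powr_powr)
  have "\<bar>(LINT x|M. a k x powr p) - (LINT x|M. b x powr p)\<bar> <= p * (LINT x|M. d k x * g k x)" for k
  proof -
    have "\<bar>(LINT x|M. a k x powr p) - (LINT x|M. b x powr p)\<bar> = \<bar>\<integral>x. a k x powr p - b x powr p \<partial>M\<bar>" using ai bi by simp
    also have "... <= (LINT x|M. \<bar>a k x powr p - b x powr p\<bar>)" by (rule integral_abs_bound)
    also have "... <= (LINT x|M. p * (d k x * g k x))"
    proof (rule integral_mono_AE)
      show "integrable M (%x. \<bar>a k x powr p - b x powr p\<bar>)" using ai bi by auto
      show "integrable M (%x. p * (d k x * g k x))" using dgi by auto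
      show "AE x in M. \<bar>a k x powr p - b x powr p\<bar> <= p * (d k x * g k x)"
        using le[of k]
      proof eventually_elim
        case (elim x)
        have "\<bar>a k x powr p - b x powr p\<bar> <= p * (a k x + b x) powr (p - 1) * \<bar>a k x - b x\<bar>"
          by (rule powr_diff_abs_le) (use nn p in auto)
        also have "... <= p * (a k x + b x) powr (p - 1) * d k x" using elim p by (intro mult_left_mono) auto
        finally show ?case by (simp add: g_def mult_ac)
      qed
    qed
    finally show ?thesis by simp
  qed
  then have "(%k. (LINT x|M. a k x powr p) - (LINT x|M. b x powr p)) ----> 0"
    by (intro Lim_null_comparison[OF _ up]) auto
  then show "(%k. \<integral>x. a k x powr p \<partial>M) ----> (LINT x|M. b x powr p)" by (simp add: LIM_zero_iff)
qed

text \<open>The known statement for convergence in L^1, applied to the p-th powers.\<close>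

lemma Lp_AE_subseq:
  fixes f :: "nat => 'b => real"
  assumes p: "p > 0" and i: "!!k. integrable M (%x. \<bar>f k x\<bar> powr p)" and lim: "(%k. \<integral>x. \<bar>f k x\<bar> powr p \<partial>M) ----> 0"
  obtains r where "strict_mono r" "AE x in M. (%k. f (r k) x) ----> 0"
proof -
  have "\<exists>r. strict_mono r \<and> (AE x in M. (%k. \<bar>f (r k) x\<bar> powr p) ----> 0)"
    by (rule tendsto_L1_AE_subseq[OF i]) (use lim in simp)
  then obtain r where r: "strict_mono r" "AE x in M. (%k. \<bar>f (r k) x\<bar> powr p) ----> 0" by (elim exE conjE)
  have "AE x in M. (%k. f (r k) x) ----> 0"
    using r(2)
  proof eventually_elim
    case (elim x)
    have "(%k. (\<bar>f (r k) x\<bar> powr p) powr (1/p)) ----> 0 powr (1/p)"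
      using p by (intro tendsto_powr2 elim tendsto_const) auto
    then have "(%k. \<bar>f (r k) x\<bar>) ----> 0" using p by (simp add: powr_powr)
    then show ?case by (rule tendsto_rabs_zero_cancel)
  qed
  then show ?thesis using that r(1) by blast
qed

section \<open>The closure of the test functions\<close>

definition Lp :: "real => 'a::euclidean_space set => ('a => 'b::euclidean_space) => bool" where
  "Lp p w f \<longleftrightarrow> f \<in> borel_measurable (lebesgue_on w) \<and> integrable (lebesgue_on w) (%x. norm (f x) powr p)"

text \<open>The p-th power of the L^p norm. Only convergence and bounds matter, so the triangle
  inequality is replaced by the version with factor \<open>2 powr p\<close>.\<close>

definition Np :: "real => 'a::euclidean_space set => ('a => 'b::euclidean_space) => real" where
  "Np p w f = (LINT x|(lebesgue_on w). norm (f x) powr p)"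

text \<open>The pair \<open>(v, g)\<close> lies in the closure, in L^p times L^p, of the graph of
  the gradient on test functions. Keeping the gradient as a second component makes every closure
  property a statement about pairs.\<close>

definition W0 :: "real => 'a::euclidean_space set => ('a => real) => ('a => 'a) => bool" where
  "W0 p w v g \<longleftrightarrow> Lp p w v \<and> Lp p w g \<and> (\<exists>phi. (\<forall>k. test_fun w (phi k)) \<and>
     (%k. Np p w (%x. phi k x - v x)) ----> 0 \<and> (%k. Np p w (%x. grad (phi k) x - g x)) ----> 0)"

lemma Lp_measurable [measurable_dest]: "Lp p w f ==> f \<in> borel_measurable (lebesgue_on w)"
  by (simp add: Lp_def)

lemma Lp_integrable: "Lp p w f ==> integrable (lebesgue_on w) (%x. norm (f x) powr p)"
  by (simp add: Lp_def)

lemma Np_nonneg: "Np p w f >= 0"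
  unfolding Np_def by (auto intro: integral_nonneg_AE)

lemma Np_diff_commute: "Np p w (%x. f x - g x) = Np p w (%x. g x - f x)"
  by (simp add: Np_def norm_minus_commute)

lemma Lp_bound:
  assumes m: "f \<in> borel_measurable (lebesgue_on w)" and g: "Lp p w g"
    and le: "AE x in lebesgue_on w. norm (f x) <= c * norm (g x)" and "c >= 0" "p >= 0"
  shows "Lp p w f" "Np p w f <= c powr p * Np p w g"
proof -
  have le': "AE x in lebesgue_on w. norm (f x) powr p <= c powr p * norm (g x) powr p"
    using le
  proof eventually_elim
    case (elim x)
    then have "norm (f x) powr p <= (c * norm (g x)) powr p" using assms by (intro powr_mono2) auto
    then show ?case by (simp add: powr_mult)
  qed
  have i: "integrable (lebesgue_on w) (%x. norm (f x) powr p)"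
  proof (rule Bochner_Integration.integrable_bound)
    show "integrable (lebesgue_on w) (%x. c powr p * norm (g x) powr p)" using Lp_integrable[OF g] by auto
    show "(%x. norm (f x) powr p) \<in> borel_measurable (lebesgue_on w)" using m by measurable
    show "AE x in lebesgue_on w. norm (norm (f x) powr p) <= norm (c powr p * norm (g x) powr p)"
      using le' by eventually_elim simp
  qed
  then show "Lp p w f" using m by (simp add: Lp_def)
  have "Np p w f <= (LINT x|(lebesgue_on w). c powr p * norm (g x) powr p)"
    unfolding Np_def by (rule integral_mono_AE[OF i _ le']) (use Lp_integrable[OF g] in auto)
  then show "Np p w f <= c powr p * Np p w g" by (simp add: Np_def)
qed

lemma Lp_add:
  assumes f: "Lp p w f" and g: "Lp p w g" and p: "p >= 0"
  shows "Lp p w (%x. f x + g x)" "Np p w (%x. f x + g x) <= 2 powr p * (Np p w f + Np p w g)"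
proof -
  note [measurable] = Lp_measurable[OF f] Lp_measurable[OF g]
  have le: "norm (f x + g x) powr p <= 2 powr p * (norm (f x) powr p + norm (g x) powr p)" for x
  proof -
    have "norm (f x + g x) powr p <= (norm (f x) + norm (g x)) powr p"
      using p by (intro powr_mono2 norm_triangle_ineq) auto
    also have "... <= 2 powr p * (norm (f x) powr p + norm (g x) powr p)" by (rule powr_add_le) (use p in auto)
    finally show ?thesis .
  qed
  have i2: "integrable (lebesgue_on w) (%x. 2 powr p * (norm (f x) powr p + norm (g x) powr p))"
    using Lp_integrable[OF f] Lp_integrable[OF g] by auto
  have i: "integrable (lebesgue_on w) (%x. norm (f x + g x) powr p)"
    by (rule Bochner_Integration.integrable_bound[OF i2]) (use le in auto)
  then show "Lp p w (%x. f x + g x)" by (simp add: Lp_def)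
  have "Np p w (%x. f x + g x) <= (LINT x|(lebesgue_on w). 2 powr p * (norm (f x) powr p + norm (g x) powr p))"
    unfolding Np_def by (rule integral_mono[OF i i2 le])
  also have "... = 2 powr p * (Np p w f + Np p w g)"
    using Lp_integrable[OF f] Lp_integrable[OF g] by (simp add: Np_def)
  finally show "Np p w (%x. f x + g x) <= 2 powr p * (Np p w f + Np p w g)" .
qed

lemma Lp_scaleR:
  assumes f: "Lp p w f" shows "Lp p w (%x. c *\<^sub>R f x)" "Np p w (%x. c *\<^sub>R f x) = \<bar>c\<bar> powr p * Np p w f"
proof -
  note [measurable] = Lp_measurable[OF f]
  show "Lp p w (%x. c *\<^sub>R f x)" using Lp_integrable[OF f] by (simp add: Lp_def powr_mult)
  show "Np p w (%x. c *\<^sub>R f x) = \<bar>c\<bar> powr p * Np p w f" by (simp add: Np_def powr_mult)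
qed

lemma Lp_mult: "Lp p w f ==> Lp p w (%x. c * f x :: real)"
  using Lp_scaleR(1)[of p w f c] by simp

lemma Np_mult: "Lp p w f ==> Np p w (%x. c * f x :: real) = \<bar>c\<bar> powr p * Np p w f"
  using Lp_scaleR(2)[of p w f c] by simp

lemma Lp_diff:
  assumes f: "Lp p w f" and g: "Lp p w g" and p: "p >= 0"
  shows "Lp p w (%x. f x - g x)" "Np p w (%x. f x - g x) <= 2 powr p * (Np p w f + Np p w g)"
  using Lp_add[OF f Lp_scaleR(1)[OF g, of "-1"] p] Lp_scaleR(2)[OF g, of "-1"] by simp_all

lemma Np_triangle_tendsto:
  assumes p: "p >= 0" and L: "!!k. Lp p w (u k)" "!!k. Lp p w (v k)" "Lp p w f"
    and 1: "(%k. Np p w (%x. u k x - v k x)) ----> 0" and 2: "(%k. Np p w (%x. v k x - f x)) ----> 0"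
  shows "(%k. Np p w (%x. u k x - f x)) ----> 0"
proof (rule tendsto_sandwich[OF _ _ tendsto_const])
  show "\<forall>\<^sub>F k in sequentially. 0 <= Np p w (%x. u k x - f x)" by (simp add: Np_nonneg)
  show "\<forall>\<^sub>F k in sequentially. Np p w (%x. u k x - f x)
     <= 2 powr p * (Np p w (%x. u k x - v k x) + Np p w (%x. v k x - f x))"
  proof (intro always_eventually allI)
    fix k
    show "Np p w (%x. u k x - f x) <= 2 powr p * (Np p w (%x. u k x - v k x) + Np p w (%x. v k x - f x))"
      using Lp_add(2)[OF Lp_diff(1)[OF L(1)[of k] L(2)[of k] p] Lp_diff(1)[OF L(2)[of k] L(3) p] p] by simp
  qed
  show "(%k. 2 powr p * (Np p w (%x. u k x - v k x) + Np p w (%x. v k x - f x))) ----> 0"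
    using tendsto_mult_left[OF tendsto_add[OF 1 2], of "2 powr p"] by simp
qed

lemma Np_tendsto:
  assumes p: "p > 1" and L: "!!k. Lp p w (u k)" "Lp p w f" and lim: "(%k. Np p w (%x. u k x - f x)) ----> 0"
  shows "(%k. Np p w (u k)) ----> Np p w f"
  unfolding Np_def
proof (rule Lp_tendsto_integral_powr(2)[OF p, where d = "%k x. norm (u k x - f x)"])
  note [measurable] = Lp_measurable[OF L(1)] Lp_measurable[OF L(2)]
  show "(%x. norm (u k x)) \<in> borel_measurable (lebesgue_on w)" for k by measurable
  show "(%x. norm (f x)) \<in> borel_measurable (lebesgue_on w)" by measurable
  show "(%x. norm (u k x - f x)) \<in> borel_measurable (lebesgue_on w)" for k by measurable
  show "integrable (lebesgue_on w) (%x. norm (u k x - f x) powr p)" for k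
    by (rule Lp_integrable, rule Lp_diff(1)[OF L]) (use p in simp)
  show "(%k. \<integral>x. norm (u k x - f x) powr p \<partial>lebesgue_on w) ----> 0" using lim by (simp add: Np_def)
qed (use Lp_integrable[OF L(2)] norm_triangle_ineq3 in auto)

locale bounded_open =
  fixes w :: "'a::euclidean_space set" and p :: real
  assumes w_open: "open w" and w_bounded: "bounded w" and p1: "p > 1"
begin

abbreviation "M \<equiv> lebesgue_on w"

lemma p0: "p >= 0" "p > 0" using p1 by auto

lemma w_lmeasurable: "w \<in> lmeasurable"
  using w_open w_bounded by (rule lmeasurable_open[rotated])

lemma finite_M: "finite_measure M"
  by (rule finite_measure_lebesgue_on[OF w_lmeasurable])

lemma borel_M: "f \<in> borel_measurable borel ==> f \<in> borel_measurable M"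
  by (intro measurable_restrict_space1 measurable_completion) simp

lemma bounded_Lp:
  fixes f :: "'a => 'b::euclidean_space"
  assumes "f \<in> borel_measurable M" "AE x in M. norm (f x) <= K"
  shows "Lp p w f"
proof -
  interpret finite_measure M by (rule finite_M)
  have "integrable M (%x. norm (f x) powr p)"
  proof (rule integrable_const_bound[where B = "K powr p"])
    show "AE x in M. norm (norm (f x) powr p) <= K powr p"
      using assms(2) by eventually_elim (auto intro!: powr_mono2 p0)
  qed (use assms in measurable)
  then show ?thesis using assms by (simp add: Lp_def)
qed

lemma test_measurable:
  assumes "test_fun w phi" shows "phi \<in> borel_measurable M" "grad phi \<in> borel_measurable M"
proof -
  have s: "smooth_fun phi" using assms by (rule test_fun_smooth)
  show "phi \<in> borel_measurable M" "grad phi \<in> borel_measurable M"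
    by (intro borel_M borel_measurable_continuous_onI smooth_continuous[OF s] smooth_grad_continuous[OF s])+
qed

lemma test_Lp:
  assumes "test_fun w phi" shows "Lp p w phi" "Lp p w (grad phi)"
proof -
  obtain K where "K > 0" and K: "!!x. \<bar>phi x\<bar> <= K" "!!x. norm (grad phi x) <= K"
    by (rule test_fun_bounded[OF assms]) (rule that)
  show "Lp p w phi" by (rule bounded_Lp[OF test_measurable(1)[OF assms] AE_I2, of K]) (simp add: K)
  show "Lp p w (grad phi)" by (rule bounded_Lp[OF test_measurable(2)[OF assms] AE_I2, of K]) (simp add: K)
qed

lemma W0_Lp: "W0 p w v g ==> Lp p w v" "W0 p w v g ==> Lp p w g"
  by (simp_all add: W0_def)

lemma W0_approx:
  assumes "W0 p w v g"
  obtains phi where "!!k. test_fun w (phi k)" "(%k. Np p w (%x. phi k x - v x)) ----> 0"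
    "(%k. Np p w (%x. grad (phi k) x - g x)) ----> 0"
  using assms unfolding W0_def by (elim conjE exE) (rule that, auto)

lemma W0_test: "test_fun w phi ==> W0 p w phi (grad phi)"
  unfolding W0_def using test_Lp[of phi] by (intro conjI exI[of _ "%_. phi"]) (auto simp: Np_def)

lemma W0_close:
  assumes "W0 p w v g" "e > 0"
  obtains phi where "test_fun w phi" "Np p w (%x. phi x - v x) < e" "Np p w (%x. grad phi x - g x) < e"
proof -
  obtain phi where phi: "!!k. test_fun w (phi k)" "(%k. Np p w (%x. phi k x - v x)) ----> 0"
    "(%k. Np p w (%x. grad (phi k) x - g x)) ----> 0" by (rule W0_approx[OF assms(1)]) (rule that)
  have "\<forall>\<^sub>F k in sequentially. Np p w (%x. phi k x - v x) < e \<and> Np p w (%x. grad (phi k) x - g x) < e"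
    using order_tendstoD(2)[OF phi(2) assms(2)] order_tendstoD(2)[OF phi(3) assms(2)] by eventually_elim auto
  then obtain k where "Np p w (%x. phi k x - v x) < e" "Np p w (%x. grad (phi k) x - g x) < e"
    using eventually_happens'[OF sequentially_bot] by blast
  then show ?thesis using that phi(1) by blast
qed

text \<open>One test function per index with error below \<open>1 / Suc m\<close>; this is the
  diagonal selection behind closedness.\<close>

lemma W0_seq_approx:
  assumes W: "!!m. W0 p w (v m) (g m)"
  obtains phi where "!!m. test_fun w (phi m)" "(%m. Np p w (%x. phi m x - v m x)) ----> 0"
    "(%m. Np p w (%x. grad (phi m) x - g m x)) ----> 0"
proof -
  have "\<forall>m. \<exists>phi. test_fun w phi \<and> Np p w (%x. phi x - v m x) < 1 / real (Suc m) \<and> Np p w (%x. grad phi x - g m x) < 1 / real (Suc m)"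
  proof
    fix m
    show "\<exists>phi. test_fun w phi \<and> Np p w (%x. phi x - v m x) < 1 / real (Suc m) \<and> Np p w (%x. grad phi x - g m x) < 1 / real (Suc m)"
      by (rule W0_close[OF W, of "1 / real (Suc m)"]) auto
  qed
  then obtain phi where phi: "\<forall>m. test_fun w (phi m) \<and> Np p w (%x. phi m x - v m x) < 1 / real (Suc m)
      \<and> Np p w (%x. grad (phi m) x - g m x) < 1 / real (Suc m)"
    by (rule choice[THEN exE])
  have lim: "(%m. 1 / real (Suc m)) ----> 0" using LIMSEQ_inverse_real_of_nat by (simp add: inverse_eq_divide)
  have "(%m. Np p w (%x. phi m x - v m x)) ----> 0"
    by (rule tendsto_sandwich[OF _ _ tendsto_const lim]) (use phi in \<open>auto simp: Np_nonneg less_imp_le\<close>)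
  moreover have "(%m. Np p w (%x. grad (phi m) x - g m x)) ----> 0"
    by (rule tendsto_sandwich[OF _ _ tendsto_const lim]) (use phi in \<open>auto simp: Np_nonneg less_imp_le\<close>)
  ultimately show ?thesis using that[of phi] phi by simp
qed

lemma W0_closed:
  assumes W: "!!m. W0 p w (v m) (g m)" and L: "Lp p w v'" "Lp p w g'"
    and lim: "(%m. Np p w (%x. v m x - v' x)) ----> 0" "(%m. Np p w (%x. g m x - g' x)) ----> 0"
  shows "W0 p w v' g'"
proof -
  obtain phi where phi: "!!m. test_fun w (phi m)" "(%m. Np p w (%x. phi m x - v m x)) ----> 0"
    "(%m. Np p w (%x. grad (phi m) x - g m x)) ----> 0" by (rule W0_seq_approx[OF W]) (rule that)
  have "(%m. Np p w (%x. phi m x - v' x)) ----> 0"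
    by (rule Np_triangle_tendsto[OF p0(1) test_Lp(1)[OF phi(1)] W0_Lp(1)[OF W] L(1) phi(2) lim(1)])
  moreover have "(%m. Np p w (%x. grad (phi m) x - g' x)) ----> 0"
    by (rule Np_triangle_tendsto[OF p0(1) test_Lp(2)[OF phi(1)] W0_Lp(2)[OF W] L(2) phi(3) lim(2)])
  ultimately show ?thesis unfolding W0_def using L phi(1) by auto
qed

lemma Lp_dominated:
  fixes f :: "nat => 'a => 'b::euclidean_space" and F :: "'a => 'c::euclidean_space"
  assumes f: "!!m. Lp p w (f m)" and f': "f' \<in> borel_measurable M" and lf: "AE x in M. (%m. f m x) ----> f' x"
    and F: "Lp p w F" and d: "!!m. AE x in M. norm (f m x) <= norm (F x)"
  shows "Lp p w f' \<and> (%m. Np p w (%x. f m x - f' x)) ----> 0"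
proof -
  note [measurable] = Lp_measurable[OF f] f' Lp_measurable[OF F]
  have dall: "AE x in M. \<forall>m. norm (f m x) <= norm (F x)" using d by (simp add: AE_all_countable)
  have d': "AE x in M. norm (f' x) <= 1 * norm (F x)"
    using dall lf
  proof eventually_elim
    case (elim x)
    have "norm (f' x) <= norm (F x)"
      by (rule LIMSEQ_le_const2[OF tendsto_norm[OF elim(2)]]) (use elim(1) in auto)
    then show ?case by simp
  qed
  have Lf': "Lp p w f'" by (rule Lp_bound(1)[OF f' F d']) (use p0 in auto)
  have "(%m. \<integral>x. norm (f m x - f' x) powr p \<partial>M) ----> (LINT x|M. 0)"
  proof (rule integral_dominated_convergence)
    show "integrable M (%x. 2 powr p * norm (F x) powr p)" using Lp_integrable[OF F] by auto
    show "AE x in M. (%m. norm (f m x - f' x) powr p) ----> 0"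
      using lf
    proof eventually_elim
      case (elim x)
      have "(%m. norm (f m x - f' x)) ----> 0" using elim LIM_zero tendsto_norm_zero by blast
      then have "(%m. norm (f m x - f' x) powr p) ----> 0 powr p"
        by (intro tendsto_powr2 tendsto_const p0) auto
      then show ?case by simp
    qed
    fix m
    show "AE x in M. norm (norm (f m x - f' x) powr p) <= 2 powr p * norm (F x) powr p"
      using dall d'
    proof eventually_elim
      case (elim x)
      have "norm (f m x - f' x) <= norm (f m x) + norm (f' x)" by (rule norm_triangle_ineq4)
      also have "... <= 2 * norm (F x)" using elim(1)[rule_format, of m] elim(2) by simp
      finally have "norm (f m x - f' x) powr p <= (2 * norm (F x)) powr p" by (intro powr_mono2 p0) auto
      then show ?case by (simp add: powr_mult)
    qed
  qed measurable
  then show ?thesis using Lf' by (simp add: Np_def)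
qed

lemma Np_add_tendsto:
  fixes a b :: "nat => 'a => 'b::euclidean_space"
  assumes L: "!!k. Lp p w (a k)" "!!k. Lp p w (b k)" "Lp p w f" "Lp p w h"
    and lim: "(%k. Np p w (%x. a k x - f x)) ----> 0" "(%k. Np p w (%x. b k x - h x)) ----> 0"
  shows "(%k. Np p w (%x. (a k x + b k x) - (f x + h x))) ----> 0"
proof (rule tendsto_sandwich[OF _ _ tendsto_const])
  show "\<forall>\<^sub>F k in sequentially. Np p w (%x. (a k x + b k x) - (f x + h x)) <= 2 powr p * (Np p w (%x. a k x - f x) + Np p w (%x. b k x - h x))"
  proof (intro always_eventually allI)
    fix k
    show "Np p w (%x. (a k x + b k x) - (f x + h x)) <= 2 powr p * (Np p w (%x. a k x - f x) + Np p w (%x. b k x - h x))"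
      using Lp_add(2)[OF Lp_diff(1)[OF L(1)[of k] L(3) p0(1)] Lp_diff(1)[OF L(2)[of k] L(4) p0(1)] p0(1)]
      by (simp add: add_diff_add)
  qed
  show "(%k. 2 powr p * (Np p w (%x. a k x - f x) + Np p w (%x. b k x - h x))) ----> 0"
    using tendsto_mult_left[OF tendsto_add[OF lim], of "2 powr p"] by simp
qed (simp add: Np_nonneg)

lemma Np_tendsto_0:
  assumes "!!k. Np p w (h k) <= c k" "c ----> 0" shows "(%k. Np p w (h k)) ----> 0"
  by (rule tendsto_sandwich[OF _ _ tendsto_const assms(2)]) (use assms(1) in \<open>auto simp: Np_nonneg\<close>)

text \<open>Dominated convergence in L^p for functions and gradients, combined with closedness of
  the graph; it yields the positive part.\<close>

lemma W0_dominated: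
  assumes W: "!!m. W0 p w (v m) (g m)"
    and m: "v' \<in> borel_measurable M" "g' \<in> borel_measurable M"
    and lim: "AE x in M. (%m. v m x) ----> v' x" "AE x in M. (%m. g m x) ----> g' x"
    and dom: "Lp p w V'" "Lp p w G'" "!!m. AE x in M. norm (v m x) <= norm (V' x)" "!!m. AE x in M. norm (g m x) <= norm (G' x)"
  shows "W0 p w v' g'"
proof -
  have 1: "Lp p w v' \<and> (%m. Np p w (%x. v m x - v' x)) ----> 0"
    by (rule Lp_dominated[OF W0_Lp(1)[OF W] m(1) lim(1) dom(1) dom(3)])
  have 2: "Lp p w g' \<and> (%m. Np p w (%x. g m x - g' x)) ----> 0"
    by (rule Lp_dominated[OF W0_Lp(2)[OF W] m(2) lim(2) dom(2) dom(4)])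
  show ?thesis by (rule W0_closed[OF W]) (use 1 2 in auto)
qed

lemma W0_add:
  assumes "W0 p w v g" "W0 p w v' g'"
  shows "W0 p w (%x. v x + v' x) (%x. g x + g' x)"
proof -
  obtain phi where phi: "!!k. test_fun w (phi k)" "(%k. Np p w (%x. phi k x - v x)) ----> 0"
    "(%k. Np p w (%x. grad (phi k) x - g x)) ----> 0" by (rule W0_approx[OF assms(1)]) (rule that)
  obtain psi where psi: "!!k. test_fun w (psi k)" "(%k. Np p w (%x. psi k x - v' x)) ----> 0"
    "(%k. Np p w (%x. grad (psi k) x - g' x)) ----> 0" by (rule W0_approx[OF assms(2)]) (rule that)
  have t: "test_fun w (%x. phi k x + psi k x)" for k using phi(1) psi(1) by (rule test_fun_add)
  have gr: "grad (%x. phi k x + psi k x) x = grad (phi k) x + grad (psi k) x" for k x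
    by (intro grad_add test_fun_smooth[OF phi(1)] test_fun_smooth[OF psi(1)])
  have "(%k. Np p w (%x. (phi k x + psi k x) - (v x + v' x))) ----> 0"
    by (rule Np_add_tendsto[OF test_Lp(1)[OF phi(1)] test_Lp(1)[OF psi(1)] W0_Lp(1)[OF assms(1)] W0_Lp(1)[OF assms(2)] phi(2) psi(2)])
  moreover have "(%k. Np p w (%x. (grad (phi k) x + grad (psi k) x) - (g x + g' x))) ----> 0"
    by (rule Np_add_tendsto[OF test_Lp(2)[OF phi(1)] test_Lp(2)[OF psi(1)] W0_Lp(2)[OF assms(1)] W0_Lp(2)[OF assms(2)] phi(3) psi(3)])
  ultimately show ?thesis
    unfolding W0_def using t Lp_add(1)[OF W0_Lp(1)[OF assms(1)] W0_Lp(1)[OF assms(2)] p0(1)] Lp_add(1)[OF W0_Lp(2)[OF assms(1)] W0_Lp(2)[OF assms(2)] p0(1)]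
    by (intro conjI exI[of _ "%k x. phi k x + psi k x"]) (auto simp: gr)
qed

lemma W0_scale:
  assumes "W0 p w v g" shows "W0 p w (%x. c * v x) (%x. c *\<^sub>R g x)"
proof -
  obtain phi where phi: "!!k. test_fun w (phi k)" "(%k. Np p w (%x. phi k x - v x)) ----> 0"
    "(%k. Np p w (%x. grad (phi k) x - g x)) ----> 0" by (rule W0_approx[OF assms(1)]) (rule that)
  note L = W0_Lp[OF assms]
  have t: "test_fun w (%x. c * phi k x)" for k using phi(1) by (rule test_fun_scale)
  have gr: "grad (%x. c * phi k x) x = c *\<^sub>R grad (phi k) x" for k x
    by (intro grad_scale test_fun_smooth[OF phi(1)])
  have "Np p w (%x. c * phi k x - c * v x) = \<bar>c\<bar> powr p * Np p w (%x. phi k x - v x)" for k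
    using Np_mult[OF Lp_diff(1)[OF test_Lp(1)[OF phi(1)] L(1) p0(1)], of c] by (simp add: right_diff_distrib)
  then have 1: "(%k. Np p w (%x. c * phi k x - c * v x)) ----> 0" using tendsto_mult_right_zero[OF phi(2)] by simp
  have "Np p w (%x. c *\<^sub>R grad (phi k) x - c *\<^sub>R g x) = \<bar>c\<bar> powr p * Np p w (%x. grad (phi k) x - g x)" for k
    using Lp_scaleR(2)[OF Lp_diff(1)[OF test_Lp(2)[OF phi(1)] L(2) p0(1)], of c] by (simp add: scaleR_diff_right)
  then have 2: "(%k. Np p w (%x. c *\<^sub>R grad (phi k) x - c *\<^sub>R g x)) ----> 0" using tendsto_mult_right_zero[OF phi(3)] by simp
  show ?thesis
    unfolding W0_def using t Lp_mult[OF L(1)] Lp_scaleR(1)[OF L(2)] 1 2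
    by (intro conjI exI[of _ "%k x. c * phi k x"]) (auto simp: gr)
qed

text \<open>Chain and product rule for \<open>psi * F v\<close> when \<open>F\<close> has a bounded
  continuous derivative. The conditions \<open>t\<close> leave the smoothness of the composites, and
  their vanishing outside a compact set, to each application. The factor \<open>psi\<close> need not
  have compact support itself, so \<open>psi = 1\<close> is allowed.\<close>

lemma W0_chain:
  assumes W: "W0 p w v g"
    and psi: "smooth_fun psi" "!!x. \<bar>psi x\<bar> <= K" "!!x. norm (grad psi x) <= K"
    and F: "!!t. (F has_real_derivative F' t) (at t)" "continuous_on UNIV F'" "!!t. \<bar>F' t\<bar> <= L"
    and t: "!!phi. test_fun w phi ==> smooth_fun (%x. F (phi x))"
      "!!phi. test_fun w phi ==> test_fun w (%x. psi x * F (phi x))"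
  shows "W0 p w (%x. psi x * F (v x)) (%x. (psi x * F' (v x)) *\<^sub>R g x + F (v x) *\<^sub>R grad psi x)"
proof -
  obtain phi0 where phi0: "!!k. test_fun w (phi0 k)" "(%k. Np p w (%x. phi0 k x - v x)) ----> 0"
    "(%k. Np p w (%x. grad (phi0 k) x - g x)) ----> 0" by (rule W0_approx[OF W]) (rule that)
  note L = W0_Lp[OF W]
  have K0: "K >= 0" using psi(2)[of undefined] by linarith
  have L0: "L >= 0" using F(3)[of 0] by linarith
  \<comment> \<open>Almost everywhere convergence makes the derivatives \<open>F'\<close> converge
    along the approximants; convergence in L^p alone says nothing pointwise.\<close>
  obtain r where r: "strict_mono r" "AE x in M. (%k. phi0 (r k) x - v x) ----> 0"
  proof (rule Lp_AE_subseq[OF p0(2), of M "%k x. phi0 k x - v x"])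
    show "integrable M (%x. \<bar>phi0 k x - v x\<bar> powr p)" for k
      using Lp_integrable[OF Lp_diff(1)[OF test_Lp(1)[OF phi0(1)] L(1) p0(1)]] by simp
    show "(%k. \<integral>x. \<bar>phi0 k x - v x\<bar> powr p \<partial>M) ----> 0" using phi0(2) by (simp add: Np_def)
  qed
  define phi where "phi k = phi0 (r k)" for k
  have phi: "!!k. test_fun w (phi k)" "(%k. Np p w (%x. phi k x - v x)) ----> 0"
    "(%k. Np p w (%x. grad (phi k) x - g x)) ----> 0" "AE x in M. (%k. phi k x) ----> v x"
    unfolding phi_def using phi0(1) LIMSEQ_subseq_LIMSEQ[OF phi0(2) r(1)] LIMSEQ_subseq_LIMSEQ[OF phi0(3) r(1)] r(2)
    by (auto simp: o_def LIM_zero_iff)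
  have Fcont: "continuous_on UNIV F" using F(1) by (meson DERIV_continuous_on has_field_derivative_at_within)
  have Flip: "\<bar>F a - F b\<bar> <= L * \<bar>a - b\<bar>" for a b
  proof -
    have "norm (F a - F b) <= L * norm (a - b)"
      by (rule field_differentiable_bound[of UNIV]) (use F in auto)
    then show ?thesis by simp
  qed
  note [measurable] = Lp_measurable[OF L(1)] Lp_measurable[OF L(2)]
  have [measurable]: "F \<in> borel_measurable borel" "F' \<in> borel_measurable borel"
    using Fcont F(2) by (auto intro: borel_measurable_continuous_onI)
  have [measurable]: "psi \<in> borel_measurable M" "grad psi \<in> borel_measurable M"
    by (intro borel_M borel_measurable_continuous_onI smooth_continuous[OF psi(1)] smooth_grad_continuous[OF psi(1)])+
  note [measurable] = test_measurable[OF phi(1)]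
  have LF: "Lp p w (%x. F (v x))"
  proof -
    have 0: "Lp p w (%x. \<bar>F 0\<bar> + L * \<bar>v x\<bar>)"
    proof (rule Lp_add(1)[OF _ _ p0(1)])
      show "Lp p w (%x. \<bar>F 0\<bar>)" by (rule bounded_Lp[where K = "\<bar>F 0\<bar>"]) auto
      show "Lp p w (%x. L * \<bar>v x\<bar>)"
        by (rule Lp_mult, rule Lp_bound(1)[OF _ L(1), where c = 1]) (use p0 in auto)
    qed
    show ?thesis
    proof (rule Lp_bound(1)[OF _ 0, where c = 1])
      have "\<bar>F (v x)\<bar> <= \<bar>F 0\<bar> + L * \<bar>v x\<bar>" for x using Flip[of "v x" 0] by simp
      then show "AE x in M. norm (F (v x)) <= 1 * norm (\<bar>F 0\<bar> + L * \<bar>v x\<bar>)"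
        using L0 by (intro AE_I2) simp
    qed (use p0 in auto)
  qed
  have Lv: "Lp p w (%x. psi x * F (v x))"
  proof (rule Lp_bound(1)[OF _ LF _ K0 p0(1)])
    show "AE x in M. norm (psi x * F (v x)) <= K * norm (F (v x))"
      using psi(2) by (intro AE_I2) (simp add: abs_mult mult_right_mono)
  qed measurable
  have Lg1: "Lp p w (%x. (psi x * F' (v x)) *\<^sub>R g x)"
  proof (rule Lp_bound(1)[OF _ L(2) _ _ p0(1)])
    show "AE x in M. norm ((psi x * F' (v x)) *\<^sub>R g x) <= (K * L) * norm (g x)"
      using psi(2) F(3) K0 by (intro AE_I2) (auto simp: abs_mult intro!: mult_right_mono mult_mono)
    show "K * L >= 0" using K0 L0 by simp
  qed measurable
  have Lg2: "Lp p w (%x. F (v x) *\<^sub>R grad psi x)"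
  proof (rule Lp_bound(1)[OF _ LF _ K0 p0(1)])
    show "AE x in M. norm (F (v x) *\<^sub>R grad psi x) <= K * norm (F (v x))"
    proof (rule AE_I2)
      fix x
      have "\<bar>F (v x)\<bar> * norm (grad psi x) <= \<bar>F (v x)\<bar> * K" by (rule mult_left_mono[OF psi(3)]) simp
      then show "norm (F (v x) *\<^sub>R grad psi x) <= K * norm (F (v x))" by (simp add: mult.commute)
    qed
  qed measurable
  have Ld: "Lp p w (%x. phi k x - v x)" "Lp p w (%x. grad (phi k) x - g x)" for k
    by (rule Lp_diff(1)[OF test_Lp(1)[OF phi(1)] L(1) p0(1)], rule Lp_diff(1)[OF test_Lp(2)[OF phi(1)] L(2) p0(1)])
  have c1: "(%k. Np p w (%x. psi x * F (phi k x) - psi x * F (v x))) ----> 0"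
  proof (rule Np_tendsto_0)
    fix k
    show "Np p w (%x. psi x * F (phi k x) - psi x * F (v x)) <= (K * L) powr p * Np p w (%x. phi k x - v x)"
    proof (rule Lp_bound(2)[OF _ Ld(1) _ _ p0(1)])
      have "\<bar>psi x\<bar> * \<bar>F (phi k x) - F (v x)\<bar> <= K * (L * \<bar>phi k x - v x\<bar>)" for x
        by (intro mult_mono psi(2) Flip K0) auto
      then show "AE x in M. norm (psi x * F (phi k x) - psi x * F (v x)) <= (K * L) * norm (phi k x - v x)"
        by (intro AE_I2) (simp add: right_diff_distrib[symmetric] abs_mult mult.assoc)
    qed (use K0 L0 in auto)
    show "(%k. (K * L) powr p * Np p w (%x. phi k x - v x)) ----> 0" by (rule tendsto_mult_right_zero[OF phi(2)])
  qed
  \<comment> \<open>The gradient error in three parts: \<open>A\<close> is small because gradients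
    converge, \<open>B\<close> by dominated convergence and continuity of \<open>F'\<close>, and
    \<open>D\<close> because \<open>F\<close> is Lipschitz.\<close>
  define A where "A k x = (psi x * F' (phi k x)) *\<^sub>R (grad (phi k) x - g x)" for k x
  define B where "B k x = (psi x * (F' (phi k x) - F' (v x))) *\<^sub>R g x" for k x
  define D where "D k x = (F (phi k x) - F (v x)) *\<^sub>R grad psi x" for k x
  have LA: "Lp p w (A k)" "Np p w (A k) <= (K * L) powr p * Np p w (%x. grad (phi k) x - g x)" for k
  proof -
    have m: "A k \<in> borel_measurable M" unfolding A_def by measurable
    have b: "AE x in M. norm (A k x) <= (K * L) * norm (grad (phi k) x - g x)"
      unfolding A_def using psi(2) F(3) K0 by (intro AE_I2) (auto simp: abs_mult intro!: mult_right_mono mult_mono)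
    show "Lp p w (A k)" "Np p w (A k) <= (K * L) powr p * Np p w (%x. grad (phi k) x - g x)"
      by (rule Lp_bound[OF m Ld(2) b _ p0(1)], use K0 L0 in simp)+
  qed
  have LD: "Lp p w (D k)" "Np p w (D k) <= (L * K) powr p * Np p w (%x. phi k x - v x)" for k
  proof -
    have m: "D k \<in> borel_measurable M" unfolding D_def by measurable
    have "\<bar>F (phi k x) - F (v x)\<bar> * norm (grad psi x) <= (L * \<bar>phi k x - v x\<bar>) * K" for x
      by (intro mult_mono psi(3) Flip) (use L0 in auto)
    then have b: "AE x in M. norm (D k x) <= (L * K) * norm (phi k x - v x)"
      unfolding D_def by (intro AE_I2) (simp add: mult_ac)
    show "Lp p w (D k)" "Np p w (D k) <= (L * K) powr p * Np p w (%x. phi k x - v x)"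
      by (rule Lp_bound[OF m Ld(1) b _ p0(1)], use K0 L0 in simp)+
  qed
  have Bb: "norm (B k x) <= (K * (2 * L)) * norm (g x)" for k x
  proof -
    have "\<bar>F' (phi k x) - F' (v x)\<bar> <= 2 * L" using F(3)[of "phi k x"] F(3)[of "v x"] by linarith
    then have "\<bar>psi x\<bar> * \<bar>F' (phi k x) - F' (v x)\<bar> <= K * (2 * L)" by (intro mult_mono psi(2) K0) auto
    then show ?thesis unfolding B_def by (simp add: abs_mult mult_right_mono)
  qed
  have mB: "B k \<in> borel_measurable M" for k unfolding B_def by measurable
  have LB: "Lp p w (B k)" for k
    by (rule Lp_bound(1)[OF mB L(2) AE_I2[OF Bb] _ p0(1)]) (use K0 L0 in auto)
  have B0: "(%k. Np p w (B k)) ----> 0"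
  proof -
    have "(%k. \<integral>x. norm (B k x) powr p \<partial>M) ----> (LINT x|M. 0)"
    proof (rule integral_dominated_convergence)
      show "integrable M (%x. (K * (2 * L)) powr p * norm (g x) powr p)" using Lp_integrable[OF L(2)] by auto
      show "(%x. norm (B k x) powr p) \<in> borel_measurable M" for k using mB by measurable
      show "AE x in M. norm (norm (B k x) powr p) <= (K * (2 * L)) powr p * norm (g x) powr p" for k
      proof (rule AE_I2)
        fix x
        have "norm (B k x) powr p <= ((K * (2 * L)) * norm (g x)) powr p" by (intro powr_mono2 Bb p0) auto
        then show "norm (norm (B k x) powr p) <= (K * (2 * L)) powr p * norm (g x) powr p" by (simp add: powr_mult)
      qed
      show "AE x in M. (%k. norm (B k x) powr p) ----> 0"
        using phi(4)
      proof eventually_elim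
        case (elim x)
        have "isCont F' (v x)" using F(2) by (simp add: continuous_on_eq_continuous_at)
        then have "(%k. F' (phi k x)) ----> F' (v x)" using elim by (rule isCont_tendsto_compose)
        then have "(%k. norm ((psi x * (F' (phi k x) - F' (v x))) *\<^sub>R g x)) ----> norm ((psi x * (F' (v x) - F' (v x))) *\<^sub>R g x)"
          by (intro tendsto_intros)
        then have "(%k. norm (B k x)) ----> 0" by (simp add: B_def)
        then have "(%k. norm (B k x) powr p) ----> 0 powr p"
          by (intro tendsto_powr2 tendsto_const p0) auto
        then show ?case by simp
      qed
    qed simp
    then show ?thesis by (simp add: Np_def)
  qed
  have gr: "grad (%x. psi x * F (phi k x)) x = (psi x * F' (phi k x)) *\<^sub>R grad (phi k) x + F (phi k x) *\<^sub>R grad psi x" for k x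
    using grad_mult[OF psi(1) t(1)[OF phi(1)], of k x] grad_compose[OF test_fun_smooth[OF phi(1)] F(1), of k x] by simp
  have c2: "(%k. Np p w (%x. grad (%x. psi x * F (phi k x)) x - ((psi x * F' (v x)) *\<^sub>R g x + F (v x) *\<^sub>R grad psi x))) ----> 0"
  proof (rule Np_tendsto_0)
    fix k
    have eq: "grad (%x. psi x * F (phi k x)) x - ((psi x * F' (v x)) *\<^sub>R g x + F (v x) *\<^sub>R grad psi x) = A k x + (B k x + D k x)" for x
      unfolding gr A_def B_def D_def by (simp add: algebra_simps)
    have "Np p w (%x. A k x + (B k x + D k x)) <= 2 powr p * (Np p w (A k) + Np p w (%x. B k x + D k x))"
      by (rule Lp_add(2)[OF LA(1) Lp_add(1)[OF LB LD(1) p0(1)] p0(1)])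
    also have "... <= 2 powr p * ((K * L) powr p * Np p w (%x. grad (phi k) x - g x)
       + 2 powr p * (Np p w (B k) + (L * K) powr p * Np p w (%x. phi k x - v x)))"
      using LA(2)[of k] LD(2)[of k] Lp_add(2)[OF LB LD(1) p0(1), of k k]
      by (intro mult_left_mono add_mono order_trans[OF Lp_add(2)[OF LB LD(1) p0(1)]]) auto
    finally show "Np p w (%x. grad (%x. psi x * F (phi k x)) x - ((psi x * F' (v x)) *\<^sub>R g x + F (v x) *\<^sub>R grad psi x)) <= ..."
      unfolding eq .
    have "(%k. 2 powr p * ((K * L) powr p * Np p w (%x. grad (phi k) x - g x)
       + 2 powr p * (Np p w (B k) + (L * K) powr p * Np p w (%x. phi k x - v x)))) ----> 2 powr p * ((K * L) powr p * 0 + 2 powr p * (0 + (L * K) powr p * 0))"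
      by (intro tendsto_intros phi B0)
    then show "(%k. 2 powr p * ((K * L) powr p * Np p w (%x. grad (phi k) x - g x)
       + 2 powr p * (Np p w (B k) + (L * K) powr p * Np p w (%x. phi k x - v x)))) ----> 0" by simp
  qed
  show ?thesis
    unfolding W0_def using Lv Lp_add(1)[OF Lg1 Lg2 p0(1)] t(2)[OF phi(1)] c1 c2
    by (intro conjI exI[of _ "%k x. psi x * F (phi k x)"]) auto
qed

end

section \<open>Completeness, uniform convexity and compactness\<close>

text \<open>Riesz and Fischer: a rapidly Cauchy subsequence converges almost everywhere, and Fatou's
  lemma identifies its limit as a limit of the whole sequence.\<close>

lemma (in bounded_open) Lp_complete:
  fixes u :: "nat => 'a => 'b::euclidean_space"
  assumes L: "!!k. Lp p w (u k)"
    and C: "!!e. e > 0 ==> \<exists>N. \<forall>k\<ge>N. \<forall>l\<ge>N. Np p w (%x. u k x - u l x) < e"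
  obtains g where "Lp p w g" "(%k. Np p w (%x. u k x - g x)) ----> 0"
proof -
  interpret finite_measure M by (rule finite_M)
  note [measurable] = Lp_measurable[OF L]
  define m where "m = measure M (space M)"
  have m0: "m >= 0" by (simp add: m_def)
  have "\<forall>i. \<exists>N. \<forall>k\<ge>N. \<forall>l\<ge>N. Np p w (%x. u k x - u l x) < (1 / 2^i) powr p"
    using C by simp
  then obtain N where N: "\<forall>i. \<forall>k\<ge>N i. \<forall>l\<ge>N i. Np p w (%x. u k x - u l x) < (1 / 2^i) powr p"
    by (rule choice[THEN exE])
  \<comment> \<open>Adding all earlier thresholds keeps \<open>r\<close> monotone while
    \<open>r i\<close> exceeds both \<open>N i\<close> and \<open>i\<close>.\<close>
  define r where "r i = i + (\<Sum>j\<le>i. N j)" for i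
  have rN: "N i <= r i" for i
  proof -
    have "N i <= (\<Sum>j\<le>i. N j)" by (rule member_le_sum) auto
    then show ?thesis by (simp add: r_def)
  qed
  have rS: "r i <= r (Suc i)" for i by (simp add: r_def)
  have ri: "i <= r i" for i by (simp add: r_def)
  define d where "d i x = norm (u (r (Suc i)) x - u (r i) x)" for i x
  have Ld: "Lp p w (%x. u (r (Suc i)) x - u (r i) x)" for i by (rule Lp_diff(1)[OF L L p0(1)])
  have di: "integrable M (%x. d i x powr p)" for i unfolding d_def by (rule Lp_integrable[OF Ld])
  have dle: "(LINT x|M. d i x powr p) <= (1 / 2^i) powr p" for i
    using N[rule_format, of i "r (Suc i)" "r i"] rN[of i] rS[of i] by (simp add: Np_def d_def)
  \<comment> \<open>Either the difference is below \<open>1 / 2^i\<close>, or its ratio to that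
    number is at least one and may be raised to the power \<open>p - 1\<close>. This turns bounds on
    p-th powers into summable bounds in L^1, the measure being finite.\<close>
  have pw: "d i x <= 1 / 2^i + (2^i) powr (p - 1) * d i x powr p" for i x
  proof (cases "d i x <= 1 / 2^i")
    case True then show ?thesis by (simp add: add_increasing2)
  next
    case False
    then have pos: "d i x > 0" by (meson divide_pos_pos less_trans not_le_imp_less zero_less_one zero_less_numeral zero_less_power)
    have "1 <= (2^i * d i x) powr (p - 1)"
      using False p1 by (intro ge_one_powr_ge_zero) (auto simp: field_simps)
    then have "d i x * 1 <= d i x * (2^i * d i x) powr (p - 1)" using pos by (intro mult_left_mono) auto
    also have "... = (2^i) powr (p - 1) * (d i x * d i x powr (p - 1))" using pos by (simp add: powr_mult)
    also have "d i x * d i x powr (p - 1) = d i x powr p" using pos powr_add[of "d i x" 1 "p - 1"] by simp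
    finally show ?thesis by (simp add: add_increasing)
  qed
  have bound: "(\<integral>\<^sup>+x. ennreal (d i x) \<partial>M) <= ennreal ((m + 1) * (1/2)^i)" for i
  proof -
    have "(\<integral>\<^sup>+x. ennreal (d i x) \<partial>M) <= (\<integral>\<^sup>+x. ennreal (1 / 2^i + (2^i) powr (p - 1) * d i x powr p) \<partial>M)"
      by (intro nn_integral_mono ennreal_leI pw)
    also have "... = ennreal (LINT x|M. 1 / 2^i + (2^i) powr (p - 1) * d i x powr p)"
      by (rule nn_integral_eq_integral) (use di in \<open>auto intro!: AE_I2 add_nonneg_nonneg\<close>)
    finally have 1: "(\<integral>\<^sup>+x. ennreal (d i x) \<partial>M) <= ennreal (LINT x|M. 1 / 2^i + (2^i) powr (p - 1) * d i x powr p)" .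
    have "(LINT x|M. 1 / 2^i + (2^i) powr (p - 1) * d i x powr p) = m * (1 / 2^i) + (2^i) powr (p - 1) * (LINT x|M. d i x powr p)"
      using di[of i] by (simp add: m_def)
    also have "... <= m * (1 / 2^i) + (2^i) powr (p - 1) * (1 / 2^i) powr p"
      by (intro add_left_mono mult_left_mono dle) auto
    also have "(2^i) powr (p - 1) * (1 / 2^i) powr p = (1/2::real)^i"
    proof -
      have "(2^i) powr (p - 1) * (1 / 2^i) powr p = ((2::real)^i) powr (p - 1) / (2^i) powr p" by (simp add: powr_divide)
      also have "... = ((2::real)^i) powr (p - 1 - p)" by (rule powr_diff[symmetric])
      also have "... = ((2::real)^i) powr (-1)" by simp
      also have "... = (1/2::real)^i" by (simp add: powr_minus power_one_over inverse_eq_divide)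
      finally show ?thesis .
    qed
    also have "m * (1 / 2^i) + (1/2)^i = (m + 1) * (1/2)^i" by (simp add: power_one_over add_divide_distrib distrib_right)
    finally show ?thesis using 1 by (meson ennreal_leI order_trans)
  qed
  have "(\<integral>\<^sup>+x. (\<Sum>i. ennreal (d i x)) \<partial>M) = (\<Sum>i. \<integral>\<^sup>+x. ennreal (d i x) \<partial>M)"
    by (rule nn_integral_suminf) (simp add: d_def)
  also have "... <= (\<Sum>i. ennreal ((m + 1) * (1/2)^i))" by (intro suminf_le bound) auto
  also have "... < \<infinity>"
  proof -
    have "summable (%i. (m + 1) * (1/2::real)^i)" by (intro summable_mult summable_geometric) simp
    then have "(\<Sum>i. ennreal ((m + 1) * (1/2)^i)) = ennreal (\<Sum>i. (m + 1) * (1/2)^i)"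
      using m0 by (intro suminf_ennreal2) auto
    then show ?thesis by simp
  qed
  finally have fin: "(\<integral>\<^sup>+x. (\<Sum>i. ennreal (d i x)) \<partial>M) ~= \<infinity>" by simp
  have "AE x in M. (\<Sum>i. ennreal (d i x)) ~= \<infinity>"
    by (rule nn_integral_PInf_AE[OF _ fin]) (simp add: d_def)
  then have conv: "AE x in M. convergent (%i. u (r i) x)"
  proof eventually_elim
    case (elim x)
    then have "summable (%i. d i x)" by (intro summable_suminf_not_top) (auto simp: d_def)
    then have "summable (%i. u (r (Suc i)) x - u (r i) x)" unfolding d_def by (rule summable_norm_cancel)
    then have "convergent (%n. \<Sum>i<n. u (r (Suc i)) x - u (r i) x)" by (simp add: summable_iff_convergent)
    then have "convergent (%n. u (r n) x - u (r 0) x)" unfolding sum_lessThan_telescope[of "%n. u (r n) x"] .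
    then have "convergent (%n. (u (r n) x - u (r 0) x) + u (r 0) x)" by (intro convergent_add convergent_const)
    then show ?case by simp
  qed
  define g where "g x = lim (%i. u (r i) x)" for x
  have gm [measurable]: "g \<in> borel_measurable M" unfolding g_def by (rule borel_measurable_lim_metric) measurable
  have lim: "AE x in M. (%i. u (r i) x) ----> g x"
    using conv by eventually_elim (simp add: g_def convergent_LIMSEQ_iff)
  have est: "integrable M (%x. norm (u k x - g x) powr p) \<and> Np p w (%x. u k x - g x) <= e"
    if K: "\<forall>k\<ge>K. \<forall>l\<ge>K. Np p w (%x. u k x - u l x) < e" and k: "k >= K" for K k e
  proof -
    have i: "integrable M (%x. norm (u k x - u (r (i + K)) x) powr p)" for i
      by (rule Lp_integrable[OF Lp_diff(1)[OF L L p0(1)]])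
    have l: "AE x in M. (%i. norm (u k x - u (r (i + K)) x) powr p) ----> norm (u k x - g x) powr p"
      using lim
    proof eventually_elim
      case (elim x)
      have "(%i. u (r (i + K)) x) ----> g x" using elim by (rule LIMSEQ_ignore_initial_segment)
      then show ?case by (intro tendsto_powr2 tendsto_norm tendsto_diff tendsto_const p0) auto
    qed
    have b: "(LINT x|M. norm (u k x - u (r (i + K)) x) powr p) <= e" for i
      using K[rule_format, of k "r (i + K)"] k ri[of "i + K"] by (simp add: Np_def)
    have mm: "(%x. norm (u k x - g x) powr p) \<in> borel_measurable M" by measurable
    show ?thesis
      using fatou_integrable[OF i _ l mm b] by (simp add: Np_def)
  qed
  show ?thesis
  proof (rule that)
    obtain K where K: "\<forall>k\<ge>K. \<forall>l\<ge>K. Np p w (%x. u k x - u l x) < 1" using C[of 1] by auto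
    have "Lp p w (%x. u K x - g x)" using est[OF K order_refl] by (simp add: Lp_def)
    from Lp_diff(1)[OF L[of K] this p0(1)] show "Lp p w g" by simp
    show "(%k. Np p w (%x. u k x - g x)) ----> 0"
    proof (rule LIMSEQ_I)
      fix e :: real assume "e > 0"
      then obtain K where K: "\<forall>k\<ge>K. \<forall>l\<ge>K. Np p w (%x. u k x - u l x) < e / 2" using C[of "e/2"] by auto
      show "\<exists>no. \<forall>n\<ge>no. norm (Np p w (%x. u n x - g x) - 0) < e"
      proof (intro exI allI impI)
        fix n assume "n >= K"
        then have "Np p w (%x. u n x - g x) <= e / 2" using est[OF K] by blast
        then show "norm (Np p w (%x. u n x - g x) - 0) < e" using \<open>e > 0\<close> by (simp add: Np_nonneg)
      qed
    qed
  qed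
qed

text \<open>Tangents at \<open>a\<close> and at the midpoint of \<open>a\<close> and
  \<open>s\<close> are chained; strict monotonicity of \<open>t powr (p - 1)\<close> makes the
  second strictly better.\<close>

lemma powr_above_tangent_strict:
  fixes a s p :: real
  assumes p: "p > 1" and a: "a > 0" and s: "s >= 0" "s ~= a"
  shows "a powr p + p * a powr (p - 1) * (s - a) < s powr p"
proof -
  define c where "c = (s + a) / 2"
  have c: "c > 0" using a s by (simp add: c_def)
  have 1: "c powr p + p * c powr (p - 1) * (s - c) <= s powr p" by (rule powr_above_tangent) (use p c s in auto)
  have 2: "a powr p + p * a powr (p - 1) * (c - a) <= c powr p" by (rule powr_above_tangent) (use p c a in auto)
  have 3: "(c powr (p - 1) - a powr (p - 1)) * (s - a) > 0"
  proof (cases "s > a")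
    case True
    then have "a powr (p - 1) < c powr (p - 1)" using p a by (intro powr_less_mono2) (auto simp: c_def)
    then show ?thesis using True by simp
  next
    case False
    then have "s < a" using s by simp
    then have "c powr (p - 1) < a powr (p - 1)" using p a c by (intro powr_less_mono2) (auto simp: c_def)
    then show ?thesis using \<open>s < a\<close> by (simp add: mult_neg_neg)
  qed
  have e: "s - c = (s - a) / 2" "c - a = (s - a) / 2" by (simp_all add: c_def field_simps)
  define h where "h = (s - a) / 2"
  have h: "s - a = 2 * h" by (simp add: h_def)
  have "0 < p * ((c powr (p - 1) - a powr (p - 1)) * h)" using 3 p unfolding h by (simp add: zero_less_mult_iff)
  then have 4: "p * a powr (p - 1) * ((s - a) / 2) < p * c powr (p - 1) * ((s - a) / 2)"
    unfolding h_def[symmetric] by (simp add: algebra_simps)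
  have 5: "p * a powr (p - 1) * (s - a) = p * a powr (p - 1) * ((s - a) / 2) + p * a powr (p - 1) * ((s - a) / 2)" by simp
  show ?thesis using 1 2 4 5 unfolding e by linarith
qed

text \<open>The defect in midpoint convexity of the p-th power of the norm.\<close>

definition convexity_gap :: "real => 'b::euclidean_space => 'b => real" where
  "convexity_gap p x y = norm x powr p / 2 + norm y powr p / 2 - norm ((1/2) *\<^sub>R (x + y)) powr p"

text \<open>Vanishing of the gap forces equality in the scalar convexity inequality, hence equal
  norms, and equality in the triangle inequality, hence equal directions.\<close>

lemma convexity_gap_nonneg:
  fixes x y :: "'b::euclidean_space"
  assumes p: "p > 1" shows "convexity_gap p x y >= 0"
    and "convexity_gap p x y = 0 ==> x = y"
proof -
  define a b c where "a = norm x" and "b = norm y" and "c = (a + b) / 2"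
  have ab: "a >= 0" "b >= 0" by (auto simp: a_def b_def)
  have n: "norm ((1/2) *\<^sub>R (x + y)) <= c" using norm_triangle_ineq[of x y] by (simp add: a_def b_def c_def)
  then have n2: "norm ((1/2) *\<^sub>R (x + y)) powr p <= c powr p" using p by (intro powr_mono2) auto
  have c0: "c >= 0" using ab by (simp add: c_def)
  have t: "c powr p + p * c powr (p - 1) * (a - c) <= a powr p" "c powr p + p * c powr (p - 1) * (b - c) <= b powr p"
    by (rule powr_above_tangent; use p ab c0 in auto)+
  have e: "a - c = - (b - c)" by (simp add: c_def field_simps)
  have sum0: "p * c powr (p - 1) * (a - c) + p * c powr (p - 1) * (b - c) = 0" unfolding e by (simp add: algebra_simps)
  show "convexity_gap p x y >= 0"
    using t n2 sum0 unfolding convexity_gap_def a_def[symmetric] b_def[symmetric] by linarith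
  assume z: "convexity_gap p x y = 0"
  show "x = y"
  proof (cases "c = 0")
    case True
    then have "a = 0" "b = 0" using ab by (auto simp: c_def)
    then show ?thesis by (simp add: a_def b_def)
  next
    case False
    then have cp: "c > 0" using c0 by simp
    have "a = c"
    proof (rule ccontr)
      assume "a ~= c"
      then have "c powr p + p * c powr (p - 1) * (a - c) < a powr p"
        using p ab cp by (intro powr_above_tangent_strict) auto
      then show False using t(2) sum0 n2 z unfolding convexity_gap_def a_def[symmetric] b_def[symmetric] by linarith
    qed
    then have ac: "a = c" "b = c" by (auto simp: c_def field_simps)
    have "norm ((1/2) *\<^sub>R (x + y)) powr p = c powr p"
      using z unfolding convexity_gap_def a_def[symmetric] b_def[symmetric] ac by simp
    then have "norm ((1/2) *\<^sub>R (x + y)) = c"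
    proof -
      assume eq: "norm ((1/2) *\<^sub>R (x + y)) powr p = c powr p"
      show ?thesis
      proof (rule ccontr)
        assume "norm ((1/2) *\<^sub>R (x + y)) ~= c"
        then have "norm ((1/2) *\<^sub>R (x + y)) < c" using n by simp
        then have "norm ((1/2) *\<^sub>R (x + y)) powr p < c powr p" using p by (intro powr_less_mono2) auto
        then show False using eq by simp
      qed
    qed
    then have "norm (x + y) = norm x + norm y" using ac by (simp add: a_def[symmetric] b_def[symmetric])
    then have "norm x *\<^sub>R y = norm y *\<^sub>R x" by (simp add: norm_triangle_eq)
    then show ?thesis using ac cp by (simp add: a_def[symmetric] b_def[symmetric])
  qed
qed

text \<open>Compactness instead of Clarkson's inequalities, so all \<open>p > 1\<close> are treated
  alike. On the part of the unit sphere of the product space where the claim is not already true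
  with \<open>C = 0\<close>, the gap has a positive minimum; homogeneity extends the inequality to
  all pairs.\<close>

lemma uniform_convexity:
  assumes p: "p > 1" and "\<epsilon> > 0"
  obtains C where "C >= 0" "!!x y :: 'b::euclidean_space.
    norm (x - y) powr p <= \<epsilon> * (norm x powr p + norm y powr p) + C * convexity_gap p x y"
proof -
  define S where "S = {z :: 'b \<times> 'b. z \<in> sphere 0 1 \<and> \<epsilon> * (norm (fst z) powr p + norm (snd z) powr p) <= norm (fst z - snd z) powr p}"
  have cont: "continuous_on UNIV (%z :: 'b \<times> 'b. norm (h z) powr p)" if "continuous_on UNIV h" for h :: "'b \<times> 'b => 'b"
    using that p by (intro continuous_on_powr' continuous_on_norm continuous_on_const) auto
  have c1: "continuous_on UNIV (%z :: 'b \<times> 'b. norm (fst z) powr p)" by (rule cont) (intro continuous_intros)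
  have c2: "continuous_on UNIV (%z :: 'b \<times> 'b. norm (snd z) powr p)" by (rule cont) (intro continuous_intros)
  have c3: "continuous_on UNIV (%z :: 'b \<times> 'b. norm (fst z - snd z) powr p)" by (rule cont) (intro continuous_intros)
  have c4: "continuous_on UNIV (%z :: 'b \<times> 'b. norm ((1/2) *\<^sub>R (fst z + snd z)) powr p)" by (rule cont) (intro continuous_intros)
  have "closed {z :: 'b \<times> 'b. \<epsilon> * (norm (fst z) powr p + norm (snd z) powr p) <= norm (fst z - snd z) powr p}"
    by (intro closed_Collect_le continuous_intros c1 c2 c3)
  moreover have "S = sphere 0 1 \<inter> {z :: 'b \<times> 'b. \<epsilon> * (norm (fst z) powr p + norm (snd z) powr p) <= norm (fst z - snd z) powr p}"
    unfolding S_def by auto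
  ultimately have Sc: "compact S" by (simp add: compact_Int_closed)
  have cg: "continuous_on S (%z. convexity_gap p (fst z) (snd z))"
    unfolding convexity_gap_def
    by (rule continuous_on_subset[of UNIV], intro continuous_intros c1 c2 c4) auto
  have pos: "convexity_gap p (fst z) (snd z) > 0" if "z \<in> S" for z
  proof (rule ccontr)
    assume "\<not> ?thesis"
    then have "convexity_gap p (fst z) (snd z) = 0" using convexity_gap_nonneg(1)[OF p, of "fst z" "snd z"] by simp
    then have eq: "fst z = snd z" by (rule convexity_gap_nonneg(2)[OF p])
    then have "\<epsilon> * (2 * norm (fst z) powr p) <= 0" using that by (simp add: S_def)
    then have "norm (fst z) powr p <= 0" using \<open>\<epsilon> > 0\<close> by (simp add: mult_le_0_iff)
    then have "fst z = 0" by (metis norm_eq_zero not_le powr_gt_zero)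
    then have "z = 0" using eq by (simp add: prod_eq_iff)
    then show False using that by (simp add: S_def)
  qed
  obtain m where m: "m > 0" "!!z. z \<in> S ==> m <= convexity_gap p (fst z) (snd z)"
  proof (cases "S = {}")
    case True then show ?thesis using that[of 1] by simp
  next
    case False
    obtain z0 where z0: "z0 \<in> S" "\<forall>z\<in>S. convexity_gap p (fst z0) (snd z0) <= convexity_gap p (fst z) (snd z)"
      using continuous_attains_inf[OF Sc False cg] by (elim bexE)
    show ?thesis by (rule that[OF pos[OF z0(1)]]) (use z0(2) in simp)
  qed
  define C where "C = 2 powr p / m"
  have C0: "C >= 0" using m by (simp add: C_def)
  have unit: "norm (fst z - snd z) powr p <= \<epsilon> * (norm (fst z) powr p + norm (snd z) powr p) + C * convexity_gap p (fst z) (snd z)"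
    if "norm z = 1" for z :: "'b \<times> 'b"
  proof (cases "z \<in> S")
    case True
    have "norm (fst z - snd z) <= 2"
      using norm_triangle_ineq4[of "fst z" "snd z"] norm_fst_le[of "fst z" "snd z"] norm_snd_le[of "snd z" "fst z"] that by simp
    then have "norm (fst z - snd z) powr p <= 2 powr p" using p by (intro powr_mono2) auto
    also have "... = C * m" using m by (simp add: C_def)
    also have "... <= C * convexity_gap p (fst z) (snd z)" by (intro mult_left_mono m True C0)
    finally show ?thesis using \<open>\<epsilon> > 0\<close> by (simp add: add_increasing)
  next
    case False
    then have "norm (fst z - snd z) powr p <= \<epsilon> * (norm (fst z) powr p + norm (snd z) powr p)"
      using that by (auto simp: S_def)
    then show ?thesis using mult_nonneg_nonneg[OF C0 convexity_gap_nonneg(1)[OF p, of "fst z" "snd z"]] by linarith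
  qed
  show ?thesis
  proof (rule that[OF C0])
    fix x y :: 'b
    show "norm (x - y) powr p <= \<epsilon> * (norm x powr p + norm y powr p) + C * convexity_gap p x y"
    proof (cases "(x, y) = 0")
      case True then show ?thesis using p by (simp add: zero_prod_def convexity_gap_def)
    next
      case False
      define t where "t = norm (x, y)"
      have t: "t > 0" using False by (simp add: t_def)
      define x' y' where "x' = (1/t) *\<^sub>R x" and "y' = (1/t) *\<^sub>R y"
      have xy: "x = t *\<^sub>R x'" "y = t *\<^sub>R y'" using t by (simp_all add: x'_def y'_def)
      have "norm (x', y') = 1"
      proof -
        have "(x', y') = (1/t) *\<^sub>R (x, y)" by (simp add: x'_def y'_def)
        then have "norm (x', y') = \<bar>1/t\<bar> * norm (x, y)" by (simp only: norm_scaleR)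
        then show ?thesis using t by (simp add: t_def[symmetric])
      qed
      from unit[OF this] have u: "norm (x' - y') powr p <= \<epsilon> * (norm x' powr p + norm y' powr p) + C * convexity_gap p x' y'" by simp
      have h: "norm (t *\<^sub>R z) powr p = t powr p * norm z powr p" for z :: 'b using t by (simp add: powr_mult)
      have e1: "norm (x - y) powr p = t powr p * norm (x' - y') powr p" unfolding xy scaleR_diff_right[symmetric] h ..
      have "(1/2) *\<^sub>R (x + y) = t *\<^sub>R ((1/2) *\<^sub>R (x' + y'))" unfolding xy by (simp add: algebra_simps)
      then have e2: "convexity_gap p x y = t powr p * convexity_gap p x' y'"
        unfolding convexity_gap_def by (simp only: h xy) (simp add: algebra_simps)
      have "t powr p * norm (x' - y') powr p <= t powr p * (\<epsilon> * (norm x' powr p + norm y' powr p) + C * convexity_gap p x' y')"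
        using u by (rule mult_left_mono) simp
      then show ?thesis unfolding e1 e2 unfolding xy h by (simp add: algebra_simps)
    qed
  qed
qed

text \<open>Iterated midpoints of the tail from index \<open>n\<close> on, that is, convex
  combinations with dyadic weights. Uniform convexity compares midpoints only, so general convex
  combinations never arise.\<close>

inductive midhull :: "(nat => 'a => real) => nat => ('a => real) => bool" for phi n where
  base: "n <= j ==> midhull phi n (phi j)"
| mid: "midhull phi n u ==> midhull phi n v ==> midhull phi n (%x. (1/2) * (u x + v x))"

lemma midhull_antimono: "midhull phi n u ==> m <= n ==> midhull phi m u"
proof (induction rule: midhull.induct)
  case (base j) then show ?case by (intro midhull.base) simp
next
  case (mid u v) then show ?case by (intro midhull.mid) auto
qed

lemma midhull_test: "midhull phi n u ==> (!!k. test_fun w (phi k)) ==> test_fun w u"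
proof (induction rule: midhull.induct)
  case (mid u v)
  then show ?case by (intro test_fun_scale test_fun_add) auto
qed simp

lemma grad_mid:
  assumes "test_fun w u" "test_fun w v"
  shows "grad (%x. (1/2) * (u x + v x)) x = (1/2) *\<^sub>R (grad u x + grad v x)"
  using grad_scale[OF smooth_add[OF test_fun_smooth[OF assms(1)] test_fun_smooth[OF assms(2)]], of "1/2" x]
    grad_add[OF test_fun_smooth[OF assms(1)] test_fun_smooth[OF assms(2)], of x] by simp

text \<open>A midpoint convex functional bounded on the tail has the same bound on its hull. It is
  used for the distance to the limit and, later, for the energy.\<close>

lemma midhull_le:
  assumes t: "!!k. test_fun w (phi k)" and u: "midhull phi n u"
    and mid: "!!u v. test_fun w u ==> test_fun w v ==> \<Psi> (%x. (1/2) * (u x + v x)) <= (\<Psi> u + \<Psi> v) / 2"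
    and le: "!!j. n <= j ==> \<Psi> (phi j) <= (c::real)"
  shows "\<Psi> u <= c"
  using u
proof (induction rule: midhull.induct)
  case (base j) then show ?case by (rule le)
next
  case (mid u v)
  have "\<Psi> (%x. (1/2) * (u x + v x)) <= (\<Psi> u + \<Psi> v) / 2"
    by (rule assms(3)[OF midhull_test[OF mid.hyps(1) t] midhull_test[OF mid.hyps(2) t]])
  moreover have "(\<Psi> u + \<Psi> v) / 2 <= c" using mid.IH by (simp add: field_simps)
  ultimately show ?case by (rule order_trans)
qed

lemma (in bounded_open) Np_mid_le:
  fixes f g :: "'a => 'b::euclidean_space"
  assumes "Lp p w f" "Lp p w g"
  shows "(LINT x|M. convexity_gap p (f x) (g x)) = Np p w f / 2 + Np p w g / 2 - Np p w (%x. (1/2) *\<^sub>R (f x + g x))"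
    "integrable M (%x. convexity_gap p (f x) (g x))"
    "Np p w (%x. (1/2) *\<^sub>R (f x + g x)) <= (Np p w f + Np p w g) / 2"
proof -
  note i = Lp_integrable[OF assms(1)] Lp_integrable[OF assms(2)]
    Lp_integrable[OF Lp_scaleR(1)[OF Lp_add(1)[OF assms p0(1)], of "1/2"]]
  show "integrable M (%x. convexity_gap p (f x) (g x))"
    unfolding convexity_gap_def using i by (intro Bochner_Integration.integrable_diff Bochner_Integration.integrable_add integrable_divide)
  show eq: "(LINT x|M. convexity_gap p (f x) (g x)) = Np p w f / 2 + Np p w g / 2 - Np p w (%x. (1/2) *\<^sub>R (f x + g x))"
    unfolding convexity_gap_def Np_def
      Bochner_Integration.integral_diff[OF Bochner_Integration.integrable_add[OF integrable_divide[OF i(1)] integrable_divide[OF i(2)]] i(3)]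
      Bochner_Integration.integral_add[OF integrable_divide[OF i(1)] integrable_divide[OF i(2)]]
    by (simp only: integral_divide_zero)
  have "(LINT x|M. convexity_gap p (f x) (g x)) >= 0"
    by (intro integral_nonneg_AE AE_I2 convexity_gap_nonneg(1) p1)
  moreover have "c <= (a + b) / 2" if "0 <= a / 2 + b / 2 - c" for a b c :: real using that by (simp add: field_simps)
  ultimately show "Np p w (%x. (1/2) *\<^sub>R (f x + g x)) <= (Np p w f + Np p w g) / 2" unfolding eq by blast
qed

text \<open>Mazur's lemma without weak topologies: nearly minimal elements of the midpoint hulls of the tails
  form a Cauchy sequence, by uniform convexity.\<close>

lemma (in bounded_open) mazur:
  assumes t: "!!k. test_fun w (phi k)" and B: "!!k. Np p w (grad (phi k)) <= B"
    and v: "Lp p w v" "(%k. Np p w (%x. phi k x - v x)) ----> 0"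
  obtains g u where "W0 p w v g" "!!k. midhull phi k (u k)" "(%k. Np p w (%x. grad (u k) x - g x)) ----> 0"
proof -
  define A where "A n = {Np p w (grad u) | u. midhull phi n u}" for n
  define d where "d n = Inf (A n)" for n
  have bdd: "bdd_below (A n)" for n unfolding A_def by (rule bdd_belowI[of _ 0]) (auto simp: Np_nonneg)
  have ne: "A n ~= {}" for n unfolding A_def using midhull.base[of n n phi] by blast
  have inA: "Np p w (grad u) \<in> A n" if "midhull phi n u" for n u unfolding A_def using that by blast
  have dle: "d n <= Np p w (grad u)" if "midhull phi n u" for n u
    unfolding d_def by (rule cInf_lower[OF inA[OF that] bdd])
  have dB: "d n <= B" for n using dle[OF midhull.base[of n n phi]] B[of n] by simp
  have dmono: "d m <= d n" if "m <= n" for m n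
    unfolding d_def
  proof (rule cInf_superset_mono[OF ne bdd])
    show "A n \<subseteq> A m" unfolding A_def using midhull_antimono[OF _ that] by blast
  qed
  have "\<exists>u. midhull phi n u \<and> Np p w (grad u) < d n + 1 / real (Suc n)" for n
  proof -
    have "Inf (A n) < d n + 1 / real (Suc n)" by (simp add: d_def)
    then obtain a where "a \<in> A n" "a < d n + 1 / real (Suc n)" using cInf_lessD[OF ne] by blast
    then show ?thesis unfolding A_def by blast
  qed
  then have "\<forall>n. \<exists>u. midhull phi n u \<and> Np p w (grad u) < d n + 1 / real (Suc n)" by blast
  then obtain u where u': "\<forall>n. midhull phi n (u n) \<and> Np p w (grad (u n)) < d n + 1 / real (Suc n)"
    by (rule choice[THEN exE])
  then have u: "midhull phi n (u n)" "Np p w (grad (u n)) < d n + 1 / real (Suc n)" for n by auto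
  have ut: "test_fun w (u n)" for n by (rule midhull_test[OF u(1) t])
  \<comment> \<open>The hulls shrink with \<open>n\<close>, so their infima increase; they are
    bounded by \<open>B\<close>.\<close>
  obtain D where D: "d ----> D" "\<forall>n. d n <= D"
    using incseq_convergent[of d B] dmono dB by (auto simp: incseq_def)
  have uB: "Np p w (grad (u n)) <= B + 1" for n
  proof -
    have "1 / real (Suc n) <= 1" by simp
    then show ?thesis using u(2)[of n] dB[of n] by linarith
  qed
  have B0: "B >= 0" using B[of 0] Np_nonneg[of p w "grad (phi 0)"] by linarith
  have half: "e / 2 + t < e" if "t < e / 2" for t e :: real using that by (simp add: field_simps)
  have arith: "a / 2 + b / 2 - X <= (D' - dk) / 2 + e1"
    if "dk <= X" "e2 <= e1" "a < dk + e1" "b < dl + e2" "dl <= D'" for a b X D' dk dl e1 e2 :: real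
    using that by (simp add: field_simps)
  \<comment> \<open>Both \<open>u k\<close> and \<open>u l\<close> lie in the hull of the tail from
    \<open>k\<close> on, hence so does their midpoint, whose energy is therefore at least
    \<open>d k\<close>.\<close>
  have gap: "(LINT x|M. convexity_gap p (grad (u k) x) (grad (u l) x)) <= (D - d k) / 2 + 1 / real (Suc k)" if "k <= l" for k l
  proof -
    have "midhull phi k (%x. (1/2) * (u k x + u l x))" by (rule midhull.mid[OF u(1) midhull_antimono[OF u(1) that]])
    define X where "X = Np p w (%x. (1/2) *\<^sub>R (grad (u k) x + grad (u l) x))"
    from dle[OF \<open>midhull phi k (%x. (1/2) * (u k x + u l x))\<close>] have "d k <= X"
      unfolding X_def by (simp only: grad_mid[OF ut ut, abs_def])
    moreover have "1 / real (Suc l) <= 1 / real (Suc k)" using that by (intro divide_left_mono) auto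
    ultimately show ?thesis
      unfolding Np_mid_le(1)[OF test_Lp(2)[OF ut] test_Lp(2)[OF ut]] X_def[symmetric]
      using u(2)[of k] u(2)[of l] D(2)[rule_format, of l] arith by blast
  qed
  have cauchy: "\<exists>N. \<forall>k\<ge>N. \<forall>l\<ge>N. Np p w (%x. grad (u k) x - grad (u l) x) < e" if "e > 0" for e
  proof -
    \<comment> \<open>Two gradients of energy at most \<open>B + 1\<close> then contribute exactly
      \<open>e / 2\<close>.\<close>
    define \<epsilon> where "\<epsilon> = e / (4 * (B + 1))"
    have \<epsilon>: "\<epsilon> > 0" using \<open>e > 0\<close> B0 by (simp add: \<epsilon>_def)
    obtain C where C: "C >= 0" "!!x y :: 'a. norm (x - y) powr p <= \<epsilon> * (norm x powr p + norm y powr p) + C * convexity_gap p x y"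
      by (rule uniform_convexity[where 'b='a, OF p1 \<epsilon>]) (rule that)
    have "(%k. C * ((D - d k) / 2 + 1 / real (Suc k))) ----> C * ((D - D) / 2 + 0)"
      using LIMSEQ_inverse_real_of_nat by (intro tendsto_intros D(1)) (simp_all add: inverse_eq_divide)
    then have "(%k. C * ((D - d k) / 2 + 1 / real (Suc k))) ----> 0" by simp
    then have "\<forall>\<^sub>F k in sequentially. C * ((D - d k) / 2 + 1 / real (Suc k)) < e / 2"
      using \<open>e > 0\<close> by (intro order_tendstoD) auto
    then obtain N where N: "!!k. k >= N ==> C * ((D - d k) / 2 + 1 / real (Suc k)) < e / 2"
      by (auto simp: eventually_sequentially)
    have small: "Np p w (%x. grad (u k) x - grad (u l) x) < e" if "k >= N" "k <= l" for k l
    proof -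
      note L = test_Lp(2)[OF ut]
      have "Np p w (%x. grad (u k) x - grad (u l) x) <= (LINT x|M. \<epsilon> * (norm (grad (u k) x) powr p + norm (grad (u l) x) powr p) + C * convexity_gap p (grad (u k) x) (grad (u l) x))"
        unfolding Np_def
        by (intro integral_mono Lp_integrable[OF Lp_diff(1)[OF L L p0(1)]] C(2) Bochner_Integration.integrable_add integrable_mult_right
            Lp_integrable[OF L] Np_mid_le(2)[OF L L])
      also have "... = \<epsilon> * (Np p w (grad (u k)) + Np p w (grad (u l))) + C * (LINT x|M. convexity_gap p (grad (u k) x) (grad (u l) x))"
        unfolding Np_def using Lp_integrable[OF L, of k] Lp_integrable[OF L, of l] Np_mid_le(2)[OF L[of k] L[of l]] by simp
      also have "... <= \<epsilon> * ((B + 1) + (B + 1)) + C * ((D - d k) / 2 + 1 / real (Suc k))"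
        using \<epsilon> C(1) by (intro add_mono mult_left_mono uB gap that) auto
      also have "\<epsilon> * ((B + 1) + (B + 1)) = e / 2" using B0 by (simp add: \<epsilon>_def field_simps)
      also have "e / 2 + C * ((D - d k) / 2 + 1 / real (Suc k)) < e" using N[OF that(1)] half by blast
      finally show ?thesis .
    qed
    show ?thesis
    proof (intro exI[of _ N] allI impI)
      fix k l assume "N <= k" "N <= l"
      then show "Np p w (%x. grad (u k) x - grad (u l) x) < e"
        using small[of k l] small[of l k] Np_diff_commute[of p w "grad (u k)" "grad (u l)"] by (cases "k <= l") auto
    qed
  qed
  obtain g where g: "Lp p w g" "(%k. Np p w (%x. grad (u k) x - g x)) ----> 0"
    by (rule Lp_complete[OF test_Lp(2)[OF ut] cauchy]) (assumption, rule that)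
  \<comment> \<open>The L^p distance to \<open>v\<close> is midpoint convex, so the hull elements
    inherit the convergence of \<open>phi\<close>.\<close>
  have uv: "(%k. Np p w (%x. u k x - v x)) ----> 0"
  proof (rule LIMSEQ_I)
    fix e :: real assume "e > 0"
    have "\<forall>\<^sub>F k in sequentially. Np p w (%x. phi k x - v x) < e / 2" using \<open>e > 0\<close> by (intro order_tendstoD(2)[OF v(2)]) auto
    then obtain N where N: "!!k. k >= N ==> Np p w (%x. phi k x - v x) < e / 2" by (auto simp: eventually_sequentially)
    show "\<exists>no. \<forall>n\<ge>no. norm (Np p w (%x. u n x - v x) - 0) < e"
    proof (intro exI[of _ N] allI impI)
      fix n assume n: "n >= N"
      have "Np p w (%x. u n x - v x) <= e / 2"
      proof (rule midhull_le[where \<Psi> = "%u. Np p w (%x. u x - v x)", OF t u(1)])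
        fix a b assume ab: "test_fun w a" "test_fun w b"
        have "(1/2) * (a x + b x) - v x = (1/2) *\<^sub>R ((a x - v x) + (b x - v x))" for x by (simp add: field_simps)
        then show "Np p w (%x. (1/2) * (a x + b x) - v x) <= (Np p w (%x. a x - v x) + Np p w (%x. b x - v x)) / 2"
          using Np_mid_le(3)[OF Lp_diff(1)[OF test_Lp(1)[OF ab(1)] v(1) p0(1)] Lp_diff(1)[OF test_Lp(1)[OF ab(2)] v(1) p0(1)]]
          by (simp only:)
      qed (use N n in \<open>auto simp: less_imp_le\<close>)
      then show "norm (Np p w (%x. u n x - v x) - 0) < e" using \<open>e > 0\<close> by (simp add: Np_nonneg)
    qed
  qed
  have "W0 p w v g" unfolding W0_def using v(1) g ut uv by blast
  then show ?thesis using that u(1) g(2) by blast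
qed

text \<open>A cell contains an open box and hence a point of the dense set; each generation thus has
  only countably many cells, each named by a point of \<open>D\<close>.\<close>

lemma cell_contains_dense:
  fixes x :: "'a::euclidean_space"
  assumes D: "!!X. open X ==> X ~= {} ==> \<exists>d\<in>D. d \<in> X"
  obtains d where "d \<in> D" "cell j d = cell j x"
proof -
  define a where "a = (\<Sum>b\<in>Basis. (real_of_int \<lfloor>2^j * (x \<bullet> b)\<rfloor> / 2^j) *\<^sub>R b)"
  define c where "c = a + (\<Sum>b\<in>Basis. (1 / 2^j) *\<^sub>R b)"
  have ab: "a \<bullet> b = real_of_int \<lfloor>2^j * (x \<bullet> b)\<rfloor> / 2^j" "c \<bullet> b = a \<bullet> b + 1 / 2^j" if "b \<in> Basis" for b
    using that by (simp_all add: a_def c_def inner_add_left)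
  have sub: "box a c \<subseteq> cell j x" by (auto simp: mem_cell_iff mem_box ab less_imp_le)
  have "box a c ~= {}" by (simp add: box_ne_empty ab)
  then obtain d where "d \<in> D" "d \<in> box a c" using D[OF open_box] by blast
  then show ?thesis using that cell_eq[of d j x] sub by blast
qed

section \<open>Rellich compactness and Poincare's inequality on balls\<close>

context bounded_open begin

lemma integral_abs_le_Np:
  fixes f :: "'a => real"
  assumes "Lp p w f"
  shows "integrable M (%x. \<bar>f x\<bar>)" "(LINT x|M. \<bar>f x\<bar>) <= measure M (space M) + Np p w f"
proof -
  interpret finite_measure M by (rule finite_M)
  note [measurable] = Lp_measurable[OF assms]
  have le: "\<bar>f x\<bar> <= 1 + \<bar>f x\<bar> powr p" for x
  proof (cases "\<bar>f x\<bar> <= 1")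
    case True then show ?thesis by (simp add: add_increasing2)
  next
    case False
    then have "\<bar>f x\<bar> powr 1 <= \<bar>f x\<bar> powr p" using p1 by (intro powr_mono) auto
    then show ?thesis using False by simp
  qed
  have i: "integrable M (%x. 1 + \<bar>f x\<bar> powr p)" using Lp_integrable[OF assms] by auto
  show i1: "integrable M (%x. \<bar>f x\<bar>)"
    by (rule Bochner_Integration.integrable_bound[OF i]) (use le in \<open>auto simp: abs_of_nonneg\<close>)
  have "(LINT x|M. \<bar>f x\<bar>) <= (LINT x|M. 1 + \<bar>f x\<bar> powr p)" by (rule integral_mono[OF i1 i le])
  also have "... = measure M (space M) + Np p w f" using Lp_integrable[OF assms] by (simp add: Np_def)
  finally show "(LINT x|M. \<bar>f x\<bar>) <= measure M (space M) + Np p w f" .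
qed

lemma test_lborel:
  assumes "test_fun w phi" "test_fun w psi"
  shows "(LINT x|lborel. \<bar>phi x\<bar>) = (LINT x|M. \<bar>phi x\<bar>)"
    "(LINT x|lborel. norm (grad phi x) powr p) = Np p w (grad phi)"
    "(LINT x|lborel. \<bar>phi x - psi x\<bar> powr p) = Np p w (%x. phi x - psi x)"
proof -
  note out = test_fun_outside[OF assms(1)] test_fun_outside[OF assms(2)]
  have [measurable]: "phi \<in> borel_measurable borel" "psi \<in> borel_measurable borel" "(%x. norm (grad phi x)) \<in> borel_measurable borel"
    using test_fun_bdd_supp[OF assms(1)] test_fun_bdd_supp[OF assms(2)] by (simp_all add: bdd_supp_measurable)
  show "(LINT x|lborel. \<bar>phi x\<bar>) = (LINT x|M. \<bar>phi x\<bar>)"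
    by (rule lebesgue_on_lborel(2)[OF w_open, symmetric]) (simp_all add: out)
  show "(LINT x|lborel. norm (grad phi x) powr p) = Np p w (grad phi)"
    unfolding Np_def by (rule lebesgue_on_lborel(2)[OF w_open, symmetric]) (simp_all add: out)
  show "(LINT x|lborel. \<bar>phi x - psi x\<bar> powr p) = Np p w (%x. phi x - psi x)"
    unfolding Np_def real_norm_def by (rule lebesgue_on_lborel(2)[OF w_open, symmetric]) (simp_all add: out)
qed

text \<open>A diagonal argument makes the averages over all dyadic cells converge. At a fixed
  generation these averages converge in L^p by domination, and the deviation from them is uniformly
  small by the gradient bound.\<close>

lemma rellich:
  fixes phi :: "nat => 'a => real"
  assumes t: "!!k. test_fun w (phi k)" and B: "!!k. Np p w (phi k) <= B" "!!k. Np p w (grad (phi k)) <= B"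
  obtains r v where "strict_mono r" "Lp p w v" "(%k. Np p w (%x. phi (r k) x - v x)) ----> 0"
proof -
  let ?n = "DIM('a)"
  obtain D :: "'a set" where D: "countable D" "!!X. open X ==> X ~= {} ==> \<exists>d\<in>D. d \<in> X"
    by (rule countable_dense_setE) (rule that)
  define A where "A = measure M (space M) + B"
  have sp: "bdd_supp (phi k)" for k by (rule test_fun_bdd_supp(1)[OF t])
  have bb: "bdd_borel (phi k)" for k by (rule bdd_supp_bdd_borel[OF sp])
  have l1: "(LINT x|lborel. \<bar>phi k x\<bar>) <= A" for k
    unfolding test_lborel(1)[OF t t] A_def using integral_abs_le_Np(2)[OF test_Lp(1)[OF t]] B(1)[of k] by (meson add_left_mono order_trans)
  \<comment> \<open>Cell integrals indexed by a generation and a point; restricted to points of the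
    dense set, they form a countable family for the diagonal selection.\<close>
  define f where "f k z = (LINT y|lborel. indicator (cell (fst z) (snd z)) y * phi k y)" for k and z :: "nat \<times> 'a"
  have fA: "\<bar>f k z\<bar> <= A" for k z
  proof -
    have "\<bar>f k z\<bar> <= (LINT y|lborel. \<bar>indicator (cell (fst z) (snd z)) y * phi k y\<bar>)" unfolding f_def by (rule integral_abs_bound)
    also have "... <= (LINT y|lborel. \<bar>phi k y\<bar>)"
      by (intro integral_mono integrable_abs cell_integrable bb bdd_supp_integrable sp) (auto split: split_indicator)
    finally show ?thesis using l1[of k] by linarith
  qed
  have "countable ((UNIV :: nat set) \<times> D)" using D(1) by simp
  moreover have "norm (f k z) <= A" for k z using fA by simp
  ultimately obtain r where r: "strict_mono r" "!!z. z \<in> (UNIV :: nat set) \<times> D ==> \<exists>l. (%k. f (r k) z) ----> l"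
    using function_convergent_subsequence[of "(UNIV :: nat set) \<times> D" f A] by blast
  have avg: "cell_avg j (phi k) x = (2^j)^?n * f k (j, x)" for j k x by (simp add: cell_avg_def f_def)
  have conv: "\<exists>l. (%k. cell_avg j (phi (r k)) x) ----> l" for j x
  proof -
    have "\<exists>d\<in>D. cell j d = cell j x" by (rule cell_contains_dense[of D j x]) (auto intro: D(2))
    then obtain d where d: "d \<in> D" "cell j d = cell j x" by (elim bexE)
    obtain l where "(%k. f (r k) (j, d)) ----> l" using r(2)[of "(j, d)"] d(1) by auto
    then have "(%k. (2^j)^?n * f (r k) (j, x)) ----> (2^j)^?n * l" using d(2) by (intro tendsto_intros) (simp add: f_def)
    then show ?thesis unfolding avg by blast
  qed
  define e where "e j x = lim (%k. cell_avg j (phi (r k)) x)" for j x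
  have e: "(%k. cell_avg j (phi (r k)) x) ----> e j x" for j x
    using conv[of j x] unfolding e_def by (auto simp: limI)
  have bc: "bdd_supp (cell_avg j (phi k))" for j k by (rule bdd_supp_cell_avg[OF sp])
  have [measurable]: "cell_avg j (phi k) \<in> borel_measurable borel" for j k using bdd_supp_measurable[OF bc] .
  obtain R where R: "!!x. x \<in> w ==> norm x <= R" using w_bounded by (auto simp: bounded_iff)
  \<comment> \<open>Averaging enlarges supports by at most the dimension, so all averages live in
    one fixed ball.\<close>
  define T where "T = R + ?n"
  have T: "cell_avg j (phi k) x = 0" if "norm x > T" for j k x
  proof -
    have "phi k y = 0" if y: "y \<in> cell j x" for y
    proof (rule test_fun_outside(1)[OF t])
      have "real ?n / 2^j <= real ?n" by (simp add: field_simps)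
      then have "norm x - norm y <= ?n" using cell_norm_diff[OF y] norm_triangle_ineq2[of x y] by (simp add: norm_minus_commute)
      then have "norm y > R" using \<open>norm x > T\<close> by (simp add: T_def)
      then show "y \<notin> w" using R[of y] by auto
    qed
    then have "cell_avg j (phi k) x = cell_avg j (%_. 0) x" by (intro cell_avg_cong) auto
    then show ?thesis by (simp add: cell_avg_const)
  qed
  have cb: "\<bar>cell_avg j (phi k) x\<bar> <= (2^j)^?n * A * indicator (cball 0 T) x" for j k x
    using T[of x j k] fA[of k "(j, x)"] unfolding avg by (auto simp: abs_mult intro!: mult_left_mono split: split_indicator)
  have em [measurable]: "e j \<in> borel_measurable borel" for j
    unfolding e_def by (rule borel_measurable_lim_metric) measurable
  have eb: "\<bar>e j x\<bar> <= (2^j)^?n * A * indicator (cball 0 T) x" for j x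
    by (rule LIMSEQ_le_const2[OF tendsto_rabs[OF e]]) (use cb in auto)
  have bsI: "bdd_supp h" if "h \<in> borel_measurable borel" "!!x. \<bar>h x\<bar> <= K * indicator (cball 0 T) x" for h :: "'a => real" and K
  proof -
    have "\<bar>h x\<bar> <= \<bar>K\<bar>" for x
      by (rule order_trans[OF that(2)]) (auto split: split_indicator)
    moreover have "norm x <= T" if "h x ~= 0" for x
      using that \<open>!!x. \<bar>h x\<bar> <= K * indicator (cball 0 T) x\<close>[of x] by (auto split: split_indicator_asm)
    ultimately show ?thesis using that(1) unfolding bdd_supp_def bdd_borel_def by blast
  qed
  have es: "bdd_supp (e j)" for j by (rule bsI[OF em eb])
  have lim: "(%k. \<integral>x. \<bar>cell_avg j (phi (r k)) x - e j x\<bar> powr p \<partial>lborel) ----> 0" for j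
  proof -
    let ?K = "((2^j)^?n * A + (2^j)^?n * A) powr p"
    have "(%k. \<integral>x. \<bar>cell_avg j (phi (r k)) x - e j x\<bar> powr p \<partial>lborel) ----> (LINT x|(lborel :: 'a measure). 0)"
    proof (rule integral_dominated_convergence)
      show "integrable lborel (%x::'a. ?K * indicator (cball 0 T) x)"
      proof (rule bdd_supp_integrable, rule bsI)
        show "(%x::'a. ?K * indicator (cball 0 T) x) \<in> borel_measurable borel"
          by (intro borel_measurable_times borel_measurable_const borel_measurable_indicator borel_closed closed_cball)
        show "\<bar>?K * indicator (cball 0 T) x\<bar> <= ?K * indicator (cball 0 T) x" for x :: 'a
          by (rule eq_refl, rule abs_of_nonneg, rule mult_nonneg_nonneg) auto
      qed
      show "AE x in lborel. (%k. \<bar>cell_avg j (phi (r k)) x - e j x\<bar> powr p) ----> 0"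
      proof (rule AE_I2)
        fix x
        have "(%k. \<bar>cell_avg j (phi (r k)) x - e j x\<bar>) ----> 0" using e[of j x] by (intro tendsto_rabs_zero LIM_zero)
        then have "(%k. \<bar>cell_avg j (phi (r k)) x - e j x\<bar> powr p) ----> 0 powr p"
          by (intro tendsto_powr2 tendsto_const p0) auto
        then show "(%k. \<bar>cell_avg j (phi (r k)) x - e j x\<bar> powr p) ----> 0" by simp
      qed
      show "AE x in lborel. norm (\<bar>cell_avg j (phi (r k)) x - e j x\<bar> powr p) <= ?K * indicator (cball 0 T) x" for k
      proof (rule AE_I2)
        fix x
        show "norm (\<bar>cell_avg j (phi (r k)) x - e j x\<bar> powr p) <= ?K * indicator (cball 0 T) x"
        proof (cases "x \<in> cball 0 T")
          case True
          have "\<bar>cell_avg j (phi (r k)) x - e j x\<bar> <= (2^j)^?n * A + (2^j)^?n * A"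
          proof -
            have "\<bar>cell_avg j (phi (r k)) x\<bar> <= (2^j)^?n * A" using cb[of j "r k" x] True by simp
            moreover have "\<bar>e j x\<bar> <= (2^j)^?n * A" using eb[of j x] True by simp
            ultimately show ?thesis by (rule order_trans[OF abs_triangle_ineq4 add_mono])
          qed
          then show ?thesis using True by (simp add: powr_mono2 p0)
        next
          case False then show ?thesis using cb[of j "r k" x] eb[of j x] by simp
        qed
      qed
    qed measurable
    then show ?thesis by simp
  qed
  have B0: "B >= 0" using B(1)[of 0] Np_nonneg[of p w "phi 0"] by linarith
  \<comment> \<open>The bound for the deviation from the averages of generation \<open>j\<close>,
    uniform in the index of the sequence.\<close>
  define \<alpha> where "\<alpha> j = 2^?n * (?n / 2^j) powr p * B" for j
  have ap: "(LINT x|lborel. \<bar>phi k x - cell_avg j (phi k) x\<bar> powr p) <= \<alpha> j" for j k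
  proof -
    have "(LINT x|lborel. \<bar>phi k x - cell_avg j (phi k) x\<bar> powr p) <= 2^?n * (?n / 2^j) powr p * (LINT x|lborel. norm (grad (phi k) x) powr p)"
      by (rule cell_avg_approx[OF t]) (use p1 in simp)
    also have "... <= \<alpha> j" unfolding \<alpha>_def test_lborel(2)[OF t t] by (intro mult_left_mono B) auto
    finally show ?thesis .
  qed
  have \<alpha>0: "\<alpha> ----> 0"
  proof -
    have "(%j. real ?n / 2^j) ----> 0" using LIMSEQ_divide_realpow_zero[of 2 "real ?n"] by simp
    then have "(%j. (real ?n / 2^j) powr p) ----> 0 powr p" by (intro tendsto_powr2 tendsto_const p0) auto
    then have "(%j. 2^?n * (real ?n / 2^j) powr p * B) ----> 2^?n * (0 powr p) * B" by (intro tendsto_mult_right tendsto_mult_left)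
    then show ?thesis by (simp add: \<alpha>_def[abs_def])
  qed
  define \<beta> where "\<beta> j k = (LINT x|lborel. \<bar>cell_avg j (phi (r k)) x - e j x\<bar> powr p)" for j k
  have main: "Np p w (%x. phi (r k) x - phi (r l) x) <= 2 powr p * (2 powr p * (\<alpha> j + \<beta> j k) + 2 powr p * (\<alpha> j + \<beta> j l))" for j k l
  proof -
    define a where "a k x = \<bar>phi (r k) x - cell_avg j (phi (r k)) x\<bar>" for k x
    define b where "b k x = \<bar>cell_avg j (phi (r k)) x - e j x\<bar>" for k x
    have ia: "integrable lborel (%x. a k x powr p)" for k
      unfolding a_def by (intro bdd_supp_integrable bdd_supp_powr bdd_supp_diff sp bc p0)
    have ib: "integrable lborel (%x. b k x powr p)" for k
      unfolding b_def by (intro bdd_supp_integrable bdd_supp_powr bdd_supp_diff bc es p0)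
    have "(LINT x|lborel. \<bar>phi (r k) x - phi (r l) x\<bar> powr p)
       <= (LINT x|lborel. 2 powr p * (2 powr p * (a k x powr p + b k x powr p) + 2 powr p * (a l x powr p + b l x powr p)))"
    proof (rule integral_mono)
      show "integrable lborel (%x. \<bar>phi (r k) x - phi (r l) x\<bar> powr p)" by (intro bdd_supp_integrable bdd_supp_powr bdd_supp_diff sp p0)
      show "integrable lborel (%x. 2 powr p * (2 powr p * (a k x powr p + b k x powr p) + 2 powr p * (a l x powr p + b l x powr p)))"
        by (intro integrable_mult_right Bochner_Integration.integrable_add ia ib)
      fix x
      have "\<bar>phi (r k) x - phi (r l) x\<bar> <= (a k x + b k x) + (a l x + b l x)" unfolding a_def b_def by linarith
      then have "\<bar>phi (r k) x - phi (r l) x\<bar> powr p <= ((a k x + b k x) + (a l x + b l x)) powr p" by (intro powr_mono2 p0) auto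
      also have "... <= 2 powr p * ((a k x + b k x) powr p + (a l x + b l x) powr p)"
        by (rule powr_add_le) (use p0 in \<open>auto simp: a_def b_def\<close>)
      also have "... <= 2 powr p * (2 powr p * (a k x powr p + b k x powr p) + 2 powr p * (a l x powr p + b l x powr p))"
        by (intro mult_left_mono add_mono powr_add_le p0) (auto simp: a_def b_def)
      finally show "\<bar>phi (r k) x - phi (r l) x\<bar> powr p <= 2 powr p * (2 powr p * (a k x powr p + b k x powr p) + 2 powr p * (a l x powr p + b l x powr p))" .
    qed
    also have "... = 2 powr p * (2 powr p * ((LINT x|lborel. a k x powr p) + (LINT x|lborel. b k x powr p)) + 2 powr p * ((LINT x|lborel. a l x powr p) + (LINT x|lborel. b l x powr p)))"
      using ia ib by simp
    also have "... <= 2 powr p * (2 powr p * (\<alpha> j + \<beta> j k) + 2 powr p * (\<alpha> j + \<beta> j l))"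
      unfolding a_def b_def \<beta>_def by (intro mult_left_mono add_mono ap order_refl) auto
    finally show ?thesis unfolding test_lborel(3)[OF t t] .
  qed
  have cauchy: "\<exists>N. \<forall>k\<ge>N. \<forall>l\<ge>N. Np p w (%x. phi (r k) x - phi (r l) x) < \<epsilon>" if "\<epsilon> > 0" for \<epsilon>
  proof -
    \<comment> \<open>With all four error terms below \<open>eta\<close>, the bound in
      \<open>main\<close> is half of \<epsilon>. The generation \<open>j\<close> is fixed before
      \<open>N\<close> is chosen.\<close>
    define eta where "eta = \<epsilon> / (2 powr p * (2 powr p * 8))"
    have eta: "eta > 0" using that by (simp add: eta_def)
    obtain j where j: "\<alpha> j < eta" using eventually_happens'[OF sequentially_bot order_tendstoD(2)[OF \<alpha>0 eta]] by blast
    have "\<forall>\<^sub>F k in sequentially. \<beta> j k < eta" unfolding \<beta>_def by (rule order_tendstoD(2)[OF lim eta])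
    then obtain N where N: "!!k. k >= N ==> \<beta> j k < eta" by (auto simp: eventually_sequentially)
    show ?thesis
    proof (intro exI[of _ N] allI impI)
      fix k l assume k: "N <= k" and l: "N <= l"
      have "Np p w (%x. phi (r k) x - phi (r l) x) <= 2 powr p * (2 powr p * (\<alpha> j + \<beta> j k) + 2 powr p * (\<alpha> j + \<beta> j l))" by (rule main)
      also have "... <= 2 powr p * (2 powr p * (eta + eta) + 2 powr p * (eta + eta))"
        using j N[OF k] N[OF l] by (intro mult_left_mono add_mono) auto
      also have "... = 2 powr p * (2 powr p * 4) * eta" by (simp add: algebra_simps)
      also have "... < 2 powr p * (2 powr p * 8) * eta" using eta by (intro mult_strict_right_mono) auto
      also have "... = \<epsilon>" by (simp add: eta_def)
      finally show "Np p w (%x. phi (r k) x - phi (r l) x) < \<epsilon>" .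
    qed
  qed
  obtain v where v: "Lp p w v" "(%k. Np p w (%x. phi (r k) x - v x)) ----> 0"
    by (rule Lp_complete[of "%k. phi (r k)", OF test_Lp(1)[OF t] cauchy]) (assumption, rule that)
  show ?thesis by (rule that[OF r(1) v])
qed

text \<open>The constant \<open>c\<close> is a value \<open>phi y\<close> at a well-chosen point,
  which replaces the mean value over the ball.\<close>

lemma poincare_ball_smooth:
  assumes phi: "test_fun w phi" and rho: "rho > 0" and sub: "ball a rho \<subseteq> w"
  obtains c where "(LINT x|M. indicator (ball a rho) x * \<bar>phi x - c\<bar> powr p)
    <= 2^DIM('a) * (2 * rho) powr p * (LINT x|M. indicator (ball a rho) x * norm (grad phi x) powr p)"
proof -
  let ?B = "ball a rho" and ?K = "2^DIM('a) * (2 * rho) powr p"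
  have s: "smooth_fun phi" by (rule test_fun_smooth[OF phi])
  note bs = test_fun_bdd_supp[OF phi]
  have [measurable]: "phi \<in> borel_measurable borel" "(%x. norm (grad phi x)) \<in> borel_measurable borel"
    using bs by (simp_all add: bdd_supp_measurable)
  have [measurable]: "?B \<in> sets borel" by simp
  have indB: "bdd_supp (indicator ?B)"
  proof -
    have "norm x <= norm a + rho" if "x \<in> ?B" for x
      using that norm_triangle_sub[of x a] by (simp add: dist_norm norm_minus_commute)
    then show ?thesis unfolding bdd_supp_def by (auto simp: bdd_borel_indicator indicator_def intro!: exI[of _ "norm a + rho"])
  qed
  have i1: "integrable lborel (%x. indicator ?B x * \<bar>phi x - c\<bar> powr p)" for c
    by (intro bdd_supp_integrable bdd_supp_mult indB bdd_borel_powr bdd_borel_diff bdd_supp_bdd_borel bs bdd_borel_const p0)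
  have i2: "integrable lborel (%x. indicator ?B x * norm (grad phi x) powr p)"
    using bdd_supp_integrable[OF bdd_supp_mult[OF indB bdd_borel_powr[OF bdd_supp_bdd_borel[OF bs(2)] p0(1)]]] by simp
  have nn1: "(\<integral>\<^sup>+x. indicator ?B x * ennreal (\<bar>phi x - c\<bar> powr p) \<partial>lborel) = ennreal (LINT x|lborel. indicator ?B x * \<bar>phi x - c\<bar> powr p)" for c
  proof -
    have "(\<integral>\<^sup>+x. indicator ?B x * ennreal (\<bar>phi x - c\<bar> powr p) \<partial>lborel) = (\<integral>\<^sup>+x. ennreal (indicator ?B x * \<bar>phi x - c\<bar> powr p) \<partial>lborel)"
      by (intro nn_integral_cong) (auto split: split_indicator)
    then show ?thesis using nn_integral_eq_integral[OF i1] by simp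
  qed
  have nn2: "(\<integral>\<^sup>+x. indicator ?B x * ennreal (norm (grad phi x) powr p) \<partial>lborel) = ennreal (LINT x|lborel. indicator ?B x * norm (grad phi x) powr p)"
  proof -
    have "(\<integral>\<^sup>+x. indicator ?B x * ennreal (norm (grad phi x) powr p) \<partial>lborel) = (\<integral>\<^sup>+x. ennreal (indicator ?B x * norm (grad phi x) powr p) \<partial>lborel)"
      by (intro nn_integral_cong) (auto split: split_indicator)
    then show ?thesis using nn_integral_eq_integral[OF i2] by simp
  qed
  define G where "G = (LINT x|lborel. indicator ?B x * norm (grad phi x) powr p)"
  have G0: "G >= 0" unfolding G_def by (auto intro: integral_nonneg_AE)
  define I where "I y = (LINT x|lborel. indicator ?B x * \<bar>phi x - phi y\<bar> powr p)" for y
  have pc: "(\<integral>\<^sup>+x. \<integral>\<^sup>+y. indicator ?B x * indicator ?B y * ennreal (\<bar>phi x - phi y\<bar> powr p) \<partial>lborel \<partial>lborel)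
    <= ennreal ?K * emeasure lborel ?B * (\<integral>\<^sup>+x. indicator ?B x * ennreal (norm (grad phi x) powr p) \<partial>lborel)"
  proof (rule poincare_convex[OF s])
    show "norm (x - y) <= 2 * rho" if "x \<in> ?B" "y \<in> ?B" for x y
      using that norm_triangle_ineq4[of "x - a" "y - a"] by (simp add: dist_norm norm_minus_commute)
  qed (use p1 in auto)
  have Im [measurable]: "(%y. \<integral>\<^sup>+x. indicator ?B x * ennreal (\<bar>phi x - phi y\<bar> powr p) \<partial>lborel) \<in> borel_measurable lborel"
    by measurable
  \<comment> \<open>Were the estimate false for every \<open>y\<close> in the ball, integrating over
    \<open>y\<close> would contradict the bound on the double integral of differences.\<close>
  have ex: "\<exists>y\<in>?B. I y <= ?K * G"
  proof (rule ccontr)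
    assume "\<not> ?thesis"
    then have gt: "I y > ?K * G" if "y \<in> ?B" for y using that by (meson not_le)
    have eB: "emeasure lborel ?B ~= 0" "emeasure lborel ?B ~= \<infinity>"
      using emeasure_bounded_finite[of ?B] rho open_not_negligible[of ?B] by (auto simp: completion.null_sets_outer negligible_iff_null_sets null_sets_def)
    have "(\<integral>\<^sup>+y. ennreal (?K * G) * indicator ?B y \<partial>lborel) < (\<integral>\<^sup>+y. indicator ?B y * ennreal (I y) \<partial>lborel)"
    proof (rule nn_integral_less)
      show "(%y. ennreal (?K * G) * indicator ?B y) \<in> borel_measurable lborel" by measurable
      show "(%y. indicator ?B y * ennreal (I y)) \<in> borel_measurable lborel"
        unfolding I_def nn1[symmetric] by measurable
      show "(\<integral>\<^sup>+y. ennreal (?K * G) * indicator ?B y \<partial>lborel) ~= \<infinity>"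
        using eB by (subst nn_integral_cmult_indicator) (auto simp: ennreal_mult_eq_top_iff)
      show "AE y in lborel. ennreal (?K * G) * indicator ?B y <= indicator ?B y * ennreal (I y)"
      proof (rule AE_I2)
        fix y
        show "ennreal (?K * G) * indicator ?B y <= indicator ?B y * ennreal (I y)"
        proof (cases "y \<in> ?B")
          case True
          show ?thesis using ennreal_leI[OF less_imp_le[OF gt[OF True]]] True by simp
        qed simp
      qed
      show "\<not> (AE y in lborel. indicator ?B y * ennreal (I y) <= ennreal (?K * G) * indicator ?B y)"
      proof
        assume "AE y in lborel. indicator ?B y * ennreal (I y) <= ennreal (?K * G) * indicator ?B y"
        then have "AE y in lborel. y \<notin> ?B"
        proof eventually_elim
          case (elim y)
          show ?case
          proof
            assume y: "y \<in> ?B"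
            have "0 <= ?K * G" using G0 by simp
            then have "ennreal (?K * G) < ennreal (I y)" using gt[OF y] by (intro ennreal_lessI) linarith+
            then show False using elim y by simp
          qed
        qed
        then have "emeasure lborel ?B = 0" by (subst (asm) AE_iff_measurable[of ?B]) auto
        then show False using eB by simp
      qed
    qed
    also have "(\<integral>\<^sup>+y. indicator ?B y * ennreal (I y) \<partial>lborel) = (\<integral>\<^sup>+x. \<integral>\<^sup>+y. indicator ?B x * indicator ?B y * ennreal (\<bar>phi x - phi y\<bar> powr p) \<partial>lborel \<partial>lborel)"
    proof (intro nn_integral_cong)
      fix y :: 'a
      have "indicator ?B y * ennreal (I y) = indicator ?B y * (\<integral>\<^sup>+x. indicator ?B x * ennreal (\<bar>phi x - phi y\<bar> powr p) \<partial>lborel)"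
        unfolding I_def nn1 ..
      also have "... = (\<integral>\<^sup>+x. indicator ?B y * (indicator ?B x * ennreal (\<bar>phi x - phi y\<bar> powr p)) \<partial>lborel)"
        by (rule nn_integral_cmult[symmetric]) measurable
      also have "... = (\<integral>\<^sup>+x. indicator ?B y * indicator ?B x * ennreal (\<bar>phi y - phi x\<bar> powr p) \<partial>lborel)"
        by (simp add: mult.assoc abs_minus_commute)
      finally show "indicator ?B y * ennreal (I y) = (\<integral>\<^sup>+x. indicator ?B y * indicator ?B x * ennreal (\<bar>phi y - phi x\<bar> powr p) \<partial>lborel)" .
    qed
    also have "... <= ennreal ?K * emeasure lborel ?B * ennreal G" using pc unfolding nn2 G_def .
    also have "... = ennreal (?K * G) * emeasure lborel ?B" using G0 by (simp add: ennreal_mult mult_ac)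
    also have "... = (\<integral>\<^sup>+y. ennreal (?K * G) * indicator ?B y \<partial>lborel)" by (subst nn_integral_cmult_indicator) auto
    finally show False by simp
  qed
  then obtain y where y: "I y <= ?K * G" by blast
  have e1: "(LINT x|M. indicator ?B x * \<bar>phi x - c\<bar> powr p) = (LINT x|lborel. indicator ?B x * \<bar>phi x - c\<bar> powr p)" for c
    by (rule lebesgue_on_lborel(2)[OF w_open]) (use sub in \<open>auto split: split_indicator\<close>)
  have e2: "(LINT x|M. indicator ?B x * norm (grad phi x) powr p) = G"
    unfolding G_def by (rule lebesgue_on_lborel(2)[OF w_open]) (use sub in \<open>auto split: split_indicator\<close>)
  show ?thesis by (rule that[of "phi y"]) (use y in \<open>simp add: e1 e2 I_def\<close>)
qed

text \<open>Transfer from a nearby test function. The constant comes from that test function, so the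
  slack \<open>e\<close> avoids passing to a limit in \<open>c\<close>; a fixed \<open>e\<close>
  suffices for the application.\<close>

lemma poincare_ball:
  assumes W: "W0 p w v g" and rho: "rho > 0" and sub: "ball a rho \<subseteq> w" and "e > 0"
  obtains c where "(LINT x|M. indicator (ball a rho) x * \<bar>v x - c\<bar> powr p)
    <= 2 powr p * (2^DIM('a) * (2 * rho) powr p * (2 powr p * (LINT x|M. indicator (ball a rho) x * norm (g x) powr p))) + e"
proof -
  let ?B = "ball a rho" and ?K = "2^DIM('a) * (2 * rho) powr p :: real"
  define e' where "e' = e / (2 powr p + 2 powr p * (?K * 2 powr p))"
  have den: "2 powr p + 2 powr p * (?K * 2 powr p) > 0" by (intro add_pos_nonneg) auto
  have e': "e' > 0" unfolding e'_def using \<open>e > 0\<close> den by simp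
  obtain phi where phi: "test_fun w phi" "Np p w (%x. phi x - v x) < e'" "Np p w (%x. grad phi x - g x) < e'"
    by (rule W0_close[OF W e']) (rule that)
  obtain c where c: "(LINT x|M. indicator ?B x * \<bar>phi x - c\<bar> powr p) <= ?K * (LINT x|M. indicator ?B x * norm (grad phi x) powr p)"
    by (rule poincare_ball_smooth[OF phi(1) rho sub]) (rule that)
  note Lv = W0_Lp(1)[OF W] and Lg = W0_Lp(2)[OF W]
  note [measurable] = Lp_measurable[OF Lv] Lp_measurable[OF Lg] test_measurable[OF phi(1)]
  have [measurable]: "(indicator ?B :: 'a => real) \<in> borel_measurable M"
    by (rule borel_M, rule borel_measurable_indicator, rule borel_open) simp
  have Lc: "Lp p w (%x. c)" by (rule bounded_Lp[where K = "\<bar>c\<bar>"]) auto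
  have ind_int: "integrable M (%x. indicator ?B x * norm (f x) powr p)" if "Lp p w f" for f :: "'a => real"
  proof (rule Bochner_Integration.integrable_bound[OF Lp_integrable[OF that]])
    show "(%x. indicator ?B x * norm (f x) powr p) \<in> borel_measurable M" using Lp_measurable[OF that] by measurable
  qed (auto split: split_indicator)
  have ind_int2: "integrable M (%x. indicator ?B x * norm (f x) powr p)" if "Lp p w f" for f :: "'a => 'a"
  proof (rule Bochner_Integration.integrable_bound[OF Lp_integrable[OF that]])
    show "(%x. indicator ?B x * norm (f x) powr p) \<in> borel_measurable M" using Lp_measurable[OF that] by measurable
  qed (auto split: split_indicator)
  note Ld = Lp_diff(1)[OF test_Lp(1)[OF phi(1)] Lv p0(1)] Lp_diff(1)[OF test_Lp(2)[OF phi(1)] Lg p0(1)]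
  have "(LINT x|M. indicator ?B x * \<bar>v x - c\<bar> powr p) <= (LINT x|M. 2 powr p * (norm (phi x - v x) powr p + indicator ?B x * norm (phi x - c) powr p))"
  proof (rule integral_mono)
    show "integrable M (%x. indicator ?B x * \<bar>v x - c\<bar> powr p)" using ind_int[OF Lp_diff(1)[OF Lv Lc p0(1)]] by simp
    show "integrable M (%x. 2 powr p * (norm (phi x - v x) powr p + indicator ?B x * norm (phi x - c) powr p))"
      by (intro integrable_mult_right Bochner_Integration.integrable_add Lp_integrable[OF Ld(1)] ind_int Lp_diff(1)[OF test_Lp(1)[OF phi(1)] Lc p0(1)])
    fix x
    have "\<bar>v x - c\<bar> powr p <= (\<bar>phi x - v x\<bar> + \<bar>phi x - c\<bar>) powr p" by (intro powr_mono2 p0) auto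
    also have "... <= 2 powr p * (\<bar>phi x - v x\<bar> powr p + \<bar>phi x - c\<bar> powr p)" by (rule powr_add_le) (use p0 in auto)
    finally show "indicator ?B x * \<bar>v x - c\<bar> powr p <= 2 powr p * (norm (phi x - v x) powr p + indicator ?B x * norm (phi x - c) powr p)"
      by (auto split: split_indicator)
  qed
  also have "... = 2 powr p * (Np p w (%x. phi x - v x) + (LINT x|M. indicator ?B x * \<bar>phi x - c\<bar> powr p))"
    using Lp_integrable[OF Ld(1)] ind_int[OF Lp_diff(1)[OF test_Lp(1)[OF phi(1)] Lc p0(1)]] by (simp add: Np_def)
  also have "... <= 2 powr p * (e' + ?K * (2 powr p * ((LINT x|M. indicator ?B x * norm (g x) powr p) + e')))"
  proof (intro mult_left_mono add_mono)
    have "(LINT x|M. indicator ?B x * norm (grad phi x) powr p) <= (LINT x|M. 2 powr p * (indicator ?B x * norm (g x) powr p + norm (grad phi x - g x) powr p))"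
    proof (rule integral_mono[OF ind_int2[OF test_Lp(2)[OF phi(1)]]])
      show "integrable M (%x. 2 powr p * (indicator ?B x * norm (g x) powr p + norm (grad phi x - g x) powr p))"
        by (intro integrable_mult_right Bochner_Integration.integrable_add Lp_integrable[OF Ld(2)] ind_int2 Lg)
      fix x
      have "norm (grad phi x) powr p <= (norm (g x) + norm (grad phi x - g x)) powr p"
        by (intro powr_mono2 p0 norm_triangle_sub) auto
      also have "... <= 2 powr p * (norm (g x) powr p + norm (grad phi x - g x) powr p)" by (rule powr_add_le) (use p0 in auto)
      finally show "indicator ?B x * norm (grad phi x) powr p <= 2 powr p * (indicator ?B x * norm (g x) powr p + norm (grad phi x - g x) powr p)"
        by (auto split: split_indicator)
    qed
    also have "... = 2 powr p * ((LINT x|M. indicator ?B x * norm (g x) powr p) + Np p w (%x. grad phi x - g x))"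
      using Lp_integrable[OF Ld(2)] ind_int2[OF Lg] by (simp add: Np_def)
    also have "... <= 2 powr p * ((LINT x|M. indicator ?B x * norm (g x) powr p) + e')"
      using phi(3) by (intro mult_left_mono add_left_mono) auto
    finally have le: "(LINT x|M. indicator ?B x * norm (grad phi x) powr p) <= 2 powr p * ((LINT x|M. indicator ?B x * norm (g x) powr p) + e')" .
    have "?K * (LINT x|M. indicator ?B x * norm (grad phi x) powr p) <= ?K * (2 powr p * ((LINT x|M. indicator ?B x * norm (g x) powr p) + e'))"
      by (rule mult_left_mono[OF le]) simp
    then show "(LINT x|M. indicator ?B x * \<bar>phi x - c\<bar> powr p) <= ?K * (2 powr p * ((LINT x|M. indicator ?B x * norm (g x) powr p) + e'))"
      using c by (rule order_trans[rotated])
  qed (use phi(2) in auto)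
  also have "... = 2 powr p * (?K * (2 powr p * (LINT x|M. indicator ?B x * norm (g x) powr p))) + (2 powr p + 2 powr p * (?K * 2 powr p)) * e'"
    by (simp add: algebra_simps)
  also have "(2 powr p + 2 powr p * (?K * 2 powr p)) * e' = e" unfolding e'_def using den by simp
  finally show ?thesis by (rule that)
qed

end

section \<open>Duality maps and the energy functional\<close>

lemma is_norm_funD:
  assumes "is_norm_fun N"
  shows "N xi >= 0" "N 0 = 0" "xi ~= 0 ==> N xi > 0" "N (c *\<^sub>R xi) = \<bar>c\<bar> * N xi" "N (xi + eta) <= N xi + N eta"
    "N (- xi) = N xi" "\<bar>N xi - N eta\<bar> <= N (xi - eta)"
proof -
  show nn: "N xi >= 0" for xi using assms by (simp add: is_norm_fun_def)
  show "N 0 = 0" using assms by (simp add: is_norm_fun_def)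
  show "xi ~= 0 ==> N xi > 0" using assms nn[of xi] by (simp add: is_norm_fun_def less_le)
  show sc: "N (c *\<^sub>R xi) = \<bar>c\<bar> * N xi" for c xi using assms by (simp add: is_norm_fun_def)
  show tri: "N (xi + eta) <= N xi + N eta" for xi eta using assms by (simp add: is_norm_fun_def)
  show neg: "N (- xi) = N xi" for xi using sc[of "-1" xi] by simp
  have "N xi <= N (xi - eta) + N eta" using tri[of "xi - eta" eta] by simp
  moreover have "N eta <= N (xi - eta) + N xi" using tri[of "eta - xi" xi] neg[of "xi - eta"] by simp
  ultimately show "\<bar>N xi - N eta\<bar> <= N (xi - eta)" by (simp add: abs_le_iff)
qed

text \<open>The properties of \<open>H x\<close> for a fixed point \<open>x\<close> outside a null
  set; isolating them lets the algebra of the operator be done without measure theory.\<close>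

definition good_norm :: "real => ('b::euclidean_space => real) => bool" where
  "good_norm \<nu> N \<longleftrightarrow> is_norm_fun N \<and> (\<forall>xi. xi ~= 0 --> N differentiable (at xi)) \<and> (\<forall>xi. N xi <= \<nu> * norm xi)"

text \<open>The operator \<open>Aop\<close> with the space variable frozen. The absolute value on
  the real line is also covered, which gives the zero-order term.\<close>

definition duality_map :: "real => ('b::euclidean_space => real) => 'b => 'b" where
  "duality_map p N xi = grad (%eta. N eta powr p / p) xi"

lemma duality_map_deriv:
  fixes N :: "'b::euclidean_space => real"
  assumes p: "p > 1" and N: "good_norm \<nu> N"
  shows "((%eta. N eta powr p / p) has_derivative (%h. duality_map p N xi \<bullet> h)) (at xi)"
  unfolding duality_map_def
proof (rule grad_works)
  have n: "is_norm_fun N" using N by (simp add: good_norm_def)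
  show "(%eta. N eta powr p / p) differentiable (at xi)"
  proof (cases "xi = 0")
    case False
    then obtain N' where N': "(N has_derivative N') (at xi)" using N by (auto simp: good_norm_def differentiable_def)
    have "((%t. t powr p) has_real_derivative p * N xi powr (p - 1)) (at (N xi))"
      by (rule has_real_derivative_powr) (rule is_norm_funD(3)[OF n False])
    then have "((%t. t powr p / p) has_real_derivative p * N xi powr (p - 1) / p) (at (N xi))" by (rule DERIV_cdivide)
    from has_derivative_compose[OF N' this[unfolded has_field_derivative_def]]
    show ?thesis by (auto simp: differentiable_def)
  next
    case True
    have "\<nu> >= 0"
    proof -
      obtain b :: 'b where b: "b \<in> Basis" using nonempty_Basis by blast
      have "0 <= N b" by (rule is_norm_funD(1)[OF n])
      also have "N b <= \<nu> * norm b" using N by (simp add: good_norm_def)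
      finally show ?thesis using b by simp
    qed
    \<comment> \<open>A norm is not differentiable at the origin, but its p-th power is of order
      \<open>norm h powr p\<close>, which is \<open>o(norm h)\<close> because
      \<open>p > 1\<close>.\<close>
    have "((%eta. N eta powr p / p) has_derivative (%h. 0)) (at 0)"
      unfolding has_derivative_at
    proof (intro conjI)
      have "((%h. \<nu> powr p / p * norm h powr (p - 1)) \<longlongrightarrow> \<nu> powr p / p * 0 powr (p - 1)) (at (0::'b))"
        using p by (intro tendsto_mult_left tendsto_powr2 tendsto_const) (auto intro!: tendsto_norm_zero tendsto_ident_at)
      then have lim: "((%h. \<nu> powr p / p * norm h powr (p - 1)) \<longlongrightarrow> 0) (at (0::'b))" by simp
      show "((%h. norm (N (0 + h) powr p / p - N 0 powr p / p - 0) / norm h) \<longlongrightarrow> 0) (at 0)"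
      proof (rule tendsto_sandwich[OF _ _ tendsto_const lim])
        show "\<forall>\<^sub>F h in at 0. norm (N (0 + h) powr p / p - N 0 powr p / p - 0) / norm h <= \<nu> powr p / p * norm h powr (p - 1)"
        proof (rule always_eventually, rule allI)
          fix h :: 'b
          show "norm (N (0 + h) powr p / p - N 0 powr p / p - 0) / norm h <= \<nu> powr p / p * norm h powr (p - 1)"
          proof (cases "h = 0")
            case False
            have "N h powr p <= (\<nu> * norm h) powr p" using N p is_norm_funD(1)[OF n] by (intro powr_mono2) (auto simp: good_norm_def)
            then have "N h powr p / p / norm h <= \<nu> powr p * norm h powr p / p / norm h"
              using p by (intro divide_right_mono) (auto simp: powr_mult)
            also have "... = \<nu> powr p / p * norm h powr (p - 1)" using False by (simp add: powr_diff)
            finally show ?thesis using p is_norm_funD(2)[OF n] by simp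
          qed simp
        qed
      qed simp
    qed simp
    then show ?thesis using True by (auto simp: differentiable_def)
  qed
qed

text \<open>The directional derivative along the fixed sequence \<open>1 / Suc m\<close>: a
  sequential form suits both measurability of the operator and dominated convergence.\<close>

lemma duality_map_quotient:
  assumes p: "p > 1" and N: "good_norm \<nu> N"
  shows "(%m. real (Suc m) * (N (xi + (1 / real (Suc m)) *\<^sub>R eta) powr p - N xi powr p) / p) ----> duality_map p N xi \<bullet> eta"
proof -
  define f where "f t = N (xi + t *\<^sub>R eta) powr p / p" for t
  have "((%t. xi + t *\<^sub>R eta) has_derivative (%t. t *\<^sub>R eta)) (at 0)" by (auto intro!: derivative_eq_intros)
  moreover have "((%eta. N eta powr p / p) has_derivative (%h. duality_map p N xi \<bullet> h)) (at (xi + 0 *\<^sub>R eta))"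
    using duality_map_deriv[OF p N, of xi] by simp
  ultimately have "(f has_derivative (%t. duality_map p N xi \<bullet> (t *\<^sub>R eta))) (at 0)"
    unfolding f_def by (rule has_derivative_compose)
  then have "(f has_real_derivative (duality_map p N xi \<bullet> eta)) (at 0)"
    by (simp add: has_field_derivative_def mult.commute[of _ "duality_map p N xi \<bullet> eta"])
  then have "((%h. (f (0 + h) - f 0) / h) \<longlongrightarrow> duality_map p N xi \<bullet> eta) (at 0)" by (simp add: DERIV_def)
  moreover have "filterlim (%m. 1 / real (Suc m)) (at 0) sequentially"
    unfolding filterlim_at using LIMSEQ_inverse_real_of_nat by (auto simp: inverse_eq_divide)
  ultimately have "(%m. (f (0 + 1 / real (Suc m)) - f 0) / (1 / real (Suc m))) ----> duality_map p N xi \<bullet> eta"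
    by (rule filterlim_compose)
  moreover have "(f (0 + 1 / real (Suc m)) - f 0) / (1 / real (Suc m))
      = real (Suc m) * (N (xi + (1 / real (Suc m)) *\<^sub>R eta) powr p - N xi powr p) / p" for m
    by (simp add: f_def diff_divide_distrib[symmetric] mult.commute del: of_nat_Suc)
  ultimately show ?thesis by simp
qed

text \<open>The Cauchy-Schwarz inequality of the norm \<open>N\<close>. The tangent inequality at
  the displaced point bounds each difference quotient, and the displacement tends to zero.\<close>

lemma duality_map_le:
  assumes p: "p > 1" and N: "good_norm \<nu> N"
  shows "duality_map p N xi \<bullet> eta <= N xi powr (p - 1) * N eta"
proof -
  have n: "is_norm_fun N" using N by (simp add: good_norm_def)
  have lim: "(%m. (N xi + N eta / real (Suc m)) powr (p - 1) * N eta) ----> (N xi + 0) powr (p - 1) * N eta"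
  proof (intro tendsto_mult_right tendsto_powr2 tendsto_add tendsto_const)
    show "(%m. N eta / real (Suc m)) ----> 0" by (rule LIMSEQ_Suc[OF lim_const_over_n])
  qed (use p is_norm_funD(1)[OF n] in \<open>auto intro!: always_eventually add_nonneg_nonneg divide_nonneg_nonneg\<close>)
  have "duality_map p N xi \<bullet> eta <= (N xi + 0) powr (p - 1) * N eta"
  proof (rule LIMSEQ_le[OF duality_map_quotient[OF p N] lim], intro exI allI impI)
    fix m :: nat
    define t where "t = 1 / real (Suc m)"
    have t: "t > 0" "real (Suc m) = 1 / t" by (simp_all add: t_def)
    define a where "a = N (xi + t *\<^sub>R eta)"
    define b where "b = N xi"
    have ab: "a >= 0" "b >= 0" unfolding a_def b_def by (rule is_norm_funD(1)[OF n])+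
    have le: "a <= b + t * N eta"
      unfolding a_def b_def using is_norm_funD(5)[OF n, of xi "t *\<^sub>R eta"] is_norm_funD(4)[OF n, of t eta] t by simp
    have Neta: "N eta >= 0" by (rule is_norm_funD(1)[OF n])
    have "a powr p - b powr p <= p * a powr (p - 1) * (a - b)"
      using powr_above_tangent[of p a b] p ab by (simp add: algebra_simps)
    also have "... <= p * a powr (p - 1) * (t * N eta)" using le p by (intro mult_left_mono) auto
    also have "... <= p * (b + t * N eta) powr (p - 1) * (t * N eta)"
      using le p ab t Neta by (intro mult_right_mono mult_left_mono powr_mono2) auto
    finally have "1 / t * (a powr p - b powr p) / p <= 1 / t * (p * (b + t * N eta) powr (p - 1) * (t * N eta)) / p"
      using t p by (intro divide_right_mono mult_left_mono) auto
    also have "... = (b + t * N eta) powr (p - 1) * N eta" using t p by simp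
    finally show "real (Suc m) * (N (xi + (1 / real (Suc m)) *\<^sub>R eta) powr p - N xi powr p) / p <= (N xi + N eta / real (Suc m)) powr (p - 1) * N eta"
      unfolding t(2) a_def b_def by (simp add: mult.commute)
  qed
  then show ?thesis by simp
qed

text \<open>Euler's identity for a p-homogeneous function; the lower bound is Bernoulli's
  inequality, the upper one the Cauchy-Schwarz bound.\<close>

lemma duality_map_self:
  assumes p: "p > 1" and N: "good_norm \<nu> N"
  shows "duality_map p N xi \<bullet> xi = N xi powr p"
proof (rule antisym)
  have n: "is_norm_fun N" using N by (simp add: good_norm_def)
  have "N xi powr (p - 1) * N xi = N xi powr p"
    using powr_add[of "N xi" "p - 1" 1] is_norm_funD(1)[OF n, of xi] by simp
  then show "duality_map p N xi \<bullet> xi <= N xi powr p" using duality_map_le[OF p N, of xi xi] by simp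
  show "N xi powr p <= duality_map p N xi \<bullet> xi"
  proof (rule LIMSEQ_le_const[OF duality_map_quotient[OF p N]], intro exI allI impI)
    fix m :: nat
    define t where "t = 1 / real (Suc m)"
    have t: "t > 0" "real (Suc m) = 1 / t" by (simp_all add: t_def)
    have "xi + t *\<^sub>R xi = (1 + t) *\<^sub>R xi" by (simp add: algebra_simps)
    then have e: "N (xi + t *\<^sub>R xi) powr p = (1 + t) powr p * N xi powr p"
      using is_norm_funD(4)[OF n, of "1 + t" xi] t by (simp add: powr_mult)
    have "1 + p * t <= (1 + t) powr p" using powr_above_tangent[of p 1 "1 + t"] p t by simp
    then have "(1 + p * t) * N xi powr p <= (1 + t) powr p * N xi powr p" by (intro mult_right_mono) auto
    then have "p * t * N xi powr p <= N (xi + t *\<^sub>R xi) powr p - N xi powr p" unfolding e by (simp add: algebra_simps)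
    then have "1 / t * (p * t * N xi powr p) / p <= 1 / t * (N (xi + t *\<^sub>R xi) powr p - N xi powr p) / p"
      using t p by (intro divide_right_mono mult_left_mono) auto
    then show "N xi powr p <= real (Suc m) * (N (xi + (1 / real (Suc m)) *\<^sub>R xi) powr p - N xi powr p) / p"
      unfolding t(2) using t p by simp
  qed
qed

lemma duality_map_uminus:
  assumes p: "p > 1" and N: "good_norm \<nu> N"
  shows "duality_map p N (- xi) \<bullet> eta = - (duality_map p N xi \<bullet> eta)"
proof -
  have n: "is_norm_fun N" using N by (simp add: good_norm_def)
  have "N (- xi + (1 / real (Suc m)) *\<^sub>R eta) = N (xi + (1 / real (Suc m)) *\<^sub>R (- eta))" for m
    using is_norm_funD(6)[OF n, of "xi + (1 / real (Suc m)) *\<^sub>R (- eta)"] by simp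
  then have "(%m. real (Suc m) * (N (xi + (1 / real (Suc m)) *\<^sub>R (- eta)) powr p - N xi powr p) / p) ----> duality_map p N (- xi) \<bullet> eta"
    using duality_map_quotient[OF p N, of "- xi" eta] is_norm_funD(6)[OF n] by simp
  then have "duality_map p N (- xi) \<bullet> eta = duality_map p N xi \<bullet> (- eta)"
    using duality_map_quotient[OF p N, of xi "- eta"] by (rule LIMSEQ_unique)
  then show ?thesis by simp
qed

lemma duality_map_abs_le:
  assumes p: "p > 1" and N: "good_norm \<nu> N"
  shows "\<bar>duality_map p N xi \<bullet> eta\<bar> <= N xi powr (p - 1) * N eta"
  using duality_map_le[OF p N, of xi eta] duality_map_le[OF p N, of xi "- eta"] is_norm_funD(6)[of N eta] N
  by (simp add: good_norm_def abs_le_iff)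

text \<open>A majorant independent of \<open>m\<close>, for dominated convergence in the derivation
  of the Euler-Lagrange equation.\<close>

lemma duality_quotient_bound:
  assumes p: "p > 1" and N: "is_norm_fun N"
  shows "\<bar>real (Suc m) * (N (xi + (1 / real (Suc m)) *\<^sub>R eta) powr p - N xi powr p) / p\<bar> <= (2 * N xi + N eta) powr p"
proof -
  define t where "t = 1 / real (Suc m)"
  have t: "t > 0" "t <= 1" "real (Suc m) = 1 / t" by (simp_all add: t_def)
  define a where "a = N (xi + t *\<^sub>R eta)"
  define b where "b = N xi"
  define c where "c = N eta"
  have nn: "a >= 0" "b >= 0" "c >= 0" unfolding a_def b_def c_def by (rule is_norm_funD(1)[OF N])+
  have tc: "N (t *\<^sub>R eta) = t * c" using is_norm_funD(4)[OF N, of t eta] t by (simp add: c_def)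
  have tc1: "t * c <= c" using t nn by (simp add: mult_left_le_one_le)
  have ab: "a + b <= 2 * b + c" using is_norm_funD(5)[OF N, of xi "t *\<^sub>R eta"] tc tc1 by (simp add: a_def b_def)
  have amb: "\<bar>a - b\<bar> <= t * c" using is_norm_funD(7)[OF N, of "xi + t *\<^sub>R eta" xi] tc by (simp add: a_def b_def)
  have "\<bar>a powr p - b powr p\<bar> <= p * (a + b) powr (p - 1) * \<bar>a - b\<bar>" by (rule powr_diff_abs_le) (use nn p in auto)
  also have "... <= p * (2 * b + c) powr (p - 1) * (t * c)"
    using nn p ab amb by (intro mult_mono mult_left_mono powr_mono2) auto
  also have "... <= p * (2 * b + c) powr (p - 1) * (t * (2 * b + c))"
    using nn p t by (intro mult_left_mono) auto
  also have "... = p * t * (2 * b + c) powr p"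
    using powr_add[of "2 * b + c" "p - 1" 1] nn by (simp add: mult_ac)
  finally have "\<bar>a powr p - b powr p\<bar> <= p * t * (2 * b + c) powr p" .
  then have "1 / t * \<bar>a powr p - b powr p\<bar> / p <= 1 / t * (p * t * (2 * b + c) powr p) / p"
    using t p by (intro divide_right_mono mult_left_mono) auto
  moreover have "\<bar>1 / t * (a powr p - b powr p) / p\<bar> = 1 / t * \<bar>a powr p - b powr p\<bar> / p"
    using t p by (simp add: abs_mult)
  ultimately show ?thesis unfolding t(3) a_def b_def c_def using t p by simp
qed

lemma good_norm_abs: "good_norm 1 (abs :: real => real)"
proof -
  have "(abs :: real => real) differentiable (at xi)" if "xi ~= 0" for xi
    using has_derivative_norm[OF that] unfolding real_norm_def[abs_def] differentiable_def by blast
  then show ?thesis by (auto simp: good_norm_def is_norm_fun_def abs_mult abs_triangle_ineq)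
qed

text \<open>The term \<open>|v|^(p-2) v\<close> is the duality map of the absolute value, so
  potential and energy are differentiated by the same lemmas.\<close>

lemma duality_map_abs:
  fixes t :: real
  assumes p: "p > 1"
  shows "duality_map p abs t = \<bar>t\<bar> powr (p - 2) * t"
proof (cases "t = 0")
  case True
  then show ?thesis using duality_map_abs_le[OF p good_norm_abs, of 0 1] p by simp
next
  case False
  have "duality_map p abs t * t = \<bar>t\<bar> powr p" using duality_map_self[OF p good_norm_abs, of t] by simp
  moreover have "\<bar>t\<bar> powr (p - 2) * t * t = \<bar>t\<bar> powr p"
  proof -
    have "t * t = \<bar>t\<bar> powr 2" using False by (simp add: power2_eq_square)
    then show ?thesis using powr_add[of "\<bar>t\<bar>" "p - 2" 2] by (simp add: mult.assoc)
  qed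
  ultimately show ?thesis using False by (metis mult_right_cancel)
qed

section \<open>Measurability of almost everywhere limits\<close>

context bounded_open begin

text \<open>Lebesgue measure is complete, so changing a function on a null set preserves
  measurability. It is needed because \<open>H x\<close> is well behaved only for almost every
  \<open>x\<close>.\<close>

lemma measurable_AE:
  fixes f g :: "'a => real"
  assumes "f \<in> borel_measurable M" "AE x in M. f x = g x"
  shows "g \<in> borel_measurable M"
proof -
  have ws: "w \<inter> space lebesgue \<in> sets lebesgue" using w_open by auto
  have "(%x. indicator w x *\<^sub>R f x) \<in> borel_measurable lebesgue"
    using assms(1) borel_measurable_restrict_space_iff[OF ws, of f] by simp
  moreover have "AE x in lebesgue. indicator w x *\<^sub>R f x = indicator w x *\<^sub>R g x"
    using assms(2) unfolding AE_restrict_space_iff[OF ws] by eventually_elim (auto split: split_indicator)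
  ultimately have "(%x. indicator w x *\<^sub>R g x) \<in> borel_measurable lebesgue" by (rule borel_measurable_AE)
  then show ?thesis using borel_measurable_restrict_space_iff[OF ws, of g] by simp
qed

lemma measurable_AE_limit:
  fixes f :: "nat => 'a => real"
  assumes m: "!!i. f i \<in> borel_measurable M" and lim: "AE x in M. (%i. f i x) ----> g x"
  shows "g \<in> borel_measurable M"
proof (rule measurable_AE)
  show "(%x. lim (%i. f i x)) \<in> borel_measurable M" by (rule borel_measurable_lim_metric) (rule m)
  show "AE x in M. lim (%i. f i x) = g x" using lim by eventually_elim (rule limI)
qed

end

text \<open>The analytic content of the hypotheses: the Morrey condition enters through
  integrability and the weighted inequality \<open>V_adams\<close>, and \<open>H\<close> through
  two-sided bounds and a good norm at almost every point.\<close>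

locale eigen_setup = bounded_open w p for w :: "'a::euclidean_space set" and p :: real +
  fixes H :: "'a => 'a => real" and V :: "'a => real" and \<kappa> \<nu> :: real
  assumes w_conn: "connected w" and w_ne: "w ~= {}"
    and V_int: "integrable (lebesgue_on w) V"
    and V_adams: "!!\<delta>. \<delta> > 0 ==> \<exists>C\<ge>0. \<forall>phi. test_fun w phi --> integrable (lebesgue_on w) (%x. \<bar>V x\<bar> * \<bar>phi x\<bar> powr p)
      \<and> (LINT x|(lebesgue_on w). \<bar>V x\<bar> * \<bar>phi x\<bar> powr p) <= \<delta> * Np p w (grad phi) + C * Np p w phi"
    and H_good: "AE x in lebesgue_on w. good_norm \<nu> (H x) \<and> (\<forall>xi. \<kappa> * norm xi <= H x xi)"
    and H_meas: "!!xi. (%x. H x xi) \<in> borel_measurable (lebesgue_on w)"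
    and H_nn: "!!x xi. H x xi >= 0"
    and \<kappa>: "\<kappa> > 0" "\<kappa> <= \<nu>"
begin

lemma \<nu>0: "\<nu> >= 0" using \<kappa> by simp

lemma V_measurable [measurable]: "V \<in> borel_measurable M"
  using V_int by (rule borel_measurable_integrable)

text \<open>\<open>H\<close> is measurable in \<open>x\<close> and, almost everywhere, continuous in
  the second variable; hence the composite is a limit along simple functions.\<close>

lemma H_compose_measurable:
  assumes f: "f \<in> borel_measurable M"
  shows "(%x. H x (f x)) \<in> borel_measurable M"
proof -
  obtain F where F: "!!i. simple_function M (F i)" "!!x. x \<in> space M ==> (%i. F i x) ----> f x"
    using borel_measurable_implies_sequence_metric[OF f, of 0] by blast
  have Fm: "(%x. H x (F i x)) \<in> borel_measurable M" for i
  proof -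
    have "(%x. \<Sum>y\<in>F i ` space M. indicator (F i -` {y} \<inter> space M) x * H x y) \<in> borel_measurable M"
      using F(1)[of i] H_meas by (intro borel_measurable_sum borel_measurable_times borel_measurable_indicator) (auto simp: simple_function_def)
    moreover have "(\<Sum>y\<in>F i ` space M. indicator (F i -` {y} \<inter> space M) x * H x y) = H x (F i x)" if x: "x \<in> space M" for x
    proof -
      have fin: "finite (F i ` space M)" using F(1)[of i] by (simp add: simple_function_def)
      have "(\<Sum>y\<in>F i ` space M. indicator (F i -` {y} \<inter> space M) x * H x y) = (\<Sum>y\<in>F i ` space M. if F i x = y then H x y else 0)"
        by (intro sum.cong refl) (use x in \<open>auto split: split_indicator\<close>)
      also have "... = H x (F i x)" using fin x by (subst sum.delta') auto
      finally show ?thesis .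
    qed
    ultimately show ?thesis by (subst measurable_cong[symmetric]) auto
  qed
  show ?thesis
  proof (rule measurable_AE_limit[OF Fm])
    show "AE x in M. (%i. H x (F i x)) ----> H x (f x)"
      using H_good AE_space
    proof eventually_elim
      case (elim x)
      then have n: "is_norm_fun (H x)" and b: "!!xi. H x xi <= \<nu> * norm xi" by (auto simp: good_norm_def)
      have "(%i. \<nu> * norm (F i x - f x)) ----> 0"
        using F(2)[OF elim(2)] by (intro tendsto_mult_right_zero tendsto_norm_zero LIM_zero)
      then have "(%i. H x (F i x) - H x (f x)) ----> 0"
      proof (rule Lim_null_comparison[rotated])
        show "\<forall>\<^sub>F i in sequentially. norm (H x (F i x) - H x (f x)) <= \<nu> * norm (F i x - f x)"
          using is_norm_funD(7)[OF n] b by (intro always_eventually allI) (auto intro: order_trans)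
      qed
      then show ?case by (simp add: LIM_zero_iff)
    qed
  qed
qed

lemma Aop_duality: "Aop p H x xi = duality_map p (H x) xi"
  by (simp add: Aop_def duality_map_def)

lemma Aop_measurable:
  assumes f: "f \<in> borel_measurable M" and h: "h \<in> borel_measurable M"
  shows "(%x. Aop p H x (f x) \<bullet> h x) \<in> borel_measurable M"
proof (rule measurable_AE_limit)
  note [measurable] = f h
  have "(%x. H x (f x + (1 / real (Suc m)) *\<^sub>R h x)) \<in> borel_measurable M" for m
    by (rule H_compose_measurable) measurable
  moreover have "(%x. H x (f x)) \<in> borel_measurable M" by (rule H_compose_measurable[OF f])
  ultimately show "(%x. real (Suc m) * (H x (f x + (1 / real (Suc m)) *\<^sub>R h x) powr p - H x (f x) powr p) / p) \<in> borel_measurable M" for m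
    by measurable
  show "AE x in M. (%m. real (Suc m) * (H x (f x + (1 / real (Suc m)) *\<^sub>R h x) powr p - H x (f x) powr p) / p) ----> Aop p H x (f x) \<bullet> h x"
    using H_good by eventually_elim (use duality_map_quotient[OF p1] in \<open>auto simp: Aop_duality\<close>)
qed

definition E :: "('a => 'a) => real" where "E g = (LINT x|M. H x (g x) powr p)"
definition PV :: "('a => real) => real" where "PV v = (LINT x|M. V x * \<bar>v x\<bar> powr p)"

lemma H_powr_integrable:
  assumes g: "Lp p w g" shows "integrable M (%x. H x (g x) powr p)" "\<kappa> powr p * Np p w g <= E g"
proof -
  note [measurable] = Lp_measurable[OF g] H_compose_measurable[OF Lp_measurable[OF g]]
  show i: "integrable M (%x. H x (g x) powr p)"
  proof (rule Bochner_Integration.integrable_bound)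
    show "integrable M (%x. \<nu> powr p * norm (g x) powr p)" using Lp_integrable[OF g] by auto
    show "AE x in M. norm (H x (g x) powr p) <= norm (\<nu> powr p * norm (g x) powr p)"
      using H_good
    proof eventually_elim
      case (elim x)
      then have "H x (g x) powr p <= (\<nu> * norm (g x)) powr p" using H_nn p0 by (intro powr_mono2) (auto simp: good_norm_def)
      then show ?case by (simp add: powr_mult)
    qed
  qed measurable
  have "(LINT x|M. \<kappa> powr p * norm (g x) powr p) <= E g"
    unfolding E_def
  proof (rule integral_mono_AE[OF _ i])
    show "integrable M (%x. \<kappa> powr p * norm (g x) powr p)" using Lp_integrable[OF g] by auto
    show "AE x in M. \<kappa> powr p * norm (g x) powr p <= H x (g x) powr p"
      using H_good
    proof eventually_elim
      case (elim x)
      then have "(\<kappa> * norm (g x)) powr p <= H x (g x) powr p" using \<kappa> p0 by (intro powr_mono2) auto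
      then show ?case by (simp add: powr_mult)
    qed
  qed
  then show "\<kappa> powr p * Np p w g <= E g" by (simp add: Np_def)
qed

lemma E_tendsto:
  assumes L: "!!k. Lp p w (u k)" "Lp p w g" and lim: "(%k. Np p w (%x. u k x - g x)) ----> 0"
  shows "(%k. E (u k)) ----> E g"
  unfolding E_def
proof (rule Lp_tendsto_integral_powr(2)[OF p1, where d = "%k x. \<nu> * norm (u k x - g x)"])
  note [measurable] = Lp_measurable[OF L(1)] Lp_measurable[OF L(2)]
  show "(%x. H x (u k x)) \<in> borel_measurable M" for k by (rule H_compose_measurable) measurable
  show "(%x. H x (g x)) \<in> borel_measurable M" by (rule H_compose_measurable) measurable
  show "(%x. \<nu> * norm (u k x - g x)) \<in> borel_measurable M" for k by measurable
  show "AE x in M. \<bar>H x (u k x) - H x (g x)\<bar> <= \<nu> * norm (u k x - g x)" for k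
    using H_good
  proof eventually_elim
    case (elim x)
    then show ?case using is_norm_funD(7)[of "H x" "u k x" "g x"] by (auto simp: good_norm_def intro: order_trans)
  qed
  show "integrable M (%x. H x (g x) powr p)" by (rule H_powr_integrable(1)[OF L(2)])
  show "integrable M (%x. (\<nu> * norm (u k x - g x)) powr p)" for k
    using Lp_integrable[OF Lp_diff(1)[OF L(1)[of k] L(2) p0(1)]] by (simp add: powr_mult)
  have "(LINT x|M. (\<nu> * norm (u k x - g x)) powr p) = \<nu> powr p * Np p w (%x. u k x - g x)" for k by (simp add: powr_mult Np_def)
  then show "(%k. \<integral>x. (\<nu> * norm (u k x - g x)) powr p \<partial>M) ----> 0" using tendsto_mult_right_zero[OF lim] by simp
qed (use H_nn \<nu>0 in auto)

text \<open>Fatou's lemma along approximants that converge almost everywhere. The slack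
  \<open>eta\<close> arises since the right-hand side converges only in the limit; it is removed at
  the end.\<close>

lemma W0_adams:
  assumes "\<delta> > 0"
  obtains C where "C >= 0" "!!v g. W0 p w v g ==> integrable M (%x. \<bar>V x\<bar> * \<bar>v x\<bar> powr p)"
    "!!v g. W0 p w v g ==> (LINT x|M. \<bar>V x\<bar> * \<bar>v x\<bar> powr p) <= \<delta> * Np p w g + C * Np p w v"
proof -
  obtain C where C: "C >= 0" and ad: "!!phi. test_fun w phi ==> integrable M (%x. \<bar>V x\<bar> * \<bar>phi x\<bar> powr p)
      \<and> (LINT x|M. \<bar>V x\<bar> * \<bar>phi x\<bar> powr p) <= \<delta> * Np p w (grad phi) + C * Np p w phi"
    using V_adams[OF assms] by blast
  have main: "integrable M (%x. \<bar>V x\<bar> * \<bar>v x\<bar> powr p) \<and> (LINT x|M. \<bar>V x\<bar> * \<bar>v x\<bar> powr p) <= (\<delta> * Np p w g + C * Np p w v) + eta"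
    if W: "W0 p w v g" and eta: "eta > 0" for v g eta
  proof -
    obtain phi where phi: "!!k. test_fun w (phi k)" "(%k. Np p w (%x. phi k x - v x)) ----> 0"
      "(%k. Np p w (%x. grad (phi k) x - g x)) ----> 0" by (rule W0_approx[OF W]) (rule that)
    note L = W0_Lp[OF W]
    note [measurable] = Lp_measurable[OF L(1)]
    obtain r where r: "strict_mono r" "AE x in M. (%k. phi (r k) x - v x) ----> 0"
    proof (rule Lp_AE_subseq[OF p0(2), of M "%k x. phi k x - v x"])
      show "integrable M (%x. \<bar>phi k x - v x\<bar> powr p)" for k
        using Lp_integrable[OF Lp_diff(1)[OF test_Lp(1)[OF phi(1)] L(1) p0(1)]] by simp
      show "(%k. \<integral>x. \<bar>phi k x - v x\<bar> powr p \<partial>M) ----> 0" using phi(2) by (simp add: Np_def)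
    qed
    have "(%k. \<delta> * Np p w (grad (phi k)) + C * Np p w (phi k)) ----> \<delta> * Np p w g + C * Np p w v"
      by (intro tendsto_add tendsto_mult_left Np_tendsto[OF p1] test_Lp phi L)
    then have "(%k. \<delta> * Np p w (grad (phi (r k))) + C * Np p w (phi (r k))) ----> \<delta> * Np p w g + C * Np p w v"
      using LIMSEQ_subseq_LIMSEQ[OF _ r(1)] by (force simp: o_def)
    then have "\<forall>\<^sub>F k in sequentially. \<delta> * Np p w (grad (phi (r k))) + C * Np p w (phi (r k)) < (\<delta> * Np p w g + C * Np p w v) + eta"
      using eta by (intro order_tendstoD) auto
    then obtain N where N: "!!k. k >= N ==> \<delta> * Np p w (grad (phi (r k))) + C * Np p w (phi (r k)) < (\<delta> * Np p w g + C * Np p w v) + eta"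
      by (auto simp: eventually_sequentially)
    define f where "f k x = \<bar>V x\<bar> * \<bar>phi (r (k + N)) x\<bar> powr p" for k x
    have fi: "integrable M (f k)" for k unfolding f_def using ad[OF phi(1)] by blast
    have f0: "f k x >= 0" for k x by (simp add: f_def)
    have fl: "AE x in M. (%k. f k x) ----> \<bar>V x\<bar> * \<bar>v x\<bar> powr p"
      using r(2)
    proof eventually_elim
      case (elim x)
      then have "(%k. phi (r k) x) ----> v x" by (simp add: LIM_zero_iff)
      then have "(%k. phi (r (k + N)) x) ----> v x" by (rule LIMSEQ_ignore_initial_segment)
      then show ?case unfolding f_def by (intro tendsto_mult_left tendsto_powr2 tendsto_rabs tendsto_const p0) auto
    qed
    have fb: "(LINT x|M. f k x) <= (\<delta> * Np p w g + C * Np p w v) + eta" for k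
      unfolding f_def using ad[OF phi(1), of "r (k + N)"] N[of "k + N"] by simp
    show ?thesis using fatou_integrable[OF fi f0 fl _ fb] by simp
  qed
  show ?thesis
  proof (rule that[OF C])
    fix v g assume W: "W0 p w v g"
    show "integrable M (%x. \<bar>V x\<bar> * \<bar>v x\<bar> powr p)" using main[OF W zero_less_one] by blast
    show "(LINT x|M. \<bar>V x\<bar> * \<bar>v x\<bar> powr p) <= \<delta> * Np p w g + C * Np p w v"
      by (rule field_le_epsilon) (use main[OF W] in blast)
  qed
qed

lemma absV_integrable:
  assumes "W0 p w v g" shows "integrable M (%x. \<bar>V x\<bar> * \<bar>v x\<bar> powr p)"
  by (rule W0_adams[OF zero_less_one]) (use assms in blast)

lemma weight_integrable:
  assumes W: "W0 p w v g" and m: "f \<in> borel_measurable M" and le: "!!x. \<bar>f x\<bar> <= c * \<bar>V x\<bar>"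
  shows "integrable M (%x. f x * \<bar>v x\<bar> powr p)"
proof (rule Bochner_Integration.integrable_bound)
  note [measurable] = m Lp_measurable[OF W0_Lp(1)[OF W]]
  show "integrable M (%x. c * (\<bar>V x\<bar> * \<bar>v x\<bar> powr p))" using absV_integrable[OF W] by auto
  show "(%x. f x * \<bar>v x\<bar> powr p) \<in> borel_measurable M" by measurable
  show "AE x in M. norm (f x * \<bar>v x\<bar> powr p) <= norm (c * (\<bar>V x\<bar> * \<bar>v x\<bar> powr p))"
  proof (rule AE_I2)
    fix x
    have "\<bar>f x\<bar> * \<bar>v x\<bar> powr p <= c * \<bar>V x\<bar> * \<bar>v x\<bar> powr p" by (rule mult_right_mono[OF le]) simp
    also have "... <= \<bar>c * \<bar>V x\<bar> * \<bar>v x\<bar> powr p\<bar>" by simp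
    finally show "norm (f x * \<bar>v x\<bar> powr p) <= norm (c * (\<bar>V x\<bar> * \<bar>v x\<bar> powr p))" by (simp add: abs_mult mult.assoc)
  qed
qed

lemma V_powr_integrable: "W0 p w v g ==> integrable M (%x. V x * \<bar>v x\<bar> powr p)"
  by (rule weight_integrable[where c = 1]) auto

text \<open>The gradients are merely bounded. Their contribution is made small by the choice of
  \<delta>, and only afterwards is the L^p distance, multiplied by the large \<open>C\<close>, sent
  to zero.\<close>

lemma absV_diff_tendsto:
  assumes W: "!!k. W0 p w (v k) (g k)" "W0 p w v' g'" and B: "!!k. Np p w (g k) <= B"
    and lim: "(%k. Np p w (%x. v k x - v' x)) ----> 0"
  shows "(%k. \<integral>x. \<bar>V x\<bar> * \<bar>v k x - v' x\<bar> powr p \<partial>M) ----> 0"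
proof (rule LIMSEQ_I)
  fix e :: real assume e: "e > 0"
  have Wd: "W0 p w (%x. v k x - v' x) (%x. g k x - g' x)" for k
    using W0_add[OF W(1)[of k] W0_scale[OF W(2), of "-1"]] by simp
  define G where "G = 2 powr p * (B + Np p w g')"
  have B0: "B >= 0" using B[of 0] Np_nonneg[of p w "g 0"] by linarith
  have G0: "G >= 0" unfolding G_def using B0 Np_nonneg[of p w g'] by simp
  have G: "Np p w (%x. g k x - g' x) <= G" for k
    unfolding G_def using Lp_diff(2)[OF W0_Lp(2)[OF W(1)[of k]] W0_Lp(2)[OF W(2)] p0(1)] B[of k]
    by (meson add_right_mono mult_left_mono order_trans powr_ge_zero)
  define \<delta> where "\<delta> = e / (2 * (G + 1))"
  have \<delta>: "\<delta> > 0" using e G0 by (simp add: \<delta>_def)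
  obtain C where C: "C >= 0" "!!v g. W0 p w v g ==> (LINT x|M. \<bar>V x\<bar> * \<bar>v x\<bar> powr p) <= \<delta> * Np p w g + C * Np p w v"
    by (rule W0_adams[OF \<delta>]) blast
  have "(%k. C * Np p w (%x. v k x - v' x)) ----> 0" by (rule tendsto_mult_right_zero[OF lim])
  then have "\<forall>\<^sub>F k in sequentially. C * Np p w (%x. v k x - v' x) < e / 2" using e by (intro order_tendstoD) auto
  then obtain N where N: "!!k. k >= N ==> C * Np p w (%x. v k x - v' x) < e / 2" by (auto simp: eventually_sequentially)
  have dG: "\<delta> * G <= e / 2"
  proof -
    have "\<delta> * G <= \<delta> * (G + 1)" using \<delta> by (intro mult_left_mono) auto
    also have "... = e / 2" using G0 by (simp add: \<delta>_def field_simps)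
    finally show ?thesis .
  qed
  show "\<exists>no. \<forall>n\<ge>no. norm ((LINT x|M. \<bar>V x\<bar> * \<bar>v n x - v' x\<bar> powr p) - 0) < e"
  proof (intro exI[of _ N] allI impI)
    fix n assume n: "n >= N"
    have "(LINT x|M. \<bar>V x\<bar> * \<bar>v n x - v' x\<bar> powr p) <= \<delta> * Np p w (%x. g n x - g' x) + C * Np p w (%x. v n x - v' x)" by (rule C(2)[OF Wd])
    also have "... <= \<delta> * G + C * Np p w (%x. v n x - v' x)" using G[of n] \<delta> by (intro add_right_mono mult_left_mono) auto
    also have "... < e / 2 + e / 2" by (rule add_le_less_mono[OF dG N[OF n]])
    finally have "(LINT x|M. \<bar>V x\<bar> * \<bar>v n x - v' x\<bar> powr p) < e" by simp
    moreover have "(LINT x|M. \<bar>V x\<bar> * \<bar>v n x - v' x\<bar> powr p) >= 0" by (auto intro!: integral_nonneg_AE)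
    ultimately show "norm ((LINT x|M. \<bar>V x\<bar> * \<bar>v n x - v' x\<bar> powr p) - 0) < e" by simp
  qed
qed

text \<open>For a nonnegative weight, \<open>f powr (1/p)\<close> is absorbed into the functions,
  which reduces the claim to unweighted convergence of p-th powers.\<close>

lemma weighted_tendsto:
  assumes W: "!!k. W0 p w (v k) (g k)" "W0 p w v' g'" and B: "!!k. Np p w (g k) <= B"
    and lim: "(%k. Np p w (%x. v k x - v' x)) ----> 0"
    and f: "f \<in> borel_measurable M" "!!x. f x >= 0" "!!x. f x <= 2 * \<bar>V x\<bar>"
  shows "(%k. \<integral>x. f x * \<bar>v k x\<bar> powr p \<partial>M) ----> (LINT x|M. f x * \<bar>v' x\<bar> powr p)"
proof -
  have Wd: "W0 p w (%x. v k x - v' x) (%x. g k x - g' x)" for k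
    using W0_add[OF W(1)[of k] W0_scale[OF W(2), of "-1"]] by simp
  note [measurable] = f(1) Lp_measurable[OF W0_Lp(1)[OF W(1)]] Lp_measurable[OF W0_Lp(1)[OF W(2)]]
  have pw: "(f x powr (1/p) * \<bar>t\<bar>) powr p = f x * \<bar>t\<bar> powr p" for x and t :: real
    using f(2)[of x] p0 by (simp add: powr_mult powr_powr)
  have af: "\<bar>f x\<bar> <= 2 * \<bar>V x\<bar>" for x using f(2,3)[of x] by simp
  have "(%k. \<integral>x. (f x powr (1/p) * \<bar>v k x\<bar>) powr p \<partial>M) ----> (LINT x|M. (f x powr (1/p) * \<bar>v' x\<bar>) powr p)"
  proof (rule Lp_tendsto_integral_powr(2)[OF p1, where d = "%k x. f x powr (1/p) * \<bar>v k x - v' x\<bar>"])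
    show "AE x in M. \<bar>f x powr (1/p) * \<bar>v k x\<bar> - f x powr (1/p) * \<bar>v' x\<bar>\<bar> <= f x powr (1/p) * \<bar>v k x - v' x\<bar>" for k
      by (intro AE_I2) (simp add: right_diff_distrib[symmetric] abs_mult mult_left_mono)
    show "integrable M (%x. (f x powr (1/p) * \<bar>v' x\<bar>) powr p)" unfolding pw by (rule weight_integrable[OF W(2) f(1) af])
    show "integrable M (%x. (f x powr (1/p) * \<bar>v k x - v' x\<bar>) powr p)" for k unfolding pw by (rule weight_integrable[OF Wd f(1) af])
    have up: "(%k. 2 * (LINT x|M. \<bar>V x\<bar> * \<bar>v k x - v' x\<bar> powr p)) ----> 0"
      by (rule tendsto_mult_right_zero[OF absV_diff_tendsto[OF W B lim]])
    show "(%k. \<integral>x. (f x powr (1/p) * \<bar>v k x - v' x\<bar>) powr p \<partial>M) ----> 0"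
      unfolding pw
    proof (rule tendsto_sandwich[OF _ _ tendsto_const up])
      show "\<forall>\<^sub>F k in sequentially. 0 <= (LINT x|M. f x * \<bar>v k x - v' x\<bar> powr p)"
        using f(2) by (intro always_eventually allI integral_nonneg_AE AE_I2) auto
      show "\<forall>\<^sub>F k in sequentially. (LINT x|M. f x * \<bar>v k x - v' x\<bar> powr p) <= 2 * (LINT x|M. \<bar>V x\<bar> * \<bar>v k x - v' x\<bar> powr p)"
      proof (intro always_eventually allI)
        fix k
        have "(LINT x|M. f x * \<bar>v k x - v' x\<bar> powr p) <= (LINT x|M. 2 * (\<bar>V x\<bar> * \<bar>v k x - v' x\<bar> powr p))"
        proof (rule integral_mono[OF weight_integrable[OF Wd f(1) af]])
          show "integrable M (%x. 2 * (\<bar>V x\<bar> * \<bar>v k x - v' x\<bar> powr p))" using absV_integrable[OF Wd] by auto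
          show "f x * \<bar>v k x - v' x\<bar> powr p <= 2 * (\<bar>V x\<bar> * \<bar>v k x - v' x\<bar> powr p)" for x
            using mult_right_mono[OF f(3)[of x], of "\<bar>v k x - v' x\<bar> powr p"] by (simp add: mult.assoc)
        qed
        then show "(LINT x|M. f x * \<bar>v k x - v' x\<bar> powr p) <= 2 * (LINT x|M. \<bar>V x\<bar> * \<bar>v k x - v' x\<bar> powr p)" by simp
      qed
    qed
  qed (use f(2) in auto)
  then show ?thesis unfolding pw .
qed

text \<open>\<open>V\<close> is the difference of the nonnegative weights \<open>|V|\<close> and
  \<open>|V| - V\<close>, both at most \<open>2 * |V|\<close>; this explains the factor two in
  \<open>weighted_tendsto\<close>.\<close>

lemma PV_tendsto:
  assumes W: "!!k. W0 p w (v k) (g k)" "W0 p w v' g'" and B: "!!k. Np p w (g k) <= B"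
    and lim: "(%k. Np p w (%x. v k x - v' x)) ----> 0"
  shows "(%k. PV (v k)) ----> PV v'"
proof -
  have l1: "(%k. \<integral>x. \<bar>V x\<bar> * \<bar>v k x\<bar> powr p \<partial>M) ----> (LINT x|M. \<bar>V x\<bar> * \<bar>v' x\<bar> powr p)"
    by (rule weighted_tendsto[OF W B lim]) auto
  have l2: "(%k. \<integral>x. (\<bar>V x\<bar> - V x) * \<bar>v k x\<bar> powr p \<partial>M) ----> (LINT x|M. (\<bar>V x\<bar> - V x) * \<bar>v' x\<bar> powr p)"
    by (rule weighted_tendsto[OF W B lim]) (auto simp: abs_if)
  have eq: "(LINT x|M. \<bar>V x\<bar> * \<bar>u x\<bar> powr p) - (LINT x|M. (\<bar>V x\<bar> - V x) * \<bar>u x\<bar> powr p) = PV u" if "W0 p w u h" for u h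
    unfolding PV_def using absV_integrable[OF that] V_powr_integrable[OF that] by (simp add: left_diff_distrib)
  show ?thesis using tendsto_diff[OF l1 l2] unfolding eq[OF W(1)] eq[OF W(2)] .
qed

definition Q :: "('a => real) => ('a => 'a) => real" where "Q v g = E g + PV v"

lemma Qfun_eq: "test_fun w phi ==> Qfun p H V w phi = Q phi (grad phi)"
  unfolding Qfun_def Q_def E_def PV_def
  using H_powr_integrable(1)[OF test_Lp(2)] V_powr_integrable[OF W0_test] by simp

text \<open>A Garding-type inequality: with \<delta> equal to half the ellipticity constant, the
  potential absorbs at most half of the energy.\<close>

lemma Q_lower:
  obtains C where "C >= 0" "!!v g. W0 p w v g ==> \<kappa> powr p / 2 * Np p w g <= Q v g + C * Np p w v"
proof -
  have k: "\<kappa> powr p / 2 > 0" using \<kappa> by simp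
  obtain C where C: "C >= 0" "!!v g. W0 p w v g ==> (LINT x|M. \<bar>V x\<bar> * \<bar>v x\<bar> powr p) <= \<kappa> powr p / 2 * Np p w g + C * Np p w v"
    by (rule W0_adams[OF k]) blast
  show ?thesis
  proof (rule that[OF C(1)])
    fix v g assume W: "W0 p w v g"
    have "- PV v <= (LINT x|M. \<bar>V x\<bar> * \<bar>v x\<bar> powr p)"
      unfolding PV_def Bochner_Integration.integral_minus[symmetric]
    proof (rule integral_mono)
      show "integrable M (%x. - (V x * \<bar>v x\<bar> powr p))" using V_powr_integrable[OF W] by auto
      show "- (V x * \<bar>v x\<bar> powr p) <= \<bar>V x\<bar> * \<bar>v x\<bar> powr p" for x
        using mult_right_mono[of "- V x" "\<bar>V x\<bar>" "\<bar>v x\<bar> powr p"] by simp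
    qed (rule absV_integrable[OF W])
    moreover note C(2)[OF W] H_powr_integrable(2)[OF W0_Lp(2)[OF W]]
    moreover have "\<kappa> powr p * Np p w g = \<kappa> powr p / 2 * Np p w g + \<kappa> powr p / 2 * Np p w g" by simp
    ultimately show "\<kappa> powr p / 2 * Np p w g <= Q v g + C * Np p w v" unfolding Q_def by linarith
  qed
qed

abbreviation "lam1 \<equiv> lambda1 p H V w"

lemma Q_tendsto:
  assumes W: "!!k. W0 p w (v k) (g k)" "W0 p w v' g'"
    and lim: "(%k. Np p w (%x. v k x - v' x)) ----> 0" "(%k. Np p w (%x. g k x - g' x)) ----> 0"
  shows "(%k. Q (v k) (g k)) ----> Q v' g'"
proof -
  have "(%k. Np p w (g k)) ----> Np p w g'" by (rule Np_tendsto[OF p1 W0_Lp(2)[OF W(1)] W0_Lp(2)[OF W(2)] lim(2)])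
  then have "Bseq (%k. Np p w (g k))" by (intro convergent_imp_Bseq convergentI)
  then obtain B where "!!k. norm (Np p w (g k)) <= B" by (rule BseqE) blast
  then have B: "Np p w (g k) <= B" for k using abs_ge_self order_trans by (metis real_norm_def)
  show ?thesis unfolding Q_def
    by (intro tendsto_add E_tendsto[OF W0_Lp(2)[OF W(1)] W0_Lp(2)[OF W(2)] lim(2)] PV_tendsto[OF W B lim(1)])
qed

text \<open>The infimum of real quotients is meaningful only after \<open>Q_lower\<close> shows them
  bounded below; density and continuity of \<open>Q\<close> extend the bound from test functions to
  pairs in \<open>W0\<close>.\<close>

lemma lam1_le:
  assumes W: "W0 p w v g" shows "lam1 * Np p w v <= Q v g"
proof -
  obtain C where C: "C >= 0" "!!v g. W0 p w v g ==> \<kappa> powr p / 2 * Np p w g <= Q v g + C * Np p w v"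
    by (rule Q_lower) blast
  have low: "- C * Np p w u <= Q u h" if "W0 p w u h" for u h
  proof -
    have "0 <= \<kappa> powr p / 2 * Np p w h" by (intro mult_nonneg_nonneg Np_nonneg) simp
    then show ?thesis using C(2)[OF that] by simp
  qed
  define S where "S = {Qfun p H V w phi / (LINT x|M. \<bar>phi x\<bar> powr p) | phi. test_fun w phi \<and> (\<exists>x. phi x ~= 0)}"
  have bdd: "bdd_below S"
  proof (rule bdd_belowI[of _ "- C"])
    fix s assume "s \<in> S"
    then obtain phi where phi: "test_fun w phi" "s = Qfun p H V w phi / (LINT x|M. \<bar>phi x\<bar> powr p)" unfolding S_def by blast
    have s: "s = Q phi (grad phi) / Np p w phi" unfolding phi(2) Qfun_eq[OF phi(1)] by (simp add: Np_def)
    show "- C <= s"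
    proof (cases "Np p w phi = 0")
      case True then show ?thesis using C(1) s by simp
    next
      case False
      then have "Np p w phi > 0" using Np_nonneg[of p w phi] by simp
      then show ?thesis using low[OF W0_test[OF phi(1)]] unfolding s by (simp add: pos_le_divide_eq)
    qed
  qed
  have test: "lam1 * Np p w phi <= Q phi (grad phi)" if phi: "test_fun w phi" for phi
  proof (cases "Np p w phi = 0")
    case True then show ?thesis using low[OF W0_test[OF phi]] by simp
  next
    case False
    then have pos: "Np p w phi > 0" using Np_nonneg[of p w phi] by simp
    have "\<exists>x. phi x ~= 0"
    proof (rule ccontr)
      assume "\<not> ?thesis"
      then have "Np p w phi = 0" by (simp add: Np_def)
      then show False using False by simp
    qed
    then have "Qfun p H V w phi / (LINT x|M. \<bar>phi x\<bar> powr p) \<in> S" unfolding S_def using phi by blast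
    then have "lam1 <= Qfun p H V w phi / (LINT x|M. \<bar>phi x\<bar> powr p)"
      unfolding lambda1_def S_def[symmetric] by (rule cInf_lower[OF _ bdd])
    then have "lam1 <= Q phi (grad phi) / Np p w phi" unfolding Qfun_eq[OF phi] by (simp add: Np_def)
    then show ?thesis using pos by (simp add: pos_le_divide_eq)
  qed
  obtain phi where phi: "!!k. test_fun w (phi k)" "(%k. Np p w (%x. phi k x - v x)) ----> 0"
    "(%k. Np p w (%x. grad (phi k) x - g x)) ----> 0" by (rule W0_approx[OF W]) (rule that)
  have "(%k. Q (phi k) (grad (phi k))) ----> Q v g" by (rule Q_tendsto[OF W0_test[OF phi(1)] W phi(2,3)])
  moreover have "(%k. lam1 * Np p w (phi k)) ----> lam1 * Np p w v"
    by (intro tendsto_mult_left Np_tendsto[OF p1] test_Lp phi W0_Lp(1)[OF W])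
  ultimately show ?thesis using test[OF phi(1)] by (intro LIMSEQ_le) auto
qed

end

section \<open>Weak solutions and minimizing sequences\<close>

lemma powr_mult_le_add_powr:
  fixes a b p :: real
  assumes "a >= 0" "b >= 0" "p > 1"
  shows "a powr (p - 1) * b <= 2 powr p * (a powr p + b powr p)"
proof -
  have "a powr (p - 1) * b <= (a + b) powr (p - 1) * (a + b)"
    using assms by (intro mult_mono powr_mono2) auto
  also have "... = (a + b) powr p" using powr_add[of "a + b" "p - 1" 1] assms by simp
  also have "... <= 2 powr p * (a powr p + b powr p)" by (rule powr_add_le) (use assms in auto)
  finally show ?thesis .
qed

lemma abs_powr_mult_self:
  fixes t p :: real
  shows "\<bar>\<bar>t\<bar> powr (p - 2) * t\<bar> = \<bar>t\<bar> powr (p - 1)"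
  using powr_add[of "\<bar>t\<bar>" "p - 2" 1] by (cases "t = 0") (auto simp: abs_mult)

lemma abs_powr_mult_self2:
  fixes t p :: real
  shows "\<bar>t\<bar> powr (p - 2) * t * t = \<bar>t\<bar> powr p"
proof (cases "t = 0")
  case False
  have "t * t = \<bar>t\<bar> powr 2" using False by (simp add: power2_eq_square)
  then show ?thesis using powr_add[of "\<bar>t\<bar>" "p - 2" 2] by (simp add: mult.assoc)
qed simp

context eigen_setup begin

lemma Aop_integrable:
  assumes g: "Lp p w g" and h: "Lp p w h"
  shows "integrable M (%x. Aop p H x (g x) \<bullet> h x)"
proof (rule Bochner_Integration.integrable_bound)
  show "integrable M (%x. 2 powr p * (H x (g x) powr p + H x (h x) powr p))"
    using H_powr_integrable(1)[OF g] H_powr_integrable(1)[OF h] by auto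
  show "(%x. Aop p H x (g x) \<bullet> h x) \<in> borel_measurable M" by (rule Aop_measurable[OF Lp_measurable[OF g] Lp_measurable[OF h]])
  show "AE x in M. norm (Aop p H x (g x) \<bullet> h x) <= norm (2 powr p * (H x (g x) powr p + H x (h x) powr p))"
    using H_good
  proof eventually_elim
    case (elim x)
    then have "\<bar>Aop p H x (g x) \<bullet> h x\<bar> <= H x (g x) powr (p - 1) * H x (h x)"
      unfolding Aop_duality using duality_map_abs_le[OF p1] by blast
    also have "... <= 2 powr p * (H x (g x) powr p + H x (h x) powr p)" by (rule powr_mult_le_add_powr[OF H_nn H_nn p1])
    finally show ?case by simp
  qed
qed

lemma W0_powr_integrable: "W0 p w v g ==> integrable M (%x. \<bar>v x\<bar> powr p)"
  using Lp_integrable[OF W0_Lp(1)] by simp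

lemma potential_integrable:
  assumes v: "W0 p w v g" and u: "W0 p w u h"
  shows "integrable M (%x. (V x - lam) * (\<bar>v x\<bar> powr (p - 2) * v x) * u x)"
    "integrable M (%x. \<bar>V x - lam\<bar> * \<bar>v x\<bar> powr p)"
proof -
  note [measurable] = Lp_measurable[OF W0_Lp(1)[OF v]] Lp_measurable[OF W0_Lp(1)[OF u]]
  have i: "integrable M (%x. (\<bar>V x\<bar> + \<bar>lam\<bar>) * \<bar>z x\<bar> powr p)" if "W0 p w z k" for z k
    using absV_integrable[OF that] W0_powr_integrable[OF that] by (simp add: distrib_right)
  show "integrable M (%x. \<bar>V x - lam\<bar> * \<bar>v x\<bar> powr p)"
    by (rule Bochner_Integration.integrable_bound[OF i[OF v]]) (auto intro!: AE_I2 mult_right_mono simp: abs_mult)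
  have dom: "integrable M (%x. 2 powr p * ((\<bar>V x\<bar> + \<bar>lam\<bar>) * \<bar>v x\<bar> powr p + (\<bar>V x\<bar> + \<bar>lam\<bar>) * \<bar>u x\<bar> powr p))"
    using i[OF v] i[OF u] by auto
  show "integrable M (%x. (V x - lam) * (\<bar>v x\<bar> powr (p - 2) * v x) * u x)"
  proof (rule Bochner_Integration.integrable_bound[OF dom])
    show "AE x in M. norm ((V x - lam) * (\<bar>v x\<bar> powr (p - 2) * v x) * u x)
      <= norm (2 powr p * ((\<bar>V x\<bar> + \<bar>lam\<bar>) * \<bar>v x\<bar> powr p + (\<bar>V x\<bar> + \<bar>lam\<bar>) * \<bar>u x\<bar> powr p))"
    proof (rule AE_I2)
      fix x
      have "\<bar>(V x - lam) * (\<bar>v x\<bar> powr (p - 2) * v x) * u x\<bar> = \<bar>V x - lam\<bar> * (\<bar>v x\<bar> powr (p - 1) * \<bar>u x\<bar>)"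
        unfolding abs_mult[of _ "u x"] abs_mult[of "V x - lam"] abs_powr_mult_self by simp
      also have "... <= (\<bar>V x\<bar> + \<bar>lam\<bar>) * (2 powr p * (\<bar>v x\<bar> powr p + \<bar>u x\<bar> powr p))"
        by (intro mult_mono powr_mult_le_add_powr p1) auto
      also have "... = 2 powr p * ((\<bar>V x\<bar> + \<bar>lam\<bar>) * \<bar>v x\<bar> powr p + (\<bar>V x\<bar> + \<bar>lam\<bar>) * \<bar>u x\<bar> powr p)" by (simp add: algebra_simps)
      finally show "norm ((V x - lam) * (\<bar>v x\<bar> powr (p - 2) * v x) * u x)
        <= norm (2 powr p * ((\<bar>V x\<bar> + \<bar>lam\<bar>) * \<bar>v x\<bar> powr p + (\<bar>V x\<bar> + \<bar>lam\<bar>) * \<bar>u x\<bar> powr p))" by simp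
    qed
  qed measurable
qed

definition weak_form :: "real => ('a => real) => ('a => 'a) => ('a => real) => ('a => 'a) => real" where
  "weak_form lam v g u h = (LINT x|M. Aop p H x (g x) \<bullet> h x) + (LINT x|M. (V x - lam) * (\<bar>v x\<bar> powr (p - 2) * v x) * u x)"

definition solves :: "real => ('a => real) => ('a => 'a) => bool" where
  "solves lam v g \<longleftrightarrow> W0 p w v g \<and> (\<forall>phi. test_fun w phi --> weak_form lam v g phi (grad phi) = 0)"

text \<open>Young's inequality with a scale \<open>t\<close>: the part of \<open>(v, g)\<close> gets
  a small factor while that of \<open>(u, h)\<close> gets a large one. This replaces a norm estimate
  and suffices for continuity in \<open>(u, h)\<close>.\<close>

lemma weak_form_bound:
  assumes v: "W0 p w v g" and u: "W0 p w u h" and t: "t > 0"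
  shows "\<bar>weak_form lam v g u h\<bar> <= 2 powr p * (t powr p * (E g + (LINT x|M. \<bar>V x - lam\<bar> * \<bar>v x\<bar> powr p))
    + t powr (- (p * (p - 1))) * (E h + (LINT x|M. \<bar>V x - lam\<bar> * \<bar>u x\<bar> powr p)))"
proof -
  note Lv = W0_Lp[OF v] and Lu = W0_Lp[OF u]
  let ?c = "t powr p" and ?d = "t powr (- (p * (p - 1)))"
  have young: "a powr (p - 1) * b <= 2 powr p * (?c * a powr p + ?d * b powr p)" if "a >= 0" "b >= 0" for a b
  proof -
    have "a powr (p - 1) * b = (t * a) powr (p - 1) * (t powr (1 - p) * b)"
      using t powr_add[of t "p - 1" "1 - p"] that by (simp add: powr_mult)
    also have "... <= 2 powr p * ((t * a) powr p + (t powr (1 - p) * b) powr p)"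
      using that t p1 by (intro powr_mult_le_add_powr) auto
    also have "... = 2 powr p * (?c * a powr p + ?d * b powr p)"
      using that t by (simp add: powr_mult powr_powr algebra_simps)
    finally show ?thesis .
  qed
  have "\<bar>\<integral>x. Aop p H x (g x) \<bullet> h x \<partial>M\<bar> <= (LINT x|M. 2 powr p * (?c * H x (g x) powr p + ?d * H x (h x) powr p))"
  proof (rule order_trans[OF integral_abs_bound integral_mono_AE])
    show "integrable M (%x. \<bar>Aop p H x (g x) \<bullet> h x\<bar>)" using Aop_integrable[OF Lv(2) Lu(2)] by simp
    show "integrable M (%x. 2 powr p * (?c * H x (g x) powr p + ?d * H x (h x) powr p))"
      using H_powr_integrable(1)[OF Lv(2)] H_powr_integrable(1)[OF Lu(2)] by simp
    show "AE x in M. \<bar>Aop p H x (g x) \<bullet> h x\<bar> <= 2 powr p * (?c * H x (g x) powr p + ?d * H x (h x) powr p)"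
      using H_good
    proof eventually_elim
      case (elim x)
      then have "\<bar>Aop p H x (g x) \<bullet> h x\<bar> <= H x (g x) powr (p - 1) * H x (h x)"
        unfolding Aop_duality by (intro duality_map_abs_le[OF p1]) blast
      then show ?case using young[OF H_nn H_nn, of x "g x" x "h x"] by linarith
    qed
  qed
  also have "... = 2 powr p * (?c * E g + ?d * E h)"
    using H_powr_integrable(1)[OF Lv(2)] H_powr_integrable(1)[OF Lu(2)] by (simp add: E_def)
  finally have 1: "\<bar>\<integral>x. Aop p H x (g x) \<bullet> h x \<partial>M\<bar> <= 2 powr p * (?c * E g + ?d * E h)" .
  note Iv = potential_integrable(2)[OF v v, of lam] and Iu = potential_integrable(2)[OF u u, of lam]
  let ?N = "%z. (LINT x|M. \<bar>V x - lam\<bar> * \<bar>z x\<bar> powr p)"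
  have "\<bar>\<integral>x. (V x - lam) * (\<bar>v x\<bar> powr (p - 2) * v x) * u x \<partial>M\<bar>
     <= (LINT x|M. 2 powr p * (?c * (\<bar>V x - lam\<bar> * \<bar>v x\<bar> powr p) + ?d * (\<bar>V x - lam\<bar> * \<bar>u x\<bar> powr p)))"
  proof (rule order_trans[OF integral_abs_bound integral_mono])
    show "integrable M (%x. \<bar>(V x - lam) * (\<bar>v x\<bar> powr (p - 2) * v x) * u x\<bar>)" using potential_integrable(1)[OF v u] by simp
    show "integrable M (%x. 2 powr p * (?c * (\<bar>V x - lam\<bar> * \<bar>v x\<bar> powr p) + ?d * (\<bar>V x - lam\<bar> * \<bar>u x\<bar> powr p)))" using Iv Iu by simp
    show "\<bar>(V x - lam) * (\<bar>v x\<bar> powr (p - 2) * v x) * u x\<bar> <= 2 powr p * (?c * (\<bar>V x - lam\<bar> * \<bar>v x\<bar> powr p) + ?d * (\<bar>V x - lam\<bar> * \<bar>u x\<bar> powr p))" for x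
    proof -
      have "\<bar>V x - lam\<bar> * (\<bar>v x\<bar> powr (p - 1) * \<bar>u x\<bar>) <= \<bar>V x - lam\<bar> * (2 powr p * (?c * \<bar>v x\<bar> powr p + ?d * \<bar>u x\<bar> powr p))"
        by (intro mult_left_mono young) auto
      then show ?thesis unfolding abs_mult[of _ "u x"] abs_mult[of "V x - lam"] abs_powr_mult_self by (simp add: algebra_simps)
    qed
  qed
  also have "... = 2 powr p * (?c * ?N v + ?d * ?N u)" using Iv Iu by simp
  finally have 2: "\<bar>\<integral>x. (V x - lam) * (\<bar>v x\<bar> powr (p - 2) * v x) * u x \<partial>M\<bar> <= 2 powr p * (?c * ?N v + ?d * ?N u)" .
  have "2 powr p * (?c * (E g + ?N v) + ?d * (E h + ?N u)) = 2 powr p * (?c * E g + ?d * E h) + 2 powr p * (?c * ?N v + ?d * ?N u)"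
    by (simp add: algebra_simps)
  then show ?thesis unfolding weak_form_def using 1 2 by linarith
qed

text \<open>The form at an approximant minus \<open>u\<close> is a fixed nonzero number if the claim
  fails; letting the approximation improve at fixed \<open>t\<close>, and choosing \<open>t\<close>
  afterwards, contradicts the scaled bound.\<close>

lemma solves_W0:
  assumes S: "solves lam v g" and u: "W0 p w u h"
  shows "weak_form lam v g u h = 0"
proof (rule ccontr)
  assume ne: "weak_form lam v g u h ~= 0"
  have v: "W0 p w v g" using S by (simp add: solves_def)
  obtain phi where phi: "!!k. test_fun w (phi k)" "(%k. Np p w (%x. phi k x - u x)) ----> 0"
    "(%k. Np p w (%x. grad (phi k) x - h x)) ----> 0" by (rule W0_approx[OF u]) (rule that)
  note Lv = W0_Lp[OF v] and Lu = W0_Lp[OF u] and Lphi = test_Lp[OF phi(1)]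
  have Wd: "W0 p w (%x. phi k x - u x) (%x. grad (phi k) x - h x)" for k
    using W0_add[OF W0_test[OF phi(1)[of k]] W0_scale[OF u, of "-1"]] by simp
  have eq: "weak_form lam v g (%x. phi k x - u x) (%x. grad (phi k) x - h x) = - weak_form lam v g u h" for k
    using Aop_integrable[OF Lv(2) Lphi(2)[of k]] Aop_integrable[OF Lv(2) Lu(2)]
      potential_integrable(1)[OF v W0_test[OF phi(1)[of k]], of lam] potential_integrable(1)[OF v u, of lam] S phi(1)[of k]
    by (simp add: weak_form_def solves_def inner_diff_right right_diff_distrib)
  define G where "G = E g + (LINT x|M. \<bar>V x - lam\<bar> * \<bar>v x\<bar> powr p)"
  define R where "R k = E (%x. grad (phi k) x - h x) + (LINT x|M. \<bar>V x - lam\<bar> * \<bar>phi k x - u x\<bar> powr p)" for k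
  have R0: "R ----> 0"
  proof -
    have "Lp p w (%x. 0 :: 'a)" by (rule bounded_Lp[where K = 0]) auto
    moreover have "E (%x. 0) = 0"
      unfolding E_def by (rule integral_eq_zero_AE) (use H_good in eventually_elim, auto simp: good_norm_def is_norm_fun_def)
    ultimately have 1: "(%k. E (%x. grad (phi k) x - h x)) ----> 0"
      using E_tendsto[OF W0_Lp(2)[OF Wd], of "%x. 0"] phi(3) by simp
    have "Bseq (%k. Np p w (grad (phi k)))"
      by (rule convergent_imp_Bseq[OF convergentI[OF Np_tendsto[OF p1 Lphi(2) Lu(2) phi(3)]]])
    then obtain B where "!!k. norm (Np p w (grad (phi k))) <= B" by (rule BseqE) blast
    then have B: "Np p w (grad (phi k)) <= B" for k using abs_ge_self order_trans by (metis real_norm_def)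
    have up: "(%k. (LINT x|M. \<bar>V x\<bar> * \<bar>phi k x - u x\<bar> powr p) + \<bar>lam\<bar> * Np p w (%x. phi k x - u x)) ----> 0"
      using tendsto_add[OF absV_diff_tendsto[OF W0_test[OF phi(1)] u B phi(2)] tendsto_mult_right_zero[OF phi(2)]] by simp
    have le: "(LINT x|M. \<bar>V x - lam\<bar> * \<bar>phi k x - u x\<bar> powr p) <= (LINT x|M. \<bar>V x\<bar> * \<bar>phi k x - u x\<bar> powr p) + \<bar>lam\<bar> * Np p w (%x. phi k x - u x)" for k
    proof -
      have "(LINT x|M. \<bar>V x - lam\<bar> * \<bar>phi k x - u x\<bar> powr p) <= (LINT x|M. \<bar>V x\<bar> * \<bar>phi k x - u x\<bar> powr p + \<bar>lam\<bar> * \<bar>phi k x - u x\<bar> powr p)"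
      proof (rule integral_mono[OF potential_integrable(2)[OF Wd Wd]])
        show "\<bar>V x - lam\<bar> * \<bar>phi k x - u x\<bar> powr p <= \<bar>V x\<bar> * \<bar>phi k x - u x\<bar> powr p + \<bar>lam\<bar> * \<bar>phi k x - u x\<bar> powr p" for x
          unfolding distrib_right[symmetric] by (rule mult_right_mono) auto
      qed (use absV_integrable[OF Wd[of k]] W0_powr_integrable[OF Wd[of k]] in simp)
      then show ?thesis using absV_integrable[OF Wd[of k]] W0_powr_integrable[OF Wd[of k]] by (simp add: Np_def)
    qed
    have "(%k. \<integral>x. \<bar>V x - lam\<bar> * \<bar>phi k x - u x\<bar> powr p \<partial>M) ----> 0"
      by (rule tendsto_sandwich[OF _ _ tendsto_const up]) (auto intro!: always_eventually integral_nonneg_AE le)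
    then show ?thesis unfolding R_def using tendsto_add[OF 1] by fastforce
  qed
  have le: "\<bar>weak_form lam v g u h\<bar> <= 2 powr p * (t powr p * G)" if t: "t > 0" for t
  proof (rule LIMSEQ_le_const)
    have "(%k. 2 powr p * (t powr p * G + t powr (- (p * (p - 1))) * R k)) ----> 2 powr p * (t powr p * G + t powr (- (p * (p - 1))) * 0)"
      by (intro tendsto_intros R0)
    then show "(%k. 2 powr p * (t powr p * G + t powr (- (p * (p - 1))) * R k)) ----> 2 powr p * (t powr p * G)" by simp
    show "\<exists>N. \<forall>n\<ge>N. \<bar>weak_form lam v g u h\<bar> <= 2 powr p * (t powr p * G + t powr (- (p * (p - 1))) * R n)"
      using weak_form_bound[OF v Wd t, of lam, unfolded eq abs_minus_cancel] by (auto simp: G_def R_def)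
  qed
  \<comment> \<open>With \<open>t powr p = b\<close>, the remaining bound is strictly below the
    number it is supposed to dominate.\<close>
  define b where "b = \<bar>weak_form lam v g u h\<bar> / (2 powr p * (\<bar>G\<bar> + 1))"
  have b: "b > 0" using ne by (simp add: b_def)
  then have "(b powr (1 / p)) powr p = b" using p0 by (simp add: powr_powr)
  then have "\<bar>weak_form lam v g u h\<bar> <= 2 powr p * (b * G)" using le[of "b powr (1 / p)"] b by simp
  also have "... < 2 powr p * (b * (\<bar>G\<bar> + 1))" using b by (intro mult_strict_left_mono) auto
  also have "... = \<bar>weak_form lam v g u h\<bar>" by (simp add: b_def)
  finally show False by simp
qed

text \<open>The equation is tested with \<open>u\<close> itself; wherever \<open>u\<close> and
  \<open>h\<close> do not vanish they agree with \<open>v\<close> and \<open>g\<close>, so Euler's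
  identity applies. The cases used are \<open>u = v\<close> and the positive part of
  \<open>v\<close>.\<close>

lemma Q_eq_if_restricted:
  assumes S: "solves lam v g" and u: "W0 p w u h"
    and eq: "AE x in M. (h x = g x \<and> u x = v x) \<or> (h x = 0 \<and> u x = 0)"
  shows "Q u h = lam * Np p w u"
proof -
  have v: "W0 p w v g" using S by (simp add: solves_def)
  note Lv = W0_Lp[OF v] and Lu = W0_Lp[OF u]
  note [measurable] = Lp_measurable[OF Lv(1)] Lp_measurable[OF Lu(1)]
  have [measurable]: "(%x. H x (h x)) \<in> borel_measurable M" by (rule H_compose_measurable[OF Lp_measurable[OF Lu(2)]])
  have "(LINT x|M. Aop p H x (g x) \<bullet> h x) = E h"
    unfolding E_def
  proof (rule integral_cong_AE)
    show "(%x. Aop p H x (g x) \<bullet> h x) \<in> borel_measurable M" by (rule Aop_measurable[OF Lp_measurable[OF Lv(2)] Lp_measurable[OF Lu(2)]])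
    show "AE x in M. Aop p H x (g x) \<bullet> h x = H x (h x) powr p"
      using H_good eq
    proof eventually_elim
      case (elim x)
      then have gn: "good_norm \<nu> (H x)" by blast
      have "H x 0 = 0" using gn is_norm_funD(2) by (auto simp: good_norm_def)
      then show ?case using elim(2) duality_map_self[OF p1 gn] by (auto simp: Aop_duality)
    qed
  qed measurable
  moreover have "(LINT x|M. (V x - lam) * (\<bar>v x\<bar> powr (p - 2) * v x) * u x) = (LINT x|M. V x * \<bar>u x\<bar> powr p - lam * \<bar>u x\<bar> powr p)"
  proof (rule integral_cong_AE)
    show "AE x in M. (V x - lam) * (\<bar>v x\<bar> powr (p - 2) * v x) * u x = V x * \<bar>u x\<bar> powr p - lam * \<bar>u x\<bar> powr p"
      using eq
    proof eventually_elim
      case (elim x)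
      show ?case
      proof (cases "u x = 0")
        case False
        then have "u x = v x" using elim by auto
        then have "(\<bar>v x\<bar> powr (p - 2) * v x) * u x = \<bar>u x\<bar> powr p" using abs_powr_mult_self2[where t = "v x" and p = p] by simp
        then show ?thesis by (simp add: mult.assoc left_diff_distrib)
      qed simp
    qed
  qed measurable
  moreover have "(LINT x|M. V x * \<bar>u x\<bar> powr p - lam * \<bar>u x\<bar> powr p) = PV u - lam * Np p w u"
    unfolding PV_def Np_def using V_powr_integrable[OF u] W0_powr_integrable[OF u] by simp
  ultimately show ?thesis using solves_W0[OF S u] by (simp add: weak_form_def Q_def)
qed

lemma solves_lam_ge:
  assumes "solves lam v g" "Np p w v > 0" shows "lam1 <= lam"
proof -
  have W: "W0 p w v g" using assms by (simp add: solves_def)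
  have "Q v g = lam * Np p w v" by (rule Q_eq_if_restricted[OF assms(1) W]) auto
  then have "lam1 * Np p w v <= lam * Np p w v" using lam1_le[OF W] by simp
  then show ?thesis using assms(2) by simp
qed

lemma solves_uminus:
  assumes S: "solves lam v g" shows "solves lam (%x. - v x) (%x. - g x)"
proof -
  have W: "W0 p w v g" using S by (simp add: solves_def)
  have W': "W0 p w (%x. - v x) (%x. - g x)" using W0_scale[OF W, of "-1"] by simp
  have "weak_form lam (%x. - v x) (%x. - g x) phi (grad phi) = - weak_form lam v g phi (grad phi)" if phi: "test_fun w phi" for phi
  proof -
    have "(LINT x|M. Aop p H x (- g x) \<bullet> grad phi x) = (LINT x|M. - (Aop p H x (g x) \<bullet> grad phi x))"
    proof (rule integral_cong_AE)
      show "(%x. Aop p H x (- g x) \<bullet> grad phi x) \<in> borel_measurable M"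
        by (rule borel_measurable_integrable[OF Aop_integrable[OF W0_Lp(2)[OF W'] test_Lp(2)[OF phi]]])
      show "(%x. - (Aop p H x (g x) \<bullet> grad phi x)) \<in> borel_measurable M"
        using borel_measurable_integrable[OF Aop_integrable[OF W0_Lp(2)[OF W] test_Lp(2)[OF phi]]] by measurable
      show "AE x in M. Aop p H x (- g x) \<bullet> grad phi x = - (Aop p H x (g x) \<bullet> grad phi x)"
        using H_good by eventually_elim (use duality_map_uminus[OF p1] in \<open>auto simp: Aop_duality\<close>)
    qed
    then show ?thesis by (simp add: weak_form_def)
  qed
  then show ?thesis using S W' by (simp add: solves_def)
qed

text \<open>The difference quotients of \<open>Q - lam1 * Np\<close> in the direction of a test
  function are nonnegative by minimality. Their limit is \<open>p\<close>-free because the quotients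
  are divided by \<open>p\<close>; applying this to \<open>phi\<close> and \<open>- phi\<close>
  gives equality.\<close>

lemma euler_lagrange:
  assumes W: "W0 p w v g" and Q: "Q v g = lam1 * Np p w v"
  shows "solves lam1 v g"
proof -
  note Lv = W0_Lp[OF W]
  have ge: "0 <= weak_form lam1 v g phi (grad phi)" if phi: "test_fun w phi" for phi
  proof -
    note Lphi = test_Lp[OF phi] and Wphi = W0_test[OF phi]
    note [measurable] = Lp_measurable[OF Lv(1)] Lp_measurable[OF Lv(2)] Lp_measurable[OF Lphi(1)] Lp_measurable[OF Lphi(2)]
    define t where "t m = 1 / real (Suc m)" for m
    have Wt: "W0 p w (%x. v x + t m * phi x) (%x. g x + t m *\<^sub>R grad phi x)" for m
      by (rule W0_add[OF W W0_scale[OF Wphi]])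
    define a where "a m x = real (Suc m) * (H x (g x + t m *\<^sub>R grad phi x) powr p - H x (g x) powr p) / p" for m x
    define b where "b m x = (V x - lam1) * (real (Suc m) * (\<bar>v x + t m * phi x\<bar> powr p - \<bar>v x\<bar> powr p) / p)" for m x
    have [measurable]: "(%x. H x (g x)) \<in> borel_measurable M" "(%x. H x (grad phi x)) \<in> borel_measurable M"
      "(%x. H x (g x + t m *\<^sub>R grad phi x)) \<in> borel_measurable M" for m
      by (intro H_compose_measurable; measurable)+
    have ai: "integrable M (%x. a m x)" for m
      unfolding a_def using H_powr_integrable(1)[OF W0_Lp(2)[OF Wt[of m]]] H_powr_integrable(1)[OF Lv(2)] by auto
    have Vi: "integrable M (%x. (V x - lam1) * \<bar>u x\<bar> powr p)" if "W0 p w u h" for u h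
      using V_powr_integrable[OF that] W0_powr_integrable[OF that] by (simp add: left_diff_distrib)
    have bi: "integrable M (%x. b m x)" for m
    proof -
      have "integrable M (%x. (real (Suc m) / p) * ((V x - lam1) * \<bar>v x + t m * phi x\<bar> powr p - (V x - lam1) * \<bar>v x\<bar> powr p))"
        using Vi[OF Wt[of m]] Vi[OF W] by auto
      moreover have "(real (Suc m) / p) * ((V x - lam1) * \<bar>v x + t m * phi x\<bar> powr p - (V x - lam1) * \<bar>v x\<bar> powr p) = b m x" for x
        unfolding b_def by (simp add: algebra_simps diff_divide_distrib)
      ultimately show ?thesis by simp
    qed
    have pos: "0 <= (LINT x|M. a m x) + (LINT x|M. b m x)" for m
    proof -
      let ?c = "real (Suc m) / p"
      have "(LINT x|M. a m x) = (LINT x|M. ?c * (H x (g x + t m *\<^sub>R grad phi x) powr p - H x (g x) powr p))"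
        unfolding a_def by simp
      also have "... = ?c * (E (%x. g x + t m *\<^sub>R grad phi x) - E g)"
        unfolding E_def integral_mult_right_zero
        by (subst Bochner_Integration.integral_diff[OF H_powr_integrable(1)[OF W0_Lp(2)[OF Wt]] H_powr_integrable(1)[OF Lv(2)]]) simp
      finally have 1: "(LINT x|M. a m x) = ?c * (E (%x. g x + t m *\<^sub>R grad phi x) - E g)" .
      have e: "(LINT x|M. (V x - lam1) * \<bar>u x\<bar> powr p) = PV u - lam1 * Np p w u" if "W0 p w u h" for u h
        unfolding PV_def Np_def left_diff_distrib using V_powr_integrable[OF that] W0_powr_integrable[OF that] by simp
      have "(LINT x|M. b m x) = (LINT x|M. ?c * ((V x - lam1) * \<bar>v x + t m * phi x\<bar> powr p - (V x - lam1) * \<bar>v x\<bar> powr p))"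
        unfolding b_def by (intro Bochner_Integration.integral_cong refl) (simp add: algebra_simps diff_divide_distrib)
      also have "... = ?c * ((PV (%x. v x + t m * phi x) - lam1 * Np p w (%x. v x + t m * phi x)) - (PV v - lam1 * Np p w v))"
        unfolding integral_mult_right_zero e[OF Wt, symmetric] e[OF W, symmetric]
        by (subst Bochner_Integration.integral_diff[OF Vi[OF Wt] Vi[OF W]]) simp
      finally have 2: "(LINT x|M. b m x) = ?c * ((PV (%x. v x + t m * phi x) - lam1 * Np p w (%x. v x + t m * phi x)) - (PV v - lam1 * Np p w v))" .
      have "0 <= ?c * ((Q (%x. v x + t m * phi x) (%x. g x + t m *\<^sub>R grad phi x) - lam1 * Np p w (%x. v x + t m * phi x)) - (Q v g - lam1 * Np p w v))"
        using lam1_le[OF Wt[of m]] Q p0 by (intro mult_nonneg_nonneg) auto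
      also have "... = (LINT x|M. a m x) + (LINT x|M. b m x)" unfolding 1 2 Q_def by (simp add: algebra_simps)
      finally show ?thesis .
    qed
    have la: "(%m. \<integral>x. a m x \<partial>M) ----> (LINT x|M. Aop p H x (g x) \<bullet> grad phi x)"
    proof (rule integral_dominated_convergence)
      show "integrable M (%x. 2 powr p * (2 powr p * H x (g x) powr p + H x (grad phi x) powr p))"
        using H_powr_integrable(1)[OF Lv(2)] H_powr_integrable(1)[OF Lphi(2)] by auto
      show "(%x. Aop p H x (g x) \<bullet> grad phi x) \<in> borel_measurable M" by (rule borel_measurable_integrable[OF Aop_integrable[OF Lv(2) Lphi(2)]])
      show "a m \<in> borel_measurable M" for m by (rule borel_measurable_integrable[OF ai])
      show "AE x in M. (%m. a m x) ----> Aop p H x (g x) \<bullet> grad phi x"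
        using H_good by eventually_elim (use duality_map_quotient[OF p1] in \<open>auto simp: Aop_duality a_def t_def\<close>)
      show "AE x in M. norm (a m x) <= 2 powr p * (2 powr p * H x (g x) powr p + H x (grad phi x) powr p)" for m
        using H_good
      proof eventually_elim
        case (elim x)
        then have n: "is_norm_fun (H x)" by (simp add: good_norm_def)
        have "\<bar>a m x\<bar> <= (2 * H x (g x) + H x (grad phi x)) powr p" unfolding a_def t_def by (rule duality_quotient_bound[OF p1 n])
        also have "... <= 2 powr p * ((2 * H x (g x)) powr p + H x (grad phi x) powr p)" by (rule powr_add_le) (use H_nn p0 in auto)
        finally show ?case by (simp add: powr_mult)
      qed
    qed
    have lb: "(%m. \<integral>x. b m x \<partial>M) ----> (LINT x|M. (V x - lam1) * (\<bar>v x\<bar> powr (p - 2) * v x) * phi x)"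
    proof (rule integral_dominated_convergence)
      show "integrable M (%x. 2 powr p * (2 powr p * (\<bar>V x - lam1\<bar> * \<bar>v x\<bar> powr p) + \<bar>V x - lam1\<bar> * \<bar>phi x\<bar> powr p))"
        using potential_integrable(2)[OF W W, of lam1] potential_integrable(2)[OF Wphi W, of lam1] by auto
      show "(%x. (V x - lam1) * (\<bar>v x\<bar> powr (p - 2) * v x) * phi x) \<in> borel_measurable M" by measurable
      show "b m \<in> borel_measurable M" for m by (rule borel_measurable_integrable[OF bi])
      show "AE x in M. (%m. b m x) ----> (V x - lam1) * (\<bar>v x\<bar> powr (p - 2) * v x) * phi x"
      proof (rule AE_I2)
        fix x
        have "(%m. real (Suc m) * (\<bar>v x + t m * phi x\<bar> powr p - \<bar>v x\<bar> powr p) / p) ----> (\<bar>v x\<bar> powr (p - 2) * v x) * phi x"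
          using duality_map_quotient[OF p1 good_norm_abs, of "v x" "phi x"] unfolding duality_map_abs[OF p1] by (simp add: t_def del: of_nat_Suc)
        then show "(%m. b m x) ----> (V x - lam1) * (\<bar>v x\<bar> powr (p - 2) * v x) * phi x"
          unfolding b_def mult.assoc[of "V x - lam1"] by (rule tendsto_mult_left)
      qed
      show "AE x in M. norm (b m x) <= 2 powr p * (2 powr p * (\<bar>V x - lam1\<bar> * \<bar>v x\<bar> powr p) + \<bar>V x - lam1\<bar> * \<bar>phi x\<bar> powr p)" for m
      proof (rule AE_I2)
        fix x
        have n: "is_norm_fun (abs :: real => real)" using good_norm_abs by (simp add: good_norm_def)
        have "\<bar>real (Suc m) * (\<bar>v x + t m * phi x\<bar> powr p - \<bar>v x\<bar> powr p) / p\<bar> <= (2 * \<bar>v x\<bar> + \<bar>phi x\<bar>) powr p"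
          using duality_quotient_bound[OF p1 n, of m "v x" "phi x"] by (simp add: t_def del: of_nat_Suc)
        also have "... <= 2 powr p * ((2 * \<bar>v x\<bar>) powr p + \<bar>phi x\<bar> powr p)" by (rule powr_add_le) (use p0 in auto)
        finally have "\<bar>V x - lam1\<bar> * \<bar>real (Suc m) * (\<bar>v x + t m * phi x\<bar> powr p - \<bar>v x\<bar> powr p) / p\<bar> <= \<bar>V x - lam1\<bar> * (2 powr p * ((2 * \<bar>v x\<bar>) powr p + \<bar>phi x\<bar> powr p))"
          by (rule mult_left_mono) simp
        also have "... = 2 powr p * (2 powr p * (\<bar>V x - lam1\<bar> * \<bar>v x\<bar> powr p) + \<bar>V x - lam1\<bar> * \<bar>phi x\<bar> powr p)"
          by (simp add: powr_mult algebra_simps)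
        finally show "norm (b m x) <= 2 powr p * (2 powr p * (\<bar>V x - lam1\<bar> * \<bar>v x\<bar> powr p) + \<bar>V x - lam1\<bar> * \<bar>phi x\<bar> powr p)"
          unfolding b_def real_norm_def abs_mult[of "V x - lam1"] .
      qed
    qed
    show ?thesis unfolding weak_form_def
      by (rule LIMSEQ_le_const[OF tendsto_add[OF la lb]]) (use pos in blast)
  qed
  have "weak_form lam1 v g phi (grad phi) = 0" if phi: "test_fun w phi" for phi
  proof -
    have mphi: "test_fun w (%x. - phi x)" using test_fun_scale[OF phi, of "-1"] by simp
    have "grad (%x. - phi x) x = - grad phi x" for x using grad_scale[OF test_fun_smooth[OF phi], of "-1" x] by simp
    then have "weak_form lam1 v g (%x. - phi x) (grad (%x. - phi x)) = - weak_form lam1 v g phi (grad phi)"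
      by (simp add: weak_form_def)
    then show ?thesis using ge[OF phi] ge[OF mphi] by simp
  qed
  then show ?thesis using W by (simp add: solves_def)
qed

lemma E_mid_le:
  assumes "Lp p w a" "Lp p w b"
  shows "E (%x. (1/2) *\<^sub>R (a x + b x)) <= (E a + E b) / 2"
proof -
  have "E (%x. (1/2) *\<^sub>R (a x + b x)) <= (LINT x|M. (H x (a x) powr p + H x (b x) powr p) / 2)"
    unfolding E_def
  proof (rule integral_mono_AE)
    show "integrable M (%x. H x ((1/2) *\<^sub>R (a x + b x)) powr p)"
      by (rule H_powr_integrable(1)[OF Lp_scaleR(1)[OF Lp_add(1)[OF assms p0(1)]]])
    show "integrable M (%x. (H x (a x) powr p + H x (b x) powr p) / 2)"
      using H_powr_integrable(1)[OF assms(1)] H_powr_integrable(1)[OF assms(2)] by auto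
    show "AE x in M. H x ((1/2) *\<^sub>R (a x + b x)) powr p <= (H x (a x) powr p + H x (b x) powr p) / 2"
      using H_good
    proof eventually_elim
      case (elim x)
      then have n: "is_norm_fun (H x)" by (simp add: good_norm_def)
      define s t c where "s = H x (a x)" and "t = H x (b x)" and "c = (s + t) / 2"
      have nn: "s >= 0" "t >= 0" "c >= 0" using H_nn by (auto simp: s_def t_def c_def)
      have "H x ((1/2) *\<^sub>R (a x + b x)) <= c"
        using is_norm_funD(4)[OF n, of "1/2" "a x + b x"] is_norm_funD(5)[OF n, of "a x" "b x"] by (simp add: s_def t_def c_def)
      then have "H x ((1/2) *\<^sub>R (a x + b x)) powr p <= c powr p" using H_nn p0 by (intro powr_mono2) auto
      also have "c powr p <= (s powr p + t powr p) / 2"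
      proof -
        have 1: "c powr p + p * c powr (p - 1) * (s - c) <= s powr p" by (rule powr_above_tangent) (use p1 nn in auto)
        have 2: "c powr p + p * c powr (p - 1) * (t - c) <= t powr p" by (rule powr_above_tangent) (use p1 nn in auto)
        have 3: "t - c = - (s - c)" by (simp add: c_def field_simps)
        have "2 * c powr p <= s powr p + t powr p" using add_mono[OF 1 2] unfolding 3 by (simp add: algebra_simps)
        then show ?thesis by simp
      qed
      finally show ?case by (simp add: s_def t_def)
    qed
  qed
  also have "... = (E a + E b) / 2" unfolding E_def using H_powr_integrable(1)[OF assms(1)] H_powr_integrable(1)[OF assms(2)] by simp
  finally show ?thesis .
qed

text \<open>Functions converge by Rellich; the gradient of the limit comes from Mazur combinations,
  and convexity of the energy gives lower semicontinuity, hence a minimizer.\<close>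

lemma minimizing_limit:
  assumes W: "!!m. W0 p w (v m) (g m)" and N1: "!!m. Np p w (v m) = 1" and Ql: "(%m. Q (v m) (g m)) ----> lam1"
  obtains r v' g' where "strict_mono (r :: nat => nat)" "(%m. Np p w (%x. v (r m) x - v' x)) ----> 0" "Np p w v' = 1" "solves lam1 v' g'"
proof -
  \<comment> \<open>Compactness and Mazur's lemma are available for test functions, so the sequence
    is replaced by nearby ones with nearly the same quotient.\<close>
  have "\<forall>m. \<exists>phi. test_fun w phi \<and> Np p w (%x. phi x - v m x) < 1 / real (Suc m) \<and> \<bar>Q phi (grad phi) - Q (v m) (g m)\<bar> < 1 / real (Suc m)"
  proof
    fix m
    obtain phi where phi: "!!k. test_fun w (phi k)" "(%k. Np p w (%x. phi k x - v m x)) ----> 0"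
      "(%k. Np p w (%x. grad (phi k) x - g m x)) ----> 0" by (rule W0_approx[OF W]) (rule that)
    have "(%k. Q (phi k) (grad (phi k))) ----> Q (v m) (g m)" by (rule Q_tendsto[OF W0_test[OF phi(1)] W phi(2,3)])
    then have l: "(%k. \<bar>Q (phi k) (grad (phi k)) - Q (v m) (g m)\<bar>) ----> 0" by (intro tendsto_rabs_zero LIM_zero)
    have e: "1 / real (Suc m) > 0" by simp
    have "\<forall>\<^sub>F k in sequentially. Np p w (%x. phi k x - v m x) < 1 / real (Suc m) \<and> \<bar>Q (phi k) (grad (phi k)) - Q (v m) (g m)\<bar> < 1 / real (Suc m)"
      using order_tendstoD(2)[OF phi(2) e] order_tendstoD(2)[OF l e] by (rule eventually_conj)
    then obtain k where "Np p w (%x. phi k x - v m x) < 1 / real (Suc m) \<and> \<bar>Q (phi k) (grad (phi k)) - Q (v m) (g m)\<bar> < 1 / real (Suc m)"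
      using eventually_happens'[OF sequentially_bot] by blast
    then show "\<exists>phi. test_fun w phi \<and> Np p w (%x. phi x - v m x) < 1 / real (Suc m) \<and> \<bar>Q phi (grad phi) - Q (v m) (g m)\<bar> < 1 / real (Suc m)"
      using phi(1) by blast
  qed
  then obtain phi where phi': "\<forall>m. test_fun w (phi m) \<and> Np p w (%x. phi m x - v m x) < 1 / real (Suc m) \<and> \<bar>Q (phi m) (grad (phi m)) - Q (v m) (g m)\<bar> < 1 / real (Suc m)"
    by (rule choice[THEN exE])
  have inv: "(%m. 1 / real (Suc m)) ----> 0" using LIMSEQ_inverse_real_of_nat by (simp add: inverse_eq_divide)
  have phi: "test_fun w (phi m)" "Np p w (%x. phi m x - v m x) <= 1 / real (Suc m)" "\<bar>Q (phi m) (grad (phi m)) - Q (v m) (g m)\<bar> <= 1 / real (Suc m)" for m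
    using phi' by (auto simp: less_imp_le)
  have phiv: "(%m. Np p w (%x. phi m x - v m x)) ----> 0" by (rule Np_tendsto_0[OF phi(2) inv])
  have Qphi: "(%m. Q (phi m) (grad (phi m))) ----> lam1"
  proof -
    have "(%m. Q (phi m) (grad (phi m)) - Q (v m) (g m)) ----> 0"
      by (rule Lim_null_comparison[OF _ inv]) (use phi(3) in auto)
    from tendsto_add[OF this Ql] show ?thesis by simp
  qed
  note Lv = W0_Lp(1)[OF W] and Lphi = test_Lp[OF phi(1)]
  have Nphi: "Np p w (phi m) <= 2 powr p * 2" for m
  proof -
    have "Np p w (phi m) = Np p w (%x. (phi m x - v m x) + v m x)" by simp
    also have "... <= 2 powr p * (Np p w (%x. phi m x - v m x) + Np p w (v m))"
      by (rule Lp_add(2)[OF Lp_diff(1)[OF Lphi(1) Lv p0(1)] Lv p0(1)])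
    also have "... <= 2 powr p * 2"
    proof (rule mult_left_mono)
      have "1 / real (Suc m) <= 1" by simp
      then show "Np p w (%x. phi m x - v m x) + Np p w (v m) <= 2" using phi(2)[of m] N1[of m] by linarith
    qed simp
    finally show ?thesis .
  qed
  obtain C where C: "C >= 0" "!!v g. W0 p w v g ==> \<kappa> powr p / 2 * Np p w g <= Q v g + C * Np p w v"
    by (rule Q_lower) blast
  have "Bseq (%m. Q (phi m) (grad (phi m)))" using Qphi by (intro convergent_imp_Bseq convergentI)
  then obtain K where K: "!!m. norm (Q (phi m) (grad (phi m))) <= K" by (rule BseqE) blast
  \<comment> \<open>The second entry is the gradient bound that coercivity of \<open>Q\<close>
    yields from bounds on \<open>Q\<close> and on the L^p norm.\<close>
  define B where "B = max (2 powr p * 2) ((K + C * (2 powr p * 2)) / (\<kappa> powr p / 2))"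
  have B: "Np p w (phi m) <= B" "Np p w (grad (phi m)) <= B" for m
  proof -
    show "Np p w (phi m) <= B" using Nphi[of m] by (simp add: B_def)
    have "\<kappa> powr p / 2 * Np p w (grad (phi m)) <= Q (phi m) (grad (phi m)) + C * Np p w (phi m)" by (rule C(2)[OF W0_test[OF phi(1)]])
    also have "... <= K + C * (2 powr p * 2)"
      using K[of m] by (intro add_mono mult_left_mono Nphi C(1)) (simp add: abs_le_iff)
    finally have "Np p w (grad (phi m)) <= (K + C * (2 powr p * 2)) / (\<kappa> powr p / 2)"
      using \<kappa>(1) by (subst pos_le_divide_eq) (auto simp: mult.commute)
    then show "Np p w (grad (phi m)) <= B" by (simp add: B_def)
  qed
  obtain r v' where r: "strict_mono r" "Lp p w v'" "(%k. Np p w (%x. phi (r k) x - v' x)) ----> 0"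
    by (rule rellich[OF phi(1) B]) (rule that)
  obtain g' u where gu: "W0 p w v' g'" "!!k. midhull (%k. phi (r k)) k (u k)" "(%k. Np p w (%x. grad (u k) x - g' x)) ----> 0"
    by (rule mazur[of "%k. phi (r k)", OF phi(1) B(2) r(2,3)]) (rule that)
  have ut: "test_fun w (u k)" for k by (rule midhull_test[OF gu(2) phi(1)])
  have PVl: "(%k. PV (phi (r k))) ----> PV v'" by (rule PV_tendsto[OF W0_test[OF phi(1)] gu(1) B(2) r(3)])
  have Ql': "(%k. Q (phi (r k)) (grad (phi (r k)))) ----> lam1" using LIMSEQ_subseq_LIMSEQ[OF Qphi r(1)] by (simp add: o_def)
  have El: "(%k. E (grad (phi (r k)))) ----> lam1 - PV v'" using tendsto_diff[OF Ql' PVl] by (simp add: Q_def)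
  have Eu: "(%k. E (grad (u k))) ----> E g'" by (rule E_tendsto[OF test_Lp(2)[OF ut] W0_Lp(2)[OF gu(1)] gu(3)])
  \<comment> \<open>The energies of a tail lie below the right-hand side, and midpoint convexity
    passes this to the Mazur combinations, whose gradients converge strongly.\<close>
  have "E g' <= lam1 - PV v' + eta" if "eta > 0" for eta
  proof -
    have "\<forall>\<^sub>F k in sequentially. E (grad (phi (r k))) < lam1 - PV v' + eta" using that by (intro order_tendstoD(2)[OF El]) auto
    then obtain N where N: "!!k. k >= N ==> E (grad (phi (r k))) < lam1 - PV v' + eta" by (auto simp: eventually_sequentially)
    have "E (grad (u k)) <= lam1 - PV v' + eta" if k: "k >= N" for k
    proof (rule midhull_le[where \<Psi> = "%u. E (grad u)", OF phi(1) gu(2)])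
      fix a b assume ab: "test_fun w a" "test_fun w b"
      show "E (grad (%x. (1/2) * (a x + b x))) <= (E (grad a) + E (grad b)) / 2"
        unfolding grad_mid[OF ab, abs_def] by (rule E_mid_le[OF test_Lp(2)[OF ab(1)] test_Lp(2)[OF ab(2)]])
    qed (use N k in \<open>auto simp: less_imp_le\<close>)
    then show ?thesis by (intro LIMSEQ_le_const2[OF Eu]) blast
  qed
  then have "E g' <= lam1 - PV v'" by (rule field_le_epsilon)
  then have Q1: "Q v' g' <= lam1" by (simp add: Q_def)
  have vr: "(%m. Np p w (%x. v (r m) x - v' x)) ----> 0"
  proof (rule Np_triangle_tendsto[OF p0(1) Lv Lphi(1) r(2) _ r(3)])
    show "(%k. Np p w (%x. v (r k) x - phi (r k) x)) ----> 0"
      using LIMSEQ_subseq_LIMSEQ[OF phiv r(1)] by (simp add: o_def Np_diff_commute[of p w "phi _"])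
  qed
  have "(%m. Np p w (v (r m))) ----> Np p w v'" by (rule Np_tendsto[OF p1 Lv r(2) vr])
  then have Nv: "Np p w v' = 1" by (simp add: N1 LIMSEQ_const_iff)
  have "Q v' g' = lam1 * Np p w v'" using Q1 lam1_le[OF gu(1)] by (simp add: Nv)
  then have "solves lam1 v' g'" by (rule euler_lagrange[OF gu(1)])
  then show ?thesis by (rule that[OF r(1) vr Nv])
qed

end

section \<open>The strong maximum principle and Picone's inequality\<close>

text \<open>A smooth positive function on the whole line that behaves like \<open>t + e\<close> for \<open>t >= 0\<close>, so that
  negative powers and logarithms of \<open>soft e v\<close> are admissible test functions.\<close>

definition soft :: "real => real => real" where "soft e t = e + (t + sqrt (t\<^sup>2 + e\<^sup>2)) / 2"

definition soft' :: "real => real => real" where "soft' e t = (1 + t / sqrt (t\<^sup>2 + e\<^sup>2)) / 2"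

lemma soft:
  assumes "e > 0"
  shows soft_pos: "e <= soft e t"
    and DERIV_soft: "(soft e has_real_derivative soft' e t) (at t)"
    and soft'_nonneg: "0 <= soft' e t" and soft'_le: "soft' e t <= 1"
    and soft'_cont: "continuous_on UNIV (soft' e)"
    and soft_smooth: "smooth_fun f ==> smooth_fun (%x. soft e (f x))"
    and soft_ge: "t >= 0 ==> t + e <= soft e t"
    and soft'_ge: "t >= 0 ==> 1 / 2 <= soft' e t"
    and soft_0: "soft e 0 = 3 / 2 * e"
proof -
  have pos: "s\<^sup>2 + e\<^sup>2 > 0" for s :: real using assms by (simp add: sum_power2_gt_zero_iff)
  have ab: "\<bar>s\<bar> <= sqrt (s\<^sup>2 + e\<^sup>2)" for s by (rule real_le_rsqrt) simp
  have "0 <= t + sqrt (t\<^sup>2 + e\<^sup>2)" using ab[of t] by linarith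
  then show "e <= soft e t" by (simp add: soft_def)
  show "(soft e has_real_derivative soft' e t) (at t)"
    unfolding soft_def soft'_def using pos[of t]
    by (auto intro!: derivative_eq_intros simp: field_simps)
  have q: "\<bar>t / sqrt (t\<^sup>2 + e\<^sup>2)\<bar> <= 1" using ab[of t] pos[of t] by (simp add: abs_divide divide_le_eq)
  show "0 <= soft' e t" "soft' e t <= 1" unfolding soft'_def using abs_le_D1[OF q] abs_le_D2[OF q] by simp_all
  have "sqrt (s\<^sup>2 + e\<^sup>2) ~= 0" for s using pos[of s] assms by simp
  then show "continuous_on UNIV (soft' e)" unfolding soft'_def by (intro continuous_intros) auto
  show "smooth_fun (%x. soft e (f x))" if f: "smooth_fun f"
  proof -
    have "smooth_fun (%x. e + (1/2) * (f x + ((f x)\<^sup>2 + e\<^sup>2) powr (1/2)))"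
      by (intro smooth_add smooth_const smooth_mult smooth_powr smooth_power f) (rule pos)
    then show ?thesis using pos by (simp add: soft_def powr_half_sqrt less_imp_le)
  qed
  show "t + e <= soft e t" if "t >= 0" using ab[of t] that by (simp add: soft_def)
  show "1 / 2 <= soft' e t" if "t >= 0" using that by (simp add: soft'_def)
  show "soft e 0 = 3 / 2 * e" using assms by (simp add: soft_def)
qed

lemma soft_tendsto:
  assumes e: "e ----> 0" and t: "t >= 0"
  shows "(%m. soft (e m) t) ----> t" "t > 0 ==> (%m. soft' (e m) t) ----> 1"
proof -
  have "(%m. soft (e m) t) ----> 0 + (t + sqrt (t\<^sup>2 + 0\<^sup>2)) / 2"
    unfolding soft_def by (intro tendsto_intros e) auto
  then show "(%m. soft (e m) t) ----> t" using t by simp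
  assume "t > 0"
  have "(%m. soft' (e m) t) ----> (1 + t / sqrt (t\<^sup>2 + 0\<^sup>2)) / 2"
    unfolding soft'_def by (intro tendsto_intros e) (use \<open>t > 0\<close> in auto)
  then show "(%m. soft' (e m) t) ----> 1" using \<open>t > 0\<close> by simp
qed

lemma grad_const: "grad (%x. c) x = 0"
  by (rule grad_eqI) simp

context bounded_open begin

lemma W0_soft_powr:
  assumes W: "W0 p w v g" and psi: "test_fun w psi" and e: "e > 0"
  shows "W0 p w (%x. psi x * soft e (v x) powr (1 - p))
    (%x. (psi x * ((1 - p) * soft e (v x) powr (- p) * soft' e (v x))) *\<^sub>R g x + soft e (v x) powr (1 - p) *\<^sub>R grad psi x)"
proof -
  obtain K where K: "K > 0" "!!x. \<bar>psi x\<bar> <= K" "!!x. norm (grad psi x) <= K" by (rule test_fun_bounded[OF psi]) blast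
  have pos: "soft e t > 0" for t using soft_pos[OF e, of t] e by linarith
  have cs: "continuous_on UNIV (soft e)" by (meson DERIV_isCont DERIV_soft e continuous_at_imp_continuous_on)
  show ?thesis
  proof (rule W0_chain[OF W test_fun_smooth[OF psi] K(2,3)])
    show "((%t. soft e t powr (1 - p)) has_real_derivative (1 - p) * soft e t powr (- p) * soft' e t) (at t)" for t
      by (rule DERIV_cong, rule DERIV_powr[OF DERIV_soft[OF e] pos DERIV_const]) (use pos[of t] in \<open>simp add: powr_diff powr_minus field_simps\<close>)
    show "continuous_on UNIV (%t. (1 - p) * soft e t powr (- p) * soft' e t)"
      using pos by (intro continuous_intros cs soft'_cont[OF e]) (auto simp: less_imp_neq[symmetric])
    show "\<bar>(1 - p) * soft e t powr (- p) * soft' e t\<bar> <= (p - 1) * e powr (- p) * 1" for t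
      unfolding abs_mult using soft'_nonneg[OF e, of t] soft'_le[OF e, of t] p1 soft_pos[OF e, of t] e
      by (intro mult_mono) (auto intro: powr_mono2')
    show sm: "smooth_fun (%x. soft e (phi x) powr (1 - p))" if "test_fun w phi" for phi
      by (intro smooth_powr soft_smooth[OF e] test_fun_smooth[OF that] pos)
    show "test_fun w (%x. psi x * soft e (phi x) powr (1 - p))" if "test_fun w phi" for phi
      by (rule test_funI[OF psi]) (auto intro!: smooth_mult test_fun_smooth[OF psi] sm that)
  qed
qed

text \<open>Subtracting the value at \<open>0\<close> makes the composite vanish with the test
  function, so that it is again a test function; the gradient does not notice the constant.\<close>

lemma W0_soft_ln:
  assumes W: "W0 p w v g" and e: "e > 0"
  shows "W0 p w (%x. ln (soft e (v x)) - ln (soft e 0)) (%x. (soft' e (v x) / soft e (v x)) *\<^sub>R g x)"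
proof -
  have pos: "soft e t > 0" for t using soft_pos[OF e, of t] e by linarith
  then have pos': "soft e t ~= 0" for t by (metis less_irrefl)
  have cs: "continuous_on UNIV (soft e)" by (meson DERIV_isCont DERIV_soft e continuous_at_imp_continuous_on)
  have "W0 p w (%x. 1 * (ln (soft e (v x)) - ln (soft e 0)))
      (%x. (1 * (soft' e (v x) / soft e (v x))) *\<^sub>R g x + (ln (soft e (v x)) - ln (soft e 0)) *\<^sub>R grad (%x. 1) x)"
  proof (rule W0_chain[OF W smooth_const, where K = 1])
    show "((%t. ln (soft e t) - ln (soft e 0)) has_real_derivative soft' e t / soft e t) (at t)" for t
      using pos[of t] by (auto intro!: derivative_eq_intros DERIV_soft[OF e])
    show "continuous_on UNIV (%t. soft' e t / soft e t)"
      using pos' by (intro continuous_intros cs soft'_cont[OF e]) auto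
    show "\<bar>soft' e t / soft e t\<bar> <= 1 / e" for t
      unfolding abs_divide using soft'_nonneg[OF e, of t] soft'_le[OF e, of t] soft_pos[OF e, of t] e
      by (intro frac_le) auto
    show sm: "smooth_fun (%x. ln (soft e (phi x)) - ln (soft e 0))" if "test_fun w phi" for phi
      by (intro smooth_diff smooth_const smooth_ln soft_smooth[OF e] test_fun_smooth[OF that] pos)
    show "test_fun w (%x. 1 * (ln (soft e (phi x)) - ln (soft e 0)))" if "test_fun w phi" for phi
      by (rule test_funI[OF that]) (use sm[OF that] in simp_all)
  qed (simp_all add: grad_const)
  then show ?thesis by (simp add: grad_const)
qed

lemma W0_pos:
  assumes W: "W0 p w v g"
  shows "W0 p w (%x. max 0 (v x)) (%x. if v x > 0 then g x else 0)"
proof -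
  note Lv = W0_Lp[OF W]
  note [measurable] = Lp_measurable[OF Lv(1)] Lp_measurable[OF Lv(2)]
  \<comment> \<open>A smooth function, zero for \<open>t <= 0\<close>, that increases to the
    positive part; its derivative for \<open>t > 0\<close> is \<open>exp (- s) * (1 + s)\<close>
    with \<open>s = 1 / ((m + 1) * t)\<close>, hence at most one.\<close>
  define F where "F m t = t * flat_exp 0 (real (Suc m) * t)" for m and t :: real
  define F' where "F' m t = flat_exp 0 (real (Suc m) * t) + t * (flat_exp 2 (real (Suc m) * t) * real (Suc m))" for m and t :: real
  have d0: "(flat_exp 0 has_real_derivative flat_exp 2 s) (at s)" for s using DERIV_flat_exp[of 0 s] by (simp add: numeral_2_eq_2)
  have dF: "(F m has_real_derivative F' m t) (at t)" for m t
    unfolding F_def F'_def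
    by (rule DERIV_cong, rule DERIV_mult[OF DERIV_ident DERIV_chain2[OF d0 DERIV_cmult[OF DERIV_ident]]]) simp
  have cont: "continuous_on UNIV (flat_exp k)" for k
    by (meson DERIV_isCont DERIV_flat_exp continuous_at_imp_continuous_on)
  have cF: "continuous_on UNIV (F' m)" for m unfolding F'_def
    by (intro continuous_intros continuous_on_compose2[OF cont]) auto
  have F'p: "F' m t = exp (- inverse (real (Suc m) * t)) * (1 + inverse (real (Suc m) * t))" if "t > 0" for m t
    using that by (simp add: F'_def flat_exp_def field_simps power2_eq_square del: of_nat_Suc)
  have F'n: "F' m t = 0" "F m t = 0" if "t <= 0" for m t
  proof -
    have "real (Suc m) * t <= 0" using that by (simp add: mult_le_0_iff)
    then show "F' m t = 0" "F m t = 0" by (auto simp: F'_def F_def flat_exp_def)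
  qed
  have Fp: "F m t = t * exp (- inverse (real (Suc m) * t))" if "t > 0" for m t
    using that by (simp add: F_def flat_exp_def del: of_nat_Suc)
  have bF: "\<bar>F' m t\<bar> <= 1" for m t
  proof (cases "t > 0")
    case True
    define s where "s = inverse (real (Suc m) * t)"
    have s: "s > 0" using True by (simp add: s_def del: of_nat_Suc)
    have "1 + s <= exp s" by simp
    then have "exp (- s) * (1 + s) <= 1" by (simp add: exp_minus field_simps)
    moreover have "F' m t = exp (- s) * (1 + s)" by (simp add: F'p[OF True] s_def)
    moreover have "0 <= exp (- s) * (1 + s)" using s by simp
    ultimately show ?thesis by simp
  qed (simp add: F'n)
  have bF0: "\<bar>F m t\<bar> <= \<bar>t\<bar>" for m t
  proof (cases "t > 0")
    case True
    then have "exp (- inverse (real (Suc m) * t)) <= 1" by (simp del: of_nat_Suc)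
    then show ?thesis using True by (simp add: Fp[OF True] abs_mult)
  qed (simp add: F'n)
  have lim0: "(%m. inverse (real (Suc m) * t)) ----> 0" for t :: real
    using tendsto_mult_right[OF LIMSEQ_inverse_real_of_nat, of "inverse t"] by simp
  have limF: "(%m. F m t) ----> max 0 t" and limF': "(%m. F' m t) ----> (if t > 0 then 1 else 0)" for t
  proof -
    have l: "(%m. exp (- inverse (real (Suc m) * t))) ----> 1"
      using tendsto_exp[OF tendsto_minus[OF lim0[of t]]] by simp
    show "(%m. F m t) ----> max 0 t"
      using tendsto_mult_left[OF l, of t] by (cases "t > 0") (auto simp: Fp F'n simp del: of_nat_Suc)
    show "(%m. F' m t) ----> (if t > 0 then 1 else 0)"
      using tendsto_mult[OF l tendsto_add[OF tendsto_const lim0[of t], of 1]] by (cases "t > 0") (auto simp: F'p F'n simp del: of_nat_Suc)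
  qed
  have smF: "smooth_fun (%x. F m (phi x))" if "test_fun w phi" for m phi
    unfolding F_def by (intro smooth_mult smooth_flat_exp smooth_const test_fun_smooth[OF that])
  have WF: "W0 p w (%x. F m (v x)) (%x. F' m (v x) *\<^sub>R g x)" for m
  proof -
    have "W0 p w (%x. 1 * F m (v x)) (%x. (1 * F' m (v x)) *\<^sub>R g x + F m (v x) *\<^sub>R grad (%x. 1) x)"
    proof (rule W0_chain[OF W smooth_const, where K = 1 and L = 1])
      show "test_fun w (%x. 1 * F m (phi x))" if "test_fun w phi" for phi
        by (rule test_funI[OF that]) (use smF[OF that] in \<open>simp_all add: F'n\<close>)
    qed (simp_all add: grad_const dF cF bF smF)
    then show ?thesis by (simp add: grad_const)
  qed
  show ?thesis
  proof (rule W0_dominated[OF WF _ _ _ _ Lv])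
    show "AE x in M. (%m. F m (v x)) ----> max 0 (v x)" using limF by simp
    show "AE x in M. (%m. F' m (v x) *\<^sub>R g x) ----> (if v x > 0 then g x else 0)"
    proof (rule AE_I2)
      show "(%m. F' m (v x) *\<^sub>R g x) ----> (if v x > 0 then g x else 0)" for x
        using tendsto_scaleR[OF limF'[of "v x"] tendsto_const[of "g x"]] by (cases "v x > 0") auto
    qed
    show "AE x in M. norm (F m (v x)) <= norm (v x)" for m using bF0 by simp
    show "AE x in M. norm (F' m (v x) *\<^sub>R g x) <= norm (g x)" for m using mult_right_mono[OF bF] by (intro AE_I2) fastforce
  qed measurable
qed

end

text \<open>Young's inequality with a cut-off power: differentiating \<open>eta ^ m\<close> leaves
  \<open>eta ^ (m - 1)\<close>, and the gradient term is absorbed into the full power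
  \<open>m\<close> up to a constant. The proof simply compares \<open>B\<close> with
  \<open>\<tau> * (a * b)\<close>.\<close>

lemma young_cut:
  fixes a b B \<tau> p K :: real and m :: nat
  assumes "a >= 0" "b >= 0" "b <= K" "\<tau> > 0" "B >= 0" "p > 1" and m: "real m >= p"
  shows "a powr (p - 1) * b ^ (m - 1) * B <= \<tau> * (a powr p * b ^ m) + (B / \<tau>) powr (p - 1) * K powr (real m - p) * B"
proof -
  have ap: "a powr p = a powr (p - 1) * a" using powr_add[of a "p - 1" 1] assms by (cases "a = 0") auto
  have m1: "m > 1" using m \<open>p > 1\<close> by simp
  then have bm: "b ^ m = b ^ (m - 1) * b" by (cases m) auto
  have n1: "0 <= (B / \<tau>) powr (p - 1) * K powr (real m - p) * B" and n2: "0 <= \<tau> * (a powr p * b ^ m)"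
    using assms by auto
  show ?thesis
  proof (cases "B <= \<tau> * (a * b)")
    case True
    then have "a powr (p - 1) * b ^ (m - 1) * B <= a powr (p - 1) * b ^ (m - 1) * (\<tau> * (a * b))"
      using assms by (intro mult_left_mono) auto
    also have "... = \<tau> * (a powr p * b ^ m)" by (simp add: ap bm mult_ac)
    finally show ?thesis using n1 by linarith
  next
    case False
    show ?thesis
    proof (cases "b = 0")
      case True
      then have "b ^ (m - 1) = 0" using m1 by simp
      then show ?thesis using n1 by (simp only: bm mult_zero_left mult_zero_right add_0)
    next
      case b: False
      then have "b ^ (m - 1) = b powr (p - 1) * b powr (real m - p)"
        using assms m1 by (simp add: powr_add[symmetric] powr_realpow[symmetric] of_nat_diff)
      then have "a powr (p - 1) * b ^ (m - 1) * B = (a * b) powr (p - 1) * b powr (real m - p) * B"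
        using assms by (simp add: powr_mult)
      also have "... <= (B / \<tau>) powr (p - 1) * K powr (real m - p) * B"
        using assms False by (intro mult_right_mono mult_mono powr_mono2) (auto simp: field_simps)
      finally show ?thesis using n2 by linarith
    qed
  qed
qed

lemma soft_measurable [measurable]:
  assumes "e > 0" shows "soft e \<in> borel_measurable borel" "soft' e \<in> borel_measurable borel"
  by (intro borel_measurable_continuous_onI soft'_cont[OF assms] continuous_at_imp_continuous_on ballI DERIV_isCont[OF DERIV_soft[OF assms]])+

text \<open>In the tested equation the potential is multiplied by this quotient; being at most one,
  it leaves \<open>|V|\<close> as a majorant, whatever the solution does.\<close>

lemma soft_quotient:
  assumes e: "e > 0" and t: "t >= 0" and p: "p > 1"
  shows "0 <= \<bar>t\<bar> powr (p - 2) * t * soft e t powr (1 - p)" "\<bar>t\<bar> powr (p - 2) * t * soft e t powr (1 - p) <= 1"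
    "\<bar>t\<bar> powr (p - 2) * t * soft e t powr (1 - p) = t powr (p - 1) * soft e t powr (1 - p)"
proof -
  have eq: "\<bar>t\<bar> powr (p - 2) * t = t powr (p - 1)" using abs_powr_mult_self[of t p] t by (simp add: abs_mult)
  have s: "soft e t > 0" "t <= soft e t" using soft_ge[OF e t] e t by linarith+
  show "0 <= \<bar>t\<bar> powr (p - 2) * t * soft e t powr (1 - p)" using t by simp
  show "\<bar>t\<bar> powr (p - 2) * t * soft e t powr (1 - p) = t powr (p - 1) * soft e t powr (1 - p)" by (simp add: eq)
  have "t powr (p - 1) * soft e t powr (1 - p) <= soft e t powr (p - 1) * soft e t powr (1 - p)"
    using s t p by (intro mult_right_mono powr_mono2) auto
  also have "... = 1" using s by (simp add: powr_add[symmetric])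
  finally show "\<bar>t\<bar> powr (p - 2) * t * soft e t powr (1 - p) <= 1" by (simp add: eq)
qed

text \<open>The pointwise core of Picone's inequality with a regularizing factor \<sigma>, from the
  tangent of the p-th power at \<open>\<sigma> * a * T / S\<close>. The value
  \<open>\<sigma> = 1\<close> is the classical case.\<close>

lemma picone_young:
  fixes a b S \<sigma> T p :: real
  assumes "a >= 0" "b >= 0" "S > 0" "\<sigma> > 0" "T >= 0" and p: "p > 1"
  shows "S powr (1 - p) * (a powr (p - 1) * (p * T powr (p - 1) * b)) <= (p - 1) * (T powr p * S powr (- p) * \<sigma> * a powr p) + \<sigma> powr (1 - p) * b powr p"
proof -
  define y where "y = a * T / S"
  have y: "y >= 0" using assms by (simp add: y_def)
  have y1: "y powr (p - 1) = a powr (p - 1) * T powr (p - 1) * S powr (1 - p)"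
    using assms powr_minus_divide[of S "p - 1"] by (simp add: y_def powr_divide powr_mult)
  have y2: "y powr p = a powr p * T powr p * S powr (- p)" using assms by (simp add: y_def powr_divide powr_mult powr_minus_divide)
  have sy: "(\<sigma> * y) powr (p - 1) * (\<sigma> * y) = (\<sigma> * y) powr p" using assms y powr_add[of "\<sigma> * y" "p - 1" 1] by (cases "y = 0") auto
  have "(\<sigma> * y) powr p + p * (\<sigma> * y) powr (p - 1) * (b - \<sigma> * y) <= b powr p"
    using assms y by (intro powr_above_tangent) auto
  then have "p * (\<sigma> * y) powr (p - 1) * b <= (p - 1) * (\<sigma> * y) powr p + b powr p"
    unfolding sy[symmetric] by (simp add: algebra_simps)
  then have "\<sigma> powr (1 - p) * (p * (\<sigma> powr (p - 1) * y powr (p - 1)) * b) <= \<sigma> powr (1 - p) * ((p - 1) * (\<sigma> powr p * y powr p) + b powr p)"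
    using assms y by (intro mult_left_mono) (simp_all add: powr_mult)
  moreover have "\<sigma> powr (1 - p) * (p * (\<sigma> powr (p - 1) * y powr (p - 1)) * b) = (\<sigma> powr (1 - p) * \<sigma> powr (p - 1)) * (p * y powr (p - 1) * b)"
    "\<sigma> powr (1 - p) * ((p - 1) * (\<sigma> powr p * y powr p) + b powr p) = (p - 1) * ((\<sigma> powr (1 - p) * \<sigma> powr p) * y powr p) + \<sigma> powr (1 - p) * b powr p"
    by (simp_all only: distrib_left mult_ac)
  moreover have "\<sigma> powr (1 - p) * \<sigma> powr (p - 1) = 1" "\<sigma> powr (1 - p) * \<sigma> powr p = \<sigma>" using assms by (simp_all add: powr_add[symmetric])
  ultimately have "p * y powr (p - 1) * b <= (p - 1) * (\<sigma> * y powr p) + \<sigma> powr (1 - p) * b powr p" by simp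
  then show ?thesis unfolding y1 y2 by (simp add: mult_ac)
qed

text \<open>A smooth substitute for \<open>|s|^p\<close> that vanishes at \<open>0\<close>, so that
  it maps test functions to test functions.\<close>

definition reg_powr :: "real => real => real => real" where
  "reg_powr p d s = (s\<^sup>2 + d\<^sup>2) powr (p / 2) - d powr p"

lemma reg_powr:
  fixes p d s :: real
  assumes d: "d > 0" and p: "p > 1"
  shows "reg_powr p d s = sqrt (s\<^sup>2 + d\<^sup>2) powr p - d powr p"
    "\<exists>D. (reg_powr p d has_real_derivative D) (at s) \<and> \<bar>D\<bar> <= p * sqrt (s\<^sup>2 + d\<^sup>2) powr (p - 1)"
    "reg_powr p d 0 = 0" "0 <= reg_powr p d s" "reg_powr p d s <= (\<bar>s\<bar> + d) powr p"
proof -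
  let ?T = "sqrt (s\<^sup>2 + d\<^sup>2)"
  have pos: "s\<^sup>2 + d\<^sup>2 > 0" for s using d by (simp add: sum_power2_gt_zero_iff)
  have T: "?T > 0" "?T powr 2 = s\<^sup>2 + d\<^sup>2" "\<bar>s\<bar> <= ?T" "d <= ?T" "?T <= \<bar>s\<bar> + d"
    using pos[of s] d by (auto intro!: real_le_rsqrt real_le_lsqrt simp: power2_sum)
  have e: "(s\<^sup>2 + d\<^sup>2) powr a = ?T powr (2 * a)" for a by (rule powr_powr[of ?T 2 a, unfolded T(2)])
  show eq: "reg_powr p d s = ?T powr p - d powr p" by (simp add: reg_powr_def e)
  show "0 <= reg_powr p d s" using T d p by (simp add: eq powr_mono2)
  have "?T powr p <= (\<bar>s\<bar> + d) powr p" using T d p by (intro powr_mono2) auto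
  then show "reg_powr p d s <= (\<bar>s\<bar> + d) powr p" unfolding eq by (smt (verit) powr_ge_zero)
  show "reg_powr p d 0 = 0" using powr_powr[of d 2 "p / 2"] d by (simp add: reg_powr_def)
  have D: "((%s. s\<^sup>2 + d\<^sup>2) has_real_derivative 2 * s) (at s)" by (auto intro!: derivative_eq_intros)
  have "(reg_powr p d has_real_derivative p * (s\<^sup>2 + d\<^sup>2) powr (p / 2 - 1) * s) (at s)"
    unfolding reg_powr_def by (rule DERIV_cong, rule DERIV_diff[OF DERIV_powr[OF D pos DERIV_const] DERIV_const])
      (use pos[of s] in \<open>simp add: powr_diff\<close>)
  moreover have "\<bar>p * (s\<^sup>2 + d\<^sup>2) powr (p / 2 - 1) * s\<bar> <= p * ?T powr (p - 1)"
  proof -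
    have "(s\<^sup>2 + d\<^sup>2) powr (p / 2 - 1) = ?T powr (p - 2)" by (rule trans[OF e]) (simp add: right_diff_distrib)
    then have "\<bar>p * (s\<^sup>2 + d\<^sup>2) powr (p / 2 - 1) * s\<bar> = p * (?T powr (p - 2) * \<bar>s\<bar>)" using p by (simp add: abs_mult)
    also have "... <= p * (?T powr (p - 2) * ?T)" using p T by (intro mult_left_mono) auto
    also have "?T powr (p - 2) * ?T = ?T powr (p - 1)" using T powr_add[of ?T "p - 2" 1] by simp
    finally show ?thesis .
  qed
  ultimately show "\<exists>D. (reg_powr p d has_real_derivative D) (at s) \<and> \<bar>D\<bar> <= p * ?T powr (p - 1)" by blast
qed

section \<open>Logarithmic estimates, positivity of solutions and comparison of eigenvalues\<close>

context eigen_setup begin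

lemma Aop_bounds:
  "AE x in M. (\<forall>xi. Aop p H x xi \<bullet> xi = H x xi powr p) \<and> (\<forall>xi eta. \<bar>Aop p H x xi \<bullet> eta\<bar> <= H x xi powr (p - 1) * H x eta)
    \<and> (\<forall>xi. H x xi <= \<nu> * norm xi) \<and> (\<forall>xi. \<kappa> * norm xi <= H x xi)"
  using H_good
proof eventually_elim
  case (elim x)
  then have N: "good_norm \<nu> (H x)" and k: "\<forall>xi. \<kappa> * norm xi <= H x xi" by auto
  show ?case unfolding Aop_duality using duality_map_self[OF p1 N] duality_map_abs_le[OF p1 N] N k by (auto simp: good_norm_def)
qed

text \<open>The equation tested with a cut-off times the power \<open>1 - p\<close> of the
  regularized solution. Both the logarithmic estimate and Picone's inequality start from this
  identity.\<close>

lemma tested_identity: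
  assumes S: "solves lam v g" and psi: "test_fun w psi" and e: "e > 0"
  defines "s \<equiv> %x. soft e (v x)" and "s' \<equiv> %x. soft' e (v x)"
  shows "integrable M (%x. psi x * s x powr (- p) * H x (g x) powr p)"
    "integrable M (%x. psi x * s x powr (- p) * s' x * H x (g x) powr p)"
    "integrable M (%x. s x powr (1 - p) * (Aop p H x (g x) \<bullet> grad psi x))"
    "integrable M (%x. (V x - lam) * (\<bar>v x\<bar> powr (p - 2) * v x) * (psi x * s x powr (1 - p)))"
    "(p - 1) * (LINT x|M. psi x * s x powr (- p) * s' x * H x (g x) powr p)
      = (LINT x|M. s x powr (1 - p) * (Aop p H x (g x) \<bullet> grad psi x))
        + (LINT x|M. (V x - lam) * (\<bar>v x\<bar> powr (p - 2) * v x) * (psi x * s x powr (1 - p)))"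
proof -
  have W: "W0 p w v g" using S by (simp add: solves_def)
  note Lv = W0_Lp[OF W]
  note [measurable] = Lp_measurable[OF Lv(1)] Lp_measurable[OF Lv(2)] test_measurable[OF psi] soft_measurable[OF e]
  let ?h = "%x. (psi x * ((1 - p) * s x powr (- p) * s' x)) *\<^sub>R g x + s x powr (1 - p) *\<^sub>R grad psi x"
  have WF: "W0 p w (%x. psi x * s x powr (1 - p)) ?h" unfolding s_def s'_def by (rule W0_soft_powr[OF W psi e])
  have [measurable]: "(%x. H x (g x)) \<in> borel_measurable M" by (rule H_compose_measurable) measurable
  have [measurable]: "s \<in> borel_measurable M" "s' \<in> borel_measurable M" unfolding s_def s'_def by measurable
  obtain K where K: "K > 0" "!!x. \<bar>psi x\<bar> <= K" "!!x. norm (grad psi x) <= K" by (rule test_fun_bounded[OF psi]) blast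
  have s: "e <= s x" "0 <= s' x" "s' x <= 1" for x
    unfolding s_def s'_def using soft_pos[OF e] soft'_nonneg[OF e] soft'_le[OF e] by auto
  have b1: "\<bar>psi x * s x powr (- p)\<bar> <= K * e powr (- p)" for x
    unfolding abs_mult using K s[of x] e p1 by (intro mult_mono) (auto intro: powr_mono2')
  have i0: "integrable M (%x. K * e powr (- p) * H x (g x) powr p)" using H_powr_integrable(1)[OF Lv(2)] by simp
  show i1: "integrable M (%x. psi x * s x powr (- p) * H x (g x) powr p)"
    by (rule Bochner_Integration.integrable_bound[OF i0]) (measurable, use K in \<open>auto intro!: AE_I2 mult_right_mono b1[unfolded abs_mult, simplified] simp: abs_mult\<close>)
  show i2: "integrable M (%x. psi x * s x powr (- p) * s' x * H x (g x) powr p)"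
    by (rule Bochner_Integration.integrable_bound[OF i1]) (measurable, use s in \<open>auto intro!: AE_I2 mult_right_mono mult_right_le_one_le simp: abs_mult\<close>)
  have "Lp p w (%x. s x powr (1 - p) *\<^sub>R grad psi x)"
  proof (rule bounded_Lp)
    show "AE x in M. norm (s x powr (1 - p) *\<^sub>R grad psi x) <= e powr (1 - p) * K"
      using K s e p1 by (auto intro!: AE_I2 mult_mono powr_mono2')
  qed measurable
  from Aop_integrable[OF Lv(2) this] show i3: "integrable M (%x. s x powr (1 - p) * (Aop p H x (g x) \<bullet> grad psi x))" by simp
  show "integrable M (%x. (V x - lam) * (\<bar>v x\<bar> powr (p - 2) * v x) * (psi x * s x powr (1 - p)))"
    by (rule potential_integrable(1)[OF W WF])
  have "(LINT x|M. Aop p H x (g x) \<bullet> ?h x) = (LINT x|M. (1 - p) * (psi x * s x powr (- p) * s' x * H x (g x) powr p) + s x powr (1 - p) * (Aop p H x (g x) \<bullet> grad psi x))"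
  proof (rule integral_cong_AE)
    show "(%x. Aop p H x (g x) \<bullet> ?h x) \<in> borel_measurable M" by (rule Aop_measurable) measurable
    show "(%x. (1 - p) * (psi x * s x powr (- p) * s' x * H x (g x) powr p) + s x powr (1 - p) * (Aop p H x (g x) \<bullet> grad psi x)) \<in> borel_measurable M"
      by (intro borel_measurable_add borel_measurable_times[OF borel_measurable_const borel_measurable_integrable[OF i2]] borel_measurable_integrable[OF i3])
    show "AE x in M. Aop p H x (g x) \<bullet> ?h x = (1 - p) * (psi x * s x powr (- p) * s' x * H x (g x) powr p) + s x powr (1 - p) * (Aop p H x (g x) \<bullet> grad psi x)"
      using Aop_bounds by eventually_elim (simp add: inner_add_right mult_ac)
  qed
  also have "... = (1 - p) * (LINT x|M. psi x * s x powr (- p) * s' x * H x (g x) powr p) + (LINT x|M. s x powr (1 - p) * (Aop p H x (g x) \<bullet> grad psi x))"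
    using i2 i3 by simp
  finally show "(p - 1) * (LINT x|M. psi x * s x powr (- p) * s' x * H x (g x) powr p)
      = (LINT x|M. s x powr (1 - p) * (Aop p H x (g x) \<bullet> grad psi x))
        + (LINT x|M. (V x - lam) * (\<bar>v x\<bar> powr (p - 2) * v x) * (psi x * s x powr (1 - p)))"
    using solves_W0[OF S WF] by (simp add: weak_form_def left_diff_distrib)
qed

text \<open>The point is that \<open>C\<close> is independent of \<open>e\<close>: the gradient of
  the logarithm is controlled uniformly as the regularization is removed.\<close>

lemma caccioppoli_log:
  assumes S: "solves lam v g" and v0: "AE x in M. v x >= 0" and r: "r > 0" "cball a r \<subseteq> w"
  obtains C where "!!e. e > 0 ==> (LINT x|M. indicator (ball a (r / 2)) x * norm ((soft' e (v x) / soft e (v x)) *\<^sub>R g x) powr p) <= C"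
proof -
  obtain eta where eta: "test_fun w eta" "!!x. eta x >= 0" "!!x. x \<in> ball a r \<longleftrightarrow> eta x > 0" by (rule ex_bump[OF r]) (rule that)
  obtain K where K: "K > 0" "!!x. \<bar>eta x\<bar> <= K" "!!x. norm (grad eta x) <= K" by (rule test_fun_bounded[OF eta(1)]) blast
  \<comment> \<open>A natural exponent keeps the power of the bump smooth, and being at least
    \<open>p\<close> it meets the condition of \<open>young_cut\<close>.\<close>
  obtain m :: nat where m: "p <= real m" using real_arch_simple by blast
  have m0: "m > 0" using m p1 by (cases m) auto
  define psi where "psi x = eta x ^ m" for x
  have sm: "smooth_fun psi" unfolding psi_def by (intro smooth_power test_fun_smooth[OF eta(1)])
  have psi: "test_fun w psi" by (rule test_funI[OF eta(1) sm]) (simp add: psi_def m0)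
  have psi0: "psi x >= 0" "psi x <= K ^ m" for x using eta(2)[of x] K(2)[of x] by (auto simp: psi_def intro: power_mono)
  have gr: "grad psi x = (real m * eta x ^ (m - 1)) *\<^sub>R grad eta x" for x
    unfolding psi_def by (rule grad_compose[OF test_fun_smooth[OF eta(1)]]) (use DERIV_pow[of m "eta x"] in simp)
  have "compact (cball a (r/2))" "cball a (r/2) ~= {}" using r by auto
  then obtain z where z: "z \<in> cball a (r/2)" "!!x. x \<in> cball a (r/2) ==> psi z <= psi x"
    using continuous_attains_inf[OF _ _ smooth_continuous[OF sm]] by metis
  have "z \<in> ball a r" using z(1) r by auto
  then have c0: "psi z > 0" using eta(3) by (simp add: psi_def)
  define B where "B = \<nu> * (real m * K)"
  \<comment> \<open>Since \<open>soft' >= 1/2\<close> at nonnegative values, the left-hand side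
    carries the factor \<open>(p - 1) / 2\<close>, which is twice this number; one half of it
    absorbs the gradient of the cut-off.\<close>
  define \<tau> where "\<tau> = (p - 1) / 4"
  define C1 where "C1 = (B / \<tau>) powr (p - 1) * K powr (real m - p) * B"
  have \<tau>: "\<tau> > 0" using p1 by (simp add: \<tau>_def)
  have B: "B >= 0" using K(1) \<nu>0 by (simp add: B_def)
  define C2 where "C2 = (LINT x|M. (\<bar>V x\<bar> + \<bar>lam\<bar>) * K ^ m)"
  define C3 where "C3 = (C1 * measure M (space M) + C2) / \<tau>"
  have main: "(LINT x|M. psi x * soft e (v x) powr (- p) * H x (g x) powr p) <= C3" if e: "e > 0" for e
  proof -
    note I = tested_identity[OF S psi e]
    let ?J = "%x. psi x * soft e (v x) powr (- p) * H x (g x) powr p"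
    define J where "J = (LINT x|M. ?J x)"
    have spos: "soft e t > 0" for t using soft_pos[OF e, of t] e by linarith
    have J0: "?J x >= 0" for x using psi0 by simp
    have "2 * \<tau> * J = (LINT x|M. 2 * \<tau> * ?J x)" by (simp add: J_def)
    also have "... <= (LINT x|M. (p - 1) * (psi x * soft e (v x) powr (- p) * soft' e (v x) * H x (g x) powr p))"
    proof (rule integral_mono_AE)
      show "AE x in M. 2 * \<tau> * ?J x <= (p - 1) * (psi x * soft e (v x) powr (- p) * soft' e (v x) * H x (g x) powr p)"
        using v0
      proof eventually_elim
        case (elim x)
        have "2 * \<tau> * ?J x = (p - 1) * (?J x * (1/2))" by (simp add: \<tau>_def)
        also have "... <= (p - 1) * (?J x * soft' e (v x))"
          using soft'_ge[OF e elim] p1 J0[of x] by (intro mult_left_mono) auto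
        finally show ?case by (simp only: mult_ac)
      qed
    qed (use I(1,2) in simp_all)
    also have "... = (p - 1) * (LINT x|M. psi x * soft e (v x) powr (- p) * soft' e (v x) * H x (g x) powr p)" by simp
    also have "... = (LINT x|M. soft e (v x) powr (1 - p) * (Aop p H x (g x) \<bullet> grad psi x))
        + (LINT x|M. (V x - lam) * (\<bar>v x\<bar> powr (p - 2) * v x) * (psi x * soft e (v x) powr (1 - p)))" by (rule I(5))
    also have "(LINT x|M. soft e (v x) powr (1 - p) * (Aop p H x (g x) \<bullet> grad psi x)) <= (LINT x|M. \<tau> * ?J x + C1)"
    proof (rule integral_mono_AE[OF I(3)])
      show "integrable M (%x. \<tau> * ?J x + C1)" using I(1) finite_M by (simp add: finite_measure.integrable_const)
      show "AE x in M. soft e (v x) powr (1 - p) * (Aop p H x (g x) \<bullet> grad psi x) <= \<tau> * ?J x + C1"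
        using Aop_bounds
      proof eventually_elim
        case (elim x)
        let ?s = "soft e (v x)" and ?h = "H x (g x)"
        have "Aop p H x (g x) \<bullet> grad psi x <= ?h powr (p - 1) * H x (grad psi x)" using elim abs_le_D1 by blast
        also have "... <= ?h powr (p - 1) * (\<nu> * norm (grad psi x))" using elim by (intro mult_left_mono) auto
        also have "... <= ?h powr (p - 1) * (\<nu> * (real m * eta x ^ (m - 1) * K))"
          unfolding gr using eta(2) K(3) \<nu>0 by (intro mult_left_mono) (auto simp: abs_mult intro!: mult_left_mono)
        finally have "?s powr (1 - p) * (Aop p H x (g x) \<bullet> grad psi x) <= ?s powr (1 - p) * (?h powr (p - 1) * (\<nu> * (real m * eta x ^ (m - 1) * K)))"
          by (intro mult_left_mono) auto
        also have "... = (?h / ?s) powr (p - 1) * eta x ^ (m - 1) * B"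
          using spos[of "v x"] H_nn[of x "g x"] powr_minus_divide[of ?s "p - 1"] by (simp add: powr_divide B_def)
        also have "... <= \<tau> * ((?h / ?s) powr p * eta x ^ m) + C1"
          unfolding C1_def using spos[of "v x"] H_nn[of x "g x"] eta(2)[of x] K(2)[of x] \<tau> B p1 m by (intro young_cut) auto
        also have "(?h / ?s) powr p * eta x ^ m = ?J x"
          using spos[of "v x"] H_nn[of x "g x"] by (simp add: powr_divide psi_def powr_minus_divide)
        finally show ?case .
      qed
    qed
    also have "(LINT x|M. \<tau> * ?J x + C1) = \<tau> * J + C1 * measure M (space M)"
      using I(1) finite_M by (simp add: finite_measure.integrable_const J_def)
    also have "(LINT x|M. (V x - lam) * (\<bar>v x\<bar> powr (p - 2) * v x) * (psi x * soft e (v x) powr (1 - p))) <= C2"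
      unfolding C2_def
    proof (rule integral_mono_AE[OF I(4)])
      show "integrable M (%x. (\<bar>V x\<bar> + \<bar>lam\<bar>) * K ^ m)" using V_int finite_M by (auto simp: finite_measure.integrable_const)
      show "AE x in M. (V x - lam) * (\<bar>v x\<bar> powr (p - 2) * v x) * (psi x * soft e (v x) powr (1 - p)) <= (\<bar>V x\<bar> + \<bar>lam\<bar>) * K ^ m"
        using v0
      proof eventually_elim
        case (elim x)
        define q where "q = \<bar>v x\<bar> powr (p - 2) * v x * soft e (v x) powr (1 - p)"
        have q: "0 <= q" "q <= 1" unfolding q_def by (rule soft_quotient(1,2)[OF e elim p1])+
        have "(V x - lam) * (q * psi x) <= (\<bar>V x\<bar> + \<bar>lam\<bar>) * (1 * K ^ m)"
          using q psi0[of x] K(1) by (intro mult_mono) auto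
        then show ?case by (simp add: q_def mult_ac)
      qed
    qed
    finally have "\<tau> * J <= C1 * measure M (space M) + C2" by (simp add: mult.commute)
    then have "J <= C3" using \<tau> by (simp add: C3_def field_simps)
    then show ?thesis by (simp add: J_def)
  qed
  define D where "D = 1 / (psi z * \<kappa> powr p)"
  have D: "D > 0" using c0 \<kappa> by (simp add: D_def)
  show ?thesis
  proof (rule that[of "D * C3"])
    fix e :: real assume e: "e > 0"
    have spos: "soft e t > 0" for t using soft_pos[OF e, of t] e by linarith
    let ?J = "%x. psi x * soft e (v x) powr (- p) * H x (g x) powr p"
    have "(LINT x|M. indicator (ball a (r / 2)) x * norm ((soft' e (v x) / soft e (v x)) *\<^sub>R g x) powr p) <= (LINT x|M. D * ?J x)"
    proof (rule integral_mono_AE')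
      show "integrable M (%x. D * ?J x)" using tested_identity(1)[OF S psi e] by simp
      show "AE x in M. indicator (ball a (r / 2)) x * norm ((soft' e (v x) / soft e (v x)) *\<^sub>R g x) powr p <= D * ?J x"
        using Aop_bounds
      proof eventually_elim
        case (elim x)
        let ?s = "soft e (v x)"
        show ?case
        proof (cases "x \<in> ball a (r/2)")
          case True
          have "norm ((soft' e (v x) / ?s) *\<^sub>R g x) <= 1 / ?s * (H x (g x) / \<kappa>)"
            unfolding norm_scaleR using elim soft'_nonneg[OF e, of "v x"] soft'_le[OF e, of "v x"] spos[of "v x"] \<kappa>
            by (intro mult_mono) (auto simp: divide_right_mono field_simps)
          then have "norm ((soft' e (v x) / ?s) *\<^sub>R g x) powr p <= (1 / ?s * (H x (g x) / \<kappa>)) powr p"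
            using p0 by (intro powr_mono2) auto
          also have "... = ?s powr (- p) * H x (g x) powr p / \<kappa> powr p"
            using spos[of "v x"] \<kappa> H_nn[of x "g x"] by (simp add: powr_mult powr_divide powr_minus_divide)
          also have "... = psi z * (D * (?s powr (- p) * H x (g x) powr p))" using c0 by (simp add: D_def)
          also have "... <= psi x * (D * (?s powr (- p) * H x (g x) powr p))"
            using z(2)[of x] True D by (intro mult_right_mono) auto
          finally show ?thesis using True by (simp add: mult_ac)
        next
          case False
          then show ?thesis using psi0[of x] D by simp
        qed
      qed
      show "AE x in M. 0 <= D * ?J x" using psi0 D by (intro AE_I2) simp
    qed
    also have "... <= D * C3" using main[OF e] D by simp
    finally show "(LINT x|M. indicator (ball a (r / 2)) x * norm ((soft' e (v x) / soft e (v x)) *\<^sub>R g x) powr p) <= D * C3" .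
  qed
qed

text \<open>Lindelof: countably many of the balls cover \<open>w\<close>, and countable unions of
  null sets are null.\<close>

lemma AE_of_local:
  assumes "!!a. a \<in> w ==> \<exists>r>0. AE x in M. x \<in> ball a r --> P x"
  shows "AE x in M. P x"
proof -
  obtain r where r: "!!a. a \<in> w ==> r a > 0" "!!a. a \<in> w ==> AE x in M. x \<in> ball a (r a) --> P x" using assms by metis
  obtain F where F: "F \<subseteq> (%a. ball a (r a)) ` w" "countable F" "\<Union>F = (\<Union>a\<in>w. ball a (r a))"
    by (rule Lindelof[of "(%a. ball a (r a)) ` w"]) auto
  have "AE x in M. x \<in> B --> P x" if "B \<in> F" for B using F(1) that r(2) by blast
  then have "AE x in M. \<forall>B\<in>F. x \<in> B --> P x" by (intro iffD2[OF AE_ball_countable[OF F(2)]] ballI)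
  moreover have "AE x in M. x \<in> w" by (rule AE_I2) simp
  ultimately show ?thesis
  proof eventually_elim
    case (elim x)
    then have "x \<in> \<Union>F" unfolding F(3) using r(1) by force
    then show ?case using elim by blast
  qed
qed

lemma ball_not_null:
  assumes "r > 0" "a \<in> w" shows "\<not> (AE x in M. x \<notin> ball a r)"
proof
  assume ae: "AE x in M. x \<notin> ball a r"
  have "a \<in> ball a r \<inter> w" using assms by simp
  then have o: "open (ball a r \<inter> w)" "ball a r \<inter> w ~= {}" using w_open by blast+
  have "AE x in lebesgue. x \<in> w --> x \<notin> ball a r" using ae w_open by (simp add: AE_restrict_space_iff)
  then have "AE x in lebesgue. x \<notin> ball a r \<inter> w" by eventually_elim auto
  then have "negligible (ball a r \<inter> w)" using o by (simp add: negligible_iff_null_sets AE_iff_null_sets)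
  then show False using open_not_negligible[OF o] by simp
qed

text \<open>The logarithm of \<open>soft e v\<close> has bounded oscillation on the ball uniformly in \<open>e\<close>, whereas its values on
  \<open>v = 0\<close> and on \<open>v \<ge> t > 0\<close> drift apart as \<open>e\<close> tends to zero.\<close>

lemma dichotomy_on_ball:
  assumes S: "solves lam v g" and v0: "AE x in M. v x >= 0" and r: "r > 0" "cball a r \<subseteq> w"
  shows "(AE x in M. x \<in> ball a (r / 2) --> v x = 0) \<or> (AE x in M. x \<in> ball a (r / 2) --> v x > 0)"
proof (rule ccontr)
  assume no: "\<not> ?thesis"
  have W: "W0 p w v g" using S by (simp add: solves_def)
  note [measurable] = Lp_measurable[OF W0_Lp(1)[OF W]]
  interpret finite_measure M by (rule finite_M)
  let ?B = "ball a (r / 2)"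
  have sub: "?B \<subseteq> w" using r by (auto simp: subset_iff)
  have [measurable]: "?B \<in> sets M" using sub w_open by (simp add: sets_restrict_space_iff)
  define Z where "Z = {x \<in> space M. x \<in> ?B \<and> v x = 0}"
  \<comment> \<open>If \<open>v\<close> is not almost everywhere zero on the ball, it exceeds some
    fixed positive level on a set of positive measure.\<close>
  define Y where "Y k = {x \<in> space M. x \<in> ?B \<and> v x >= 1 / real (Suc k)}" for k
  have [measurable]: "Z \<in> sets M" "Y k \<in> sets M" for k unfolding Z_def Y_def by measurable
  have nul: "AE x in M. x \<notin> A" if "A \<in> sets M" "\<not> measure M A > 0" for A
    using that by (intro AE_not_in) (auto simp: null_sets_def emeasure_eq_measure zero_less_measure_iff)
  have z: "measure M Z > 0"
  proof (rule ccontr)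
    assume "\<not> measure M Z > 0"
    then have "AE x in M. x \<notin> Z" by (intro nul) auto
    then have "AE x in M. x \<in> ?B --> v x > 0" using v0 AE_space by eventually_elim (auto simp: Z_def)
    then show False using no by blast
  qed
  obtain k where y: "measure M (Y k) > 0"
  proof (rule ccontr)
    assume "\<not> thesis"
    then have "AE x in M. x \<notin> Y k" for k using that by (intro nul) auto
    then have "AE x in M. \<forall>k. x \<notin> Y k" by (simp add: AE_all_countable)
    then have "AE x in M. x \<in> ?B --> v x = 0" using v0 AE_space
    proof eventually_elim
      case (elim x)
      show ?case
      proof (rule ccontr)
        assume n: "\<not> (x \<in> ?B --> v x = 0)"
        then obtain k where "1 / real (Suc k) < v x" using elim nat_approx_posE[of "v x"] by auto
        then have "x \<in> Y k" using n elim(3) by (auto simp: Y_def intro: less_imp_le)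
        then show False using elim by blast
      qed
    qed
    then show False using no by blast
  qed
  obtain C where C: "!!e. e > 0 ==> (LINT x|M. indicator ?B x * norm ((soft' e (v x) / soft e (v x)) *\<^sub>R g x) powr p) <= C"
    by (rule caccioppoli_log[OF S v0 r]) blast
  define D where "D = 2 powr p * (2^DIM('a) * (2 * (r / 2)) powr p * (2 powr p * C)) + 1"
  define \<mu> where "\<mu> = min (measure M Z) (measure M (Y k))"
  define t where "t = 1 / real (Suc k)"
  have \<mu>: "\<mu> > 0" and t: "t > 0" using z y by (auto simp: \<mu>_def t_def)
  have main: "\<mu> * (ln (t / (3 / 2 * e)) / 2) powr p <= D" if e: "e > 0" "3 / 2 * e < t" for e
  proof -
    define L where "L = ln (t / (3 / 2 * e)) / 2"
    define u where "u x = ln (soft e (v x)) - ln (soft e 0)" for x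
    have L: "L > 0" using e by (simp add: L_def)
    have Wu: "W0 p w u (%x. (soft' e (v x) / soft e (v x)) *\<^sub>R g x)" unfolding u_def by (rule W0_soft_ln[OF W e(1)])
    note [measurable] = Lp_measurable[OF W0_Lp(1)[OF Wu]]
    have r2: "r / 2 > 0" using r by simp
    obtain c where c: "(LINT x|M. indicator ?B x * \<bar>u x - c\<bar> powr p) <= 2 powr p * (2^DIM('a) * (2 * (r / 2)) powr p
        * (2 powr p * (LINT x|M. indicator ?B x * norm ((soft' e (v x) / soft e (v x)) *\<^sub>R g x) powr p))) + 1"
      by (rule poincare_ball[OF Wu r2 sub zero_less_one]) (rule that)
    have "... <= D" unfolding D_def using C[OF e(1)] by (intro add_right_mono mult_left_mono) auto
    then have cD: "(LINT x|M. indicator ?B x * \<bar>u x - c\<bar> powr p) <= D" using c by simp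
    have "Lp p w (%x. u x - c)" by (rule Lp_diff(1)[OF W0_Lp(1)[OF Wu] bounded_Lp p0(1)]) auto
    then have iu: "integrable M (%x. indicator ?B x * \<bar>u x - c\<bar> powr p)"
      using integrable_mult_indicator[of ?B M "%x. \<bar>u x - c\<bar> powr p"] by (simp add: Lp_def)
    \<comment> \<open>Chebyshev's inequality for the deviation from \<open>c\<close>.\<close>
    have lower: "measure M A * L powr p <= D" if A: "A \<in> sets M" "A \<subseteq> ?B" "!!x. x \<in> A ==> L <= \<bar>u x - c\<bar>" for A
    proof -
      have "A \<inter> w = A" using sets.sets_into_space[OF A(1)] by auto
      then have "measure M A * L powr p = (LINT x|M. indicator A x * L powr p)" by simp
      also have "... <= (LINT x|M. indicator ?B x * \<bar>u x - c\<bar> powr p)"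
      proof (rule integral_mono[OF _ iu])
        show "indicator A x * L powr p <= indicator ?B x * \<bar>u x - c\<bar> powr p" for x
          using A(2) powr_mono2[of p L "\<bar>u x - c\<bar>"] A(3)[of x] L p0 by (auto simp: indicator_def)
      qed (use A(1) in \<open>auto simp: emeasure_eq_measure intro!: integrable_mult_left integrable_real_indicator\<close>)
      finally show ?thesis using cD by linarith
    qed
    \<comment> \<open>The function \<open>u\<close> is \<open>0\<close> on \<open>Z\<close> and at
      least \<open>2 * L\<close> on \<open>Y k\<close>, so the constant \<open>c\<close> is at
      distance at least \<open>L\<close> from one of these values.\<close>
    have "measure M Z * L powr p <= D \<or> measure M (Y k) * L powr p <= D"
    proof (cases "\<bar>c\<bar> >= L")
      case True
      have "measure M Z * L powr p <= D" by (rule lower, measurable) (use True in \<open>auto simp: Z_def u_def\<close>)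
      then show ?thesis ..
    next
      case False
      have "L <= \<bar>u x - c\<bar>" if "x \<in> Y k" for x
      proof -
        have vx: "v x >= t" using that by (simp add: Y_def t_def)
        have "t <= soft e (v x)" using soft_ge[OF e(1), of "v x"] vx t e by linarith
        then have "ln t <= ln (soft e (v x))" using t by simp
        moreover have "2 * L = ln t - ln (3 / 2 * e)" using ln_divide_pos[of t "3 / 2 * e"] e t unfolding L_def by simp
        ultimately have "2 * L <= u x" by (simp add: u_def soft_0[OF e(1)])
        then show ?thesis using False by linarith
      qed
      then have "measure M (Y k) * L powr p <= D" by (intro lower, measurable) (auto simp: Y_def)
      then show ?thesis ..
    qed
    moreover have "\<mu> * L powr p <= measure M Z * L powr p" "\<mu> * L powr p <= measure M (Y k) * L powr p"
      by (intro mult_right_mono; simp add: \<mu>_def)+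
    ultimately show ?thesis unfolding L_def[symmetric] by linarith
  qed
  \<comment> \<open>With this \<open>T\<close> and \<open>e\<close>, the half drift \<open>L\<close>
    equals \<open>T / 2\<close>, and \<mu> times its p-th power is \<open>|D| + \<mu>\<close>, which
    exceeds \<open>D\<close>.\<close>
  define T where "T = 2 * (\<bar>D\<bar> / \<mu> + 1) powr (1 / p)"
  define e where "e = t * exp (- T) / (3 / 2)"
  have "\<bar>D\<bar> / \<mu> + 1 > 0" using \<mu> by (intro add_nonneg_pos) auto
  then have T: "T > 0" "(T / 2) powr p = \<bar>D\<bar> / \<mu> + 1" using p0 by (simp_all add: T_def powr_powr)
  have e: "e > 0" "3 / 2 * e < t" using t T by (auto simp: e_def)
  have "t / (3 / 2 * e) = exp T" using t by (simp add: e_def exp_minus field_simps)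
  then have "\<mu> * (T / 2) powr p <= D" using main[OF e] by simp
  then have "\<bar>D\<bar> + \<mu> <= D" using \<mu> unfolding T(2) by (simp add: distrib_left)
  then show False using \<mu> by linarith
qed

text \<open>The points near which \<open>v\<close> is zero and those near which it is positive, both
  almost everywhere, form disjoint open sets; the local dichotomy says that they cover
  \<open>w\<close>, and connectedness leaves only one.\<close>

theorem strong_maximum_principle:
  assumes S: "solves lam v g" and v0: "AE x in M. v x >= 0" and nz: "\<not> (AE x in M. v x = 0)"
  shows "AE x in M. v x > 0"
proof -
  define U where "U P = {a \<in> w. \<exists>r>0. AE x in M. x \<in> ball a r --> P (v x)}" for P :: "real => bool"
  have op: "open (U P)" for P
    unfolding open_contains_ball
  proof
    fix a assume "a \<in> U P"
    then obtain r where r: "r > 0" "AE x in M. x \<in> ball a r --> P (v x)" and a: "a \<in> w" by (auto simp: U_def)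
    obtain s where s: "s > 0" "ball a s \<subseteq> w" using w_open a by (auto simp: open_contains_ball)
    have "ball a (min (r/2) s) \<subseteq> U P"
    proof
      fix b assume b: "b \<in> ball a (min (r/2) s)"
      have sb: "ball b (r/2) \<subseteq> ball a r"
      proof
        fix x assume "x \<in> ball b (r/2)"
        then show "x \<in> ball a r" using b dist_triangle[of a x b] by simp
      qed
      have "AE x in M. x \<in> ball b (r/2) --> P (v x)" using r(2) by eventually_elim (use sb in blast)
      moreover have "b \<in> w" using b s by auto
      ultimately show "b \<in> U P" using r(1) unfolding U_def by (intro CollectI conjI exI[of _ "r/2"]) auto
    qed
    then show "\<exists>e>0. ball a e \<subseteq> U P" using r(1) s(1) by (intro exI[of _ "min (r/2) s"]) auto
  qed
  have cover: "w \<subseteq> U (%t. t = 0) \<union> U (%t. t > 0)"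
  proof
    fix a assume a: "a \<in> w"
    then obtain r where r: "r > 0" "cball a r \<subseteq> w" using w_open by (auto simp: open_contains_cball)
    have "r / 2 > 0" using r by simp
    then show "a \<in> U (%t. t = 0) \<union> U (%t. t > 0)" using dichotomy_on_ball[OF S v0 r] a unfolding U_def by blast
  qed
  have disj: "U (%t. t = 0) \<inter> U (%t. t > 0) \<inter> w = {}"
  proof (rule ccontr)
    assume "\<not> ?thesis"
    then obtain a r s where a: "a \<in> w" "r > 0" "s > 0" "AE x in M. x \<in> ball a r --> v x = 0" "AE x in M. x \<in> ball a s --> v x > 0"
      by (auto simp: U_def)
    have "AE x in M. x \<notin> ball a (min r s)" using a(4,5) by eventually_elim auto
    then show False using ball_not_null[of "min r s" a] a by simp
  qed
  from connectedD[OF w_conn op op disj cover] have "U (%t. t = 0) \<inter> w = {} \<or> U (%t. t > 0) \<inter> w = {}" .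
  then have "w \<subseteq> U (%t. t > 0) \<or> w \<subseteq> U (%t. t = 0)" using cover by blast
  moreover have "AE x in M. P (v x)" if "w \<subseteq> U P" for P
    by (rule AE_of_local) (use that in \<open>auto simp: U_def\<close>)
  ultimately show ?thesis using nz by blast
qed

text \<open>The test function is \<open>phi^p v^(1 - p)\<close>, with both factors regularized.\<close>

lemma picone:
  assumes S: "solves lam v g" and v0: "AE x in M. v x >= 0" and nz: "\<not> (AE x in M. v x = 0)" and phi: "test_fun w phi"
  shows "lam * Np p w phi <= Q phi (grad phi)"
proof -
  have W: "W0 p w v g" using S by (simp add: solves_def)
  have vpos: "AE x in M. v x > 0" by (rule strong_maximum_principle[OF S v0 nz])
  note Lv = W0_Lp[OF W]
  note [measurable] = Lp_measurable[OF Lv(1)] Lp_measurable[OF Lv(2)] test_measurable[OF phi]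
  have [measurable]: "(%x. H x (grad phi x)) \<in> borel_measurable M" by (rule H_compose_measurable) measurable
  note Iphi = H_powr_integrable(1)[OF test_Lp(2)[OF phi]] and Ig = H_powr_integrable(1)[OF Lv(2)]
  obtain K where K: "K > 0" "!!x. \<bar>phi x\<bar> <= K" "!!x. norm (grad phi x) <= K" by (rule test_fun_bounded[OF phi]) blast
  define e where "e m = 1 / real (Suc m)" for m
  \<comment> \<open>The regularization of \<open>phi\<close> must vanish faster than that of
    \<open>v\<close>: the error contains \<open>d powr p * s powr (- p)\<close>, at most
    \<open>e powr p\<close> because \<open>s >= e\<close>.\<close>
  define d where "d m = e m * e m" for m
  have e: "e m > 0" "e m <= 1" for m by (simp_all add: e_def)
  have d: "d m > 0" "d m <= 1" for m using e[of m] by (simp_all add: d_def mult_le_one)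
  have e0: "e ----> 0" unfolding e_def by (rule LIMSEQ_Suc[OF lim_1_over_n])
  have d0: "d ----> 0" unfolding d_def using tendsto_mult[OF e0 e0] by simp
  define psi where "psi m x = reg_powr p (d m) (phi x)" for m x
  define s where "s m x = soft (e m) (v x)" for m x
  define s' where "s' m x = soft' (e m) (v x)" for m x
  have [measurable]: "s m \<in> borel_measurable M" "s' m \<in> borel_measurable M" for m
    using soft_measurable[OF e(1)[of m]] unfolding s_def s'_def by measurable
  have sm: "smooth_fun (psi m)" for m unfolding psi_def reg_powr_def
    using d(1)[of m] by (intro smooth_diff smooth_const smooth_powr smooth_add smooth_power test_fun_smooth[OF phi]) (simp add: sum_power2_gt_zero_iff)
  have psi: "test_fun w (psi m)" for m
    by (rule test_funI[OF phi sm]) (simp add: psi_def reg_powr(3)[OF d(1) p1])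
  note [measurable] = test_measurable(1)[OF psi]
  have psib: "0 <= psi m x" "psi m x <= (K + 1) powr p" for m x
  proof -
    show "0 <= psi m x" unfolding psi_def by (rule reg_powr(4)[OF d(1) p1])
    have "psi m x <= (\<bar>phi x\<bar> + d m) powr p" unfolding psi_def by (rule reg_powr(5)[OF d(1) p1])
    also have "... <= (K + 1) powr p" using K(2)[of x] d[of m] p1 by (intro powr_mono2) auto
    finally show "psi m x <= (K + 1) powr p" .
  qed
  let ?q = "%m x. \<bar>v x\<bar> powr (p - 2) * v x * s m x powr (1 - p)"
  \<comment> \<open>The energy density of \<open>phi\<close> with the weight produced by
    \<open>\<sigma> = s'\<close> in \<open>picone_young\<close>; the weight is bounded because
    \<open>s' >= 1/2\<close>.\<close>
  let ?b = "%m x. s' m x powr (1 - p) * H x (grad phi x) powr p"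
  have bb: "AE x in M. norm (?b m x) <= (1/2) powr (1 - p) * H x (grad phi x) powr p" for m
    using v0
  proof eventually_elim
    case (elim x)
    have "1 / 2 <= s' m x" unfolding s'_def by (rule soft'_ge[OF e(1) elim])
    then have "s' m x powr (1 - p) <= (1/2) powr (1 - p)" using p1 by (intro powr_mono2') auto
    then show ?case by (simp add: mult_right_mono)
  qed
  have Ib0: "integrable M (%x. (1/2) powr (1 - p) * H x (grad phi x) powr p)" using Iphi by simp
  have Ib: "integrable M (?b m)" for m
    by (rule Bochner_Integration.integrable_bound[OF Ib0]) (measurable, use bb[of m] in \<open>eventually_elim, simp\<close>)
  \<comment> \<open>The pointwise inequality reproduces the left-hand side of
    \<open>tested_identity\<close>, so those terms cancel and only the error \<open>e powr p\<close>
    of the regularization remains.\<close>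
  have ge: "0 <= (LINT x|M. (V x - lam) * (?q m x * psi m x)) + (p - 1) * e m powr p * E g + (LINT x|M. ?b m x)" for m
  proof -
    note I = tested_identity[OF S psi e(1), of m m, folded s_def s'_def]
    have "(LINT x|M. s m x powr (1 - p) * (Aop p H x (g x) \<bullet> grad (psi m) x))
      <= (LINT x|M. (p - 1) * (psi m x * s m x powr (- p) * s' m x * H x (g x) powr p) + (p - 1) * e m powr p * H x (g x) powr p + ?b m x)"
    proof (rule integral_mono_AE[OF I(3)])
      show "integrable M (%x. (p - 1) * (psi m x * s m x powr (- p) * s' m x * H x (g x) powr p) + (p - 1) * e m powr p * H x (g x) powr p + ?b m x)"
        using I(2) Ig Ib[of m] by simp
      show "AE x in M. s m x powr (1 - p) * (Aop p H x (g x) \<bullet> grad (psi m) x)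
        <= (p - 1) * (psi m x * s m x powr (- p) * s' m x * H x (g x) powr p) + (p - 1) * e m powr p * H x (g x) powr p + ?b m x"
        using v0 Aop_bounds H_good
      proof eventually_elim
        case (elim x)
        define T where "T = sqrt ((phi x)\<^sup>2 + (d m)\<^sup>2)"
        have T0: "T >= 0" by (simp add: T_def)
        obtain D where D: "(reg_powr p (d m) has_real_derivative D) (at (phi x))" "\<bar>D\<bar> <= p * T powr (p - 1)"
          using reg_powr(2)[OF d(1) p1] unfolding T_def by blast
        have gr: "grad (psi m) x = D *\<^sub>R grad phi x" unfolding psi_def by (rule grad_compose[OF test_fun_smooth[OF phi] D(1)])
        have sx: "e m <= s m x" "1 / 2 <= s' m x" "s' m x <= 1"
          unfolding s_def s'_def by (rule soft_pos[OF e(1)], rule soft'_ge[OF e(1) elim(1)], rule soft'_le[OF e(1)])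
        let ?h = "H x (g x)"
        have "Aop p H x (g x) \<bullet> grad (psi m) x <= \<bar>D\<bar> * \<bar>Aop p H x (g x) \<bullet> grad phi x\<bar>"
          unfolding gr by (simp add: abs_mult[symmetric])
        also have "... <= (p * T powr (p - 1)) * (?h powr (p - 1) * H x (grad phi x))"
          using D(2) elim(2) by (intro mult_mono) auto
        finally have "s m x powr (1 - p) * (Aop p H x (g x) \<bullet> grad (psi m) x) <= s m x powr (1 - p) * (?h powr (p - 1) * (p * T powr (p - 1) * H x (grad phi x)))"
          by (intro mult_left_mono) (auto simp: mult_ac)
        also have "... <= (p - 1) * (T powr p * s m x powr (- p) * s' m x * ?h powr p) + s' m x powr (1 - p) * H x (grad phi x) powr p"
          using sx e(1)[of m] T0 H_nn p1 by (intro picone_young) auto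
        also have "T powr p = psi m x + d m powr p" unfolding psi_def T_def by (simp add: reg_powr(1)[OF d(1) p1])
        also have "(p - 1) * ((psi m x + d m powr p) * s m x powr (- p) * s' m x * ?h powr p)
           = (p - 1) * (psi m x * s m x powr (- p) * s' m x * ?h powr p) + (p - 1) * (d m powr p * s m x powr (- p) * s' m x * ?h powr p)"
          by (simp add: algebra_simps)
        also have "(p - 1) * (d m powr p * s m x powr (- p) * s' m x * ?h powr p) <= (p - 1) * (e m powr p * ?h powr p)"
        proof -
          have "s m x powr (- p) <= e m powr (- p)" using sx e(1)[of m] p1 by (intro powr_mono2') auto
          then have "d m powr p * s m x powr (- p) <= d m powr p * e m powr (- p)" by (intro mult_left_mono) auto
          also have "... = e m powr p" using e(1)[of m] by (simp add: d_def powr_mult powr_minus)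
          finally have "(d m powr p * s m x powr (- p)) * s' m x <= e m powr p * 1" using sx by (intro mult_mono) auto
          then show ?thesis using p1 by (intro mult_left_mono mult_right_mono) auto
        qed
        finally show ?case by (simp add: mult.assoc)
      qed
    qed
    also have "... = (p - 1) * (LINT x|M. psi m x * s m x powr (- p) * s' m x * H x (g x) powr p) + (p - 1) * e m powr p * E g + (LINT x|M. ?b m x)"
      using I(2) Ig Ib[of m] by (simp add: E_def)
    finally show ?thesis unfolding I(5) by (simp add: mult_ac)
  qed
  \<comment> \<open>Positivity almost everywhere is used here: where \<open>v > 0\<close>, both
    \<open>s'\<close> and the quotient multiplying the potential tend to one.\<close>
  have "(%m. (LINT x|M. (V x - lam) * (?q m x * psi m x)) + (p - 1) * e m powr p * E g + (LINT x|M. ?b m x))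
    ----> (LINT x|M. (V x - lam) * \<bar>phi x\<bar> powr p) + (p - 1) * 0 * E g + (LINT x|M. H x (grad phi x) powr p)"
  proof (intro tendsto_add tendsto_mult tendsto_const)
    have "(%m. e m powr p) ----> 0 powr p" using e p1 by (intro tendsto_powr'[OF e0 tendsto_const]) (auto simp: less_imp_le)
    then show "(%m. e m powr p) ----> 0" by simp
    show "(%m. \<integral>x. ?b m x \<partial>M) ----> (LINT x|M. H x (grad phi x) powr p)"
    proof (rule integral_dominated_convergence[OF _ _ Ib0 _ bb])
      show "AE x in M. (%m. ?b m x) ----> H x (grad phi x) powr p" using vpos
      proof eventually_elim
        case (elim x)
        have "(%m. s' m x) ----> 1" unfolding s'_def using soft_tendsto(2)[OF e0] elim by simp
        then have "(%m. ?b m x) ----> 1 powr (1 - p) * H x (grad phi x) powr p" by (intro tendsto_intros) auto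
        then show ?case by simp
      qed
    qed measurable
    show "(%m. \<integral>x. (V x - lam) * (?q m x * psi m x) \<partial>M) ----> (LINT x|M. (V x - lam) * \<bar>phi x\<bar> powr p)"
    proof (rule integral_dominated_convergence[where w = "%x. (\<bar>V x\<bar> + \<bar>lam\<bar>) * (K + 1) powr p"])
      show "integrable M (%x. (\<bar>V x\<bar> + \<bar>lam\<bar>) * (K + 1) powr p)" using V_int finite_M by (auto simp: finite_measure.integrable_const)
      show "AE x in M. (%m. (V x - lam) * (?q m x * psi m x)) ----> (V x - lam) * \<bar>phi x\<bar> powr p" using vpos
      proof eventually_elim
        case (elim x)
        have "(%m. s m x) ----> v x" unfolding s_def using soft_tendsto(1)[OF e0] elim by simp
        then have "(%m. v x powr (p - 1) * s m x powr (1 - p)) ----> v x powr (p - 1) * v x powr (1 - p)" using elim by (intro tendsto_intros) auto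
        moreover have "v x powr (p - 1) * v x powr (1 - p) = 1" using elim by (simp add: powr_add[symmetric])
        moreover have "?q m x = v x powr (p - 1) * s m x powr (1 - p)" for m
          unfolding s_def by (rule soft_quotient(3)[OF e(1) _ p1]) (use elim in simp)
        ultimately have q: "(%m. ?q m x) ----> 1" by (simp only:)
        have "(%m. sqrt ((phi x)\<^sup>2 + (d m)\<^sup>2) powr p - d m powr p) ----> sqrt ((phi x)\<^sup>2 + 0\<^sup>2) powr p - 0 powr p"
          using d p1 by (intro tendsto_diff tendsto_powr' tendsto_real_sqrt tendsto_add tendsto_power d0 tendsto_const) (auto simp: less_imp_le)
        then have "(%m. psi m x) ----> \<bar>phi x\<bar> powr p" by (simp add: psi_def reg_powr(1)[OF d(1) p1])
        then have "(%m. (V x - lam) * (?q m x * psi m x)) ----> (V x - lam) * (1 * \<bar>phi x\<bar> powr p)" by (intro tendsto_mult tendsto_const q)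
        then show ?case by simp
      qed
      show "AE x in M. norm ((V x - lam) * (?q m x * psi m x)) <= (\<bar>V x\<bar> + \<bar>lam\<bar>) * (K + 1) powr p" for m using v0
      proof eventually_elim
        case (elim x)
        define q where "q = ?q m x"
        have q: "0 <= q" "q <= 1" unfolding q_def s_def by (rule soft_quotient(1,2)[OF e(1) elim p1])+
        have "\<bar>V x - lam\<bar> * (q * psi m x) <= (\<bar>V x\<bar> + \<bar>lam\<bar>) * (1 * (K + 1) powr p)"
          using q psib by (intro mult_mono) auto
        then show ?case using q(1) psib(1) by (simp add: q_def[symmetric] abs_mult)
      qed
    qed measurable
  qed
  from LIMSEQ_le_const[OF this] ge
  have "0 <= (LINT x|M. (V x - lam) * \<bar>phi x\<bar> powr p) + E (grad phi)" unfolding E_def by auto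
  also have "(LINT x|M. (V x - lam) * \<bar>phi x\<bar> powr p) = PV phi - lam * Np p w phi"
    using V_powr_integrable[OF W0_test[OF phi]] W0_powr_integrable[OF W0_test[OF phi]] by (simp add: left_diff_distrib PV_def Np_def)
  finally show ?thesis by (simp add: Q_def)
qed

section \<open>From comparison of eigenvalues to isolation\<close>

lemma test_Np_pos:
  assumes phi: "test_fun w phi" and x: "phi x ~= 0"
  shows "Np p w phi > 0"
proof -
  have "open {y. phi y ~= 0}"
    using open_Collect_neq[OF smooth_continuous[OF test_fun_smooth[OF phi]] continuous_on_const] by simp
  then obtain r where r: "r > 0" "ball x r \<subseteq> {y. phi y ~= 0}" using x by (auto simp: open_contains_ball)
  have xw: "x \<in> w" using test_fun_outside(1)[OF phi] x by blast
  have "Np p w phi ~= 0"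
  proof
    assume "Np p w phi = 0"
    then have "AE y in M. norm (phi y) powr p = 0"
      unfolding Np_def using integral_nonneg_eq_0_iff_AE[OF Lp_integrable[OF test_Lp(1)[OF phi]]] by simp
    then have "AE y in M. y \<notin> ball x r" by eventually_elim (use r(2) in auto)
    then show False using ball_not_null[OF r(1) xw] by blast
  qed
  then show ?thesis using Np_nonneg[of p w phi] by linarith
qed

text \<open>Picone bounds every Rayleigh quotient below by \<open>lam\<close>. The bump shows that
  the set of quotients is nonempty, without which the infimum would be unspecified.\<close>

lemma solves_nonneg_lam_le:
  assumes S: "solves lam v g" and v0: "AE x in M. v x >= 0" and nz: "\<not> (AE x in M. v x = 0)"
  shows "lam <= lam1"
  unfolding lambda1_def
proof (rule cInf_greatest)
  obtain a where a: "a \<in> w" using w_ne by blast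
  then obtain r where r: "r > 0" "cball a r \<subseteq> w" using w_open by (auto simp: open_contains_cball)
  obtain eta where eta: "test_fun w eta" "!!x. eta x >= 0" "!!x. x \<in> ball a r \<longleftrightarrow> eta x > 0" by (rule ex_bump[OF r]) (rule that)
  have "eta a ~= 0" using eta(3)[of a] r by simp
  then show "{Qfun p H V w phi / (LINT x|M. \<bar>phi x\<bar> powr p) |phi. test_fun w phi \<and> (\<exists>x. phi x ~= 0)} ~= {}" using eta(1) by blast
next
  fix y assume "y \<in> {Qfun p H V w phi / (LINT x|M. \<bar>phi x\<bar> powr p) |phi. test_fun w phi \<and> (\<exists>x. phi x ~= 0)}"
  then obtain phi x where phi: "test_fun w phi" "phi x ~= 0" and y: "y = Qfun p H V w phi / (LINT x|M. \<bar>phi x\<bar> powr p)" by blast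
  have "y = Q phi (grad phi) / Np p w phi" by (simp add: y Qfun_eq[OF phi(1)] Np_def)
  then show "lam <= y" using picone[OF S v0 nz phi(1)] test_Np_pos[OF phi] by (simp add: pos_le_divide_eq)
qed

lemma Np_eq_0_iff: "Lp p w v ==> Np p w v = 0 \<longleftrightarrow> (AE x in M. v x = 0)"
  using integral_nonneg_eq_0_iff_AE[of M "%x. norm (v x) powr p"] by (simp add: Np_def Lp_def)

text \<open>The positive part is a restriction of the solution, so its quotient equals the
  eigenvalue; p-homogeneity allows its norm to be scaled to one.\<close>

lemma positive_part_normalized:
  assumes S: "solves lam v g" and pos: "\<not> (AE x in M. v x <= 0)"
  obtains c h where "c > 0" "W0 p w (%x. c * max 0 (v x)) h" "Np p w (%x. c * max 0 (v x)) = 1" "Q (%x. c * max 0 (v x)) h = lam"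
proof -
  have W: "W0 p w v g" using S by (simp add: solves_def)
  define u where "u x = max 0 (v x)" for x
  define h where "h x = (if v x > 0 then g x else 0)" for x
  have Wu: "W0 p w u h" using W0_pos[OF W] unfolding u_def h_def .
  have Qu: "Q u h = lam * Np p w u" by (rule Q_eq_if_restricted[OF S Wu]) (auto simp: u_def h_def)
  have "Np p w u ~= 0"
  proof
    assume "Np p w u = 0"
    then have "AE x in M. u x = 0" using Np_eq_0_iff[OF W0_Lp(1)[OF Wu]] by simp
    then have "AE x in M. v x <= 0" by eventually_elim (auto simp: u_def max_def split: if_splits)
    then show False using pos by blast
  qed
  then have N: "Np p w u > 0" using Np_nonneg[of p w u] by linarith
  define c where "c = Np p w u powr (- (1 / p))"
  have "c powr p = Np p w u powr (- 1)" unfolding c_def powr_powr using p0 by simp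
  then have c: "c > 0" "c powr p * Np p w u = 1" using N by (simp_all add: c_def powr_minus)
  have N1: "Np p w (%x. c * u x) = 1" using Np_mult[OF W0_Lp(1)[OF Wu], of c] c by simp
  have "E (%x. c *\<^sub>R h x) = (LINT x|M. c powr p * H x (h x) powr p)"
    unfolding E_def
  proof (rule integral_cong_AE)
    have "(%x. H x (h x)) \<in> borel_measurable M" "(%x. H x (c *\<^sub>R h x)) \<in> borel_measurable M"
      using Lp_measurable[OF W0_Lp(2)[OF Wu]] by (auto intro!: H_compose_measurable)
    then show "(%x. H x (c *\<^sub>R h x) powr p) \<in> borel_measurable M" "(%x. c powr p * H x (h x) powr p) \<in> borel_measurable M" by measurable
    show "AE x in M. H x (c *\<^sub>R h x) powr p = c powr p * H x (h x) powr p"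
      using H_good by eventually_elim (use c H_nn in \<open>auto simp: good_norm_def is_norm_fun_def powr_mult\<close>)
  qed
  moreover have "PV (%x. c * u x) = c powr p * PV u" 
    using c integral_mult_right_zero[of M "c powr p" "%x. V x * \<bar>u x\<bar> powr p"] by (simp add: PV_def abs_mult powr_mult mult.left_commute)
  ultimately have "Q (%x. c * u x) (%x. c *\<^sub>R h x) = c powr p * Q u h" by (simp add: Q_def E_def distrib_left)
  also have "... = lam * (c powr p * Np p w u)" unfolding Qu by (simp only: mult_ac)
  finally have Q1: "Q (%x. c * u x) (%x. c *\<^sub>R h x) = lam" using c by simp
  show ?thesis
    by (rule that[of c "%x. c *\<^sub>R h x"]) (use c N1 Q1 W0_scale[OF Wu, of c] in \<open>simp_all add: u_def\<close>)
qed

text \<open>Nonnegativity passes to the limit along an almost everywhere convergent subsequence, and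
  norm one excludes the zero function, so the strong maximum principle applies.\<close>

lemma limit_positive:
  assumes S: "solves lam v' g'" and N1: "Np p w v' = 1"
    and W: "!!m. W0 p w (v m) (g m)" and nn: "!!m x. v m x >= 0"
    and lim: "(%m. Np p w (%x. v m x - v' x)) ----> 0"
  obtains r where "strict_mono (r :: nat => nat)" "AE x in M. (%m. v (r m) x) ----> v' x \<and> v' x > 0"
proof -
  have W': "W0 p w v' g'" using S by (simp add: solves_def)
  note Lv = W0_Lp(1)[OF W] and Lv' = W0_Lp(1)[OF W']
  note Ld = Lp_diff(1)[OF Lv Lv' p0(1)]
  obtain r where r: "strict_mono (r :: nat => nat)" "AE x in M. (%m. v (r m) x - v' x) ----> 0"
    by (rule Lp_AE_subseq[OF p0(2), of M "%m x. v m x - v' x"]) (use Ld lim in \<open>auto simp: Lp_def Np_def\<close>)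
  have l: "AE x in M. (%m. v (r m) x) ----> v' x" using r(2) by eventually_elim (rule LIM_zero_cancel)
  have "AE x in M. v' x >= 0" using l by eventually_elim (rule LIMSEQ_le_const, auto simp: nn)
  moreover have "\<not> (AE x in M. v' x = 0)" using Np_eq_0_iff[OF Lv'] N1 by simp
  ultimately have "AE x in M. v' x > 0" by (rule strong_maximum_principle[OF S])
  with l have "AE x in M. (%m. v (r m) x) ----> v' x \<and> v' x > 0" by eventually_elim blast
  then show ?thesis using r(1) that by blast
qed

theorem lam1_isolated:
  obtains \<delta> where "\<delta> > 0" "!!lam v g. solves lam v g ==> \<not> (AE x in M. v x = 0) ==> lam ~= lam1 ==> \<delta> <= \<bar>lam - lam1\<bar>"
proof (rule ccontr)
  assume no: "\<not> thesis"
  have "\<exists>lam v g. solves lam v g \<and> \<not> (AE x in M. v x = 0) \<and> lam ~= lam1 \<and> \<bar>lam - lam1\<bar> < 1 / real (Suc m)" for m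
  proof (rule ccontr)
    assume "\<not> ?thesis"
    then have "1 / real (Suc m) <= \<bar>lam - lam1\<bar>" if "solves lam v g" "\<not> (AE x in M. v x = 0)" "lam ~= lam1" for lam v g
      using that not_le by blast
    then show False using no that[of "1 / real (Suc m)"] by simp
  qed
  then obtain lam v g where s: "!!m. solves (lam m) (v m) (g m)" "!!m. \<not> (AE x in M. v m x = 0)" "!!m. lam m ~= lam1"
    "!!m. \<bar>lam m - lam1\<bar> < 1 / real (Suc m)" by metis
  \<comment> \<open>A solution tested with itself shows that its eigenvalue is a Rayleigh quotient,
    hence at least \<open>lam1\<close>.\<close>
  have gt: "lam1 < lam m" for m
  proof -
    have "W0 p w (v m) (g m)" using s(1) by (simp add: solves_def)
    then have "Np p w (v m) > 0" using Np_eq_0_iff[OF W0_Lp(1), of "v m" "g m"] s(2)[of m] Np_nonneg[of p w "v m"] by linarith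
    then show ?thesis using solves_lam_ge[OF s(1)] s(3)[of m] by (simp add: less_le)
  qed
  have lim: "lam ----> lam1"
  proof (rule LIMSEQ_I)
    fix e :: real assume "e > 0"
    then obtain n where n: "1 / real (Suc n) < e" using nat_approx_posE by blast
    have "norm (lam m - lam1) < e" if "m >= n" for m
    proof -
      have "1 / real (Suc m) <= 1 / real (Suc n)" using that by (simp add: field_simps)
      then show ?thesis using s(4)[of m] n by simp
    qed
    then show "\<exists>n. \<forall>m\<ge>n. norm (lam m - lam1) < e" by blast
  qed
  \<comment> \<open>Otherwise the negative would be a nonnegative eigenfunction, and Picone would
    give the reverse inequality. Applied to \<open>v\<close> and to \<open>- v\<close>, this shows
    that both parts are nonzero.\<close>
  have no_sign: "\<not> (AE x in M. z x <= 0)" if "solves (lam m) z k" "\<not> (AE x in M. z x = 0)" for m z k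
  proof
    assume "AE x in M. z x <= 0"
    then have "AE x in M. - z x >= 0" by eventually_elim simp
    moreover have "\<not> (AE x in M. - z x = 0)" using that(2) by simp
    ultimately have "lam m <= lam1" using solves_nonneg_lam_le[OF solves_uminus[OF that(1)]] by blast
    then show False using gt[of m] by simp
  qed
  have "\<exists>c h. c > 0 \<and> W0 p w (%x. c * max 0 (v m x)) h \<and> Np p w (%x. c * max 0 (v m x)) = 1 \<and> Q (%x. c * max 0 (v m x)) h = lam m" for m
    by (rule positive_part_normalized[OF s(1) no_sign[OF s(1,2)]]) blast
  then obtain c h where c: "!!m. c m > 0" "!!m. W0 p w (%x. c m * max 0 (v m x)) (h m)" "!!m. Np p w (%x. c m * max 0 (v m x)) = 1"
    "!!m. Q (%x. c m * max 0 (v m x)) (h m) = lam m" by metis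
  have s2: "\<not> (AE x in M. - v m x = 0)" for m using s(2) by simp
  have "\<exists>c h. c > 0 \<and> W0 p w (%x. c * max 0 (- v m x)) h \<and> Np p w (%x. c * max 0 (- v m x)) = 1 \<and> Q (%x. c * max 0 (- v m x)) h = lam m" for m
    by (rule positive_part_normalized[OF solves_uminus[OF s(1)] no_sign[OF solves_uminus[OF s(1)] s2]]) blast
  then obtain b k where b: "!!m. b m > 0" "!!m. W0 p w (%x. b m * max 0 (- v m x)) (k m)" "!!m. Np p w (%x. b m * max 0 (- v m x)) = 1"
    "!!m. Q (%x. b m * max 0 (- v m x)) (k m) = lam m" by metis
  define P where "P m x = c m * max 0 (v m x)" for m x
  define N where "N m x = b m * max 0 (- v m x)" for m x
  have PN: "P m x = 0 \<or> N m x = 0" "P m x >= 0" "N m x >= 0" for m x using c(1)[of m] b(1)[of m] by (auto simp: P_def N_def max_def)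
  have Pe: "P m = (%x. c m * max 0 (v m x))" and Ne: "N m = (%x. b m * max 0 (- v m x))" for m by (simp_all add: P_def N_def fun_eq_iff)
  have WP: "W0 p w (P m) (h m)" "Np p w (P m) = 1" and WN: "W0 p w (N m) (k m)" "Np p w (N m) = 1" for m
    unfolding Pe Ne by (fact c b)+
  have lP: "(%m. Q (P m) (h m)) ----> lam1" unfolding Pe c(4) by (rule lim)
  obtain r P' g' where P': "strict_mono (r :: nat => nat)" "(%m. Np p w (%x. P (r m) x - P' x)) ----> 0" "Np p w P' = 1" "solves lam1 P' g'"
    by (rule minimizing_limit[OF WP lP]) (rule that)
  obtain r1 where r1: "strict_mono (r1 :: nat => nat)" "AE x in M. (%m. P (r (r1 m)) x) ----> P' x \<and> P' x > 0"
    by (rule limit_positive[OF P'(4,3) WP(1) PN(2) P'(2)]) (rule that)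
  \<comment> \<open>The sequence of negative parts is thinned out along the indices already chosen
    for the positive parts, so that both finally converge along common indices.\<close>
  define rho where "rho = r \<circ> r1"
  have rho: "strict_mono rho" unfolding rho_def by (rule strict_mono_o[OF P'(1) r1(1)])
  have lN: "(%m. Q (N (rho m)) (k (rho m))) ----> lam1"
    unfolding Ne b(4) using LIMSEQ_subseq_LIMSEQ[OF lim rho] by (simp add: comp_def)
  obtain r' N' g'' where N': "strict_mono (r' :: nat => nat)" "(%m. Np p w (%x. N (rho (r' m)) x - N' x)) ----> 0" "Np p w N' = 1" "solves lam1 N' g''"
    by (rule minimizing_limit[OF WN lN]) (rule that)
  obtain r2 where r2: "strict_mono (r2 :: nat => nat)" "AE x in M. (%m. N (rho (r' (r2 m))) x) ----> N' x \<and> N' x > 0"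
    by (rule limit_positive[OF N'(4,3) WN(1) PN(3) N'(2)]) (rule that)
  \<comment> \<open>The product of the two parts vanishes identically for every index, but its
    pointwise limit is a product of two positive numbers.\<close>
  have "AE x in M. False" using r1(2) r2(2)
  proof eventually_elim
    case (elim x)
    have "strict_mono (r' \<circ> r2)" by (rule strict_mono_o[OF N'(1) r2(1)])
    then have "(%m. P (rho (r' (r2 m))) x) ----> P' x"
      using LIMSEQ_subseq_LIMSEQ[of "%m. P (r (r1 m)) x" "P' x" "r' \<circ> r2"] elim(1) by (simp add: rho_def comp_def)
    then have "(%m. P (rho (r' (r2 m))) x * N (rho (r' (r2 m))) x) ----> P' x * N' x" using elim(2) by (intro tendsto_mult) auto
    moreover have "P m x * N m x = 0" for m using PN(1)[of m x] by auto
    ultimately have "(%m::nat. 0::real) ----> P' x * N' x" by simp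
    then have "P' x * N' x = 0" by (simp add: LIMSEQ_const_iff)
    then show ?case using elim by auto
  qed
  then have "AE x in M. x \<notin> ball a 1" for a by eventually_elim blast
  then show False using ball_not_null[of 1] w_ne by (meson ex_in_conv zero_less_one)
qed

end

text \<open>Membership of the gradient in L^p is given componentwise; summing the components over
  the basis yields the vector-valued form.\<close>

lemma W01p_imp_W0:
  assumes "W01p p w v g" "p > 0" shows "W0 p w v g"
proof -
  have v: "Lp_on p w v" and gb: "!!b. b \<in> Basis ==> Lp_on p w (%x. g x \<bullet> b)" using assms by (auto simp: W01p_def W1p_def)
  obtain phi :: "nat => 'a => real" where phi: "\<forall>k. test_fun w (phi k)" "(%k. \<integral>x. \<bar>phi k x - v x\<bar> powr p \<partial>lebesgue_on w) ----> 0"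
    "(%k. \<integral>x. norm (grad (phi k) x - g x) powr p \<partial>lebesgue_on w) ----> 0" using assms by (auto simp: W01p_def)
  have gm: "g \<in> borel_measurable (lebesgue_on w)"
    using gb by (subst borel_measurable_euclidean_space) (auto simp: Lp_on_def)
  have L: "Lp p w (%x. (g x \<bullet> b) *\<^sub>R b)" if "b \<in> Basis" for b
    using gb[OF that] that by (auto simp: Lp_def Lp_on_def)
  have "Lp p w (%x. \<Sum>b\<in>B. (g x \<bullet> b) *\<^sub>R b)" if "finite B" "B \<subseteq> Basis" for B
    using that
  proof (induction B rule: finite_induct)
    case empty
    then show ?case using assms(2) by (simp add: Lp_def)
  next
    case (insert b B)
    then show ?case using Lp_add(1)[OF L[of b], of "%x. \<Sum>b\<in>B. (g x \<bullet> b) *\<^sub>R b"] assms(2) by simp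
  qed
  from this[OF finite_Basis order_refl] have "Lp p w g" by (simp add: euclidean_representation)
  then show ?thesis using v phi by (auto simp: W0_def Lp_def Lp_on_def Np_def)
qed

theorem theoremA10:
  fixes \<Omega> :: "'a::euclidean_space set"
    and H :: "'a \<Rightarrow> 'a \<Rightarrow> real"
    and V :: "'a \<Rightarrow> real"
    and p q :: real
    and \<omega> :: "'a set"
  assumes "DIM('a) \<ge> 2"
    and "1 < p"
    and "domain \<Omega>"
    and "admissible_H \<Omega> H"
    and "morrey_loc q p \<Omega> V"
    and "cc_subdomain \<omega> \<Omega>"
  shows "\<exists>\<delta>>0. \<forall>lam. is_eigenvalue p H V \<omega> lam \<longrightarrow>
           \<not> (0 < \<bar>lam - lambda1 p H V \<omega>\<bar> \<and> \<bar>lam - lambda1 p H V \<omega>\<bar> < \<delta>)"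
proof -
  have dom: "open \<omega>" "connected \<omega>" "\<omega> ~= {}" and bd: "bounded \<omega>" and sub: "\<omega> \<subseteq> \<Omega>" and o: "open \<Omega>"
    using assms(3,6) closure_subset by (auto simp: cc_subdomain_def domain_def intro: bounded_subset[OF compact_imp_bounded])
  have mo: "morrey q p \<omega> V" using assms(5,6) by (simp add: morrey_loc_def)
  obtain \<kappa> \<nu> where k: "0 < \<kappa>" "\<kappa> <= \<nu>" "AE x in lebesgue_on \<omega>. \<forall>xi. \<kappa> * norm xi <= H x xi \<and> H x xi <= \<nu> * norm xi"
    using assms(4,6) unfolding admissible_H_def by meson
  \<comment> \<open>Properties of \<open>H\<close> hold almost everywhere in the large domain and
    are restricted to the open subset.\<close>
  have ae: "AE x in lebesgue_on \<omega>. P x" if "AE x in lebesgue_on \<Omega>. P x" for P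
  proof -
    have "AE x in lebesgue. x \<in> \<Omega> --> P x" using that o by (simp add: AE_restrict_space_iff)
    then have "AE x in lebesgue. x \<in> \<omega> --> P x" by eventually_elim (use sub in blast)
    then show ?thesis using dom by (simp add: AE_restrict_space_iff)
  qed
  interpret eigen_setup \<omega> p H V \<kappa> \<nu>
  proof
    show "AE x in lebesgue_on \<omega>. good_norm \<nu> (H x) \<and> (\<forall>xi. \<kappa> * norm xi <= H x xi)"
    proof -
      have "AE x in lebesgue_on \<omega>. is_norm_fun (H x)" "AE x in lebesgue_on \<omega>. \<forall>xi. xi ~= 0 --> H x differentiable (at xi)"
        using assms(4) by (auto simp: admissible_H_def intro!: ae)
      then show ?thesis using k(3) by eventually_elim (auto simp: good_norm_def)
    qed
    show "(%x. H x xi) \<in> borel_measurable (lebesgue_on \<omega>)" for xi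
      using assms(4) sub by (auto simp: admissible_H_def intro: measurable_restrict_mono)
    show "H x xi >= 0" for x xi using assms(4) by (simp add: admissible_H_def)
    show "integrable (lebesgue_on \<omega>) V" by (rule morrey_integrable[OF mo bd dom(3)])
    show "\<exists>C\<ge>0. \<forall>phi. test_fun \<omega> phi --> integrable (lebesgue_on \<omega>) (%x. \<bar>V x\<bar> * \<bar>phi x\<bar> powr p)
      \<and> (LINT x|(lebesgue_on \<omega>). \<bar>V x\<bar> * \<bar>phi x\<bar> powr p) <= \<delta> * Np p \<omega> (grad phi) + C * Np p \<omega> phi" if "\<delta> > 0" for \<delta>
      by (rule morrey_adams[OF assms(1,2) mo dom(1) bd dom(3) that]) (auto simp: Np_def)
  qed (use dom bd assms(2) k in auto)
  obtain \<delta> where \<delta>: "\<delta> > 0" "!!lam v g. solves lam v g ==> \<not> (AE x in M. v x = 0) ==> lam ~= lam1 ==> \<delta> <= \<bar>lam - lam1\<bar>"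
    by (rule lam1_isolated) (rule that)
  have "\<not> (0 < \<bar>lam - lam1\<bar> \<and> \<bar>lam - lam1\<bar> < \<delta>)" if "is_eigenvalue p H V \<omega> lam" for lam
  proof -
    obtain v g where v: "W01p p \<omega> v g" "\<not> (AE x in M. v x = 0)" "\<forall>phi. test_fun \<omega> phi --> weak_form lam v g phi (grad phi) = 0"
      using \<open>is_eigenvalue p H V \<omega> lam\<close> unfolding is_eigenvalue_def weak_form_def by blast
    have "solves lam v g" unfolding solves_def using W01p_imp_W0[OF v(1) p0(2)] v(3) by blast
    then show ?thesis using \<delta>(2)[OF _ v(2)] by force
  qed
  then show ?thesis using \<delta>(1) by blast
qed

end
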